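(* Let $0<k<n$, and let $A=(a_{ij})$, $B=(b_{ij})$ be $n\times n$ matrices of independent indeterminates. The bihomogeneous polynomial $T_k(A,B)$ is irreducible in $K[a_{ij},b_{ij}:i,j=1,\dots,n]$ for every field $K$, and also irreducible in $\mathbb Z[a_{ij},b_{ij}:i,j=1,\dots,n]$.
   Context: Notation for $T_k$: $[n]=\{1,\dots,n\}$; $A_k$ is the $\binom nk$-square matrix, in the lexicographically ordered basis $e_S=e_{s_1}\wedge\dots\wedge e_{s_k}$ ($S=\{s_1<\dots<s_k\}\subseteq[n]$) of $\bigwedge^k$, of $v_1\wedge\dots\wedge v_k\mapsto\sum_{i}v_1\wedge\dots\wedge Av_i\wedge\dots\wedge v_k$ (entries are integer linear forms in the $a_{ij}$). For square $X,Y$ of size $m$, $M(X,Y)$ is the block matrix with $(i,j)$-th $m\times m$ block $X^{j-1}Y^{i-1}$ and $T(X,Y)=\det M(X,Y)$. For $\lambda_S=\sum_{s\in S}\lambda_s$ and $r\ge2$, $\delta_r(\lambda_1,\dots,\lambda_n)=\prod(\lambda_T-\lambda_S)$ over disjoint $r$-subsets $S,T\subseteq[n]$ with $\min S<\min T$; $D_r(A)=\delta_r$ of the eigenvalues of $A$ (an integer polynomial in the entries of $A$); $G_k(A)=\prod_{2\le r\le k}D_r(A)^{\binom nk\binom{n-2r}{k-r}}$ ($\binom mj=0$ if $m<0$ or $j\notin[0,m]$). The $k$-th triangulant $T_k(A,B)\in\mathbb Z[a_{ij},b_{ij}]$ is the exact quotient $T(A_k,B_k)/(G_k(A)G_k(B))$;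 it is bihomogeneous of degree $\binom n2\binom nk\binom{n-2}{k-1}$ in each set of variables. *)

theory Defs
  imports "Jordan_Normal_Form.Determinant" "Jordan_Normal_Form.Char_Poly"
    "HOL-Library.Poly_Mapping" "HOL-Library.List_Lexorder"
    "HOL-Computational_Algebra.Factorial_Ring"
begin

type_synonym ('v, 'a) mpoly = "('v \<Rightarrow>\<^sub>0 nat) \<Rightarrow>\<^sub>0 'a"

definition Var :: "'v \<Rightarrow> ('v, 'a::{zero,one}) mpoly" where
  "Var v = Poly_Mapping.single (Poly_Mapping.single v 1) 1"

definition mpeval :: "('v, int) mpoly \<Rightarrow> ('v \<Rightarrow> complex) \<Rightarrow> complex" where
  "mpeval p x = (\<Sum>m\<in>Poly_Mapping.keys p. of_int (Poly_Mapping.lookup p m) *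
      (\<Prod>v\<in>Poly_Mapping.keys m. x v ^ Poly_Mapping.lookup m v))"

text \<open>Variables: (False,i,j) is a_ij, (True,i,j) is b_ij, with i,j ranging over
  the finite linearly ordered type 'n, which plays the role of [n] (n = CARD of 'n).\<close>
type_synonym 'n var = "bool \<times> 'n \<times> 'n"

definition idx :: "nat \<Rightarrow> 'n::{finite,linorder}" where
  "idx i = sorted_list_of_set (UNIV :: 'n set) ! i"

definition kbasis :: "nat \<Rightarrow> ('n::{finite,linorder}) set list" where
  "kbasis k = map set (sorted_list_of_set {xs :: 'n list. sorted_wrt (<) xs \<and> length xs = k})"

text \<open>Number of inversions of a list, and the coefficient of e_S in
  e_{x1} wedge ... wedge e_{xk}.\<close>
definition inversions :: "'n::linorder list \<Rightarrow> nat" where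
  "inversions xs = card {(i, j). i < j \<and> j < length xs \<and> xs ! j < xs ! i}"

definition wedge_coeff :: "'n::linorder set \<Rightarrow> 'n list \<Rightarrow> int" where
  "wedge_coeff S xs = (if distinct xs \<and> set xs = S then (-1) ^ inversions xs else 0)"

text \<open>The matrix A_k (c = False) resp. B_k (c = True): column e_T is mapped to
  sum_i e_{t1} wedge .. wedge (A e_{ti}) wedge .. wedge e_{tk}, with A e_t = sum_j a_{jt} e_j.\<close>
definition ext_mat :: "bool \<Rightarrow> nat \<Rightarrow> ('n::{finite,linorder} var, int) mpoly mat" where
  "ext_mat c k = (let B = (kbasis k :: 'n set list); N = length B in
     mat N N (\<lambda>(p, q). let ts = sorted_list_of_set (B ! q) in
       (\<Sum>i<k. \<Sum>j\<in>(UNIV :: 'n set).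
          of_int (wedge_coeff (B ! p) (ts[i := j])) * Var (c, j, ts ! i))))"

definition blockM :: "'a::comm_ring_1 mat \<Rightarrow> 'a mat \<Rightarrow> 'a mat" where
  "blockM X Y = (let m = dim_row X in
     mat (m * m) (m * m) (\<lambda>(r, c). (X ^\<^sub>m (c div m) * Y ^\<^sub>m (r div m)) $$ (r mod m, c mod m)))"

definition Tdet :: "'a::comm_ring_1 mat \<Rightarrow> 'a mat \<Rightarrow> 'a" where
  "Tdet X Y = det (blockM X Y)"

definition delta :: "nat \<Rightarrow> nat \<Rightarrow> (nat \<Rightarrow> complex) \<Rightarrow> complex" where
  "delta n r lam = (\<Prod>(S, T)\<in>{(S, T). S \<subseteq> {0..<n} \<and> T \<subseteq> {0..<n} \<and> card S = r \<and> card T = r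
        \<and> S \<inter> T = {} \<and> Min S < Min T}.
      (\<Sum>t\<in>T. lam t) - (\<Sum>s\<in>S. lam s))"

definition Dpoly :: "bool \<Rightarrow> nat \<Rightarrow> ('n::{finite,linorder} var, int) mpoly" where
  "Dpoly c r = (THE p. \<forall>(x :: 'n var \<Rightarrow> complex) lam.
      char_poly (mat (card (UNIV :: 'n set)) (card (UNIV :: 'n set)) (\<lambda>(i, j). x (c, idx i, idx j)))
        = (\<Prod>i<card (UNIV :: 'n set). [:- lam i, 1:]) \<longrightarrow> mpeval p x = delta (card (UNIV :: 'n set)) r lam)"

definition ibinom :: "int \<Rightarrow> nat \<Rightarrow> nat" where
  "ibinom m j = (if m < 0 then 0 else nat m choose j)"

definition Gpoly :: "bool \<Rightarrow> nat \<Rightarrow> ('n::{finite,linorder} var, int) mpoly" where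
  "Gpoly c k = (\<Prod>r\<in>{2..k}. Dpoly c r ^ ((card (UNIV :: 'n set) choose k) *
       ibinom (int (card (UNIV :: 'n set)) - 2 * int r) (k - r)))"

definition Tk :: "nat \<Rightarrow> ('n::{finite,linorder} var, int) mpoly" where
  "Tk k = (THE q. Tdet (ext_mat False k) (ext_mat True k) = q * Gpoly False k * Gpoly True k)"

end

theory Submission
  imports "HOL-Algebra.Algebraic_Closure_Type" "HOL-Computational_Algebra.Fundamental_Theorem_Algebra"
    "HOL-Library.Product_Lexorder" Defs
begin

text \<open>The eigenvalues of \<open>A\<^sub>k\<close> are the sums \<open>\<lambda>\<^sub>S\<close>. Put \<open>f\<^sub>S(t) = \<Prod>s\<in>S. t - \<lambda>\<^sub>s\<close> and \<open>h = n - k\<close>.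
  The \<open>h\<close>-minors of the coefficient matrix of \<open>f, t f, \<dots>, t\<^sup>h\<^sup>-\<^sup>1 f\<close> for \<open>f = \<Lambda>\<^sup>k(t - A)\<close> are integral
  matrices \<open>Z\<^sub>b(A)\<close>, indexed by the \<open>h\<close>-subsets \<open>b\<close> and diagonal in the eigenbasis of \<open>A\<^sub>k\<close>. Replacing
  the powers of \<open>A\<^sub>k\<close>, \<open>B\<^sub>k\<close> in the block matrix by the \<open>Z\<^sub>b(A)\<close>, \<open>Z\<^sub>b(B)\<close> replaces the Vandermonde
  determinant of the \<open>\<lambda>\<^sub>S\<close> by a power of the Vandermonde determinant of the \<open>\<lambda>\<^sub>i\<close>. The quotient of
  the two is a product of the \<open>\<delta>\<^sub>r\<close>, so the new determinant \<open>F\<close> is \<open>T\<^sub>k\<close> up to sign.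

  Over an algebraically closed field substitute \<open>A = det P \<sqdot> P \<Lambda> adj P\<close> and
  \<open>B = det Q \<sqdot> Q M adj Q\<close> with generic \<open>P\<close>, \<open>Q\<close> and generic diagonal \<open>\<Lambda>\<close>, \<open>M\<close>. Then \<open>F\<close> becomes, up to
  powers of \<open>det P\<close>, \<open>det Q\<close> and of eigenvalue differences, the product of the prime polynomials
  \<open>D = det(P\<^sub>R | Q\<^sub>S)\<close> over all \<open>h\<close>-sets \<open>R\<close> and \<open>k\<close>-sets \<open>S\<close> of columns. Permuting eigenvectors
  permutes these transitively and fixes everything in \<open>A\<close>, \<open>B\<close>, so in a factorization of \<open>F\<close> one
  factor is prime to all of them. Evaluated at \<open>A\<close>, \<open>B\<close> that factor is a constant times a product of eigenvalue
  differences. But \<open>F = \<plusminus>1\<close> at a pair of nilpotent matrices, so there are no differences and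
  the factor is constant. The value \<open>\<plusminus>1\<close> also makes \<open>F\<close> primitive, which gives the result over the integers.\<close>

section \<open>Evaluation of multivariate polynomials\<close>

text \<open>The quotient defining \<open>T_k\<close> comes with no formula: its denominator is known
  only through the eigenvalues of complex matrices, while the claim concerns every field. The
  matrices \<open>Z_b\<close> arise from integral ring operations, so \<open>F\<close> has a value
  over every commutative ring. Their eigenvalues at \<open>S\<close> are the Pluecker coordinates of
  the space of polynomials of degree \<open>< n\<close> that vanish at all
  \<open>\<lambda>_s\<close> with \<open>s\<close> in \<open>S\<close>. Taking values at all
  \<open>\<lambda>_i\<close> turns this space into a coordinate subspace; so the matrix of Pluecker
  coordinates becomes monomial after multiplication by the compound of a Vandermonde matrix, and
  only a power of the Vandermonde determinant is left. In the substitution, the additional factor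
  \<open>det P\<close> absorbs the sign of a permutation of the eigenvectors. The nilpotent pair is
  not diagonalizable, so its value is obtained as a limit of companion matrices with eigenvalues
  tending to zero; one of them is written in the reversed basis, which keeps the limit a
  unit.\<close>

definition mmon :: "('v \<Rightarrow> 'b::comm_ring_1) \<Rightarrow> ('v \<Rightarrow>\<^sub>0 nat) \<Rightarrow> 'b" where
  "mmon x m = (\<Prod>v\<in>Poly_Mapping.keys m. x v ^ Poly_Mapping.lookup m v)"

definition mev :: "('a::comm_ring_1 \<Rightarrow> 'b::comm_ring_1) \<Rightarrow> ('v \<Rightarrow> 'b) \<Rightarrow> ('v, 'a) mpoly \<Rightarrow> 'b" where
  "mev h x p = (\<Sum>m\<in>Poly_Mapping.keys p. h (Poly_Mapping.lookup p m) * mmon x m)"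

definition Cst :: "'a::comm_ring_1 \<Rightarrow> ('v, 'a) mpoly" where
  "Cst a = Poly_Mapping.single 0 a"

lemma mmon_superset:
  assumes "finite S" "Poly_Mapping.keys m \<subseteq> S"
  shows "mmon x m = (\<Prod>v\<in>S. x v ^ Poly_Mapping.lookup m v)"
  unfolding mmon_def using assms
  by (intro prod.mono_neutral_left) (auto simp: in_keys_iff)

lemma mmon_add: "mmon x (m + m') = mmon x m * mmon x m'"
proof -
  let ?S = "Poly_Mapping.keys m \<union> Poly_Mapping.keys m'"
  have "mmon x (m + m') = (\<Prod>v\<in>?S. x v ^ Poly_Mapping.lookup (m + m') v)"
    by (rule mmon_superset) (auto dest: subsetD[OF Poly_Mapping.keys_add])
  also have "\<dots> = mmon x m * mmon x m'"
    by (simp add: mmon_superset[of ?S] lookup_add power_add prod.distrib)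
  finally show ?thesis .
qed

lemma mmon_0 [simp]: "mmon x 0 = 1"
  by (simp add: mmon_def)

lemma mmon_single [simp]: "mmon x (Poly_Mapping.single v n) = x v ^ n"
  by (simp add: mmon_def)

lemma poly_mapping_single_induct [case_names zero add]:
  assumes "P 0" "\<And>m a p. P p \<Longrightarrow> P (Poly_Mapping.single m a + p)"
  shows "P (p :: 'k \<Rightarrow>\<^sub>0 'b::comm_monoid_add)"
proof (induction p rule: update_induct)
  case const
  then show ?case using assms(1) by simp
next
  case (update f a b)
  have "Poly_Mapping.update a b f = Poly_Mapping.single a b + f"
    using update(1) by (intro poly_mapping_eqI) (auto simp: lookup_update lookup_add lookup_single in_keys_iff)
  then show ?case using assms(2) update by simp
qed

lemma Cst_add: "Cst (a + b) = Cst a + Cst b"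
  by (simp add: Cst_def single_add)

lemma Cst_mult: "Cst (a * b) = Cst a * Cst b"
  by (simp add: Cst_def mult_single)

lemma Cst_0 [simp]: "Cst 0 = 0"
  by (simp add: Cst_def)

lemma Cst_1 [simp]: "Cst 1 = 1"
  by (simp add: Cst_def)

lemma Cst_hom: "comm_ring_hom Cst"
  by unfold_locales (auto simp: Cst_add Cst_mult)

lemma mpoly_induct [case_names Cst Var add mult]:
  fixes p :: "('v, 'a::comm_ring_1) mpoly"
  assumes C: "\<And>a. P (Cst a)" and V: "\<And>v. P (Var v)"
    and add: "\<And>p q. P p \<Longrightarrow> P q \<Longrightarrow> P (p + q)" and mult: "\<And>p q. P p \<Longrightarrow> P q \<Longrightarrow> P (p * q)"
  shows "P p"
proof -
  have pow: "P (Poly_Mapping.single (Poly_Mapping.single v n) 1)" for v n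
  proof (induction n)
    case 0
    then show ?case using C[of 1] by simp
  next
    case (Suc n)
    have "Poly_Mapping.single (Poly_Mapping.single v (Suc n)) (1::'a) =
        Var v * Poly_Mapping.single (Poly_Mapping.single v n) 1"
      by (simp add: Var_def mult_single flip: single_add)
    then show ?case using mult[OF V Suc.IH] by simp
  qed
  have mon: "P (Poly_Mapping.single m 1)" for m
  proof (induction m rule: poly_mapping_single_induct)
    case zero
    then show ?case using C[of 1] by simp
  next
    case (add m a p)
    have "Poly_Mapping.single (Poly_Mapping.single m a + p) (1::'a) =
      Poly_Mapping.single (Poly_Mapping.single m a) 1 * Poly_Mapping.single p 1"
      by (simp add: mult_single)
    then show ?case using mult[OF pow add] by simp
  qed
  show ?thesis
  proof (induction p rule: poly_mapping_single_induct)
    case zero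
    then show ?case using C[of 0] by simp
  next
    case (add m a p)
    have "Poly_Mapping.single m a = Cst a * Poly_Mapping.single m 1"
      by (simp add: Cst_def mult_single)
    then show ?case using assms(3)[OF mult[OF C mon] add] by simp
  qed
qed

context comm_ring_hom
begin

lemma mev_superset:
  assumes "finite S" "Poly_Mapping.keys p \<subseteq> S"
  shows "mev hom x p = (\<Sum>m\<in>S. hom (Poly_Mapping.lookup p m) * mmon x m)"
  unfolding mev_def using assms
  by (intro sum.mono_neutral_left) (auto simp: in_keys_iff)

lemma mev_add: "mev hom x (p + q) = mev hom x p + mev hom x q"
proof -
  let ?S = "Poly_Mapping.keys p \<union> Poly_Mapping.keys q"
  have "mev hom x (p + q) = (\<Sum>m\<in>?S. hom (Poly_Mapping.lookup (p + q) m) * mmon x m)"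
    by (rule mev_superset) (auto dest: subsetD[OF Poly_Mapping.keys_add])
  also have "\<dots> = mev hom x p + mev hom x q"
    by (simp add: mev_superset[of ?S] lookup_add hom_add algebra_simps sum.distrib)
  finally show ?thesis .
qed

lemma mev_single: "mev hom x (Poly_Mapping.single m a) = hom a * mmon x m"
  by (simp add: mev_def)

lemma mev_Cst [simp]: "mev hom x (Cst a) = hom a"
  by (simp add: Cst_def mev_single)

lemma mev_Var [simp]: "mev hom x (Var v) = x v"
  by (simp add: Var_def mev_single)

lemma mev_mult: "mev hom x (p * q) = mev hom x p * mev hom x q"
proof (induction p rule: poly_mapping_single_induct)
  case zero
  then show ?case by (simp add: mev_def)
next
  case (add m a p)
  have "mev hom x (Poly_Mapping.single m a * q) = hom a * mmon x m * mev hom x q"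
  proof (induction q rule: poly_mapping_single_induct)
    case zero
    then show ?case by (simp add: mev_def)
  next
    case (add m' b q)
    then show ?case
      by (simp add: distrib_left mult_single mev_add mev_single mmon_add hom_mult algebra_simps)
  qed
  then show ?case using add by (simp add: distrib_right mev_add mev_single)
qed

lemma mev_hom: "comm_ring_hom (mev hom x)"
proof
  show "mev hom x 0 = 0" by (simp add: mev_def)
  show "mev hom x 1 = 1" using mev_Cst[of x 1] by simp
qed (auto simp: mev_add mev_mult)

end

lemma comm_ring_hom_id: "comm_ring_hom (\<lambda>x. x)"
  by unfold_locales auto

lemma comm_ring_hom_of_int: "comm_ring_hom (of_int :: int \<Rightarrow> 'a::comm_ring_1)"
  by unfold_locales auto

lemma comm_ring_hom_compose:
  assumes "comm_ring_hom f" "comm_ring_hom g"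
  shows "comm_ring_hom (\<lambda>x. g (f x))"
proof -
  interpret f: comm_ring_hom f by fact
  interpret g: comm_ring_hom g by fact
  show ?thesis by unfold_locales (auto simp: f.hom_add f.hom_mult g.hom_add g.hom_mult)
qed

text \<open>Constants and variables generate the ring, so any two substitutions need to be compared
  only there.\<close>

lemma mpoly_hom_unique:
  assumes "comm_ring_hom f" "comm_ring_hom g"
    and "\<And>a. f (Cst a) = g (Cst a)" "\<And>v. f (Var v) = g (Var v)"
  shows "f p = g p"
proof -
  interpret f: comm_ring_hom f by fact
  interpret g: comm_ring_hom g by fact
  show ?thesis
    by (induction p rule: mpoly_induct) (auto simp: assms f.hom_add f.hom_mult g.hom_add g.hom_mult)
qed

lemma hom_mev:
  assumes "comm_ring_hom h" "comm_ring_hom f"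
  shows "f (mev h x p) = mev (\<lambda>a. f (h a)) (\<lambda>v. f (x v)) p"
proof -
  interpret h: comm_ring_hom h by fact
  interpret f: comm_ring_hom f by fact
  interpret fh: comm_ring_hom "\<lambda>a. f (h a)" by (rule comm_ring_hom_compose[OF assms])
  show ?thesis
    by (rule mpoly_hom_unique[OF comm_ring_hom_compose[OF h.mev_hom assms(2)] fh.mev_hom]) auto
qed

lemma mev_Cst_Var: "mev Cst Var p = p"
  by (rule mpoly_hom_unique[OF comm_ring_hom.mev_hom[OF Cst_hom] comm_ring_hom_id])
    (simp_all add: comm_ring_hom.mev_Cst[OF Cst_hom] comm_ring_hom.mev_Var[OF Cst_hom])

lemma mpeval_eq: "mpeval p x = mev of_int x p"
  by (simp add: mpeval_def mev_def mmon_def)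

text \<open>Seen as an evaluation, a change of coefficients composes with every other substitution
  through \<open>hom_mev\<close>.\<close>

lemma map_mpoly_eq:
  fixes h :: "'a::comm_ring_1 \<Rightarrow> 'b::comm_ring_1"
  assumes "comm_ring_hom h"
  shows "Poly_Mapping.map h p = mev (\<lambda>a. Cst (h a)) Var p"
proof -
  interpret h: comm_ring_hom h by fact
  interpret Ch: comm_ring_hom "\<lambda>a. Cst (h a)" by (rule comm_ring_hom_compose[OF assms Cst_hom])
  have L: "Poly_Mapping.lookup (Poly_Mapping.map h p) m = h (Poly_Mapping.lookup p m)" for p :: "('v, 'a) mpoly" and m
    by (simp add: Poly_Mapping.map.rep_eq when_def)
  have map_add: "Poly_Mapping.map h (p + q) = Poly_Mapping.map h p + Poly_Mapping.map h q" for p q :: "('v, 'a) mpoly"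
    by (intro poly_mapping_eqI) (simp add: L lookup_add h.hom_add)
  have mon: "Poly_Mapping.single m b = Cst b * mmon Var m" for m :: "'v \<Rightarrow>\<^sub>0 nat" and b :: 'b
  proof -
    have "mev Cst Var (Poly_Mapping.single m b) = Cst b * mmon Var m"
      by (rule comm_ring_hom.mev_single[OF Cst_hom])
    then show ?thesis by (simp add: mev_Cst_Var)
  qed
  show ?thesis
  proof (induction p rule: poly_mapping_single_induct)
    case zero
    have "Poly_Mapping.map h 0 = (0 :: ('v, 'b) mpoly)" by (intro poly_mapping_eqI) (simp add: L)
    then show ?case by (simp add: mev_def)
  next
    case (add m a p)
    have "Poly_Mapping.map h (Poly_Mapping.single m a) = Poly_Mapping.single m (h a)"
      by (intro poly_mapping_eqI) (auto simp: L lookup_single when_def)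
    then show ?case by (simp add: map_add add Ch.mev_add Ch.mev_single mon)
  qed
qed

lemma mev_map:
  assumes "comm_ring_hom h" "comm_ring_hom f"
  shows "mev f x (Poly_Mapping.map h p) = mev (\<lambda>a. f (h a)) x p"
proof -
  interpret f: comm_ring_hom f by fact
  show ?thesis
    unfolding map_mpoly_eq[OF assms(1)]
    by (subst hom_mev[OF comm_ring_hom_compose[OF assms(1) Cst_hom] f.mev_hom]) simp
qed

section \<open>Polynomials in a given set of variables\<close>

text \<open>Closure under ring operations, rather than a condition on supports, gives rule induction
  for polynomials free of a variable.\<close>

inductive_set polyin :: "'v set \<Rightarrow> ('v, 'a::comm_ring_1) mpoly set" for V where
  Cst: "Cst a \<in> polyin V"
| Var: "v \<in> V \<Longrightarrow> Var v \<in> polyin V"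
| add: "p \<in> polyin V \<Longrightarrow> q \<in> polyin V \<Longrightarrow> p + q \<in> polyin V"
| mult: "p \<in> polyin V \<Longrightarrow> q \<in> polyin V \<Longrightarrow> p * q \<in> polyin V"

lemma polyin_mono: "p \<in> polyin V \<Longrightarrow> V \<subseteq> W \<Longrightarrow> p \<in> polyin W"
  by (induction rule: polyin.induct) (auto intro: polyin.intros)

lemma polyin_0: "0 \<in> polyin V"
  using polyin.Cst[of 0] by simp

lemma polyin_uminus: "p \<in> polyin V \<Longrightarrow> - p \<in> polyin V"
proof -
  assume "p \<in> polyin V"
  moreover have "- p = Cst (- 1) * p"
  proof -
    interpret C: comm_ring_hom Cst by (rule Cst_hom)
    show ?thesis by (simp add: C.hom_uminus)
  qed
  ultimately show ?thesis by (metis polyin.mult polyin.Cst)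
qed

lemma polyin_sum: "(\<And>i. i \<in> I \<Longrightarrow> f i \<in> polyin V) \<Longrightarrow> sum f I \<in> polyin V"
  by (induction I rule: infinite_finite_induct) (auto intro: polyin.intros polyin_0)

lemma polyin_prod: "(\<And>i. i \<in> I \<Longrightarrow> f i \<in> polyin V) \<Longrightarrow> prod f I \<in> polyin V"
  using polyin.Cst[of 1 V] by (induction I rule: infinite_finite_induct) (auto intro: polyin.intros)

lemma polyin_finite: "\<exists>V. finite V \<and> p \<in> polyin V"
proof (induction p rule: mpoly_induct)
  case (Cst a)
  then show ?case by (auto intro: polyin.intros)
next
  case (Var v)
  then show ?case by (intro exI[of _ "{v}"]) (auto intro: polyin.intros)
next
  case (add p q)
  then obtain V W where "finite V" "p \<in> polyin V" "finite W" "q \<in> polyin W" by blast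
  then show ?case by (intro exI[of _ "V \<union> W"]) (auto intro: polyin.intros polyin_mono)
next
  case (mult p q)
  then obtain V W where "finite V" "p \<in> polyin V" "finite W" "q \<in> polyin W" by blast
  then show ?case by (intro exI[of _ "V \<union> W"]) (auto intro: polyin.intros polyin_mono)
qed

lemma mev_cong_polyin:
  assumes "comm_ring_hom h" "p \<in> polyin V" "\<And>v. v \<in> V \<Longrightarrow> x v = y v"
  shows "mev h x p = mev h y p"
proof -
  interpret h: comm_ring_hom h by fact
  show ?thesis using assms(2)
    by induction (auto simp: assms(3) h.mev_add h.mev_mult)
qed

text \<open>Prepares induction on the number of variables: one is singled out, and the coefficients
  use only the remaining ones.\<close>

lemma polyin_insert_poly:
  assumes "p \<in> polyin (insert v V)"
  shows "\<exists>q. (\<forall>j. coeff q j \<in> polyin V) \<and> poly q (Var v) = p"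
  using assms
proof induction
  case (Cst a)
  then show ?case
    by (intro exI[of _ "[:Cst a:]"]) (auto intro: polyin.intros polyin_0 simp: coeff_pCons split: nat.split)
next
  case (Var w)
  show ?case
  proof (cases "w = v")
    case True
    have "1 \<in> polyin V" using polyin.Cst[of 1] by simp
    then show ?thesis using True
      by (intro exI[of _ "[:0, 1:]"]) (auto intro: polyin.intros polyin_0 simp: coeff_pCons split: nat.split)
  next
    case False
    then show ?thesis using Var
      by (intro exI[of _ "[:Var w:]"]) (auto intro: polyin.intros polyin_0 simp: coeff_pCons split: nat.split)
  qed
next
  case (add p q)
  then show ?case by (metis coeff_add poly_add polyin.add)
next
  case (mult p q)
  then obtain p' q' where pq: "\<forall>j. coeff p' j \<in> polyin V" "poly p' (Var v) = p"
     "\<forall>j. coeff q' j \<in> polyin V" "poly q' (Var v) = q" by blast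
  have "coeff (p' * q') j \<in> polyin V" for j
    unfolding coeff_mult using pq by (intro polyin_sum polyin.mult) auto
  then show ?case using pq by (intro exI[of _ "p' * q'"]) auto
qed

section \<open>Testing polynomial identities at points of an infinite domain\<close>

lemma poly_map_poly_hom:
  assumes "comm_ring_hom h"
  shows "poly (map_poly h p) (h x) = h (poly p x)"
proof -
  interpret comm_ring_hom h by fact
  show ?thesis by (induction p) (simp_all add: hom_add hom_mult)
qed

text \<open>Over a finite field the product of all \<open>x - a\<close>, plus \<open>1\<close>,
  would have positive degree and no root.\<close>

lemma infinite_UNIV_alg_closed: "infinite (UNIV :: 'a::alg_closed_field set)"
proof
  assume fin: "finite (UNIV :: 'a set)"
  let ?p = "(\<Prod>a\<in>(UNIV :: 'a set). [:- a, 1:])"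
  have "degree ?p = card (UNIV :: 'a set)" by (subst degree_prod_eq_sum_degree) auto
  moreover have "card (UNIV :: 'a set) > 0" using fin by (simp add: card_gt_0_iff)
  ultimately have "degree (?p + 1) > 0" by (simp add: degree_add_eq_left)
  then obtain a where "poly (?p + 1) a = 0" using alg_closed_imp_poly_has_root by blast
  moreover have "poly ?p a = 0" using fin by (auto simp: poly_prod)
  ultimately show False by simp
qed

definition ev :: "('v \<Rightarrow> 'a::comm_ring_1) \<Rightarrow> ('v, 'a) mpoly \<Rightarrow> 'a" where
  "ev = mev (\<lambda>a. a)"

lemma ev_Cst [simp]: "ev x (Cst a) = a"
  unfolding ev_def by (rule comm_ring_hom.mev_Cst[OF comm_ring_hom_id])

lemma ev_Var [simp]: "ev x (Var v) = x v"
  unfolding ev_def by (rule comm_ring_hom.mev_Var[OF comm_ring_hom_id])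

lemma ev_hom: "comm_ring_hom (ev x)"
  unfolding ev_def by (rule comm_ring_hom.mev_hom[OF comm_ring_hom_id])

lemma ev_cong_polyin: "p \<in> polyin V \<Longrightarrow> (\<And>v. v \<in> V \<Longrightarrow> x v = y v) \<Longrightarrow> ev x p = ev y p"
  unfolding ev_def by (rule mev_cong_polyin[OF comm_ring_hom_id])

lemma ev_map: "comm_ring_hom h \<Longrightarrow> ev x (Poly_Mapping.map h p) = mev h x p"
  unfolding ev_def by (rule mev_map[OF _ comm_ring_hom_id])

text \<open>Induction on the variables that occur: with the others fixed, a polynomial in one
  variable with infinitely many roots is zero.\<close>

lemma mpoly_eq_0_infinite:
  fixes p :: "('v, 'a::idom) mpoly"
  assumes inf: "infinite (UNIV :: 'a set)" and 0: "\<And>x. ev x p = 0"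
  shows "p = 0"
proof -
  have "p = 0" if "finite V" "p \<in> polyin V" "\<And>x. ev x p = 0" for V and p :: "('v, 'a) mpoly"
    using that
  proof (induction V arbitrary: p rule: finite_induct)
    case empty
    from empty.prems(1) have "\<exists>a. p = Cst a"
      by induction (auto simp flip: Cst_add Cst_mult)
    then show ?case using empty.prems(2) by auto
  next
    case (insert v V)
    obtain q where q: "\<And>j. coeff q j \<in> polyin V" "poly q (Var v) = p"
      using polyin_insert_poly[OF insert.prems(1)] by blast
    have "ev x (coeff q j) = 0" for x j
    proof -
      interpret e: comm_ring_hom "ev x" by (rule ev_hom)
      have "poly (map_poly (ev x) q) t = 0" for t
      proof -
        interpret et: comm_ring_hom "ev (x(v := t))" by (rule ev_hom)
        interpret mp: map_poly_comm_ring_hom "ev (x(v := t))" ..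
        \<comment> \<open>The coefficients are free of \<open>v\<close>, so the value at
          \<open>v\<close> may vary without changing them.\<close>
        have "map_poly (ev x) q = map_poly (ev (x(v := t))) q"
          by (intro poly_eqI) (auto simp: coeff_map_poly insert.hyps intro!: ev_cong_polyin[OF q(1)])
        moreover have "poly (map_poly (ev (x(v := t))) q) (ev (x(v := t)) (Var v)) = 0"
          unfolding poly_map_poly_hom[OF ev_hom] q(2) by (rule insert.prems(2))
        ultimately show ?thesis by simp
      qed
      then have "map_poly (ev x) q = 0"
        using inf poly_roots_finite[of "map_poly (ev x) q"] by auto
      then have "coeff (map_poly (ev x) q) j = 0" by simp
      then show ?thesis by (simp add: coeff_map_poly)
    qed
    then have "coeff q j = 0" for j using insert.IH[OF q(1)] by blast
    then have "q = 0" by (simp add: poly_eqI)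
    then show ?case using q(2) by simp
  qed
  then show ?thesis using polyin_finite 0 by blast
qed

text \<open>Zariski density: \<open>d * (p - q)\<close> vanishes at every point, hence is zero, and
  the polynomial ring is a domain.\<close>

lemma mpoly_eqI_generic:
  fixes p q d :: "('v::linorder, 'a::idom) mpoly"
  assumes "infinite (UNIV :: 'a set)" and "d \<noteq> 0"
    and "\<And>x. ev x d \<noteq> 0 \<Longrightarrow> ev x p = ev x q"
  shows "p = q"
proof -
  interpret e: comm_ring_hom "ev x" for x :: "'v \<Rightarrow> 'a" by (rule ev_hom)
  have "d * (p - q) = 0"
  proof (rule mpoly_eq_0_infinite[OF assms(1)])
    fix x
    show "ev x (d * (p - q)) = 0"
      using assms(3)[of x] by (cases "ev x d = 0") (auto simp: e.hom_mult e.hom_minus)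
  qed
  then show ?thesis using assms(2) by simp
qed

lemma mpoly_int_eq_0_complex:
  fixes p :: "('v, int) mpoly"
  assumes "\<And>x :: 'v \<Rightarrow> complex. mev of_int x p = 0"
  shows "p = 0"
proof -
  have "Poly_Mapping.map of_int p = (0 :: ('v, complex) mpoly)"
    using assms
    by (intro mpoly_eq_0_infinite) (auto simp: infinite_UNIV_char_0 ev_map[OF comm_ring_hom_of_int])
  then have "\<forall>m. Poly_Mapping.lookup (Poly_Mapping.map of_int p) m = (0 :: complex)" by simp
  then have "Poly_Mapping.lookup p m = 0" for m
    using spec[of "\<lambda>m. Poly_Mapping.lookup (Poly_Mapping.map of_int p) m = (0 :: complex)" m]
    by (auto simp: Poly_Mapping.map.rep_eq when_def split: if_splits)
  then show ?thesis by (intro poly_mapping_eqI) simp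
qed

section \<open>Compound matrices\<close>

text \<open>Entries given by a function carry no dimensions, so rows and columns can be reindexed
  without carrier conditions.\<close>

definition mdet :: "nat \<Rightarrow> (nat \<Rightarrow> nat \<Rightarrow> 'a::comm_ring_1) \<Rightarrow> 'a" where
  "mdet k f = det (mat k k (\<lambda>(i, j). f i j))"

lemma permutes_lt: "p permutes {0..<k} \<Longrightarrow> i < k \<Longrightarrow> p i < (k::nat)"
  using permutes_in_image[of p "{0..<k}" i] by simp

lemma mdet_sum: "mdet k f = (\<Sum>p | p permutes {0..<k}. signof p * (\<Prod>i=0..<k. f i (p i)))"
proof -
  have "mdet k f = (\<Sum>p | p permutes {0..<k}. signof p * (\<Prod>i=0..<k. mat k k (\<lambda>(i, j). f i j) $$ (i, p i)))"
    unfolding mdet_def by (rule det_def') simp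
  also have "\<dots> = (\<Sum>p | p permutes {0..<k}. signof p * (\<Prod>i=0..<k. f i (p i)))"
    by (intro sum.cong refl arg_cong2[of _ _ _ _ "(*)"] prod.cong) (auto dest: permutes_in_image)
  finally show ?thesis .
qed

lemma mdet_cong: "(\<And>i j. i < k \<Longrightarrow> j < k \<Longrightarrow> f i j = g i j) \<Longrightarrow> mdet k f = mdet k g"
  unfolding mdet_def by (intro arg_cong[of _ _ det] eq_matI) auto

lemma det_eq_mdet: "A \<in> carrier_mat n n \<Longrightarrow> det A = mdet n (\<lambda>i j. A $$ (i, j))"
  unfolding mdet_def by (intro arg_cong[of _ _ det] eq_matI) auto

lemma mdet_transpose: "mdet k (\<lambda>i j. f j i) = mdet k f"
proof -
  have "mat k k (\<lambda>(i, j). f j i) = transpose_mat (mat k k (\<lambda>(i, j). f i j))" by (intro eq_matI) auto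
  then show ?thesis unfolding mdet_def by (simp add: det_transpose[of _ k])
qed

lemma mdet_permute_rows:
  assumes "p permutes {0..<k}"
  shows "mdet k (\<lambda>i j. f (p i) j) = signof p * mdet k f"
proof -
  have "mdet k (\<lambda>i j. f (p i) j) = det (mat k k (\<lambda>(i, j). mat k k (\<lambda>(i, j). f i j) $$ (p i, j)))"
    unfolding mdet_def using assms by (intro arg_cong[of _ _ det] eq_matI) (auto simp: permutes_lt)
  also have "\<dots> = signof p * mdet k f"
    unfolding mdet_def by (rule det_permute_rows[OF _ assms]) simp
  finally show ?thesis .
qed

lemma mdet_permute_cols:
  assumes "p permutes {0..<k}"
  shows "mdet k (\<lambda>i j. f i (p j)) = signof p * mdet k f"
  using mdet_permute_rows[OF assms, of "\<lambda>i j. f j i"]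
  by (subst mdet_transpose[symmetric]) (simp add: mdet_transpose[of k f])

lemma mdet_identical_rows:
  assumes "i < k" "j < k" "i \<noteq> j" "\<And>l. l < k \<Longrightarrow> f i l = f j l"
  shows "mdet k f = 0"
  unfolding mdet_def
  by (rule det_identical_rows[of _ k i j]) (use assms in \<open>auto simp: Matrix.row_def\<close>)

lemma mdet_identical_cols:
  assumes "i < k" "j < k" "i \<noteq> j" "\<And>l. l < k \<Longrightarrow> f l i = f l j"
  shows "mdet k f = 0"
  using mdet_identical_rows[OF assms(1-3), of "\<lambda>i j. f j i"] assms(4) by (simp add: mdet_transpose[of k f])

lemma mdet_zero_row:
  assumes "i < k" "\<And>j. j < k \<Longrightarrow> f i j = 0"
  shows "mdet k f = 0"
  unfolding mdet_sum
proof (intro sum.neutral ballI)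
  fix p assume "p \<in> {p. p permutes {0..<k}}"
  then have "f i (p i) = 0" using assms by (auto simp: permutes_lt)
  then have "(\<Prod>i=0..<k. f i (p i)) = 0" using assms(1) by (intro prod_zero) auto
  then show "signof p * (\<Prod>i=0..<k. f i (p i)) = 0" by simp
qed

lemma mdet_zero_col:
  assumes "i < k" "\<And>j. j < k \<Longrightarrow> f j i = 0"
  shows "mdet k f = 0"
  using mdet_zero_row[OF assms(1), of "\<lambda>i j. f j i"] assms(2) by (simp add: mdet_transpose[of k f])

lemma mdet_upper_triangular:
  assumes "\<And>i j. j < i \<Longrightarrow> i < k \<Longrightarrow> f i j = 0"
  shows "mdet k f = (\<Prod>i<k. f i i)"
proof -
  have "mdet k f = prod_list (diag_mat (mat k k (\<lambda>(i, j). f i j)))"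
    unfolding mdet_def by (rule det_upper_triangular[of _ k]) (use assms in \<open>auto simp: upper_triangular_def\<close>)
  also have "\<dots> = (\<Prod>i<k. f i i)"
    by (simp add: prod_list_diag_prod atLeast0LessThan)
  finally show ?thesis .
qed

lemma mdet_diag: "mdet k (\<lambda>i j. if i = j then f i else 0) = (\<Prod>i<k. f i)"
  by (subst mdet_upper_triangular) auto

lemma mdet_scale_rows: "mdet k (\<lambda>i j. c i * f i j) = (\<Prod>i<k. c i) * mdet k f"
  unfolding mdet_sum sum_distrib_left
  by (intro sum.cong refl) (simp add: prod.distrib atLeast0LessThan algebra_simps)

lemma mdet_scale_cols: "mdet k (\<lambda>i j. c j * f i j) = (\<Prod>i<k. c i) * mdet k f"
  using mdet_scale_rows[of k c "\<lambda>i j. f j i"]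
  by (subst mdet_transpose[symmetric]) (simp add: mdet_transpose[of k f])

lemma mdet_hom:
  assumes "comm_ring_hom h"
  shows "h (mdet k f) = mdet k (\<lambda>i j. h (f i j))"
proof -
  interpret comm_ring_hom h by fact
  show ?thesis unfolding mdet_sum by (simp add: hom_sum hom_mult hom_prod)
qed

lemma index_mult_mat_sum:
  assumes "A \<in> carrier_mat n m" "B \<in> carrier_mat m r" "i < n" "j < r"
  shows "(A * B) $$ (i, j) = (\<Sum>l<m. A $$ (i, l) * B $$ (l, j))"
  using assms by (auto simp: scalar_prod_def atLeast0LessThan)

lemma mdet_mult: "mdet k (\<lambda>i j. \<Sum>l<k. f i l * g l j) = mdet k f * mdet k g"
proof -
  have "mat k k (\<lambda>(i, j). \<Sum>l<k. f i l * g l j) = mat k k (\<lambda>(i, j). f i j) * mat k k (\<lambda>(i, j). g i j)"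
    by (intro eq_matI) (auto simp: scalar_prod_def atLeast0LessThan)
  then show ?thesis unfolding mdet_def by (simp add: det_mult[of _ k])
qed

definition minor :: "'a::comm_ring_1 mat \<Rightarrow> nat list \<Rightarrow> nat list \<Rightarrow> 'a" where
  "minor M xs ys = mdet (length xs) (\<lambda>i j. M $$ (xs ! i, ys ! j))"

text \<open>The order of the lists in \<open>KB\<close>, which index a basis of the exterior power, is immaterial.\<close>
definition kbase :: "nat \<Rightarrow> nat \<Rightarrow> nat list list \<Rightarrow> bool" where
  "kbase n k KB \<longleftrightarrow> distinct KB \<and>
     set KB = {xs. sorted_wrt (<) xs \<and> length xs = k \<and> set xs \<subseteq> {..<n}}"

definition compound :: "nat list list \<Rightarrow> 'a::comm_ring_1 mat \<Rightarrow> 'a mat" where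
  "compound KB M = mat (length KB) (length KB) (\<lambda>(p, q). minor M (KB ! p) (KB ! q))"

lemma kbaseD:
  assumes "kbase n k KB" "p < length KB"
  shows "sorted_wrt (<) (KB ! p)" "length (KB ! p) = k" "set (KB ! p) \<subseteq> {..<n}" "distinct (KB ! p)"
    and "i < k \<Longrightarrow> KB ! p ! i < n"
proof -
  have "KB ! p \<in> set KB" using assms(2) by simp
  then show 1: "sorted_wrt (<) (KB ! p)" "length (KB ! p) = k" "set (KB ! p) \<subseteq> {..<n}"
    using assms(1) by (auto simp: kbase_def)
  then show "distinct (KB ! p)" by (simp add: strict_sorted_iff)
  show "i < k \<Longrightarrow> KB ! p ! i < n" using 1 by (metis lessThan_iff nth_mem subsetD)
qed

lemma kbase_distinct: "kbase n k KB \<Longrightarrow> p < length KB \<Longrightarrow> q < length KB \<Longrightarrow> KB ! p = KB ! q \<longleftrightarrow> p = q"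
  by (auto simp: kbase_def nth_eq_iff_index_eq)

lemma kbase_set_eq:
  assumes "kbase n k KB" "p < length KB" "q < length KB"
  shows "set (KB ! p) = set (KB ! q) \<longleftrightarrow> p = q"
  using assms kbaseD(1)[of n k KB] by (metis kbase_distinct strict_sorted_equal)

lemma kbase_bij:
  assumes "kbase n k KB"
  shows "bij_betw (\<lambda>p. set (KB ! p)) {..<length KB} {S. S \<subseteq> {..<n} \<and> card S = k}"
proof -
  have "inj_on (\<lambda>p. set (KB ! p)) {..<length KB}"
    using assms by (auto simp: inj_on_def kbase_set_eq)
  moreover have "S \<in> (\<lambda>p. set (KB ! p)) ` {..<length KB}" if S: "S \<subseteq> {..<n}" "card S = k" for S
  proof -
    have fin: "finite S" using S(1) by (rule finite_subset) auto
    then have "sorted_list_of_set S \<in> set KB"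
      using S assms by (auto simp: kbase_def)
    then obtain p where "p < length KB" "KB ! p = sorted_list_of_set S" by (auto simp: in_set_conv_nth)
    then have "set (KB ! p) = S" using fin by simp
    then show ?thesis using \<open>p < length KB\<close> by blast
  qed
  moreover have "set (KB ! p) \<subseteq> {..<n} \<and> card (set (KB ! p)) = k" if "p < length KB" for p
    using kbaseD[OF assms that] by (simp add: distinct_card)
  ultimately show ?thesis unfolding bij_betw_def by (intro conjI) blast+
qed

lemma kbase_length:
  assumes "kbase n k KB"
  shows "length KB = n choose k"
  using bij_betw_same_card[OF kbase_bij[OF assms]] n_subsets[of "{..<n}" k] by simp

lemma kbase_exists: "\<exists>KB. kbase n k KB"
proof -
  have "finite {xs. sorted_wrt (<) xs \<and> length xs = k \<and> set xs \<subseteq> {..<n}}"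
    by (rule finite_subset[OF _ finite_lists_length_eq[of "{..<n}" k]]) auto
  from finite_distinct_list[OF this] show ?thesis
    by (rule ex_forward) (simp add: kbase_def)
qed

lemma distinct_lists_permutation:
  assumes "distinct xs" "distinct ys" "set xs = set ys"
  obtains p where "p permutes {0..<length xs}" "\<And>i. i < length xs \<Longrightarrow> xs ! i = ys ! p i"
proof -
  have "mset xs = mset ys" using assms set_eq_iff_mset_eq_distinct by blast
  then obtain p where p: "p permutes {..<length ys}" "permute_list p ys = xs" by (rule mset_eq_permutation)
  moreover have "length xs = length ys" using p(2) by auto
  ultimately show thesis using permute_list_nth[OF p(1)]
    by (intro that[of p]) (auto simp: atLeast0LessThan)
qed

text \<open>Expanding all rows gives a sum over maps \<open>g\<close> from the row indices to
  \<open>{..<n}\<close>. A map that is not injective repeats a row and contributes zero; an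
  injective one is a sorted \<open>k\<close>-list composed with a permutation, and summing over the
  permutations restores the minor of \<open>M\<close>.\<close>

lemma cauchy_binet_mdet:
  fixes M Y :: "nat \<Rightarrow> nat \<Rightarrow> 'a::comm_ring_1"
  assumes KB: "kbase n k KB"
  shows "mdet k (\<lambda>i j. \<Sum>l<n. M i l * Y l j) =
    (\<Sum>q<length KB. mdet k (\<lambda>i j. M i (KB ! q ! j)) * mdet k (\<lambda>i j. Y (KB ! q ! i) j))"
proof -
  let ?F = "PiE {0..<k} (\<lambda>_. {..<n})"
  let ?S = "{p. p permutes {0..<k}}"
  let ?I = "{g \<in> ?F. inj_on g {0..<k}}"
  define d where "d g = mdet k (\<lambda>i j. Y (g i) j)" for g
  have finF: "finite ?F" by (rule finite_PiE) auto
  have finS: "finite ?S" by (rule finite_permutations) simp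
  have "mdet k (\<lambda>i j. \<Sum>l<n. M i l * Y l j) =
     (\<Sum>p\<in>?S. signof p * (\<Sum>g\<in>?F. \<Prod>i=0..<k. M i (g i) * Y (g i) (p i)))"
    unfolding mdet_sum by (intro sum.cong refl arg_cong2[of _ _ _ _ "(*)"] prod_sum_PiE) auto
  also have "\<dots> = (\<Sum>g\<in>?F. (\<Prod>i=0..<k. M i (g i)) * d g)"
    unfolding d_def mdet_sum sum_distrib_left
    by (subst sum.swap, intro sum.cong refl) (simp add: prod.distrib algebra_simps)
  also have "\<dots> = (\<Sum>g\<in>?I. (\<Prod>i=0..<k. M i (g i)) * d g)"
  proof (rule sum.mono_neutral_right[OF finF])
    show "\<forall>g\<in>?F - ?I. (\<Prod>i=0..<k. M i (g i)) * d g = 0"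
    proof
      fix g assume "g \<in> ?F - ?I"
      then obtain i j where "i < k" "j < k" "i \<noteq> j" "g i = g j" by (auto simp: inj_on_def)
      then have "d g = 0" unfolding d_def by (intro mdet_identical_rows[of i k j]) auto
      then show "(\<Prod>i=0..<k. M i (g i)) * d g = 0" by simp
    qed
  qed auto
  also have "\<dots> = (\<Sum>(q, p)\<in>{..<length KB} \<times> ?S.
     (\<Prod>i=0..<k. M i (KB ! q ! p i)) * d (\<lambda>i. KB ! q ! p i))"
  proof -
    let ?R = "\<lambda>(q, p). restrict (\<lambda>i. KB ! q ! p i) {0..<k}"
    have inj: "inj_on ?R ({..<length KB} \<times> ?S)"
      proof (rule inj_onI, clarsimp)
        fix q p q' p'
        assume q: "q < length KB" "q' < length KB" and p: "p permutes {0..<k}" "p' permutes {0..<k}"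
          and eq: "restrict (\<lambda>i. KB ! q ! p i) {0..<k} = restrict (\<lambda>i. KB ! q' ! p' i) {0..<k}"
        have e: "KB ! q ! p i = KB ! q' ! p' i" if "i < k" for i
          using fun_cong[OF eq, of i] that by simp
        have im: "(\<lambda>i. KB ! q ! p i) ` {0..<k} = set (KB ! q)" if "q < length KB" "p permutes {0..<k}" for q p
        proof -
          have "(\<lambda>i. KB ! q ! p i) ` {0..<k} = (!) (KB ! q) ` (p ` {0..<k})" by (simp add: image_image)
          also have "\<dots> = (!) (KB ! q) ` {0..<k}" using permutes_image[OF that(2)] by simp
          also have "\<dots> = set (KB ! q)" using kbaseD(2)[OF KB that(1)] by (auto simp: set_conv_nth)
          finally show ?thesis .
        qed
        have "set (KB ! q) = set (KB ! q')"
          unfolding im[OF q(1) p(1), symmetric] im[OF q(2) p(2), symmetric] using e by (intro image_cong) auto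
        then have qq: "q = q'" using kbase_set_eq[OF KB q] by simp
        have "p i = p' i" for i
        proof (cases "i < k")
          case True
          then have "p i < k" "p' i < k" using p by (auto simp: permutes_lt)
          then show ?thesis using e[OF True] qq kbaseD[OF KB q(2)] by (auto simp: nth_eq_iff_index_eq)
        next
          case False
          then show ?thesis using p by (auto simp: permutes_def)
        qed
        then show "q = q' \<and> p = p'" using qq by auto
      qed
    have sub: "?R ` ({..<length KB} \<times> ?S) \<subseteq> ?I"
    proof
      fix g assume "g \<in> ?R ` ({..<length KB} \<times> ?S)"
      then obtain q p where q: "q < length KB" and p: "p permutes {0..<k}"
        and g: "g = restrict (\<lambda>i. KB ! q ! p i) {0..<k}" by auto
      have pk: "p i < k" if "i < k" for i using p that by (auto simp: permutes_lt)
      have "inj_on g {0..<k}"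
        using kbaseD[OF KB q] pk permutes_inj[OF p]
        by (auto simp: inj_on_def g nth_eq_iff_index_eq)
      moreover have "g \<in> ?F" using kbaseD(5)[OF KB q] pk by (auto simp: g)
      ultimately show "g \<in> ?I" by simp
    qed
    have sup: "?I \<subseteq> ?R ` ({..<length KB} \<times> ?S)"
    proof
      fix g assume g: "g \<in> ?I"
      let ?xs = "map g [0..<k]"
      let ?ys = "sorted_list_of_set (set ?xs)"
      have d: "distinct ?xs" using g by (auto simp: distinct_map)
      have "?ys \<in> set KB" using KB g d distinct_card[OF d] by (auto simp: kbase_def)
      then obtain q where q: "q < length KB" "KB ! q = ?ys" by (auto simp: in_set_conv_nth)
      obtain p where p: "p permutes {0..<length ?xs}" "\<And>i. i < length ?xs \<Longrightarrow> ?xs ! i = ?ys ! p i"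
        using distinct_lists_permutation[of ?xs ?ys] d by auto
      have "g = restrict (\<lambda>i. KB ! q ! p i) {0..<k}"
      proof
        fix i show "g i = restrict (\<lambda>i. KB ! q ! p i) {0..<k} i"
          using p(2)[of i] g q(2) by (cases "i < k") (auto simp: PiE_def extensional_def)
      qed
      then show "g \<in> ?R ` ({..<length KB} \<times> ?S)"
        using p(1) q(1) by (intro image_eqI[of _ _ "(q, p)"]) auto
    qed
    have "bij_betw ?R ({..<length KB} \<times> ?S) ?I"
      unfolding bij_betw_def by (intro conjI subset_antisym inj sub sup)
    from sum.reindex_bij_betw[OF this, of "\<lambda>g. (\<Prod>i=0..<k. M i (g i)) * d g"]
    have "(\<Sum>g\<in>?I. (\<Prod>i=0..<k. M i (g i)) * d g) =
      (\<Sum>x\<in>{..<length KB} \<times> ?S. (\<Prod>i=0..<k. M i ((case x of (q, p) \<Rightarrow> restrict (\<lambda>i. KB ! q ! p i) {0..<k}) i)) *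
        d (case x of (q, p) \<Rightarrow> restrict (\<lambda>i. KB ! q ! p i) {0..<k}))" by (rule sym)
    also have "\<dots> = (\<Sum>(q, p)\<in>{..<length KB} \<times> ?S. (\<Prod>i=0..<k. M i (KB ! q ! p i)) * d (\<lambda>i. KB ! q ! p i))"
      unfolding d_def by (intro sum.cong refl) (auto intro!: arg_cong2[of _ _ _ _ "(*)"] mdet_cong)
    finally show ?thesis .
  qed
  also have "\<dots> = (\<Sum>q<length KB. \<Sum>p\<in>?S. (\<Prod>i=0..<k. M i (KB ! q ! p i)) * d (\<lambda>i. KB ! q ! p i))"
    by (simp add: sum.cartesian_product)
  also have "\<dots> = (\<Sum>q<length KB. mdet k (\<lambda>i j. M i (KB ! q ! j)) * mdet k (\<lambda>i j. Y (KB ! q ! i) j))"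
  proof (intro sum.cong refl)
    fix q assume "q \<in> {..<length KB}"
    have "(\<Sum>p\<in>?S. (\<Prod>i=0..<k. M i (KB ! q ! p i)) * d (\<lambda>i. KB ! q ! p i)) =
      (\<Sum>p\<in>?S. (\<Prod>i=0..<k. M i (KB ! q ! p i)) * (signof p * mdet k (\<lambda>i j. Y (KB ! q ! i) j)))"
      unfolding d_def by (intro sum.cong refl) (auto simp: mdet_permute_rows[of _ k "\<lambda>i j. Y (KB ! q ! i) j"])
    also have "\<dots> = mdet k (\<lambda>i j. M i (KB ! q ! j)) * mdet k (\<lambda>i j. Y (KB ! q ! i) j)"
      unfolding mdet_sum[of k "\<lambda>i j. M i (KB ! q ! j)"] sum_distrib_right
      by (intro sum.cong refl) (simp add: algebra_simps)
    finally show "(\<Sum>p\<in>?S. (\<Prod>i=0..<k. M i (KB ! q ! p i)) * d (\<lambda>i. KB ! q ! p i)) =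
      mdet k (\<lambda>i j. M i (KB ! q ! j)) * mdet k (\<lambda>i j. Y (KB ! q ! i) j)" .
  qed
  finally show ?thesis .
qed

lemma cauchy_binet:
  assumes "kbase n k KB" "M \<in> carrier_mat m n" "Y \<in> carrier_mat n r"
    and "length xs = k" "length zs = k" "set xs \<subseteq> {..<m}" "set zs \<subseteq> {..<r}"
  shows "minor (M * Y) xs zs = (\<Sum>q<length KB. minor M xs (KB ! q) * minor Y (KB ! q) zs)"
proof -
  have "xs ! i < m" "zs ! i < r" if "i < k" for i
    using that assms by (metis lessThan_iff nth_mem subsetD)+
  then have "minor (M * Y) xs zs = mdet k (\<lambda>i j. \<Sum>l<n. M $$ (xs ! i, l) * Y $$ (l, zs ! j))"
    unfolding minor_def assms(4) by (intro mdet_cong index_mult_mat_sum[OF assms(2,3)]) auto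
  also have "\<dots> = (\<Sum>q<length KB. minor M xs (KB ! q) * minor Y (KB ! q) zs)"
    unfolding cauchy_binet_mdet[OF assms(1)] minor_def using assms(4) kbaseD(2)[OF assms(1)]
    by (intro sum.cong refl) auto
  finally show ?thesis .
qed

lemma compound_carrier [simp]: "compound KB M \<in> carrier_mat (length KB) (length KB)"
  by (simp add: compound_def)

lemma compound_dims [simp]: "dim_row (compound KB M) = length KB" "dim_col (compound KB M) = length KB"
  by (simp_all add: compound_def)

lemma compound_mult:
  assumes "kbase n k KB" "M \<in> carrier_mat n n" "Y \<in> carrier_mat n n"
  shows "compound KB (M * Y) = compound KB M * compound KB Y"
proof (rule eq_matI)
  fix p q assume "p < dim_row (compound KB M * compound KB Y)" "q < dim_col (compound KB M * compound KB Y)"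
  then have pq: "p < length KB" "q < length KB" by auto
  have "(compound KB M * compound KB Y) $$ (p, q) = (\<Sum>l<length KB. compound KB M $$ (p, l) * compound KB Y $$ (l, q))"
    by (rule index_mult_mat_sum[OF compound_carrier compound_carrier pq])
  also have "\<dots> = compound KB (M * Y) $$ (p, q)"
    using pq cauchy_binet[OF assms] kbaseD[OF assms(1)] by (simp add: compound_def)
  finally show "compound KB (M * Y) $$ (p, q) = (compound KB M * compound KB Y) $$ (p, q)" by simp
qed auto

definition dg :: "nat \<Rightarrow> (nat \<Rightarrow> 'a::zero) \<Rightarrow> 'a mat" where
  "dg n f = mat n n (\<lambda>(i, j). if i = j then f i else 0)"

lemma dg_carrier [simp]: "dg n f \<in> carrier_mat n n"
  by (simp add: dg_def)

lemma dg_dims [simp]: "dim_row (dg n f) = n" "dim_col (dg n f) = n"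
  by (simp_all add: dg_def)

lemma dg_index [simp]: "i < n \<Longrightarrow> j < n \<Longrightarrow> dg n f $$ (i, j) = (if i = j then f i else 0)"
  by (simp add: dg_def)

lemma index_mult_dg:
  assumes "A \<in> carrier_mat m n" "i < m" "j < n"
  shows "(A * dg n f) $$ (i, j) = A $$ (i, j) * (f j :: 'a::comm_ring_1)"
  unfolding index_mult_mat_sum[OF assms(1) dg_carrier assms(2,3)] using assms
  by (simp add: if_distrib[of "(*) _"] sum.delta cong: if_cong)

lemma one_mat_dg: "1\<^sub>m n = dg n (\<lambda>_. 1)"
  by (intro eq_matI) auto

lemma det_dg: "det (dg n f) = (\<Prod>i<n. f i)"
  by (simp add: dg_def mdet_diag flip: mdet_def)

lemma compound_dg:
  assumes KB: "kbase n k KB"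
  shows "compound KB (dg n f) = dg (length KB) (\<lambda>p. \<Prod>s\<in>set (KB ! p). f s)"
proof (rule eq_matI)
  fix p q assume "p < dim_row (dg (length KB) (\<lambda>p. \<Prod>s\<in>set (KB ! p). f s))"
    "q < dim_col (dg (length KB) (\<lambda>p. \<Prod>s\<in>set (KB ! p). f s))"
  then have pq: "p < length KB" "q < length KB" by auto
  note P = kbaseD[OF KB pq(1)] and Q = kbaseD[OF KB pq(2)]
  show "compound KB (dg n f) $$ (p, q) = dg (length KB) (\<lambda>p. \<Prod>s\<in>set (KB ! p). f s) $$ (p, q)"
  proof (cases "p = q")
    case True
    have "minor (dg n f) (KB ! p) (KB ! p) = mdet k (\<lambda>i j. if i = j then f (KB ! p ! i) else 0)"
      unfolding minor_def P(2) using P by (intro mdet_cong) (auto simp: nth_eq_iff_index_eq)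
    also have "\<dots> = (\<Prod>i<k. f (KB ! p ! i))" by (rule mdet_diag)
    also have "\<dots> = (\<Prod>s\<in>set (KB ! p). f s)"
      using P by (intro prod.reindex_bij_betw bij_betw_nth) auto
    finally show ?thesis using pq True by (simp add: compound_def)
  next
    case False
    then have "set (KB ! p) \<noteq> set (KB ! q)" using kbase_set_eq[OF KB pq] by simp
    then have "\<not> set (KB ! p) \<subseteq> set (KB ! q)"
      using P(2,4) Q(2,4) by (metis List.finite_set card_subset_eq distinct_card)
    then obtain i where i: "i < k" "KB ! p ! i \<notin> set (KB ! q)" using P(2) by (metis in_set_conv_nth subsetI)
    have "minor (dg n f) (KB ! p) (KB ! q) = 0"
      unfolding minor_def P(2)
    proof (rule mdet_zero_row[OF i(1)])
      fix j assume "j < k"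
      then have "KB ! p ! i \<noteq> KB ! q ! j" using i(2) Q(2) by (metis nth_mem)
      then show "dg n f $$ (KB ! p ! i, KB ! q ! j) = 0" using P(5)[OF i(1)] Q(5)[OF \<open>j < k\<close>] by simp
    qed
    then show ?thesis using pq False by (simp add: compound_def)
  qed
qed auto

lemma compound_one: "kbase n k KB \<Longrightarrow> compound KB (1\<^sub>m n) = 1\<^sub>m (length KB)"
  by (simp add: one_mat_dg compound_dg)

lemma compound_hom:
  assumes "comm_ring_hom h" "kbase n k KB" "M \<in> carrier_mat n n"
  shows "compound KB (map_mat h M) = map_mat h (compound KB M)"
proof (rule eq_matI)
  fix p q assume "p < dim_row (map_mat h (compound KB M))" "q < dim_col (map_mat h (compound KB M))"
  then have pq: "p < length KB" "q < length KB" by auto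
  have "minor (map_mat h M) (KB ! p) (KB ! q) = h (minor M (KB ! p) (KB ! q))"
    unfolding minor_def mdet_hom[OF assms(1)] using assms(3) kbaseD[OF assms(2) pq(1)] kbaseD[OF assms(2) pq(2)]
    by (intro mdet_cong) auto
  then show "compound KB (map_mat h M) $$ (p, q) = map_mat h (compound KB M) $$ (p, q)"
    using pq by (simp add: compound_def)
qed auto

section \<open>Vandermonde determinants\<close>

lemma newton_poly_degree: "degree (\<Prod>l<i::nat. [:- x l, 1:]) = i" "coeff (\<Prod>l<i. [:- x l, 1::'a::idom:]) i = 1"
proof -
  show 1: "degree (\<Prod>l<i::nat. [:- x l, 1::'a:]) = i" for x :: "nat \<Rightarrow> 'a"
    by (subst degree_prod_eq_sum_degree) auto
  have "lead_coeff (\<Prod>l<i::nat. [:- x l, 1::'a:]) = 1" by (simp add: lead_coeff_prod)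
  then show "coeff (\<Prod>l<i. [:- x l, 1:]) i = 1" using 1 by simp
qed

text \<open>The Newton basis \<open>1, t - x 0, (t - x 0) (t - x 1), \<dots>\<close> differs from
  the monomials by a unitriangular matrix, and its values at the nodes form a triangular
  one.\<close>

lemma vandermonde:
  fixes x :: "nat \<Rightarrow> 'a::idom"
  shows "mdet n (\<lambda>i j. x j ^ i) = (\<Prod>j<n. \<Prod>i<j. x j - x i)"
proof -
  let ?q = "\<lambda>i. \<Prod>l<i. [:- x l, 1:]"
  have low: "mdet n (\<lambda>i m. coeff (?q i) m) = 1"
    by (subst mdet_transpose[symmetric], subst mdet_upper_triangular)
      (auto intro!: coeff_eq_0 simp: newton_poly_degree)
  have "mdet n (\<lambda>i j. poly (?q i) (x j)) = mdet n (\<lambda>i j. \<Sum>m<n. coeff (?q i) m * x j ^ m)"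
  proof (rule mdet_cong)
    fix i j assume ij: "i < n" "j < n"
    show "poly (?q i) (x j) = (\<Sum>m<n. coeff (?q i) m * x j ^ m)"
      unfolding poly_altdef newton_poly_degree using ij
      by (intro sum.mono_neutral_left) (auto intro!: coeff_eq_0 simp: newton_poly_degree)
  qed
  also have "\<dots> = mdet n (\<lambda>i j. x j ^ i)"
    using low by (simp add: mdet_mult)
  finally have "mdet n (\<lambda>i j. x j ^ i) = mdet n (\<lambda>i j. poly (?q i) (x j))" ..
  also have "\<dots> = (\<Prod>j<n. poly (?q j) (x j))"
    by (rule mdet_upper_triangular) (auto simp: poly_prod)
  also have "\<dots> = (\<Prod>j<n. \<Prod>i<j. x j - x i)" by (simp add: poly_prod)
  finally show ?thesis .
qed

lemma vandermonde_nonzero: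
  fixes x :: "nat \<Rightarrow> 'a::idom"
  assumes "inj_on x {..<n}"
  shows "mdet n (\<lambda>i j. x j ^ i) \<noteq> 0"
proof -
  have "x j - x i \<noteq> 0" if "j < n" "i < j" for i j
    using inj_onD[OF assms, of j i] that by auto
  then show ?thesis unfolding vandermonde by simp
qed

section \<open>Generic matrices are diagonalizable\<close>

text \<open>Written without the inverse of \<open>P\<close>, so that it can be stated over rings as
  well as over fields.\<close>

definition diagz :: "nat \<Rightarrow> 'a::comm_ring_1 mat \<Rightarrow> 'a mat \<Rightarrow> (nat \<Rightarrow> 'a) \<Rightarrow> bool" where
  "diagz n A P l \<longleftrightarrow> A \<in> carrier_mat n n \<and> P \<in> carrier_mat n n \<and> det P \<noteq> 0 \<and> A * P = P * dg n l"

text \<open>This is \<open>p'(A)\<close>, where \<open>p\<close> is the characteristic polynomial of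
  \<open>A\<close>.\<close>

definition deriv_mat :: "nat \<Rightarrow> 'a::comm_ring_1 mat \<Rightarrow> 'a mat" where
  "deriv_mat n A = mat n n (\<lambda>(p, q). \<Sum>i<n. of_nat (Suc i) * coeff (char_poly A) (Suc i) * (A ^\<^sub>m i) $$ (p, q))"

text \<open>Up to sign this is the discriminant of the characteristic polynomial.\<close>
definition dsc :: "nat \<Rightarrow> 'a::comm_ring_1 mat \<Rightarrow> 'a" where
  "dsc n A = det (deriv_mat n A)"

lemma deriv_mat_carrier [simp]: "deriv_mat n A \<in> carrier_mat n n"
  by (simp add: deriv_mat_def)

lemma dsc_hom:
  assumes "comm_ring_hom h" "A \<in> carrier_mat n n"
  shows "dsc n (map_mat h A) = h (dsc n A)"
proof -
  interpret comm_ring_hom h by fact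
  have "deriv_mat n (map_mat h A) = map_mat h (deriv_mat n A)"
  proof (rule eq_matI)
    fix p q assume "p < dim_row (map_mat h (deriv_mat n A))" "q < dim_col (map_mat h (deriv_mat n A))"
    then have pq: "p < n" "q < n" by (auto simp: deriv_mat_def)
    have pw: "(map_mat h A ^\<^sub>m i) $$ (p, q) = h ((A ^\<^sub>m i) $$ (p, q))" for i
      using pq carrier_matD[OF pow_carrier_mat[OF assms(2), of i]]
      unfolding mat_hom_pow[OF assms(2), symmetric] by simp
    show "deriv_mat n (map_mat h A) $$ (p, q) = map_mat h (deriv_mat n A) $$ (p, q)"
      using pq by (simp add: deriv_mat_def pw char_poly_hom[OF assms(2)] hom_sum hom_mult hom_add hom_of_nat)
  qed (auto simp: deriv_mat_def)
  then show ?thesis by (simp add: dsc_def)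
qed

lemma dg_pow: "dg n f ^\<^sub>m i = dg n (\<lambda>p. f p ^ i :: 'a::comm_ring_1)"
proof (induction i)
  case 0
  then show ?case by (simp add: one_mat_dg)
next
  case (Suc i)
  show ?case
  proof (rule eq_matI)
    fix p q assume "p < dim_row (dg n (\<lambda>p. f p ^ Suc i))" "q < dim_col (dg n (\<lambda>p. f p ^ Suc i))"
    then show "(dg n f ^\<^sub>m Suc i) $$ (p, q) = dg n (\<lambda>p. f p ^ Suc i) $$ (p, q)"
      by (simp add: Suc.IH index_mult_dg[OF dg_carrier] algebra_simps del: index_mult_mat)
  qed (auto simp: Suc.IH)
qed

lemma char_poly_dg: "char_poly (dg n f) = (\<Prod>i<n. [:- f i, 1 :: 'a::comm_ring_1:])"
proof -
  have "char_poly (dg n f) = (\<Prod>a\<leftarrow>diag_mat (dg n f). [:- a, 1:])"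
    by (rule char_poly_upper_triangular[of _ n]) (auto simp: upper_triangular_def)
  also have "diag_mat (dg n f) = map f [0..<n]" by (auto simp: diag_mat_def)
  also have "(\<Prod>a\<leftarrow>map f [0..<n]. [:- a, 1:]) = (\<Prod>i<n. [:- f i, 1:])"
    by (simp add: prod.distinct_set_conv_list[symmetric] atLeast0LessThan comp_def)
  finally show ?thesis .
qed

lemma pderiv_char_poly_sum:
  assumes "A \<in> carrier_mat n n"
  shows "poly (pderiv (char_poly A)) x = (\<Sum>i<n. of_nat (Suc i) * coeff (char_poly A) (Suc i) * (x :: 'a::idom) ^ i)"
proof -
  have 0: "coeff (pderiv (char_poly A)) i = 0" if "i \<ge> n" for i
    using degree_monic_char_poly[OF assms] that by (simp add: coeff_pderiv coeff_eq_0)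
  have "poly (pderiv (char_poly A)) x = (\<Sum>i<n. coeff (pderiv (char_poly A)) i * x ^ i)"
    unfolding poly_altdef
  proof (rule sum.mono_neutral_cong)
    fix i assume "i \<in> {..<n} - {..degree (pderiv (char_poly A))}"
    then show "coeff (pderiv (char_poly A)) i * x ^ i = 0" by (auto intro: coeff_eq_0)
  next
    fix i assume "i \<in> {..degree (pderiv (char_poly A))} - {..<n}"
    then show "coeff (pderiv (char_poly A)) i * x ^ i = 0" using 0[of i] by auto
  qed auto
  then show ?thesis by (simp add: coeff_pderiv)
qed

lemma dsc_dg_nonzero:
  fixes f :: "nat \<Rightarrow> 'a::idom"
  assumes "inj_on f {..<n}"
  shows "dsc n (dg n f) \<noteq> 0"
proof -
  let ?c = "char_poly (dg n f)"
  have "deriv_mat n (dg n f) = dg n (\<lambda>p. poly (pderiv ?c) (f p))"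
  proof (rule eq_matI)
    fix p q assume "p < dim_row (dg n (\<lambda>p. poly (pderiv ?c) (f p)))" "q < dim_col (dg n (\<lambda>p. poly (pderiv ?c) (f p)))"
    then show "deriv_mat n (dg n f) $$ (p, q) = dg n (\<lambda>p. poly (pderiv ?c) (f p)) $$ (p, q)"
      by (simp add: deriv_mat_def dg_pow pderiv_char_poly_sum[OF dg_carrier])
  qed (auto simp: deriv_mat_def)
  then have "dsc n (dg n f) = (\<Prod>p<n. poly (pderiv ?c) (f p))" by (simp add: dsc_def det_dg)
  also have "\<dots> \<noteq> 0"
  proof -
    have "poly (pderiv ?c) (f p) \<noteq> 0" if p: "p < n" for p
    proof -
      have "poly (pderiv ?c) (f p) = (\<Sum>a<n. \<Prod>i\<in>{..<n} - {a}. f p - f i)"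
        unfolding char_poly_dg pderiv_prod by (simp add: poly_sum poly_prod pderiv_pCons)
      \<comment> \<open>Every other term of the product rule keeps the factor
        \<open>f p - f p\<close>.\<close>
      also have "\<dots> = (\<Sum>a\<in>{p}. \<Prod>i\<in>{..<n} - {a}. f p - f i)"
        using p by (intro sum.mono_neutral_right) auto
      also have "\<dots> \<noteq> 0" using p inj_onD[OF assms, of p] by auto
      finally show ?thesis .
    qed
    then show ?thesis by simp
  qed
  finally show ?thesis .
qed

lemma diag_pow:
  assumes "A \<in> carrier_mat n n" "P \<in> carrier_mat n n" "A * P = P * dg n l"
  shows "A ^\<^sub>m i * P = P * dg n (\<lambda>j. l j ^ i :: 'a::comm_ring_1)"
proof (induction i)
  case 0
  then show ?case using assms by (simp flip: one_mat_dg)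
next
  case (Suc i)
  have "A ^\<^sub>m Suc i * P = A ^\<^sub>m i * (P * dg n l)"
    using assms by (simp add: assoc_mult_mat[of _ n n _ n _ n])
  also have "\<dots> = P * dg n (\<lambda>j. l j ^ i) * dg n l"
    using assms Suc.IH by (simp add: assoc_mult_mat[of _ n n _ n _ n, symmetric])
  also have "\<dots> = P * (dg n (\<lambda>j. l j ^ i) * dg n l)"
    using assms by (simp add: assoc_mult_mat[of _ n n _ n _ n])
  also have "dg n (\<lambda>j. l j ^ i) * dg n l = dg n (\<lambda>j. l j ^ Suc i)"
    using dg_pow[of n l "Suc i"] unfolding pow_mat.simps(2) dg_pow .
  finally show ?case .
qed

text \<open>If \<open>P w = 0\<close>, then \<open>P diag(l^i) w = A^i P w = 0\<close> for all
  \<open>i\<close>. Row \<open>p\<close> of these relations is a Vandermonde system for the numbers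
  \<open>w_j P_pj\<close>, which must therefore all vanish.\<close>

lemma distinct_eigenvectors_det:
  fixes A :: "'a::field mat"
  assumes A: "A \<in> carrier_mat n n" and P: "P \<in> carrier_mat n n" and AP: "A * P = P * dg n l"
    and l: "inj_on l {..<n}" and nz: "\<And>j. j < n \<Longrightarrow> \<exists>p<n. P $$ (p, j) \<noteq> 0"
  shows "det P \<noteq> 0"
proof
  assume "det P = 0"
  then obtain w where w: "w \<in> carrier_vec n" "w \<noteq> 0\<^sub>v n" "P *\<^sub>v w = 0\<^sub>v n"
    using det_0_iff_vec_prod_zero_field[OF P] by blast
  then obtain j where j: "j < n" "w $ j \<noteq> 0" by (metis carrier_vecD eq_vecI index_zero_vec)
  obtain p where p: "p < n" "P $$ (p, j) \<noteq> 0" using nz[OF j(1)] by blast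
  let ?V = "mat n n (\<lambda>(i, j). l j ^ i)"
  define u where "u = vec n (\<lambda>j. w $ j * P $$ (p, j))"
  have "?V *\<^sub>v u = 0\<^sub>v n"
  proof (rule eq_vecI)
    fix i assume i: "i < dim_vec (0\<^sub>v n)"
    have "P * dg n (\<lambda>j. l j ^ i) *\<^sub>v w = A ^\<^sub>m i *\<^sub>v (P *\<^sub>v w)"
      using A P w(1) by (simp add: diag_pow[OF A P AP, symmetric] assoc_mult_mat_vec[of _ n n _ n])
    also have "\<dots> = 0\<^sub>v n" unfolding w(3) using pow_carrier_mat[OF A, of i]
      by (intro eq_vecI) (auto simp: mult_mat_vec_def scalar_prod_def)
    finally have "(P * dg n (\<lambda>j. l j ^ i) *\<^sub>v w) $ p = 0" using p by simp
    moreover have "(P * dg n (\<lambda>j. l j ^ i) *\<^sub>v w) $ p = (\<Sum>j<n. (P * dg n (\<lambda>j. l j ^ i)) $$ (p, j) * w $ j)"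
      using p P w(1) by (simp add: scalar_prod_def atLeast0LessThan mult_mat_vec_def)
    moreover have "\<dots> = (\<Sum>j<n. P $$ (p, j) * l j ^ i * w $ j)"
      using p by (intro sum.cong refl) (simp add: index_mult_dg[OF P])
    moreover have "(?V *\<^sub>v u) $ i = (\<Sum>j<n. P $$ (p, j) * l j ^ i * w $ j)"
      using i unfolding u_def by (simp add: scalar_prod_def atLeast0LessThan mult_mat_vec_def algebra_simps)
    ultimately show "(?V *\<^sub>v u) $ i = 0\<^sub>v n $ i" using i by simp
  qed (auto simp: mult_mat_vec_def)
  moreover have "u \<in> carrier_vec n" by (simp add: u_def)
  moreover have "u \<noteq> 0\<^sub>v n"
  proof
    assume "u = 0\<^sub>v n"
    then have "u $ j = 0" using j(1) by simp
    then show False using j p by (simp add: u_def)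
  qed
  moreover have "det ?V \<noteq> 0" using vandermonde_nonzero[OF l] by (simp add: mdet_def)
  ultimately show False using det_0_iff_vec_prod_zero_field[of ?V n] by auto
qed

text \<open>The characteristic polynomial \<open>p\<close> splits. At a repeated root
  \<open>p'\<close> vanishes as well, so \<open>p'(A)\<close> kills an eigenvector and
  \<open>dsc n A\<close> would be zero. Distinct roots then give an invertible matrix of
  eigenvectors.\<close>

lemma dsc_nonzero_diagz:
  fixes A :: "'a::alg_closed_field mat"
  assumes A: "A \<in> carrier_mat n n" and "dsc n A \<noteq> 0"
  shows "\<exists>P l. diagz n A P l \<and> inj_on l {..<n}"
proof -
  let ?c = "char_poly A"
  have mon: "degree ?c = n" "lead_coeff ?c = 1" using degree_monic_char_poly[OF A] by auto
  then have "?c \<noteq> 0" by auto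
  then obtain M where M: "size M = n" "?c = (\<Prod>x\<in>#M. [:- x, 1:])"
    using alg_closed_imp_factorization[of ?c] mon by auto
  obtain as where as: "mset as = M" using ex_mset by blast
  define l where "l j = as ! j" for j
  have len: "length as = n" using as M(1) by auto
  have c: "?c = (\<Prod>j<n. [:- l j, 1:])"
  proof -
    have "?c = prod_list (map (\<lambda>x. [:- x, 1:]) as)" unfolding M(2) as[symmetric]
      by (simp add: prod_mset_prod_list[symmetric])
    also have "\<dots> = (\<Prod>j<n. [:- l j, 1:])"
      by (simp add: prod.list_conv_set_nth len l_def atLeast0LessThan)
    finally show ?thesis .
  qed
  have ev: "\<exists>v. eigenvector A v (l j)" if "j < n" for j
  proof -
    have "poly ?c (l j) = 0" unfolding c using that by (auto simp: poly_prod)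
    then show ?thesis using eigenvalue_root_char_poly[OF A] by (auto simp: eigenvalue_def)
  qed
  have inj: "inj_on l {..<n}"
  proof (rule inj_onI, rule ccontr)
    fix i j assume ij: "i \<in> {..<n}" "j \<in> {..<n}" "l i = l j" "i \<noteq> j"
    obtain v where v: "eigenvector A v (l j)" using ev ij by auto
    then have vc: "v \<in> carrier_vec n" "v \<noteq> 0\<^sub>v n" using A by (auto simp: eigenvector_def)
    \<comment> \<open>Whichever factor \<open>b\<close> the product rule differentiates, one of the
      two equal roots remains.\<close>
    have "\<exists>a\<in>{..<n} - {b}. l j = l a" for b
      using ij by (cases "b = i") (auto intro: bexI[of _ j] bexI[of _ i])
    then have "poly (pderiv ?c) (l j) = 0"
      unfolding c pderiv_prod by (auto simp: poly_sum poly_prod intro!: sum.neutral)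
    then have z: "(\<Sum>i<n. of_nat (Suc i) * coeff ?c (Suc i) * l j ^ i) = 0"
      unfolding pderiv_char_poly_sum[OF A] .
    have "deriv_mat n A *\<^sub>v v = 0\<^sub>v n"
    proof (rule eq_vecI)
      fix p assume p: "p < dim_vec (0\<^sub>v n)"
      have pw: "(\<Sum>q<n. (A ^\<^sub>m i) $$ (p, q) * v $ q) = l j ^ i * v $ p" for i
      proof -
        have "(A ^\<^sub>m i *\<^sub>v v) $ p = (l j ^ i \<cdot>\<^sub>v v) $ p" using eigenvector_pow[OF A v] by simp
        then show ?thesis using p vc A pow_carrier_mat[OF A, of i]
          by (simp add: scalar_prod_def atLeast0LessThan mult_mat_vec_def)
      qed
      have "(deriv_mat n A *\<^sub>v v) $ p = (\<Sum>q<n. (\<Sum>i<n. of_nat (Suc i) * coeff ?c (Suc i) * (A ^\<^sub>m i) $$ (p, q)) * v $ q)"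
        using p vc by (simp add: deriv_mat_def scalar_prod_def atLeast0LessThan mult_mat_vec_def)
      also have "\<dots> = (\<Sum>i<n. of_nat (Suc i) * coeff ?c (Suc i) * (\<Sum>q<n. (A ^\<^sub>m i) $$ (p, q) * v $ q))"
        unfolding sum_distrib_left sum_distrib_right by (subst sum.swap) (simp add: algebra_simps)
      also have "\<dots> = (\<Sum>i<n. of_nat (Suc i) * coeff ?c (Suc i) * l j ^ i) * v $ p"
        unfolding pw sum_distrib_right by (simp add: algebra_simps)
      finally show "(deriv_mat n A *\<^sub>v v) $ p = 0\<^sub>v n $ p" using p z by simp
    qed (auto simp: deriv_mat_def)
    then have "det (deriv_mat n A) = 0" using vc det_0_iff_vec_prod_zero_field[OF deriv_mat_carrier, of n A] by auto
    then show False using assms(2) by (simp add: dsc_def)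
  qed
  define v where "v j = (SOME v. eigenvector A v (l j))" for j
  have v: "eigenvector A (v j) (l j)" if "j < n" for j
    unfolding v_def by (rule someI_ex[OF ev[OF that]])
  define P where "P = mat n n (\<lambda>(i, j). v j $ i)"
  have P: "P \<in> carrier_mat n n" by (simp add: P_def)
  have "A * P = P * dg n l"
  proof (rule eq_matI)
    fix i j assume "i < dim_row (P * dg n l)" "j < dim_col (P * dg n l)"
    then have ij: "i < n" "j < n" using P by auto
    have "v j \<in> carrier_vec n" using v[OF ij(2)] A by (simp add: eigenvector_def)
    then have "(A * P) $$ (i, j) = (A *\<^sub>v v j) $ i"
      using A P ij unfolding index_mult_mat_sum[OF A P ij]
      by (simp add: P_def scalar_prod_def atLeast0LessThan mult_mat_vec_def)
    also have "\<dots> = l j * v j $ i" using v[OF ij(2)] A ij by (auto simp: eigenvector_def)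
    finally show "(A * P) $$ (i, j) = (P * dg n l) $$ (i, j)"
      unfolding index_mult_dg[OF P ij] using ij by (simp add: P_def)
  qed (use A P in auto)
  moreover have "\<exists>p<n. P $$ (p, j) \<noteq> 0" if "j < n" for j
  proof (rule ccontr)
    assume "\<not> ?thesis"
    then have "v j = 0\<^sub>v n" using v[OF that] A that by (intro eq_vecI) (auto simp: P_def eigenvector_def)
    then show False using v[OF that] A by (auto simp: eigenvector_def)
  qed
  ultimately have "diagz n A P l"
    unfolding diagz_def using A P distinct_eigenvectors_det[OF A P _ inj] by auto
  then show ?thesis using inj by blast
qed

lemma ex_inj_on_infinite:
  assumes "infinite (UNIV :: 'a set)"
  shows "\<exists>f :: nat \<Rightarrow> 'a. inj f"
  using infinite_countable_subset[OF assms] by blast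

text \<open>The index \<open>c\<close> runs through a finite family of generic matrices in pairwise
  distinct variables. The product of their discriminants is a nonzero polynomial, so an identity may
  be checked where every matrix of the family is diagonalizable with simple spectrum.\<close>

lemma mpoly_eqI_diagz:
  fixes p q :: "('v::linorder, 'a::alg_closed_field) mpoly" and w :: "'c \<Rightarrow> nat \<Rightarrow> nat \<Rightarrow> 'v"
  assumes inj: "\<And>c i j c' i' j'. i < n \<Longrightarrow> j < n \<Longrightarrow> i' < n \<Longrightarrow> j' < n \<Longrightarrow>
      w c i j = w c' i' j' \<Longrightarrow> c = c' \<and> i = i' \<and> j = j'" and fin: "finite (UNIV :: 'c set)"
    and eq: "\<And>x. (\<And>c. \<exists>P l. diagz n (mat n n (\<lambda>(i, j). x (w c i j))) P l \<and> inj_on l {..<n}) \<Longrightarrow> ev x p = ev x q"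
  shows "p = q"
proof -
  let ?G = "\<lambda>c. mat n n (\<lambda>(i, j). Var (w c i j)) :: ('v, 'a) mpoly mat"
  define d where "d = (\<Prod>c\<in>UNIV. dsc n (?G c))"
  have ed: "ev x d = (\<Prod>c\<in>UNIV. dsc n (mat n n (\<lambda>(i, j). x (w c i j))))" for x
  proof -
    interpret comm_ring_hom "ev x" by (rule ev_hom)
    have "ev x d = (\<Prod>c\<in>UNIV. ev x (dsc n (?G c)))" unfolding d_def by (rule hom_prod)
    also have "\<dots> = (\<Prod>c\<in>UNIV. dsc n (map_mat (ev x) (?G c)))"
      by (intro prod.cong refl dsc_hom[symmetric] ev_hom) simp
    also have "\<dots> = (\<Prod>c\<in>UNIV. dsc n (mat n n (\<lambda>(i, j). x (w c i j))))"
      by (intro prod.cong refl arg_cong[of _ _ "dsc n"] eq_matI) auto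
    finally show ?thesis .
  qed
  obtain f :: "nat \<Rightarrow> 'a" where f: "inj f" using ex_inj_on_infinite[OF infinite_UNIV_alg_closed] by blast
  \<comment> \<open>The point at which every matrix of the family is diagonal with the distinct
    entries \<open>f i\<close>.\<close>
  define x0 where "x0 v = (if \<exists>c i. i < n \<and> v = w c i i then f (SOME i. i < n \<and> (\<exists>c. v = w c i i)) else 0)" for v
  have "mat n n (\<lambda>(i, j). x0 (w c i j)) = dg n f" for c
  proof (rule eq_matI)
    fix i j assume "i < dim_row (dg n f)" "j < dim_col (dg n f)"
    then have ij: "i < n" "j < n" by auto
    show "mat n n (\<lambda>(i, j). x0 (w c i j)) $$ (i, j) = dg n f $$ (i, j)"
    proof (cases "i = j")
      case True
      have "(SOME i'. i' < n \<and> (\<exists>c'. w c i i = w c' i' i')) = i"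
        using inj[of i i] ij(1) by (intro some_equality) blast+
      then show ?thesis using ij True by (auto simp: x0_def)
    next
      case False
      then have "\<not> (\<exists>c' i'. i' < n \<and> w c i j = w c' i' i')" using inj[of i j] ij by blast
      then show ?thesis using ij False by (auto simp: x0_def)
    qed
  qed auto
  then have "ev x0 d \<noteq> 0"
    unfolding ed using fin inj_on_subset[OF f] by (simp add: dsc_dg_nonzero)
  then have "d \<noteq> 0" using comm_ring_hom.axioms(1)[OF ev_hom] by (auto simp: ring_hom_def semiring_hom_def comm_monoid_add_hom_def monoid_add_hom_def zero_hom_def)
  then show ?thesis
  proof (rule mpoly_eqI_generic[OF infinite_UNIV_alg_closed])
    fix x assume "ev x d \<noteq> 0"
    then have "dsc n (mat n n (\<lambda>(i, j). x (w c i j))) \<noteq> 0" for c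
      unfolding ed using fin by auto
    then show "ev x p = ev x q" by (intro eq dsc_nonzero_diagz) auto
  qed
qed

section \<open>The determinant of a compound matrix\<close>

lemma card_subsets_containing:
  assumes "s < n" "0 < k"
  shows "card {S. S \<subseteq> {..<n} \<and> card S = k \<and> s \<in> S} = (n - 1) choose (k - 1)"
proof -
  have "bij_betw (insert s) {S. S \<subseteq> {..<n} - {s} \<and> card S = k - 1} {S. S \<subseteq> {..<n} \<and> card S = k \<and> s \<in> S}"
  proof (rule bij_betw_byWitness[of _ "\<lambda>S. S - {s}"])
    show "insert s ` {S. S \<subseteq> {..<n} - {s} \<and> card S = k - 1} \<subseteq> {S. S \<subseteq> {..<n} \<and> card S = k \<and> s \<in> S}"
    proof
      fix T assume "T \<in> insert s ` {S. S \<subseteq> {..<n} - {s} \<and> card S = k - 1}"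
      then obtain S where S: "T = insert s S" "S \<subseteq> {..<n} - {s}" "card S = k - 1" by auto
      have "finite S" using S(2) by (rule finite_subset) auto
      then show "T \<in> {S. S \<subseteq> {..<n} \<and> card S = k \<and> s \<in> S}" using S assms by (auto simp: card_insert_if)
    qed
  qed (auto simp: card_Diff_singleton_if)
  then have "card {S. S \<subseteq> {..<n} \<and> card S = k \<and> s \<in> S} = card {S. S \<subseteq> {..<n} - {s} \<and> card S = k - 1}"
    by (rule bij_betw_same_card[symmetric])
  also have "\<dots> = (n - 1) choose (k - 1)" using assms by (subst n_subsets) auto
  finally show ?thesis .
qed

lemma prod_subsets_elements:
  fixes f :: "nat \<Rightarrow> 'a::comm_ring_1"
  assumes "kbase n k KB" "0 < k"
  shows "(\<Prod>p<length KB. \<Prod>s\<in>set (KB ! p). f s) = (\<Prod>s<n. f s) ^ ((n - 1) choose (k - 1))"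
proof -
  let ?A = "{S. S \<subseteq> {..<n} \<and> card S = k}"
  have fin: "finite ?A" by (rule finite_subset[of _ "Pow {..<n}"]) auto
  have "(\<Prod>p<length KB. \<Prod>s\<in>set (KB ! p). f s) = (\<Prod>S\<in>?A. \<Prod>s\<in>S. f s)"
    by (rule prod.reindex_bij_betw[OF kbase_bij[OF assms(1)]])
  also have "\<dots> = (\<Prod>S\<in>?A. \<Prod>s<n. if s \<in> S then f s else 1)"
    by (intro prod.cong refl prod.mono_neutral_cong_left) auto
  also have "\<dots> = (\<Prod>s<n. \<Prod>S\<in>?A. if s \<in> S then f s else 1)" by (rule prod.swap)
  also have "\<dots> = (\<Prod>s<n. f s ^ ((n - 1) choose (k - 1)))"
  proof (intro prod.cong refl)
    fix s assume s: "s \<in> {..<n}"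
    have "(\<Prod>S\<in>?A. if s \<in> S then f s else 1) = f s ^ card {S \<in> ?A. s \<in> S}"
      unfolding prod.inter_filter[OF fin, symmetric] by (rule prod_constant)
    also have "{S \<in> ?A. s \<in> S} = {S. S \<subseteq> {..<n} \<and> card S = k \<and> s \<in> S}" by auto
    finally show "(\<Prod>S\<in>?A. if s \<in> S then f s else 1) = f s ^ ((n - 1) choose (k - 1))"
      using s assms by (simp add: card_subsets_containing)
  qed
  finally show ?thesis by (simp add: prod_power_distrib)
qed

lemma mat_inverse_exists:
  assumes "P \<in> carrier_mat n n" "det P \<noteq> (0 :: 'a::field)"
  obtains R where "R \<in> carrier_mat n n" "P * R = 1\<^sub>m n" "R * P = 1\<^sub>m n" "det R * det P = 1"
proof -
  let ?R = "inverse (det P) \<cdot>\<^sub>m adj_mat P"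
  have 1: "?R \<in> carrier_mat n n" using adj_mat(1)[OF assms(1)] by simp
  have sm: "inverse (det P) \<cdot>\<^sub>m (det P \<cdot>\<^sub>m 1\<^sub>m n) = 1\<^sub>m n"
    using assms(2) by (intro eq_matI) auto
  have 2: "P * ?R = 1\<^sub>m n"
    using adj_mat[OF assms(1)] assms sm by (simp add: mult_smult_distrib[of _ n n _ n])
  have 3: "?R * P = 1\<^sub>m n"
    using adj_mat[OF assms(1)] assms sm by (simp add: mult_smult_assoc_mat[of _ n n _ n])
  have "det ?R * det P = 1" using 3 det_mult[OF 1 assms(1)] by simp
  then show thesis using that 1 2 3 by blast
qed

lemma compound_inverse:
  assumes "kbase n k KB" "P \<in> carrier_mat n n" "R \<in> carrier_mat n n" "P * R = 1\<^sub>m n"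
  shows "compound KB P * compound KB R = 1\<^sub>m (length KB)"
  using compound_mult[OF assms(1-3)] assms(4) compound_one[OF assms(1)] by metis

lemma det_compound_nonzero:
  assumes "kbase n k KB" "P \<in> carrier_mat n n" "det P \<noteq> (0 :: 'a::field)"
  shows "det (compound KB P) \<noteq> 0"
proof -
  obtain R where R: "R \<in> carrier_mat n n" "P * R = 1\<^sub>m n" using mat_inverse_exists[OF assms(2,3)] by blast
  have "det (compound KB P) * det (compound KB R) = 1"
    using compound_inverse[OF assms(1,2) R] det_mult[OF compound_carrier compound_carrier, of KB P R] by simp
  then show ?thesis by auto
qed

lemma sylvester_franke_diagz:
  assumes "kbase n k KB" "0 < k" "diagz n A P (l :: nat \<Rightarrow> 'a::field)"
  shows "det (compound KB A) = det A ^ ((n - 1) choose (k - 1))"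
proof -
  have A: "A \<in> carrier_mat n n" "P \<in> carrier_mat n n" "det P \<noteq> 0" "A * P = P * dg n l"
    using assms(3) by (auto simp: diagz_def)
  have "det A * det P = det P * (\<Prod>i<n. l i)"
    using det_mult[OF A(1,2)] det_mult[OF A(2) dg_carrier, of l] A(4) by (auto simp: det_dg)
  then have 1: "det A = (\<Prod>i<n. l i)" using A(3) by (metis mult.commute mult_cancel_left)
  have "compound KB A * compound KB P = compound KB P * dg (length KB) (\<lambda>p. \<Prod>s\<in>set (KB ! p). l s)"
    using compound_mult[OF assms(1) A(1,2)] compound_mult[OF assms(1) A(2) dg_carrier] A(4) compound_dg[OF assms(1)] by metis
  then have "det (compound KB A) * det (compound KB P) = det (compound KB P) * (\<Prod>p<length KB. \<Prod>s\<in>set (KB ! p). l s)"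
    using det_mult[OF compound_carrier compound_carrier, of KB A P] det_mult[OF compound_carrier dg_carrier, of KB P]
    by (auto simp: det_dg)
  then have "det (compound KB A) = (\<Prod>p<length KB. \<Prod>s\<in>set (KB ! p). l s)"
    using det_compound_nonzero[OF assms(1) A(2,3)] by simp
  then show ?thesis using 1 prod_subsets_elements[OF assms(1,2)] by simp
qed

text \<open>For diagonalizable \<open>A\<close> the eigenvalues of the compound are the products
  over \<open>k\<close>-sets, and each index lies in \<open>(n - 1) choose (k - 1)\<close> of these
  sets. Both sides are polynomial in the entries, so density covers every matrix.\<close>

theorem sylvester_franke:
  fixes A :: "'a::alg_closed_field mat"
  assumes KB: "kbase n k KB" and k: "0 < k" and A: "A \<in> carrier_mat n n"
  shows "det (compound KB A) = det A ^ ((n - 1) choose (k - 1))"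
proof -
  let ?w = "\<lambda>(c::unit) i j. (i, j) :: nat \<times> nat"
  let ?G = "mat n n (\<lambda>(i, j). Var (i, j)) :: (nat \<times> nat, 'a) mpoly mat"
  have ev: "ev x (det (compound KB ?G)) = det (compound KB (mat n n (\<lambda>(i, j). x (i, j))))"
    "ev x (det ?G ^ e) = det (mat n n (\<lambda>(i, j). x (i, j))) ^ e" for x e
  proof -
    interpret comm_ring_hom "ev x" by (rule ev_hom)
    have G: "map_mat (ev x) ?G = mat n n (\<lambda>(i, j). x (i, j))" by (intro eq_matI) auto
    show "ev x (det (compound KB ?G)) = det (compound KB (mat n n (\<lambda>(i, j). x (i, j))))"
      unfolding G[symmetric] by (simp add: compound_hom[OF ev_hom KB])
    show "ev x (det ?G ^ e) = det (mat n n (\<lambda>(i, j). x (i, j))) ^ e"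
      unfolding G[symmetric] by (simp add: hom_power)
  qed
  have "det (compound KB ?G) = det ?G ^ ((n - 1) choose (k - 1))"
  proof (rule mpoly_eqI_diagz[of n ?w])
    fix x :: "nat \<times> nat \<Rightarrow> 'a"
    assume "\<And>c. \<exists>P l. diagz n (mat n n (\<lambda>(i, j). x (?w c i j))) P l \<and> inj_on l {..<n}"
    then obtain P l where "diagz n (mat n n (\<lambda>(i, j). x (i, j))) P l" by auto
    then show "ev x (det (compound KB ?G)) = ev x (det ?G ^ ((n - 1) choose (k - 1)))"
      unfolding ev by (rule sylvester_franke_diagz[OF KB k])
  qed auto
  then have "ev (\<lambda>ij. A $$ ij) (det (compound KB ?G)) = ev (\<lambda>ij. A $$ ij) (det ?G ^ ((n - 1) choose (k - 1)))" by simp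
  moreover have "mat n n (\<lambda>(i, j). A $$ (i, j)) = A" using A by (intro eq_matI) auto
  ultimately show ?thesis unfolding ev by simp
qed

section \<open>Determinants of block matrices\<close>

text \<open>A row number \<open>i * N + p\<close> stands for position \<open>p\<close> in block
  \<open>i\<close>, and likewise \<open>j\<close>, \<open>q\<close> for columns.\<close>

definition bdet :: "nat \<Rightarrow> (nat \<Rightarrow> nat \<Rightarrow> nat \<Rightarrow> nat \<Rightarrow> 'a::comm_ring_1) \<Rightarrow> 'a" where
  "bdet N g = mdet (N * N) (\<lambda>r c. g (r div N) (r mod N) (c div N) (c mod N))"

text \<open>Swaps the two digits of \<open>r\<close> in base \<open>N\<close>.\<close>
definition swap_digits :: "nat \<Rightarrow> nat \<Rightarrow> nat" where
  "swap_digits N r = (if r < N * N then (r mod N) * N + r div N else r)"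

lemma div_mod_less_square:
  assumes "r < N * (N::nat)"
  shows "r div N < N" "r mod N < N" "0 < N"
  using assms by (auto simp: less_mult_imp_div_less intro!: mod_less_divisor gr0I)

lemma sum_div_mod: "(\<Sum>l<N * M. f (l div M) (l mod M)) = (\<Sum>a<N. \<Sum>b<(M::nat). f a b)"
proof -
  have "(\<Sum>l<N * M. f (l div M) (l mod M)) = (\<Sum>a<N. \<Sum>l\<in>{a * M..<a * M + M}. f (l div M) (l mod M))"
    by (rule sum.nat_group[symmetric])
  also have "\<dots> = (\<Sum>a<N. \<Sum>b<M. f a b)"
  proof (rule sum.cong[OF refl])
    fix a
    have "(\<Sum>l\<in>{a * M..<a * M + M}. f (l div M) (l mod M)) = (\<Sum>b\<in>{0..<M}. f ((b + a * M) div M) ((b + a * M) mod M))"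
      using sum.shift_bounds_nat_ivl[of "\<lambda>l. f (l div M) (l mod M)" 0 "a * M" M] by (simp add: add.commute)
    also have "\<dots> = (\<Sum>b<M. f a b)" by (intro sum.cong) auto
    finally show "(\<Sum>l\<in>{a * M..<a * M + M}. f (l div M) (l mod M)) = (\<Sum>b<M. f a b)" .
  qed
  finally show ?thesis .
qed

lemma prod_div_mod: "(\<Prod>l<N * M. f (l div M) (l mod M)) = (\<Prod>a<N. \<Prod>b<(M::nat). f a b)"
proof -
  have "(\<Prod>l<N * M. f (l div M) (l mod M)) = (\<Prod>a<N. \<Prod>l\<in>{a * M..<a * M + M}. f (l div M) (l mod M))"
    by (rule prod.nat_group[symmetric])
  also have "\<dots> = (\<Prod>a<N. \<Prod>b<M. f a b)"
  proof (rule prod.cong[OF refl])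
    fix a
    have "(\<Prod>l\<in>{a * M..<a * M + M}. f (l div M) (l mod M)) = (\<Prod>b\<in>{0..<M}. f ((b + a * M) div M) ((b + a * M) mod M))"
      using prod.shift_bounds_nat_ivl[of "\<lambda>l. f (l div M) (l mod M)" 0 "a * M" M] by (simp add: add.commute)
    also have "\<dots> = (\<Prod>b<M. f a b)" by (intro prod.cong) auto
    finally show "(\<Prod>l\<in>{a * M..<a * M + M}. f (l div M) (l mod M)) = (\<Prod>b<M. f a b)" .
  qed
  finally show ?thesis .
qed

lemma bdet_cong:
  assumes "\<And>i p j q. i < N \<Longrightarrow> p < N \<Longrightarrow> j < N \<Longrightarrow> q < N \<Longrightarrow> f i p j q = g i p j q"
  shows "bdet N f = bdet N g"
  unfolding bdet_def by (intro mdet_cong assms div_mod_less_square)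

lemma bdet_mult: "bdet N (\<lambda>i p j q. \<Sum>a<N. \<Sum>b<N. f i p a b * g a b j q) = bdet N f * bdet N g"
  unfolding bdet_def mdet_mult[symmetric]
  by (intro mdet_cong) (simp add: sum_div_mod[of "\<lambda>a b. f _ _ a b * g a b _ _"])

lemma bdet_diag: "bdet N (\<lambda>i p j q. if i = j \<and> p = q then w i p else 0) = (\<Prod>i<N. \<Prod>p<N. w i p)"
proof -
  have "bdet N (\<lambda>i p j q. if i = j \<and> p = q then w i p else 0) =
    mdet (N * N) (\<lambda>r c. if r = c then w (r div N) (r mod N) else 0)"
    unfolding bdet_def by (intro mdet_cong) (metis div_mult_mod_eq)
  then show ?thesis by (simp add: mdet_diag prod_div_mod)
qed

lemma mdet_block_diag:
  fixes f :: "nat \<Rightarrow> nat \<Rightarrow> 'a::idom"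
  shows "mdet (n * N) (\<lambda>r c. if r div N = c div N then f (r mod N) (c mod N) else 0) = mdet N f ^ n"
proof (induction n)
  case 0
  then show ?case by (simp add: mdet_sum)
next
  case (Suc n)
  let ?g = "\<lambda>r c. if r div N = c div N then f (r mod N) (c mod N) else 0"
  let ?A = "mat (n * N) (n * N) (\<lambda>(r, c). ?g r c)" and ?D = "mat N N (\<lambda>(i, j). f i j)"
  have "mat (Suc n * N) (Suc n * N) (\<lambda>(r, c). ?g r c) =
    four_block_mat ?A (0\<^sub>m (n * N) N) (0\<^sub>m N (n * N)) ?D" (is "?L = ?R")
  proof (rule eq_matI)
    fix r c assume "r < dim_row ?R" "c < dim_col ?R"
    then have rc: "r < Suc n * N" "c < Suc n * N" by auto
    have lt: "a div N < n" if "a < n * N" for a using that by (simp add: less_mult_imp_div_less)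
    have ge: "a div N = n \<and> a mod N = a - n * N" if "\<not> a < n * N" "a < Suc n * N" for a
    proof -
      define d where "d = a - n * N"
      have "a = d + n * N" "d < N" using that by (auto simp: d_def)
      then show ?thesis by simp
    qed
    show "?L $$ (r, c) = ?R $$ (r, c)"
    proof (cases "r < n * N"; cases "c < n * N")
      assume "r < n * N" "c < n * N"
      then show ?thesis using rc by simp
    next
      assume a: "r < n * N" "\<not> c < n * N"
      then have "r div N \<noteq> c div N" using lt[of r] ge[of c] rc by simp
      then show ?thesis using rc a by simp
    next
      assume a: "\<not> r < n * N" "c < n * N"
      then have "r div N \<noteq> c div N" using lt[of c] ge[of r] rc by simp
      then show ?thesis using rc a by simp
    next
      assume a: "\<not> r < n * N" "\<not> c < n * N"
      then show ?thesis using rc ge[of c] ge[of r] by simp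
    qed
  qed auto
  then have "mdet (Suc n * N) ?g = det ?A * det ?D"
    unfolding mdet_def by (simp add: det_four_block_mat_lower_left_zero[of _ "n * N" _ N])
  then show ?case using Suc.IH by (simp add: mdet_def algebra_simps)
qed

lemma bdet_block_diag:
  fixes f :: "nat \<Rightarrow> nat \<Rightarrow> 'a::idom"
  shows "bdet N (\<lambda>i p j q. if i = j then f p q else 0) = mdet N f ^ N"
  unfolding bdet_def by (rule mdet_block_diag)

lemma swap_digits_div_mod:
  assumes "r < N * N"
  shows "swap_digits N r < N * N" "swap_digits N r div N = r mod N" "swap_digits N r mod N = r div N"
proof -
  note d = div_mod_less_square[OF assms]
  have "(r mod N) * N + r div N < (r mod N) * N + N" using d by simp
  also have "\<dots> \<le> N * N" using d(2) by (metis Suc_leI add.commute mult_Suc mult_le_mono1)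
  finally show "swap_digits N r < N * N" using assms by (simp add: swap_digits_def)
  show "swap_digits N r div N = r mod N" "swap_digits N r mod N = r div N" using assms d by (auto simp: swap_digits_def)
qed

lemma swap_digits_permutes: "swap_digits N permutes {0..<N * N}"
proof (rule bij_imp_permutes)
  have inv: "swap_digits N (swap_digits N r) = r" if "r < N * N" for r
    using swap_digits_div_mod[OF that] that by (simp add: swap_digits_def)
  show "bij_betw (swap_digits N) {0..<N * N} {0..<N * N}"
    by (rule bij_betw_byWitness[of _ "swap_digits N"]) (auto simp: inv swap_digits_div_mod)
  show "\<And>x. x \<notin> {0..<N * N} \<Longrightarrow> swap_digits N x = x" by (auto simp: swap_digits_def)
qed

lemma bdet_swap_rows: "bdet N (\<lambda>i p j q. f p i j q) = signof (swap_digits N) * bdet N f"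
  unfolding bdet_def mdet_permute_rows[OF swap_digits_permutes, symmetric]
  by (intro mdet_cong) (simp add: swap_digits_div_mod)

lemma bdet_swap_cols: "bdet N (\<lambda>i p j q. f i p q j) = signof (swap_digits N) * bdet N f"
  unfolding bdet_def mdet_permute_cols[OF swap_digits_permutes, symmetric]
  by (intro mdet_cong) (simp add: swap_digits_div_mod)

text \<open>Swapping the digits of rows and of columns costs the same sign twice, which
  cancels.\<close>

lemma bdet_block_diag':
  fixes f :: "nat \<Rightarrow> nat \<Rightarrow> 'a::idom"
  shows "bdet N (\<lambda>i p j q. if p = q then f i j else 0) = mdet N f ^ N"
proof -
  have "bdet N (\<lambda>i p j q. if p = q then f i j else 0) =
    signof (swap_digits N) * (signof (swap_digits N) * bdet N (\<lambda>i p j q. if i = j then f p q else 0))"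
    by (subst bdet_swap_rows[symmetric], subst bdet_swap_cols[symmetric]) simp
  also have "\<dots> = bdet N (\<lambda>i p j q. if i = j then f p q else 0)" by (simp add: sign_def)
  finally show ?thesis by (simp add: bdet_block_diag)
qed

text \<open>The block matrix is a product of five square matrices, with index pairs running through
  \<open>(i,p)\<close>, \<open>(i,S)\<close>, \<open>(T,S)\<close>, \<open>(T,S)\<close>,
  \<open>(j,T)\<close>, \<open>(j,q)\<close>. The passage from \<open>(T,S)\<close> to
  \<open>(j,T)\<close> exchanges the two digits and accounts for the sign.\<close>

lemma bdet_factor:
  fixes C D x y W :: "nat \<Rightarrow> nat \<Rightarrow> 'a::idom"
  shows "bdet N (\<lambda>i p j q. \<Sum>S<N. \<Sum>T<N. C p S * x j S * W S T * y i T * D T q) =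
    signof (swap_digits N) * mdet N C ^ N * mdet N x ^ N * mdet N y ^ N * (\<Prod>S<N. \<Prod>T<N. W S T) * mdet N D ^ N"
proof -
  define f1 where "f1 i p a b = (if i = a then C p b else 0)" for i p a b :: nat
  define f2 where "f2 i p a b = (if p = b then y i a else 0)" for i p a b :: nat
  define f3 where "f3 i p a b = (if i = a \<and> p = b then W p i else 0)" for i p a b :: nat
  define f4 where "f4 i p a b = (if i = b then x a p else 0)" for i p a b :: nat
  define f5 where "f5 i p a b = (if i = a then D p b else 0)" for i p a b :: nat
  let ?m = "\<lambda>f g i p j q. \<Sum>a<N. \<Sum>b<N. f i p a b * g a b j q"
  have d1: "bdet N f1 = mdet N C ^ N" unfolding f1_def by (rule bdet_block_diag)
  have d2: "bdet N f2 = mdet N y ^ N" unfolding f2_def by (rule bdet_block_diag')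
  have d3: "bdet N f3 = (\<Prod>S<N. \<Prod>T<N. W S T)"
    unfolding f3_def bdet_diag by (rule prod.swap)
  have d4: "bdet N f4 = signof (swap_digits N) * mdet N x ^ N"
  proof -
    have "bdet N f4 = signof (swap_digits N) * bdet N (\<lambda>i p j q. if i = j then x q p else 0)"
      unfolding f4_def by (rule bdet_swap_cols)
    then show ?thesis unfolding bdet_block_diag[of N "\<lambda>p q. x q p"] mdet_transpose[of N x] .
  qed
  have d5: "bdet N f5 = mdet N D ^ N" unfolding f5_def by (rule bdet_block_diag)
  have "bdet N (\<lambda>i p j q. \<Sum>S<N. \<Sum>T<N. C p S * x j S * W S T * y i T * D T q) =
    bdet N (?m (?m (?m (?m f1 f2) f3) f4) f5)"
  proof (rule bdet_cong)
    fix i p j q assume l: "i < N" "p < N" "j < N" "q < N"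
    have m12: "?m f1 f2 i p a b = C p b * y i a" if "i < N" "b < N" for i p a b
    proof -
      have "?m f1 f2 i p a b = (\<Sum>a'<N. if a' = i then C p b * y i a else 0)"
        unfolding f1_def f2_def
        using that by (intro sum.cong refl) (auto simp: if_distrib[of "\<lambda>x. x * _"] if_distrib[of "(*) _"] sum.delta' sum.delta cong: if_cong)
      then show ?thesis using that by simp
    qed
    have m123: "?m (?m f1 f2) f3 i p a b = C p b * y i a * W b a" if "i < N" "a < N" "b < N" for i p a b
    proof -
      have "?m (?m f1 f2) f3 i p a b = (\<Sum>a'<N. \<Sum>b'<N. if a' = a \<and> b' = b then C p b * y i a * W b a else 0)"
        using that by (intro sum.cong refl) (auto simp: m12 f3_def)
      also have "\<dots> = (\<Sum>a'<N. if a' = a then C p b * y i a * W b a else 0)"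
        using that by (intro sum.cong refl) (auto simp: sum.delta cong: if_cong)
      finally show ?thesis using that by simp
    qed
    have m1234: "?m (?m (?m f1 f2) f3) f4 i p j b = (\<Sum>S<N. C p S * y i b * W S b * x j S)" if "i < N" "b < N" for i p j b
    proof -
      have "?m (?m (?m f1 f2) f3) f4 i p j b = (\<Sum>a'<N. if a' = b then (\<Sum>S<N. C p S * y i b * W S b * x j S) else 0)"
        using that by (intro sum.cong refl) (auto simp: m123 f4_def)
      then show ?thesis using that by simp
    qed
    have "?m (?m (?m (?m f1 f2) f3) f4) f5 i p j q =
      (\<Sum>a<N. if a = j then (\<Sum>T<N. (\<Sum>S<N. C p S * y i T * W S T * x j S) * D T q) else 0)"
      using l by (intro sum.cong refl) (auto simp: m1234 f5_def)
    also have "\<dots> = (\<Sum>T<N. (\<Sum>S<N. C p S * y i T * W S T * x j S) * D T q)" using l by simp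
    also have "\<dots> = (\<Sum>S<N. \<Sum>T<N. C p S * x j S * W S T * y i T * D T q)"
      unfolding sum_distrib_right by (subst sum.swap) (simp add: algebra_simps)
    finally show "(\<Sum>S<N. \<Sum>T<N. C p S * x j S * W S T * y i T * D T q) = ?m (?m (?m (?m f1 f2) f3) f4) f5 i p j q" ..
  qed
  also have "\<dots> = bdet N f1 * bdet N f2 * bdet N f3 * bdet N f4 * bdet N f5"
    by (simp only: bdet_mult)
  finally show ?thesis unfolding d1 d2 d3 d4 d5 by (simp add: algebra_simps)
qed

lemma triple_product_index:
  fixes C U :: "'a::comm_ring_1 mat"
  assumes "C \<in> carrier_mat N N" "U \<in> carrier_mat N N" "p < N" "q < N"
  shows "(C * dg N f * U) $$ (p, q) = (\<Sum>S<N. C $$ (p, S) * f S * U $$ (S, q))"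
proof -
  have "C * dg N f \<in> carrier_mat N N" using assms(1) by simp
  then show ?thesis unfolding index_mult_mat_sum[OF \<open>C * dg N f \<in> carrier_mat N N\<close> assms(2-4)]
    using index_mult_dg[OF assms(1,3)] by (intro sum.cong refl) simp
qed

text \<open>Since \<open>Ms j * Ys i = C diag(x_j) (R D) diag(y_i) Q\<close>, the families enter
  only through the determinants of their eigenvalues. Families with the same eigenvectors can thus
  be compared: powers of \<open>extm\<close> for \<open>Tdet\<close>, the matrices
  \<open>zmat\<close> for \<open>fdet\<close>.\<close>

lemma bdet_families:
  fixes C D :: "'a::field mat"
  assumes C: "C \<in> carrier_mat N N" "R \<in> carrier_mat N N" "C * R = 1\<^sub>m N" "R * C = 1\<^sub>m N"
    and D: "D \<in> carrier_mat N N" "Q \<in> carrier_mat N N" "D * Q = 1\<^sub>m N" "Q * D = 1\<^sub>m N"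
    and Ms: "\<And>j. j < N \<Longrightarrow> Ms j \<in> carrier_mat N N" "\<And>j. j < N \<Longrightarrow> Ms j * C = C * dg N (x j)"
    and Ys: "\<And>i. i < N \<Longrightarrow> Ys i \<in> carrier_mat N N" "\<And>i. i < N \<Longrightarrow> Ys i * D = D * dg N (y i)"
  shows "bdet N (\<lambda>i p j q. (Ms j * Ys i) $$ (p, q)) =
    signof (swap_digits N) * det C ^ N * mdet N x ^ N * mdet N y ^ N * (\<Prod>S<N. \<Prod>T<N. (R * D) $$ (S, T)) * det Q ^ N"
proof -
  have fac: "M = C * dg N f * R" if "M \<in> carrier_mat N N" "M * C = C * dg N f" "C \<in> carrier_mat N N" "R \<in> carrier_mat N N" "C * R = 1\<^sub>m N"
    for M C R :: "'a mat" and f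
  proof -
    have "M = M * (C * R)" using that by simp
    also have "\<dots> = M * C * R" by (rule assoc_mult_mat[OF that(1,3,4), symmetric])
    finally show ?thesis unfolding that(2) .
  qed
  have "(Ms j * Ys i) $$ (p, q) = (\<Sum>S<N. \<Sum>T<N. C $$ (p, S) * x j S * (R * D) $$ (S, T) * y i T * Q $$ (T, q))"
    if l: "i < N" "p < N" "j < N" "q < N" for i p j q
  proof -
    have "Ms j * Ys i = C * dg N (x j) * R * (D * dg N (y i) * Q)"
      using fac[OF Ms(1,2)[OF l(3)] C(1-3)] fac[OF Ys(1,2)[OF l(1)] D(1-3)] by simp
    also have "\<dots> = C * dg N (x j) * (R * (D * dg N (y i) * Q))"
      using C D by (intro assoc_mult_mat[of _ N N _ N _ N] mult_carrier_mat[of _ N N _ N] dg_carrier)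
    also have "R * (D * dg N (y i) * Q) = R * (D * dg N (y i)) * Q"
      using C D by (intro assoc_mult_mat[of _ N N _ N _ N, symmetric] mult_carrier_mat[of _ N N _ N] dg_carrier)
    also have "R * (D * dg N (y i)) = R * D * dg N (y i)"
      using C D by (intro assoc_mult_mat[of _ N N _ N _ N, symmetric] dg_carrier)
    finally have "(Ms j * Ys i) $$ (p, q) = (\<Sum>S<N. C $$ (p, S) * x j S * (R * D * dg N (y i) * Q) $$ (S, q))"
      using C D l by (simp only: triple_product_index[of C N "R * D * dg N (y i) * Q" p q] mult_carrier_mat[of _ N N _ N] dg_carrier)
    also have "\<dots> = (\<Sum>S<N. C $$ (p, S) * x j S * (\<Sum>T<N. (R * D) $$ (S, T) * y i T * Q $$ (T, q)))"
      using C D l by (intro sum.cong refl arg_cong2[of _ _ _ _ "(*)"] triple_product_index) auto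
    finally show ?thesis unfolding sum_distrib_left by (simp add: algebra_simps)
  qed
  then have "bdet N (\<lambda>i p j q. (Ms j * Ys i) $$ (p, q)) =
    bdet N (\<lambda>i p j q. \<Sum>S<N. \<Sum>T<N. C $$ (p, S) * x j S * (R * D) $$ (S, T) * y i T * Q $$ (T, q))"
    by (intro bdet_cong)
  also have "\<dots> = signof (swap_digits N) * det C ^ N * mdet N x ^ N * mdet N y ^ N * (\<Prod>S<N. \<Prod>T<N. (R * D) $$ (S, T)) * det Q ^ N"
    unfolding bdet_factor by (simp add: det_eq_mdet[OF C(1)] det_eq_mdet[OF D(2)])
  finally show ?thesis .
qed

lemma Tdet_bdet:
  assumes "dim_row M = N"
  shows "Tdet M Y = bdet N (\<lambda>i p j q. (M ^\<^sub>m j * Y ^\<^sub>m i) $$ (p, q))"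
  using assms by (simp add: Tdet_def blockM_def bdet_def mdet_def Let_def)

section \<open>A determinantal formula for the triangulant\<close>

definition tmat :: "nat \<Rightarrow> 'a::comm_ring_1 mat \<Rightarrow> 'a poly mat" where
  "tmat n A = mat n n (\<lambda>(i, j). [:- A $$ (i, j), if i = j then 1 else 0:])"

text \<open>The coefficient at \<open>t\<^sup>d\<close> of \<open>t\<^sup>j \<Lambda>\<^sup>k(t - A)\<close>.\<close>
definition emat :: "nat \<Rightarrow> nat list list \<Rightarrow> 'a::comm_ring_1 mat \<Rightarrow> nat \<Rightarrow> nat \<Rightarrow> 'a mat" where
  "emat n KB A d j = mat (length KB) (length KB)
     (\<lambda>(p, q). coeff (monom 1 j * compound KB (tmat n A) $$ (p, q)) d)"

text \<open>The Leibniz expansion of the minor with columns \<open>b\<close> of the matrix whose rows hold the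
  coefficients of \<open>t\<^sup>j \<Lambda>\<^sup>k(t - A)\<close>. On diagonalizable \<open>A\<close> its eigenvalues are the \<open>zev\<close> below.\<close>
definition zmat :: "nat \<Rightarrow> nat list list \<Rightarrow> 'a::comm_ring_1 mat \<Rightarrow> nat list \<Rightarrow> 'a mat" where
  "zmat n KB A b = mat (length KB) (length KB)
     (\<lambda>(p, q). \<Sum>\<sigma> | \<sigma> permutes {0..<length b}.
        signof \<sigma> * foldr (*) (map (\<lambda>j. emat n KB A (b ! \<sigma> j) j) [0..<length b]) (1\<^sub>m (length KB)) $$ (p, q))"

definition fdet :: "nat \<Rightarrow> nat list list \<Rightarrow> nat list list \<Rightarrow> 'a::comm_ring_1 mat \<Rightarrow> 'a mat \<Rightarrow> 'a" where
  "fdet n KB KB' A B = bdet (length KB) (\<lambda>i p j q. (zmat n KB A (KB' ! j) * zmat n KB B (KB' ! i)) $$ (p, q))"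

definition spoly :: "nat list list \<Rightarrow> (nat \<Rightarrow> 'a::comm_ring_1) \<Rightarrow> nat \<Rightarrow> 'a poly" where
  "spoly KB l p = (\<Prod>s\<in>set (KB ! p). [:- l s, 1:])"

definition zev :: "nat list list \<Rightarrow> (nat \<Rightarrow> 'a::comm_ring_1) \<Rightarrow> nat list \<Rightarrow> nat \<Rightarrow> 'a" where
  "zev KB l b p = mdet (length b) (\<lambda>j i. coeff (monom 1 j * spoly KB l p) (b ! i))"

lemma emat_carrier [simp]: "emat n KB A d j \<in> carrier_mat (length KB) (length KB)"
  by (simp add: emat_def)

lemma zmat_carrier [simp]: "zmat n KB A b \<in> carrier_mat (length KB) (length KB)"
  by (simp add: zmat_def)

text \<open>The matrix \<open>a A + b\<close>: taking \<open>a = - 1\<close>, \<open>b = t\<close>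
  gives \<open>t - A\<close> for \<open>zmat\<close>, and \<open>a = t\<close>, \<open>b = 1\<close>
  gives \<open>1 + t A\<close> for \<open>extm\<close>.\<close>

definition pencil :: "nat \<Rightarrow> 'a poly \<Rightarrow> 'a poly \<Rightarrow> 'a::comm_ring_1 mat \<Rightarrow> 'a poly mat" where
  "pencil n a b A = mat n n (\<lambda>(i, j). smult (A $$ (i, j)) a + (if i = j then b else 0))"

lemma pencil_carrier [simp]: "pencil n a b A \<in> carrier_mat n n"
  by (simp add: pencil_def)

lemma comm_ring_hom_const_poly: "comm_ring_hom (\<lambda>a::'a::comm_ring_1. [:a:])"
  by unfold_locales (auto simp: one_pCons)

lemma pencil_diag:
  fixes A P :: "'a::comm_ring_1 mat"
  assumes A: "A \<in> carrier_mat n n" and P: "P \<in> carrier_mat n n" and AP: "A * P = P * dg n l"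
  shows "pencil n a b A * map_mat (\<lambda>a. [:a:]) P = map_mat (\<lambda>a. [:a:]) P * dg n (\<lambda>s. smult (l s) a + b)"
    (is "_ * ?c P = _ * dg n ?g")
proof (rule eq_matI)
  fix i j assume "i < dim_row (?c P * dg n ?g)" "j < dim_col (?c P * dg n ?g)"
  then have ij: "i < n" "j < n" using P by auto
  have "(pencil n a b A * ?c P) $$ (i, j) = (\<Sum>m<n. (smult (A $$ (i, m)) a + (if i = m then b else 0)) * [:P $$ (m, j):])"
    using ij P by (subst index_mult_mat_sum[OF pencil_carrier, of _ n]) (auto simp: pencil_def)
  also have "\<dots> = (\<Sum>m<n. smult (A $$ (i, m) * P $$ (m, j)) a) + (\<Sum>m<n. if i = m then smult (P $$ (m, j)) b else 0)"
    unfolding sum.distrib[symmetric]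
    by (intro sum.cong refl) (auto simp: smult_add_right mult.commute)
  also have "\<dots> = smult (\<Sum>m<n. A $$ (i, m) * P $$ (m, j)) a + smult (P $$ (i, j)) b"
    using ij by (simp add: smult_sum)
  also have "(\<Sum>m<n. A $$ (i, m) * P $$ (m, j)) = P $$ (i, j) * l j"
    using index_mult_mat_sum[OF A P ij] index_mult_dg[OF P ij, of l] AP by simp
  moreover have "(?c P * dg n ?g) $$ (i, j) = ?c P $$ (i, j) * ?g j"
    by (rule index_mult_dg) (use ij P in auto)
  ultimately show "(pencil n a b A * ?c P) $$ (i, j) = (?c P * dg n ?g) $$ (i, j)"
    using ij P by (simp add: smult_add_right del: index_mult_mat(1))
qed (use P in \<open>auto simp: pencil_def\<close>)

text \<open>The compound of the constant matrix \<open>P\<close> has constant entries, so extracting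
  a coefficient commutes with multiplying by it. The factor \<open>u\<close> provides the shifts by
  powers of \<open>t\<close>.\<close>

lemma coeff_compound_diag:
  fixes P :: "'a::comm_ring_1 mat"
  assumes KB: "kbase n k KB" and T: "T \<in> carrier_mat n n" and P: "P \<in> carrier_mat n n"
    and TP: "T * map_mat (\<lambda>a. [:a:]) P = map_mat (\<lambda>a. [:a:]) P * dg n g"
  shows "mat (length KB) (length KB) (\<lambda>(p, q). coeff (u * compound KB T $$ (p, q)) d) * compound KB P =
    compound KB P * dg (length KB) (\<lambda>p. coeff (u * (\<Prod>s\<in>set (KB ! p). g s)) d)"
    (is "?E * _ = _ * dg ?N ?f")
proof -
  let ?c = "map_mat (\<lambda>a. [:a:])" and ?sp = "\<lambda>p. \<Prod>s\<in>set (KB ! p). g s"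
  have cP: "?c P \<in> carrier_mat n n" using P by simp
  have eq: "compound KB T * ?c (compound KB P) = ?c (compound KB P) * dg ?N ?sp"
    using compound_mult[OF KB T cP] compound_mult[OF KB cP dg_carrier, of g]
      compound_hom[OF comm_ring_hom_const_poly KB P] compound_dg[OF KB, of g] TP by simp
  show ?thesis
  proof (rule eq_matI)
    fix p q assume "p < dim_row (compound KB P * dg ?N ?f)" "q < dim_col (compound KB P * dg ?N ?f)"
    then have pq: "p < ?N" "q < ?N" by auto
    have "(compound KB T * ?c (compound KB P)) $$ (p, q) = (\<Sum>a<?N. compound KB T $$ (p, a) * [:compound KB P $$ (a, q):])"
      using pq by (subst index_mult_mat_sum[OF compound_carrier]) auto
    moreover have "(?c (compound KB P) * dg ?N ?sp) $$ (p, q) = [:compound KB P $$ (p, q):] * ?sp q"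
      using pq by (subst index_mult_dg) auto
    ultimately have e: "(\<Sum>a<?N. compound KB T $$ (p, a) * [:compound KB P $$ (a, q):]) = [:compound KB P $$ (p, q):] * ?sp q"
      using eq by simp
    have "(?E * compound KB P) $$ (p, q) = (\<Sum>a<?N. coeff (u * compound KB T $$ (p, a)) d * compound KB P $$ (a, q))"
      using pq by (subst index_mult_mat_sum[OF _ compound_carrier]) auto
    also have "\<dots> = coeff (u * (\<Sum>a<?N. compound KB T $$ (p, a) * [:compound KB P $$ (a, q):])) d"
      unfolding sum_distrib_left coeff_sum by (intro sum.cong refl) (simp add: mult.commute[of _ "[:_:]"] mult.left_commute mult_ac)
    also have "\<dots> = compound KB P $$ (p, q) * ?f q"
      unfolding e by (simp add: mult.left_commute)
    finally show "(?E * compound KB P) $$ (p, q) = (compound KB P * dg ?N ?f) $$ (p, q)"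
      unfolding index_mult_dg[OF compound_carrier pq] .
  qed auto
qed

lemma emat_diag:
  assumes KB: "kbase n k KB" and A: "A \<in> carrier_mat n n" and P: "P \<in> carrier_mat n n"
    and AP: "A * P = P * dg n l"
  shows "emat n KB A d j * compound KB P = compound KB P * dg (length KB) (\<lambda>p. coeff (monom 1 j * spoly KB l p) d)"
proof -
  have t: "tmat n A = pencil n (- 1) [:0, 1:] A"
    using A by (intro eq_matI) (auto simp: tmat_def pencil_def one_pCons)
  have g: "smult (l s) (- 1) + [:0, 1:] = [:- l s, 1:]" for s by (simp add: one_pCons)
  show ?thesis
    unfolding emat_def spoly_def t using coeff_compound_diag[OF KB pencil_carrier P pencil_diag[OF A P AP]]
    by (simp only: g)
qed

lemma foldr_mult_diag:
  fixes C :: "'a::comm_ring_1 mat"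
  assumes C: "C \<in> carrier_mat N N"
    and F: "\<And>j. j \<in> set js \<Longrightarrow> F j \<in> carrier_mat N N" "\<And>j. j \<in> set js \<Longrightarrow> F j * C = C * dg N (g j)"
  shows "foldr (*) (map F js) (1\<^sub>m N) \<in> carrier_mat N N \<and>
    foldr (*) (map F js) (1\<^sub>m N) * C = C * dg N (\<lambda>p. \<Prod>j\<leftarrow>js. g j p)"
  using F
proof (induction js)
  case Nil
  then show ?case using C by (simp flip: one_mat_dg)
next
  case (Cons j js)
  let ?M = "foldr (*) (map F js) (1\<^sub>m N)"
  have IH: "?M \<in> carrier_mat N N" "?M * C = C * dg N (\<lambda>p. \<Prod>j\<leftarrow>js. g j p)" using Cons by auto
  have Fj: "F j \<in> carrier_mat N N" "F j * C = C * dg N (g j)" using Cons.prems by auto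
  have dd: "dg N (g j) * dg N (\<lambda>p. \<Prod>j\<leftarrow>js. g j p) = dg N (\<lambda>p. \<Prod>j\<leftarrow>j # js. g j p)"
    by (rule eq_matI) (auto simp: index_mult_dg[OF dg_carrier] simp del: index_mult_mat(1))
  have "F j * ?M * C = F j * (C * dg N (\<lambda>p. \<Prod>j\<leftarrow>js. g j p))"
    using IH Fj C by (simp add: assoc_mult_mat[of _ N N _ N _ N])
  also have "\<dots> = C * dg N (g j) * dg N (\<lambda>p. \<Prod>j\<leftarrow>js. g j p)"
    using IH Fj C by (simp add: assoc_mult_mat[of _ N N _ N _ N, symmetric])
  also have "\<dots> = C * dg N (\<lambda>p. \<Prod>j\<leftarrow>j # js. g j p)"
    unfolding dd[symmetric] using C by (simp add: assoc_mult_mat[of _ N N _ N _ N])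
  finally show ?case using IH Fj by simp
qed

text \<open>All factors \<open>emat\<close> are diagonal in the basis \<open>compound KB P\<close>,
  so their products have the products of the eigenvalues, and the Leibniz sum of matrices becomes
  the Leibniz sum of the determinant \<open>zev\<close>.\<close>

lemma zmat_diag:
  assumes KB: "kbase n k KB" and A: "A \<in> carrier_mat n n" and P: "P \<in> carrier_mat n n"
    and AP: "A * P = P * dg n l"
  shows "zmat n KB A b * compound KB P = compound KB P * dg (length KB) (zev KB l b)"
proof -
  let ?N = "length KB" and ?h = "length b"
  let ?M = "\<lambda>\<sigma>. foldr (*) (map (\<lambda>j. emat n KB A (b ! \<sigma> j) j) [0..<?h]) (1\<^sub>m ?N)"
  let ?g = "\<lambda>\<sigma> p. \<Prod>j\<leftarrow>[0..<?h]. coeff (monom 1 j * spoly KB l p) (b ! \<sigma> j)"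
  have M: "?M \<sigma> \<in> carrier_mat ?N ?N" "?M \<sigma> * compound KB P = compound KB P * dg ?N (?g \<sigma>)" for \<sigma>
    using foldr_mult_diag[OF compound_carrier, of "[0..<?h]" "\<lambda>j. emat n KB A (b ! \<sigma> j) j" KB P
        "\<lambda>j p. coeff (monom 1 j * spoly KB l p) (b ! \<sigma> j)"] emat_diag[OF KB A P AP] by auto
  show ?thesis
  proof (rule eq_matI)
    fix p q assume "p < dim_row (compound KB P * dg ?N (zev KB l b))" "q < dim_col (compound KB P * dg ?N (zev KB l b))"
    then have pq: "p < ?N" "q < ?N" by auto
    have "(zmat n KB A b * compound KB P) $$ (p, q) =
      (\<Sum>a<?N. (\<Sum>\<sigma> | \<sigma> permutes {0..<?h}. signof \<sigma> * ?M \<sigma> $$ (p, a)) * compound KB P $$ (a, q))"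
      using pq by (subst index_mult_mat_sum[OF zmat_carrier compound_carrier]) (auto simp: zmat_def)
    also have "\<dots> = (\<Sum>\<sigma> | \<sigma> permutes {0..<?h}. signof \<sigma> * (\<Sum>a<?N. ?M \<sigma> $$ (p, a) * compound KB P $$ (a, q)))"
      unfolding sum_distrib_left sum_distrib_right by (subst sum.swap) (simp add: algebra_simps)
    also have "\<dots> = (\<Sum>\<sigma> | \<sigma> permutes {0..<?h}. signof \<sigma> * (compound KB P $$ (p, q) * ?g \<sigma> q))"
      unfolding index_mult_mat_sum[OF M(1) compound_carrier pq, symmetric] M(2) index_mult_dg[OF compound_carrier pq] ..
    also have "\<dots> = compound KB P $$ (p, q) * zev KB l b q"
      unfolding zev_def mdet_sum sum_distrib_left
      by (intro sum.cong refl) (simp add: prod.distinct_set_conv_list[symmetric] algebra_simps)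
    finally show "(zmat n KB A b * compound KB P) $$ (p, q) = (compound KB P * dg ?N (zev KB l b)) $$ (p, q)"
      unfolding index_mult_dg[OF compound_carrier pq] .
  qed (auto simp: zmat_def)
qed

lemma comm_ring_hom_map_poly:
  assumes "comm_ring_hom h"
  shows "comm_ring_hom (map_poly h)"
proof -
  interpret m: map_poly_comm_ring_hom h by (simp add: map_poly_comm_ring_hom_def assms)
  show ?thesis ..
qed

lemma compound_tmat_hom:
  assumes "comm_ring_hom h" "kbase n k KB" "A \<in> carrier_mat n n" "p < length KB" "q < length KB"
  shows "compound KB (tmat n (map_mat h A)) $$ (p, q) = map_poly h (compound KB (tmat n A) $$ (p, q))"
proof -
  interpret comm_ring_hom h by fact
  have hp: "comm_ring_hom (map_poly h)" by (rule comm_ring_hom_map_poly[OF assms(1)])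
  have T: "tmat n A \<in> carrier_mat n n" by (simp add: tmat_def)
  have h2: "map_poly h [:a, b:] = [:h a, h b:]" "map_poly h [:a:] = [:h a:]" for a b
    by (intro poly_eqI; simp add: coeff_map_poly coeff_pCons split: nat.split)+
  have "tmat n (map_mat h A) = map_mat (map_poly h) (tmat n A)"
    using assms(3) by (intro eq_matI) (auto simp: tmat_def hom_uminus h2)
  then show ?thesis using compound_hom[OF hp assms(2) T] assms(4,5) by simp
qed

lemma foldr_mult_hom:
  assumes "comm_ring_hom h" "\<And>j. j \<in> set js \<Longrightarrow> F j \<in> carrier_mat N N"
  shows "foldr (*) (map F js) (1\<^sub>m N) \<in> carrier_mat N N \<and>
    foldr (*) (map (\<lambda>j. map_mat h (F j)) js) (1\<^sub>m N) = map_mat h (foldr (*) (map F js) (1\<^sub>m N))"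
  using assms(2)
proof (induction js)
  case Nil
  interpret comm_ring_hom h by fact
  show ?case by (simp add: mat_hom_one)
next
  case (Cons j js)
  interpret comm_ring_hom h by fact
  let ?M = "foldr (*) (map F js) (1\<^sub>m N)"
  have "?M \<in> carrier_mat N N" "foldr (*) (map (\<lambda>j. map_mat h (F j)) js) (1\<^sub>m N) = map_mat h ?M"
    "F j \<in> carrier_mat N N" using Cons by auto
  then show ?case using mat_hom_mult[of "F j" N N ?M N] by simp
qed

lemma zmat_hom:
  assumes h: "comm_ring_hom h" and KB: "kbase n k KB" and A: "A \<in> carrier_mat n n"
  shows "zmat n KB (map_mat h A) b = map_mat h (zmat n KB A b)"
proof -
  interpret comm_ring_hom h by fact
  have "emat n KB (map_mat h A) d j = map_mat h (emat n KB A d j)" for d j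
  proof (rule eq_matI)
    fix p q assume "p < dim_row (map_mat h (emat n KB A d j))" "q < dim_col (map_mat h (emat n KB A d j))"
    then have pq: "p < length KB" "q < length KB" by (auto simp: emat_def)
    show "emat n KB (map_mat h A) d j $$ (p, q) = map_mat h (emat n KB A d j) $$ (p, q)"
      using pq by (simp add: emat_def compound_tmat_hom[OF h KB A] coeff_monom_mult)
  qed (auto simp: emat_def)
  then have F: "foldr (*) (map (\<lambda>j. emat n KB (map_mat h A) (b ! \<sigma> j) j) [0..<length b]) (1\<^sub>m (length KB)) =
      map_mat h (foldr (*) (map (\<lambda>j. emat n KB A (b ! \<sigma> j) j) [0..<length b]) (1\<^sub>m (length KB)))"
    "foldr (*) (map (\<lambda>j. emat n KB A (b ! \<sigma> j) j) [0..<length b]) (1\<^sub>m (length KB)) \<in> carrier_mat (length KB) (length KB)" for \<sigma>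
    using foldr_mult_hom[OF h, of "[0..<length b]" "\<lambda>j. emat n KB A (b ! \<sigma> j) j" "length KB"] by auto
  show ?thesis
  proof (rule eq_matI)
    fix p q assume "p < dim_row (map_mat h (zmat n KB A b))" "q < dim_col (map_mat h (zmat n KB A b))"
    then have pq: "p < length KB" "q < length KB" by (auto simp: zmat_def)
    show "zmat n KB (map_mat h A) b $$ (p, q) = map_mat h (zmat n KB A b) $$ (p, q)"
      using pq F(2) unfolding zmat_def F(1) by (simp add: hom_sum hom_mult carrier_matD[OF F(2)])
  qed (auto simp: zmat_def)
qed

text \<open>Hence \<open>fdet\<close> of the generic integral matrices is a single polynomial whose
  values over every commutative ring are again given by \<open>fdet\<close>.\<close>

lemma fdet_hom:
  assumes h: "comm_ring_hom h" and KB: "kbase n k KB" and A: "A \<in> carrier_mat n n" and B: "B \<in> carrier_mat n n"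
  shows "fdet n KB KB' (map_mat h A) (map_mat h B) = h (fdet n KB KB' A B)"
proof -
  interpret comm_ring_hom h by fact
  show ?thesis
    unfolding fdet_def bdet_def mdet_hom[OF h] zmat_hom[OF h KB A] zmat_hom[OF h KB B]
      mat_hom_mult[OF zmat_carrier zmat_carrier, symmetric]
  proof (rule mdet_cong)
    fix r c assume "r < length KB * length KB" "c < length KB * length KB"
    note d = div_mod_less_square[OF this(1)] div_mod_less_square[OF this(2)]
    have "zmat n KB A b * zmat n KB B b' \<in> carrier_mat (length KB) (length KB)" for b b'
      by (rule mult_carrier_mat[OF zmat_carrier zmat_carrier])
    from carrier_matD[OF this] show "map_mat h (zmat n KB A (KB' ! (c div length KB)) * zmat n KB B (KB' ! (r div length KB))) $$ (r mod length KB, c mod length KB) =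
      h ((zmat n KB A (KB' ! (c div length KB)) * zmat n KB B (KB' ! (r div length KB))) $$ (r mod length KB, c mod length KB))"
      using d by (intro index_map_mat) simp_all
  qed
qed

section \<open>Counting subsets\<close>

definition vd :: "nat set \<Rightarrow> (nat \<Rightarrow> 'a::comm_ring_1) \<Rightarrow> 'a" where
  "vd R l = (\<Prod>b\<in>R. \<Prod>a\<in>{a\<in>R. a < b}. l b - l a)"

lemma vd_lessThan: "vd {..<n} l = (\<Prod>b<n. \<Prod>a<b. l b - l a)"
  unfolding vd_def by (intro prod.cong) auto

lemma vd_nonzero:
  assumes "inj_on l R" "finite R"
  shows "vd R l \<noteq> (0 :: 'a::idom)"
proof -
  have "l b - l a \<noteq> 0" if "b \<in> R" "a \<in> R" "a < b" for a b
    using inj_onD[OF assms(1), of b a] that by auto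
  then show ?thesis using assms(2) by (auto simp: vd_def)
qed

lemma prod_sorted_nth:
  assumes "sorted_wrt (<) (xs :: nat list)"
  shows "(\<Prod>j<length xs. \<Prod>i<j. f (xs ! i) (xs ! j)) = (\<Prod>b\<in>set xs. \<Prod>a\<in>{a\<in>set xs. a < b}. f a b)"
proof -
  have d: "distinct xs" using assms by (simp add: strict_sorted_iff)
  have bij: "bij_betw ((!) xs) {..<length xs} (set xs)" by (rule bij_betw_nth[OF d]) auto
  have "bij_betw ((!) xs) {..<j} {a\<in>set xs. a < xs ! j}" if j: "j < length xs" for j
  proof (rule bij_betw_imageI)
    show "inj_on ((!) xs) {..<j}" using bij j by (auto simp: bij_betw_def inj_on_def)
    have "xs ! i < xs ! j \<longleftrightarrow> i < j" if "i < length xs" for i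
      using sorted_wrt_nth_less[OF assms, of i j] sorted_wrt_nth_less[OF assms, of j i] that j
      by (cases i j rule: linorder_cases) auto
    then show "(!) xs ` {..<j} = {a\<in>set xs. a < xs ! j}"
      using j by (auto simp: in_set_conv_nth) (metis less_trans)
  qed
  then have "(\<Prod>j<length xs. \<Prod>i<j. f (xs ! i) (xs ! j)) = (\<Prod>j<length xs. \<Prod>a\<in>{a\<in>set xs. a < xs ! j}. f a (xs ! j))"
    by (intro prod.cong refl prod.reindex_bij_betw) auto
  also have "\<dots> = (\<Prod>b\<in>set xs. \<Prod>a\<in>{a\<in>set xs. a < b}. f a b)"
    by (rule prod.reindex_bij_betw[OF bij])
  finally show ?thesis .
qed

lemma vandermonde_sorted:
  fixes l :: "nat \<Rightarrow> 'a::idom"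
  assumes "sorted_wrt (<) xs"
  shows "mdet (length xs) (\<lambda>i j. l (xs ! j) ^ i) = vd (set xs) l"
  unfolding vandermonde vd_def by (rule prod_sorted_nth[OF assms, of "\<lambda>a b. l b - l a"])

lemma card_subsets_separating:
  assumes "a < n" "b < n" "a \<noteq> b" "0 < k"
  shows "card {S. S \<subseteq> {..<n} \<and> card S = k \<and> a \<in> S \<and> b \<notin> S} = (n - 2) choose (k - 1)"
proof -
  have "bij_betw (insert a) {S. S \<subseteq> {..<n} - {a, b} \<and> card S = k - 1} {S. S \<subseteq> {..<n} \<and> card S = k \<and> a \<in> S \<and> b \<notin> S}"
  proof (rule bij_betw_byWitness[of _ "\<lambda>S. S - {a}"])
    show "insert a ` {S. S \<subseteq> {..<n} - {a, b} \<and> card S = k - 1} \<subseteq> {S. S \<subseteq> {..<n} \<and> card S = k \<and> a \<in> S \<and> b \<notin> S}"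
    proof
      fix T assume "T \<in> insert a ` {S. S \<subseteq> {..<n} - {a, b} \<and> card S = k - 1}"
      then obtain S where S: "T = insert a S" "S \<subseteq> {..<n} - {a, b}" "card S = k - 1" by auto
      have "finite S" using S(2) by (rule finite_subset) auto
      then show "T \<in> {S. S \<subseteq> {..<n} \<and> card S = k \<and> a \<in> S \<and> b \<notin> S}" using S assms by (auto simp: card_insert_if)
    qed
  qed (auto simp: card_Diff_singleton_if)
  then have "card {S. S \<subseteq> {..<n} \<and> card S = k \<and> a \<in> S \<and> b \<notin> S} = card {S. S \<subseteq> {..<n} - {a, b} \<and> card S = k - 1}"
    by (rule bij_betw_same_card[symmetric])
  also have "\<dots> = (n - 2) choose (k - 1)" using assms by (subst n_subsets) (auto simp: numeral_2_eq_2)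
  finally show ?thesis .
qed

text \<open>The factor of an ordered pair \<open>(s, r)\<close> occurs once for each
  \<open>k\<close>-set that contains \<open>s\<close> but not \<open>r\<close>.\<close>

lemma prod_subsets_separated_pairs:
  fixes g :: "nat \<Rightarrow> nat \<Rightarrow> 'a::comm_ring_1"
  assumes KB: "kbase n k KB" and k: "0 < k"
  shows "(\<Prod>p<length KB. \<Prod>s\<in>set (KB ! p). \<Prod>r\<in>{..<n} - set (KB ! p). g s r) =
    (\<Prod>s<n. \<Prod>r\<in>{..<n} - {s}. g s r) ^ ((n - 2) choose (k - 1))"
proof -
  let ?A = "{S. S \<subseteq> {..<n} \<and> card S = k}" and ?c = "(n - 2) choose (k - 1)"
  have fin: "finite ?A" by (rule finite_subset[of _ "Pow {..<n}"]) auto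
  have "(\<Prod>p<length KB. \<Prod>s\<in>set (KB ! p). \<Prod>r\<in>{..<n} - set (KB ! p). g s r) =
    (\<Prod>S\<in>?A. \<Prod>s\<in>S. \<Prod>r\<in>{..<n} - S. g s r)"
    by (rule prod.reindex_bij_betw[OF kbase_bij[OF KB]])
  also have "\<dots> = (\<Prod>S\<in>?A. \<Prod>s<n. \<Prod>r\<in>{..<n} - {s}. if s \<in> S \<and> r \<notin> S then g s r else 1)"
  proof (rule prod.cong[OF refl])
    fix S assume S: "S \<in> ?A"
    show "(\<Prod>s\<in>S. \<Prod>r\<in>{..<n} - S. g s r) = (\<Prod>s<n. \<Prod>r\<in>{..<n} - {s}. if s \<in> S \<and> r \<notin> S then g s r else 1)"
    proof (rule prod.mono_neutral_cong_left)
      fix s assume s: "s \<in> S"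
      show "(\<Prod>r\<in>{..<n} - S. g s r) = (\<Prod>r\<in>{..<n} - {s}. if s \<in> S \<and> r \<notin> S then g s r else 1)"
        by (rule prod.mono_neutral_cong_left) (use s in auto)
    qed (use S in auto)
  qed
  also have "\<dots> = (\<Prod>s<n. \<Prod>S\<in>?A. \<Prod>r\<in>{..<n} - {s}. if s \<in> S \<and> r \<notin> S then g s r else 1)" by (rule prod.swap)
  also have "\<dots> = (\<Prod>s<n. \<Prod>r\<in>{..<n} - {s}. g s r ^ ?c)"
  proof (rule prod.cong[OF refl])
    fix s assume s: "s \<in> {..<n}"
    have "(\<Prod>S\<in>?A. \<Prod>r\<in>{..<n} - {s}. if s \<in> S \<and> r \<notin> S then g s r else 1) =
      (\<Prod>r\<in>{..<n} - {s}. \<Prod>S\<in>?A. if s \<in> S \<and> r \<notin> S then g s r else 1)" by (rule prod.swap)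
    also have "\<dots> = (\<Prod>r\<in>{..<n} - {s}. g s r ^ ?c)"
    proof (rule prod.cong[OF refl])
      fix r assume r: "r \<in> {..<n} - {s}"
      have "(\<Prod>S\<in>?A. if s \<in> S \<and> r \<notin> S then g s r else 1) = g s r ^ card {S \<in> ?A. s \<in> S \<and> r \<notin> S}"
        unfolding prod.inter_filter[OF fin, symmetric] by (rule prod_constant)
      also have "{S \<in> ?A. s \<in> S \<and> r \<notin> S} = {S. S \<subseteq> {..<n} \<and> card S = k \<and> s \<in> S \<and> r \<notin> S}" by auto
      finally show "(\<Prod>S\<in>?A. if s \<in> S \<and> r \<notin> S then g s r else 1) = g s r ^ ?c"
        using s r k by (simp add: card_subsets_separating)
    qed
    finally show "(\<Prod>S\<in>?A. \<Prod>r\<in>{..<n} - {s}. if s \<in> S \<and> r \<notin> S then g s r else 1) = (\<Prod>r\<in>{..<n} - {s}. g s r ^ ?c)" .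
  qed
  finally show ?thesis by (simp add: prod_power_distrib)
qed

text \<open>For \<open>k \<ge> 2\<close> a pair lies in \<open>(n - 2) choose (k - 2)\<close> of the
  sets, which is \<open>(n - 1) choose (k - 1)\<close> minus \<open>(n - 2) choose (k - 1)\<close>.
  The multiplied form avoids subtraction and covers \<open>k = 1\<close> too.\<close>

lemma prod_vd_subsets:
  fixes l :: "nat \<Rightarrow> 'a::comm_ring_1"
  assumes KB: "kbase n k KB" and k: "0 < k"
  shows "(\<Prod>p<length KB. vd (set (KB ! p)) l) * vd {..<n} l ^ ((n - 2) choose (k - 1)) =
    vd {..<n} l ^ ((n - 1) choose (k - 1))"
proof -
  let ?g = "\<lambda>b a. if a < b then l b - l a else 1"
  have "(\<Prod>p<length KB. \<Prod>b\<in>set (KB ! p). \<Prod>a<b. l b - l a) =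
    (\<Prod>p<length KB. vd (set (KB ! p)) l * (\<Prod>b\<in>set (KB ! p). \<Prod>a\<in>{..<n} - set (KB ! p). ?g b a))"
  proof (rule prod.cong[OF refl])
    fix p assume p: "p \<in> {..<length KB}"
    have "(\<Prod>a<b. l b - l a) = (\<Prod>a\<in>{a \<in> set (KB ! p). a < b}. l b - l a) * (\<Prod>a\<in>{..<n} - set (KB ! p). ?g b a)"
      if b: "b \<in> set (KB ! p)" for b
    proof -
      have bn: "b < n" using kbaseD(3)[OF KB, of p] p b by auto
      have "(\<Prod>a\<in>{..<n} - set (KB ! p). ?g b a) = (\<Prod>a\<in>{..<b} - set (KB ! p). l b - l a)"
        using bn by (intro prod.mono_neutral_cong_right) auto
      moreover have "{a \<in> set (KB ! p). a < b} = {..<b} \<inter> set (KB ! p)" by auto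
      ultimately show ?thesis by (simp add: prod.Int_Diff[of "{..<b}" _ "set (KB ! p)"])
    qed
    then show "(\<Prod>b\<in>set (KB ! p). \<Prod>a<b. l b - l a) =
      vd (set (KB ! p)) l * (\<Prod>b\<in>set (KB ! p). \<Prod>a\<in>{..<n} - set (KB ! p). ?g b a)"
      unfolding vd_def prod.distrib[symmetric] by (intro prod.cong refl) auto
  qed
  moreover have "(\<Prod>s<n. \<Prod>r\<in>{..<n} - {s}. ?g s r) = vd {..<n} l"
    unfolding vd_lessThan by (intro prod.cong refl prod.mono_neutral_cong_right) auto
  ultimately show ?thesis
    using prod_subsets_elements[OF KB k, of "\<lambda>b. \<Prod>a<b. l b - l a"] prod_subsets_separated_pairs[OF KB k, of ?g]
    by (simp only: prod.distrib vd_lessThan)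
qed

lemma prod_all_differences:
  fixes l :: "nat \<Rightarrow> 'a::comm_ring_1"
  shows "(\<Prod>s<n. \<Prod>r\<in>{..<n} - {s}. l r - l s) = of_int (\<Prod>s<n. (- 1) ^ s) * vd {..<n} l ^ 2"
proof -
  have "(\<Prod>s<n. \<Prod>r\<in>{..<n} - {s}. l r - l s) = (\<Prod>s<n. (\<Prod>r<s. l r - l s) * (\<Prod>r\<in>{s<..<n}. l r - l s))"
  proof (rule prod.cong[OF refl])
    fix s assume "s \<in> {..<n}"
    then have eq: "{..<n} - {s} = {..<s} \<union> {s<..<n}" by auto
    show "(\<Prod>r\<in>{..<n} - {s}. l r - l s) = (\<Prod>r<s. l r - l s) * (\<Prod>r\<in>{s<..<n}. l r - l s)"
      unfolding eq by (rule prod.union_disjoint) auto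
  qed
  also have "\<dots> = (\<Prod>s<n. \<Prod>r<s. l r - l s) * (\<Prod>s<n. \<Prod>r\<in>{s<..<n}. l r - l s)" by (rule prod.distrib)
  also have "(\<Prod>s<n. \<Prod>r\<in>{s<..<n}. l r - l s) = (\<Prod>(s, r)\<in>Sigma {..<n} (\<lambda>s. {s<..<n}). l r - l s)"
    by (rule prod.Sigma) auto
  also have "\<dots> = (\<Prod>(r, s)\<in>Sigma {..<n} (\<lambda>r. {..<r}). l r - l s)"
    by (rule prod.reindex_bij_witness[of _ "\<lambda>(r, s). (s, r)" "\<lambda>(s, r). (r, s)"]) auto
  also have "\<dots> = (\<Prod>r<n. \<Prod>s<r. l r - l s)" by (rule prod.Sigma[symmetric]) auto
  also have "\<dots> = vd {..<n} l" unfolding vd_lessThan ..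
  also have "(\<Prod>s<n. \<Prod>r<s. l r - l s) = (\<Prod>s<n. (- 1) ^ s * (\<Prod>r<s. l s - l r))"
  proof (rule prod.cong[OF refl])
    fix s :: nat
    have "(\<Prod>r<s. l r - l s) = (\<Prod>r<s. (- 1) * (l s - l r))" by (intro prod.cong refl) simp
    then show "(\<Prod>r<s. l r - l s) = (- 1) ^ s * (\<Prod>r<s. l s - l r)" by (simp only: prod.distrib) simp
  qed
  also have "\<dots> = of_int (\<Prod>s<n. (- 1) ^ s) * vd {..<n} l" by (simp add: prod.distrib vd_lessThan of_int_prod)
  finally show ?thesis by (simp add: power2_eq_square mult.assoc)
qed

text \<open>The orders of \<open>KB\<close> and \<open>KB'\<close> are unrelated, so taking
  complements becomes some permutation of positions; its sign is absorbed in the undetermined signs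
  below.\<close>

lemma complement_permutation:
  assumes KB: "kbase n k KB" and KB': "kbase n h KB'" and "h + k = n"
  obtains \<pi> where "\<pi> permutes {0..<length KB}" "\<And>p. p < length KB \<Longrightarrow> set (KB' ! \<pi> p) = {..<n} - set (KB ! p)"
    "\<And>p. p < length KB \<Longrightarrow> \<pi> p < length KB'"
proof -
  let ?B = "\<lambda>k. {S. S \<subseteq> {..<n} \<and> card S = k}"
  have len: "length KB' = length KB"
    unfolding kbase_length[OF KB] kbase_length[OF KB'] using assms(3) binomial_symmetric[of k n] by auto
  have c: "bij_betw (\<lambda>S. {..<n} - S) (?B k) (?B h)"
  proof (rule bij_betw_byWitness[of _ "\<lambda>S. {..<n} - S"])
    have "card ({..<n} - S) = n - card S" if "S \<subseteq> {..<n}" for S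
      using that by (subst card_Diff_subset) (auto intro: finite_subset)
    then show "(\<lambda>S. {..<n} - S) ` ?B k \<subseteq> ?B h" "(\<lambda>S. {..<n} - S) ` ?B h \<subseteq> ?B k"
      using assms(3) by auto
  qed auto
  let ?i = "inv_into {..<length KB'} (\<lambda>p. set (KB' ! p))"
  define \<pi> where "\<pi> p = (if p < length KB then ?i ({..<n} - set (KB ! p)) else p)" for p
  have b: "bij_betw (?i \<circ> ((\<lambda>S. {..<n} - S) \<circ> (\<lambda>p. set (KB ! p)))) {..<length KB} {..<length KB'}"
    by (intro bij_betw_trans[OF bij_betw_trans[OF kbase_bij[OF KB] c] bij_betw_inv_into[OF kbase_bij[OF KB']]])
  then have "bij_betw \<pi> {..<length KB} {..<length KB}"
    unfolding len by (rule bij_betw_cong[THEN iffD1, rotated]) (auto simp: \<pi>_def len)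
  then have 1: "\<pi> permutes {0..<length KB}"
    by (intro bij_imp_permutes) (auto simp: \<pi>_def atLeast0LessThan)
  have 2: "set (KB' ! \<pi> p) = {..<n} - set (KB ! p)" if "p < length KB" for p
  proof -
    have "{..<n} - set (KB ! p) \<in> ?B h"
      using bij_betwE[OF bij_betw_trans[OF kbase_bij[OF KB] c]] that by auto
    then show ?thesis using that bij_betw_inv_into_right[OF kbase_bij[OF KB']] by (simp add: \<pi>_def)
  qed
  show thesis using that[OF 1 2] 1 len by (auto simp: permutes_lt)
qed

section \<open>Evaluating the two block determinants\<close>

lemma poly_sum_lessThan:
  assumes "degree q < n"
  shows "(\<Sum>i<n. coeff q i * y ^ i) = poly q (y :: 'a::comm_ring_1)"
  unfolding poly_altdef using assms by (intro sum.mono_neutral_right) (auto intro: le_degree)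

lemma degree_spoly:
  assumes "kbase n k KB" "p < length KB"
  shows "degree (spoly KB (l :: nat \<Rightarrow> 'a::idom) p) = k"
proof -
  have "degree (spoly KB l p) = card (set (KB ! p))"
    unfolding spoly_def by (subst degree_prod_eq_sum_degree) auto
  then show ?thesis using kbaseD[OF assms] by (simp add: distinct_card)
qed

text \<open>Cauchy-Binet with a Vandermonde matrix replaces the coefficients of
  \<open>t^j f_S\<close> by values at the eigenvalues of an \<open>h\<close>-set \<open>R\<close>,
  and the resulting determinant vanishes unless \<open>R\<close> is the complement of
  \<open>S\<close>. The sign is quantified before \<open>l\<close>, because it must be the same at
  all points when polynomials are compared later.\<close>

lemma zev_det:
  assumes KB: "kbase n k KB" and KB': "kbase n h KB'" and hk: "h + k = n" "0 < h" "0 < k"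
  shows "\<exists>s\<in>{1, - 1 :: int}. \<forall>l :: nat \<Rightarrow> 'a::alg_closed_field. inj_on l {..<n} \<longrightarrow>
    mdet (length KB) (\<lambda>j p. zev KB l (KB' ! j) p) = of_int s * vd {..<n} l ^ ((n - 2) choose (k - 1))"
proof -
  let ?N = "length KB" and ?c = "(n - 2) choose (k - 1)" and ?a = "(n - 1) choose (h - 1)"
  obtain \<pi> where \<pi>: "\<pi> permutes {0..<?N}" "\<And>p. p < ?N \<Longrightarrow> set (KB' ! \<pi> p) = {..<n} - set (KB ! p)"
    "\<And>p. p < ?N \<Longrightarrow> \<pi> p < length KB'" using complement_permutation[OF KB KB' hk(1)] by blast
  have len: "length KB' = ?N"
    unfolding kbase_length[OF KB] kbase_length[OF KB'] using hk(1) binomial_symmetric[of k n] by auto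
  have ch: "(n - 2) choose (h - 1) = ?c"
  proof -
    have "n - 2 - (k - 1) = h - 1" "k - 1 \<le> n - 2" using hk by auto
    then show ?thesis using binomial_symmetric[of "k - 1" "n - 2"] by simp
  qed
  define s where "s = sign \<pi> * (\<Prod>s<n. (- 1) ^ s) ^ ?c"
  have pm: "x \<in> {1, - 1 :: int} \<Longrightarrow> x ^ e \<in> {1, - 1}" for x e by (induction e) auto
  have "(\<Prod>s<m. (- 1 :: int) ^ s) \<in> {1, - 1}" for m :: nat
  proof (induction m)
    case (Suc m)
    then show ?case using pm[of "- 1" m] by auto
  qed auto
  then have "s \<in> {1, - 1}" using pm[of "\<Prod>s<n. (- 1) ^ s" ?c] by (auto simp: s_def sign_def)
  moreover have "mdet ?N (\<lambda>j p. zev KB l (KB' ! j) p) = of_int s * vd {..<n} l ^ ?c"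
    if inj: "inj_on l {..<n}" for l :: "nat \<Rightarrow> 'a"
  proof -
    let ?V = "mat n n (\<lambda>(i, j). l j ^ i)"
    \<comment> \<open>Passes from coefficients to values at the nodes.\<close>
    define G where "G p \<rho> = (\<Sum>\<beta><?N. zev KB l (KB' ! \<beta>) p * compound KB' ?V $$ (\<beta>, \<rho>))" for p \<rho>
    have G: "G p \<rho> = (\<Prod>r\<in>set (KB' ! \<rho>). \<Prod>s\<in>set (KB ! p). l r - l s) * vd (set (KB' ! \<rho>)) l"
      if p: "p < ?N" "\<rho> < ?N" for p \<rho>
    proof -
      let ?R = "KB' ! \<rho>" and ?sp = "spoly KB l p"
      have R: "sorted_wrt (<) ?R" "length ?R = h" "distinct ?R" "\<And>i. i < h \<Longrightarrow> ?R ! i < n"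
        using kbaseD[OF KB', of \<rho>] p len by auto
      have "G p \<rho> = (\<Sum>q<length KB'. mdet h (\<lambda>j i. coeff (monom 1 j * ?sp) (KB' ! q ! i)) * mdet h (\<lambda>i j. l (?R ! j) ^ (KB' ! q ! i)))"
        unfolding G_def len[symmetric]
      proof (intro sum.cong refl arg_cong2[of _ _ _ _ "(*)"])
        fix q assume "q \<in> {..<length KB'}"
        then have q: "q < length KB'" by simp
        show "zev KB l (KB' ! q) p = mdet h (\<lambda>j i. coeff (monom 1 j * ?sp) (KB' ! q ! i))"
          by (simp add: zev_def kbaseD(2)[OF KB' q])
        show "compound KB' ?V $$ (q, \<rho>) = mdet h (\<lambda>i j. l (?R ! j) ^ (KB' ! q ! i))"
          using q p len kbaseD(5)[OF KB' q] R(4)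
          by (auto simp: compound_def minor_def kbaseD(2)[OF KB' q] intro!: mdet_cong)
      qed
      also have "\<dots> = mdet h (\<lambda>j j'. \<Sum>i<n. coeff (monom 1 j * ?sp) i * l (?R ! j') ^ i)"
        by (rule cauchy_binet_mdet[OF KB', symmetric])
      also have "\<dots> = mdet h (\<lambda>j j'. poly ?sp (l (?R ! j')) * l (?R ! j') ^ j)"
      proof (rule mdet_cong)
        fix j j' assume "j < h" "j' < h"
        have "degree (monom 1 j * ?sp) \<le> degree (monom (1::'a) j) + degree ?sp" by (rule degree_mult_le)
        also have "\<dots> < n" using \<open>j < h\<close> hk(1) degree_spoly[OF KB p(1), of l] degree_monom_le[of "1::'a" j] by simp
        finally have "degree (monom 1 j * ?sp) < n" .
        from poly_sum_lessThan[OF this]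
        show "(\<Sum>i<n. coeff (monom 1 j * ?sp) i * l (?R ! j') ^ i) = poly ?sp (l (?R ! j')) * l (?R ! j') ^ j"
          by (simp add: poly_monom)
      qed
      also have "\<dots> = (\<Prod>j<h. poly ?sp (l (?R ! j))) * mdet h (\<lambda>j j'. l (?R ! j') ^ j)"
        by (rule mdet_scale_cols)
      also have "mdet h (\<lambda>j j'. l (?R ! j') ^ j) = vd (set ?R) l"
        using vandermonde_sorted[OF R(1), of l] R(2) by simp
      also have "(\<Prod>j<h. poly ?sp (l (?R ! j))) = (\<Prod>r\<in>set ?R. poly ?sp (l r))"
        using R by (intro prod.reindex_bij_betw[of "(!) ?R" "{..<h}" "set ?R"] bij_betw_nth) auto
      also have "\<dots> = (\<Prod>r\<in>set ?R. \<Prod>s\<in>set (KB ! p). l r - l s)" by (simp add: spoly_def poly_prod)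
      finally show ?thesis .
    qed
    have "mdet ?N G = mdet ?N (\<lambda>j p. zev KB l (KB' ! j) p) * mdet ?N (\<lambda>i j. compound KB' ?V $$ (i, j))"
      unfolding G_def mdet_mult by (subst mdet_transpose[symmetric]) simp
    also have "mdet ?N (\<lambda>i j. compound KB' ?V $$ (i, j)) = det (compound KB' ?V)"
      using det_eq_mdet[OF compound_carrier, of KB' ?V] len by simp
    also have "\<dots> = vd {..<n} l ^ ?a"
      using sylvester_franke[OF KB' hk(2), of ?V] vandermonde[of n l] by (simp add: mdet_def vd_lessThan)
    finally have 1: "mdet ?N G = mdet ?N (\<lambda>j p. zev KB l (KB' ! j) p) * vd {..<n} l ^ ?a" .
    \<comment> \<open>If \<open>R\<close> is the complement of a set other than \<open>S\<close>,
      then \<open>R\<close> and \<open>S\<close> share some \<open>s\<close>, and the factor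
      \<open>l s - l s\<close> occurs.\<close>
    have off: "G p (\<pi> q) = 0" if pq: "p < ?N" "q < ?N" "p \<noteq> q" for p q
    proof -
      have "\<not> set (KB ! p) \<subseteq> set (KB ! q)"
        using pq kbase_set_eq[OF KB pq(1,2)] kbaseD(2,4)[OF KB pq(1)] kbaseD(2,4)[OF KB pq(2)]
        by (metis List.finite_set card_subset_eq distinct_card)
      then obtain s where s: "s \<in> set (KB ! p)" "s \<notin> set (KB ! q)" by blast
      then have "s \<in> set (KB' ! \<pi> q)" using kbaseD(3)[OF KB pq(1)] \<pi>(2)[OF pq(2)] by auto
      then have "(\<Prod>r\<in>set (KB' ! \<pi> q). \<Prod>s\<in>set (KB ! p). l r - l s) = 0"
        using s(1) by (auto intro!: bexI[of _ s])
      then show ?thesis using G[of p "\<pi> q"] pq \<pi>(3)[OF pq(2)] len by simp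
    qed
    have "of_int (sign \<pi>) * mdet ?N G = mdet ?N (\<lambda>p q. G p (\<pi> q))"
      by (rule mdet_permute_cols[OF \<pi>(1), symmetric])
    also have "\<dots> = (\<Prod>p<?N. G p (\<pi> p))" by (rule mdet_upper_triangular) (auto simp: off)
    also have "\<dots> = (\<Prod>p<?N. (\<Prod>s\<in>set (KB ! p). \<Prod>r\<in>{..<n} - set (KB ! p). l r - l s) * vd (set (KB' ! \<pi> p)) l)"
      using \<pi> len by (intro prod.cong refl) (auto simp: G intro: prod.swap)
    also have "\<dots> = (\<Prod>p<?N. \<Prod>s\<in>set (KB ! p). \<Prod>r\<in>{..<n} - set (KB ! p). l r - l s) * (\<Prod>p<?N. vd (set (KB' ! \<pi> p)) l)"
      by (rule prod.distrib)
    also have "(\<Prod>p<?N. vd (set (KB' ! \<pi> p)) l) = (\<Prod>p<length KB'. vd (set (KB' ! p)) l)"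
      unfolding len using permutes_imp_bij[OF \<pi>(1)] by (intro prod.reindex_bij_betw) (simp add: atLeast0LessThan)
    also have "(\<Prod>p<?N. \<Prod>s\<in>set (KB ! p). \<Prod>r\<in>{..<n} - set (KB ! p). l r - l s) =
      (of_int (\<Prod>s<n. (- 1) ^ s) * vd {..<n} l ^ 2) ^ ?c"
      unfolding prod_subsets_separated_pairs[OF KB hk(3)] prod_all_differences ..
    finally have 2: "of_int (sign \<pi>) * mdet ?N G =
      of_int (\<Prod>s<n. (- 1) ^ s) ^ ?c * vd {..<n} l ^ (2 * ?c) * (\<Prod>p<length KB'. vd (set (KB' ! p)) l)"
      by (simp add: power_mult_distrib power_mult)
    have 3: "(\<Prod>p<length KB'. vd (set (KB' ! p)) l) * vd {..<n} l ^ ?c = vd {..<n} l ^ ?a"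
      using prod_vd_subsets[OF KB' hk(2), of l] ch by simp
    let ?v = "vd {..<n} l" and ?z = "mdet ?N (\<lambda>j p. zev KB l (KB' ! j) p)"
    have nz: "?v \<noteq> 0" by (rule vd_nonzero[OF inj]) simp
    have sg: "of_int (sign \<pi>) * of_int (sign \<pi>) = (1 :: 'a)" by (simp add: sign_def)
    \<comment> \<open>The extra power of \<open>?v\<close> is the one demanded by the multiplied
      form of \<open>prod_vd_subsets\<close>; it is cancelled at the end.\<close>
    have "(?v ^ ?a * ?v ^ ?c) * ?z = of_int (sign \<pi>) * (of_int (sign \<pi>) * mdet ?N G) * ?v ^ ?c"
      unfolding 1 using sg by (simp add: mult.assoc[symmetric])
    also have "\<dots> = of_int s * ?v ^ (2 * ?c) * ((\<Prod>p<length KB'. vd (set (KB' ! p)) l) * ?v ^ ?c)"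
      unfolding 2 s_def by (simp add: mult_ac of_int_power)
    also have "\<dots> = (?v ^ ?a * ?v ^ ?c) * (of_int s * ?v ^ ?c)"
      unfolding 3 by (simp add: mult_2 power_add mult_ac)
    finally show ?thesis using nz by simp
  qed
  ultimately show ?thesis by blast
qed

section \<open>The matrices of the derivation on exterior powers\<close>

text \<open>Permuting the nodes \<open>0, \<dots>, k - 1\<close> multiplies the integer Vandermonde
  determinant by \<open>sign p\<close>, while in its product formula each inversion makes exactly
  one factor negative.\<close>

lemma sign_inversions:
  fixes p :: "nat \<Rightarrow> nat"
  assumes p: "p permutes {0..<k}"
  shows "sign p = (- 1) ^ card {(i, j). i < j \<and> j < k \<and> p j < p i}"
proof -
  let ?Q = "Sigma {..<k} (\<lambda>j. {..<j})"
  let ?d = "\<lambda>j i. int (p j) - int (p i)"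
  let ?Inv = "{(j, i) \<in> ?Q. p j < p i}"
  have inj: "p i = p j \<longleftrightarrow> i = j" for i j using permutes_inj[OF p] by (simp add: inj_eq)
  have fin: "finite ?Q" by auto
  define V where "V = mdet k (\<lambda>i j. int j ^ i)"
  have "V = (\<Prod>j<k. \<Prod>i<j. int j - int i)" unfolding V_def by (rule vandermonde)
  then have Vpos: "V > 0" by (auto intro!: prod_pos)
  have "(\<Prod>(j, i)\<in>?Q. ?d j i) = (\<Prod>j<k. \<Prod>i<j. ?d j i)" by (rule prod.Sigma[symmetric]) auto
  also have "\<dots> = mdet k (\<lambda>i j. int (p j) ^ i)" by (rule vandermonde[symmetric])
  also have "\<dots> = sign p * V" unfolding V_def using mdet_permute_cols[OF p, of "\<lambda>i j. int j ^ i"] by simp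
  finally have 1: "(\<Prod>(j, i)\<in>?Q. ?d j i) = sign p * V" .
  have "(\<Prod>(j, i)\<in>?Q. ?d j i) = (\<Prod>x\<in>?Q. (if x \<in> ?Inv then - 1 else 1) * \<bar>?d (fst x) (snd x)\<bar>)"
    by (intro prod.cong refl) (auto split: if_splits)
  also have "\<dots> = (\<Prod>x\<in>?Q. if x \<in> ?Inv then - 1 else 1) * (\<Prod>x\<in>?Q. \<bar>?d (fst x) (snd x)\<bar>)" by (rule prod.distrib)
  also have "(\<Prod>x\<in>?Q. \<bar>?d (fst x) (snd x)\<bar>) = \<bar>\<Prod>(j, i)\<in>?Q. ?d j i\<bar>"
    by (simp add: abs_prod case_prod_unfold)
  also have "\<dots> = V" unfolding 1 using Vpos by (simp add: abs_mult sign_def)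
  also have "(\<Prod>x\<in>?Q. if x \<in> ?Inv then - 1 else 1 :: int) = (- 1) ^ card {x \<in> ?Q. x \<in> ?Inv}"
    unfolding prod.inter_filter[OF fin, symmetric] by (rule prod_constant)
  also have "card {x \<in> ?Q. x \<in> ?Inv} = card {(i, j). i < j \<and> j < k \<and> p j < p i}"
    by (rule bij_betw_same_card[of "\<lambda>(j, i). (i, j)"], rule bij_betw_byWitness[of _ "\<lambda>(i, j). (j, i)"]) auto
  finally show ?thesis unfolding 1 using Vpos by simp
qed

text \<open>Matching \<open>s\<close> against \<open>xs\<close> gives a permutation matrix when
  \<open>xs\<close> rearranges \<open>s\<close>; otherwise two columns agree or a row is
  zero.\<close>

lemma mdet_wedge_coeff:
  fixes s xs :: "'n::linorder list"
  assumes s: "sorted_wrt (<) s" "length s = k" and xs: "length xs = k"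
  shows "mdet k (\<lambda>a b. if s ! a = xs ! b then 1 else 0) = (of_int (wedge_coeff (set s) xs) :: 'a::comm_ring_1)"
proof (cases "distinct xs \<and> set xs = set s")
  case True
  have d: "distinct s" using s by (simp add: strict_sorted_iff)
  obtain p where p: "p permutes {0..<k}" "\<And>i. i < k \<Longrightarrow> xs ! i = s ! p i"
    using distinct_lists_permutation[of xs s] True d xs by auto
  have lt: "s ! a < s ! b \<longleftrightarrow> a < b" if "a < k" "b < k" for a b
    using sorted_wrt_nth_less[OF s(1), of a b] sorted_wrt_nth_less[OF s(1), of b a] that s(2)
    by (cases a b rule: linorder_cases) auto
  have "mdet k (\<lambda>a b. if s ! a = xs ! b then 1 else 0) = mdet k (\<lambda>a b. if a = p b then 1 else 0 :: 'a)"
    using p d s(2) by (intro mdet_cong) (auto simp: nth_eq_iff_index_eq permutes_lt)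
  also have "\<dots> = signof p"
    using mdet_permute_cols[OF p(1), of "\<lambda>a b. if a = b then 1 else 0 :: 'a"] by (simp add: mdet_diag)
  also have "sign p = (- 1) ^ inversions xs"
  proof -
    have "{(i, j). i < j \<and> j < length xs \<and> xs ! j < xs ! i} = {(i, j). i < j \<and> j < k \<and> p j < p i}"
      using p xs by (auto simp: lt permutes_lt)
    then show ?thesis by (simp add: sign_inversions[OF p(1)] inversions_def)
  qed
  finally show ?thesis using True by (simp add: wedge_coeff_def)
next
  case False
  have "mdet k (\<lambda>a b. if s ! a = xs ! b then 1 else 0 :: 'a) = 0"
  proof (cases "distinct xs")
    case False
    then obtain i j where "i < k" "j < k" "i \<noteq> j" "xs ! i = xs ! j" using xs by (auto simp: distinct_conv_nth)
    then show ?thesis by (intro mdet_identical_cols[of i k j]) auto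
  next
    case True
    then have "set xs \<noteq> set s" using \<open>\<not> (distinct xs \<and> set xs = set s)\<close> by simp
    then have "\<not> set s \<subseteq> set xs"
      using True s xs by (metis List.finite_set card_subset_eq distinct_card strict_sorted_iff)
    then obtain a where a: "a < k" "s ! a \<notin> set xs" using s(2) by (metis in_set_conv_nth subsetI)
    show ?thesis by (rule mdet_zero_row[OF a(1)]) (use a xs in auto)
  qed
  then show ?thesis using False by (auto simp: wedge_coeff_def)
qed

lemma coeff_1_prod_linear:
  fixes a b :: "'i \<Rightarrow> 'a::comm_ring_1"
  assumes "finite I"
  shows "coeff (\<Prod>i\<in>I. [:b i, a i:]) 0 = (\<Prod>i\<in>I. b i)"
    "coeff (\<Prod>i\<in>I. [:b i, a i:]) 1 = (\<Sum>i\<in>I. a i * (\<Prod>j\<in>I - {i}. b j))"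
proof -
  show 0: "coeff (\<Prod>i\<in>I. [:b i, a i:]) 0 = (\<Prod>i\<in>I. b i)" for I
    by (induction I rule: infinite_finite_induct) (auto simp: coeff_mult)
  show "coeff (\<Prod>i\<in>I. [:b i, a i:]) 1 = (\<Sum>i\<in>I. a i * (\<Prod>j\<in>I - {i}. b j))"
    using assms
  proof (induction I)
    case (insert i I)
    have "(\<Sum>m\<in>I. a m * (\<Prod>j\<in>insert i I - {m}. b j)) = (\<Sum>m\<in>I. b i * (a m * (\<Prod>j\<in>I - {m}. b j)))"
    proof (rule sum.cong[OF refl])
      fix m assume "m \<in> I"
      then have "insert i I - {m} = insert i (I - {m})" using insert.hyps by auto
      then show "a m * (\<Prod>j\<in>insert i I - {m}. b j) = b i * (a m * (\<Prod>j\<in>I - {m}. b j))"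
        using insert.hyps by (simp add: algebra_simps)
    qed
    moreover have "coeff ([:b i, a i:] * F) 1 = b i * coeff F 1 + a i * coeff F 0" for F
      by (simp add: coeff_pCons split: nat.split)
    ultimately show ?case using insert.hyps insert.IH 0[of I] by (simp add: sum_distrib_left del: mult_pCons_left)
  qed simp
qed

text \<open>The derivation \<open>A\<^sub>k\<close> is the linear coefficient of \<open>\<Lambda>\<^sup>k(1 + t A)\<close>.\<close>
definition extm :: "nat \<Rightarrow> nat list list \<Rightarrow> 'a::comm_ring_1 mat \<Rightarrow> 'a mat" where
  "extm n KB A = mat (length KB) (length KB) (\<lambda>(p, q). coeff (compound KB (pencil n [:0, 1:] 1 A) $$ (p, q)) 1)"

lemma extm_carrier [simp]: "extm n KB A \<in> carrier_mat (length KB) (length KB)"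
  by (simp add: extm_def)

lemma extm_diag:
  assumes KB: "kbase n k KB" and A: "A \<in> carrier_mat n n" and P: "P \<in> carrier_mat n n"
    and AP: "A * P = P * dg n l"
  shows "extm n KB A * compound KB P = compound KB P * dg (length KB) (\<lambda>p. \<Sum>s\<in>set (KB ! p). l s)"
proof -
  have g: "smult (l s) [:0, 1:] + 1 = [:1, l s:]" for s by (simp add: one_pCons)
  have "coeff (1 * (\<Prod>s\<in>set (KB ! p). [:1, l s:])) 1 = (\<Sum>s\<in>set (KB ! p). l s)" for p
    by (simp add: coeff_1_prod_linear One_nat_def[symmetric] del: One_nat_def)
  then show ?thesis
    using coeff_compound_diag[OF KB pencil_carrier P pencil_diag[OF A P AP, of "[:0, 1:]" 1], of 1 1]
    unfolding extm_def g by simp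
qed

section \<open>Ranks in the finite linear order and the standard basis of the exterior power\<close>

lemma idx_bij: "bij_betw (idx :: nat \<Rightarrow> 'n::{finite,linorder}) {..<(card (UNIV :: 'n set))} UNIV"
  using bij_betw_nth[of "sorted_list_of_set (UNIV :: 'n set)" "{..<(card (UNIV :: 'n set))}" UNIV]
  by (simp add: idx_def[abs_def])

lemma idx_less:
  assumes "i < card (UNIV :: 'n::{finite,linorder} set)" "j < (card (UNIV :: 'n set))"
  shows "(idx i :: 'n) < idx j \<longleftrightarrow> i < j"
proof -
  have s: "sorted_wrt (<) (sorted_list_of_set (UNIV :: 'n set))" by simp
  show ?thesis
    using sorted_wrt_nth_less[OF s, of i j] sorted_wrt_nth_less[OF s, of j i] assms
    by (cases i j rule: linorder_cases) (auto simp: idx_def)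
qed

definition ix :: "'n::{finite,linorder} \<Rightarrow> nat" where
  "ix = inv_into {..<(card (UNIV :: 'n set))} idx"

lemma ix_idx: "i < card (UNIV :: 'n::{finite,linorder} set) \<Longrightarrow> ix (idx i :: 'n) = i"
  unfolding ix_def using bij_betw_inv_into_left[OF idx_bij, of i] by simp

lemma idx_ix: "idx (ix a) = (a :: 'n::{finite,linorder})"
  unfolding ix_def using bij_betw_inv_into_right[OF idx_bij, of a] by simp

lemma ix_lt: "ix (a :: 'n::{finite,linorder}) < (card (UNIV :: 'n set))"
  unfolding ix_def using bij_betw_inv_into[OF idx_bij] by (auto dest: bij_betwE)

lemma ix_less: "ix a < ix b \<longleftrightarrow> (a :: 'n::{finite,linorder}) < b"
  using idx_less[OF ix_lt ix_lt, of a b] by (simp add: idx_ix)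

lemma ix_eq: "ix a = ix b \<longleftrightarrow> (a :: 'n::{finite,linorder}) = b"
  by (metis idx_ix)

text \<open>The lists behind \<open>kbasis\<close>, kept before the passage to sets because minors
  need an order.\<close>

definition klists :: "nat \<Rightarrow> 'n::{finite,linorder} list list" where
  "klists k = sorted_list_of_set {xs. sorted_wrt (<) xs \<and> length xs = k}"

text \<open>Keeps the order of \<open>kbasis\<close> and replaces elements by their ranks, so that
  matrices can be compared entry by entry.\<close>

definition KBn :: "'n::{finite,linorder} itself \<Rightarrow> nat \<Rightarrow> nat list list" where
  "KBn _ k = map (map ix) (klists k :: 'n list list)"

lemma klists_set: "set (klists k :: 'n::{finite,linorder} list list) = {xs. sorted_wrt (<) xs \<and> length xs = k}"
proof -
  have "finite {xs :: 'n list. sorted_wrt (<) xs \<and> length xs = k}"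
    by (rule finite_subset[OF _ finite_lists_length_eq[of UNIV k]]) auto
  then show ?thesis by (simp add: klists_def)
qed

lemma sorted_wrt_map_ix: "sorted_wrt (<) (map ix xs) \<longleftrightarrow> sorted_wrt (<) (xs :: 'n::{finite,linorder} list)"
  by (simp add: sorted_wrt_map ix_less)

lemma kbase_KBn: "kbase (card (UNIV :: 'n set)) k (KBn TYPE('n::{finite,linorder}) k)"
  unfolding kbase_def
proof (intro conjI subset_antisym subsetI)
  have "distinct (klists k :: 'n list list)" by (simp add: klists_def)
  moreover have "inj_on (map ix) (set (klists k :: 'n list list))"
    by (rule inj_on_subset[OF _ subset_UNIV], rule inj_mapI) (simp add: inj_def ix_eq)
  ultimately show "distinct (KBn TYPE('n) k)" by (simp add: KBn_def distinct_map)
  fix xs assume "xs \<in> set (KBn TYPE('n) k)"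
  then show "xs \<in> {xs. sorted_wrt (<) xs \<and> length xs = k \<and> set xs \<subseteq> {..<(card (UNIV :: 'n set))}}"
    by (auto simp: KBn_def klists_set sorted_wrt_map_ix ix_lt)
next
  fix xs assume "xs \<in> {xs. sorted_wrt (<) xs \<and> length xs = k \<and> set xs \<subseteq> {..<(card (UNIV :: 'n set))}}"
  then have xs: "sorted_wrt (<) xs" "length xs = k" "set xs \<subseteq> {..<(card (UNIV :: 'n set))}" by auto
  have eq: "map ix (map (idx :: nat \<Rightarrow> 'n) xs) = xs"
    using xs(3) by (auto simp: ix_idx intro!: map_idI)
  then have "sorted_wrt (<) (map (idx :: nat \<Rightarrow> 'n) xs)" using xs(1) sorted_wrt_map_ix by metis
  then have "map (idx :: nat \<Rightarrow> 'n) xs \<in> set (klists k)" using xs(2) by (simp add: klists_set)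
  then have "map ix (map (idx :: nat \<Rightarrow> 'n) xs) \<in> set (KBn TYPE('n) k)"
    unfolding KBn_def set_map by (rule imageI)
  then show "xs \<in> set (KBn TYPE('n) k)" by (simp only: eq)
qed

text \<open>Both sides become sums over a permutation \<open>\<sigma>\<close> and a distinguished
  position \<open>i\<close>: on the left the position where \<open>A\<close> acts, on the right the
  factor of a Leibniz product that contributes \<open>t\<close>.\<close>

lemma ext_mat_eval:
  fixes x :: "'n::{finite,linorder} var \<Rightarrow> 'a::comm_ring_1"
  shows "map_mat (mev of_int x) (ext_mat c k) =
    extm (card (UNIV :: 'n set)) (KBn TYPE('n) k) (mat (card (UNIV :: 'n set)) (card (UNIV :: 'n set)) (\<lambda>(i, j). x (c, idx i, idx j)))"
    (is "_ = extm ?n ?KB ?A")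
proof (rule eq_matI)
  interpret h: comm_ring_hom "mev of_int x" by (rule comm_ring_hom.mev_hom[OF comm_ring_hom_of_int])
  have len: "length (kbasis k :: 'n set list) = length ?KB"
    by (simp add: kbasis_def KBn_def klists_def)
  show dims: "dim_row (map_mat (mev of_int x) (ext_mat c k)) = dim_row (extm ?n ?KB ?A)"
    "dim_col (map_mat (mev of_int x) (ext_mat c k)) = dim_col (extm ?n ?KB ?A)"
    by (simp_all add: ext_mat_def Let_def len extm_def)
  fix p q assume "p < dim_row (extm ?n ?KB ?A)" "q < dim_col (extm ?n ?KB ?A)"
  then have pq: "p < length ?KB" "q < length ?KB" by (auto simp: extm_def)
  let ?s = "klists k ! p :: 'n list" and ?t = "klists k ! q :: 'n list"
  have lk: "length (klists k :: 'n list list) = length ?KB" by (simp add: KBn_def)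
  have "?s \<in> set (klists k)" "?t \<in> set (klists k)" using pq lk by (metis nth_mem)+
  then have s: "sorted_wrt (<) ?s" "length ?s = k" and t: "sorted_wrt (<) ?t" "length ?t = k"
    by (auto simp: klists_set)
  have B: "kbasis k ! p = set ?s" "kbasis k ! q = set ?t"
    using pq lk by (simp_all add: kbasis_def klists_def)
  have ts: "sorted_list_of_set (set ?t) = ?t"
    by (rule sorted_list_of_set.idem_if_sorted_distinct; rule t(1)[unfolded strict_sorted_iff, THEN conjunct1] t(1)[unfolded strict_sorted_iff, THEN conjunct2])
  have K: "?KB ! p = map ix ?s" "?KB ! q = map ix ?t" using pq unfolding KBn_def by simp_all
  have "map_mat (mev of_int x) (ext_mat c k) $$ (p, q) =
    (\<Sum>i<k. \<Sum>j\<in>UNIV. of_int (wedge_coeff (set ?s) (?t[i := j])) * x (c, j, ?t ! i))"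
    using pq len by (simp add: ext_mat_def Let_def B ts h.hom_sum h.hom_mult h.hom_of_int
        comm_ring_hom.mev_Var[OF comm_ring_hom_of_int])
  \<comment> \<open>As determinants, the wedge coefficients expand over the same permutations as the
    minor.\<close>
  also have "\<dots> = (\<Sum>i<k. \<Sum>j\<in>UNIV. mdet k (\<lambda>a b. if ?s ! a = ?t[i := j] ! b then 1 else 0) * x (c, j, ?t ! i))"
    using s t by (intro sum.cong refl arg_cong2[of _ _ _ _ "(*)"] mdet_wedge_coeff[symmetric]) auto
  also have "\<dots> = (\<Sum>i<k. \<Sum>j\<in>UNIV. \<Sum>\<sigma> | \<sigma> permutes {0..<k}.
      signof \<sigma> * ((\<Prod>b=0..<k. if ?s ! \<sigma> b = ?t[i := j] ! b then 1 else 0) * x (c, j, ?t ! i)))"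
    by (subst mdet_transpose[symmetric]) (simp only: mdet_sum sum_distrib_right mult.assoc)
  also have "\<dots> = (\<Sum>i<k. \<Sum>\<sigma> | \<sigma> permutes {0..<k}. \<Sum>j\<in>UNIV.
      signof \<sigma> * ((\<Prod>b=0..<k. if ?s ! \<sigma> b = ?t[i := j] ! b then 1 else 0) * x (c, j, ?t ! i)))"
    by (intro sum.cong refl) (rule sum.swap)
  also have "\<dots> = (\<Sum>\<sigma> | \<sigma> permutes {0..<k}. signof \<sigma> * (\<Sum>i<k. \<Sum>j\<in>UNIV.
      (\<Prod>b=0..<k. if ?s ! \<sigma> b = ?t[i := j] ! b then 1 else 0) * x (c, j, ?t ! i)))"
    unfolding sum_distrib_left by (rule sum.swap)
  also have "\<dots> = (\<Sum>\<sigma> | \<sigma> permutes {0..<k}. signof \<sigma> *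
      (\<Sum>i\<in>{0..<k}. x (c, ?s ! \<sigma> i, ?t ! i) * (\<Prod>b\<in>{0..<k} - {i}. if ?s ! \<sigma> b = ?t ! b then 1 else 0)))"
  proof (intro sum.cong refl arg_cong2[of _ _ _ _ "(*)"])
    fix \<sigma> i assume i: "i \<in> {0..<k}"
    \<comment> \<open>Position \<open>i\<close> of the updated list holds \<open>j\<close>, so only
      \<open>j = ?s ! \<sigma> i\<close> contributes.\<close>
    have "(\<Prod>b=0..<k. if ?s ! \<sigma> b = ?t[i := j] ! b then 1 else 0 :: 'a) =
      (if ?s ! \<sigma> i = j then \<Prod>b\<in>{0..<k} - {i}. if ?s ! \<sigma> b = ?t ! b then 1 else 0 else 0)" for j
    proof -
      have "(\<Prod>b=0..<k. if ?s ! \<sigma> b = ?t[i := j] ! b then 1 else 0 :: 'a) =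
        (if ?s ! \<sigma> i = ?t[i := j] ! i then 1 else 0) * (\<Prod>b\<in>{0..<k} - {i}. if ?s ! \<sigma> b = ?t[i := j] ! b then 1 else 0)"
        by (rule prod.remove) (use i in auto)
      also have "(\<Prod>b\<in>{0..<k} - {i}. if ?s ! \<sigma> b = ?t[i := j] ! b then 1 else 0 :: 'a) =
        (\<Prod>b\<in>{0..<k} - {i}. if ?s ! \<sigma> b = ?t ! b then 1 else 0)"
        by (intro prod.cong) auto
      finally show ?thesis using i t(2) by simp
    qed
    then show "(\<Sum>j\<in>UNIV. (\<Prod>b=0..<k. if ?s ! \<sigma> b = ?t[i := j] ! b then 1 else 0) * x (c, j, ?t ! i)) =
      x (c, ?s ! \<sigma> i, ?t ! i) * (\<Prod>b\<in>{0..<k} - {i}. if ?s ! \<sigma> b = ?t ! b then 1 else 0)"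
      by (simp add: if_distrib[of "\<lambda>y. y * _"] sum.delta cong: if_cong)
  qed auto
  also have "\<dots> = coeff (\<Sum>\<sigma> | \<sigma> permutes {0..<k}. of_int (sign \<sigma>) *
      (\<Prod>i=0..<k. [:if ?s ! \<sigma> i = ?t ! i then 1 else 0, x (c, ?s ! \<sigma> i, ?t ! i):])) 1"
    unfolding coeff_sum
  proof (rule sum.cong[OF refl])
    fix \<sigma> assume "\<sigma> \<in> {\<sigma>. \<sigma> permutes {0..<k}}"
    let ?f = "\<Prod>i=0..<k. [:if ?s ! \<sigma> i = ?t ! i then 1 else 0, x (c, ?s ! \<sigma> i, ?t ! i):]"
    have "coeff (of_int (sign \<sigma>) * ?f) 1 = signof \<sigma> * coeff ?f 1" by (simp add: sign_def)
    then show "signof \<sigma> * (\<Sum>i\<in>{0..<k}. x (c, ?s ! \<sigma> i, ?t ! i) * (\<Prod>b\<in>{0..<k} - {i}. if ?s ! \<sigma> b = ?t ! b then 1 else 0)) =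
      coeff (of_int (sign \<sigma>) * ?f) 1"
      by (simp only: coeff_1_prod_linear(2)[OF finite_atLeastLessThan])
  qed
  also have "\<dots> = coeff (mdet k (\<lambda>a b. [:if ?s ! b = ?t ! a then 1 else 0, x (c, ?s ! b, ?t ! a):])) 1"
    unfolding mdet_sum ..
  also have "mdet k (\<lambda>a b. [:if ?s ! b = ?t ! a then 1 else 0, x (c, ?s ! b, ?t ! a):]) =
    mdet k (\<lambda>a b. [:if ?s ! a = ?t ! b then 1 else 0, x (c, ?s ! a, ?t ! b):])"
    by (rule mdet_transpose)
  also have "\<dots> = minor (pencil ?n [:0, 1:] 1 ?A) (?KB ! p) (?KB ! q)"
    unfolding minor_def K length_map s(2)
    by (rule mdet_cong) (use s(2) t(2) in \<open>simp add: pencil_def ix_lt idx_ix ix_eq one_pCons\<close>)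
  finally show "map_mat (mev of_int x) (ext_mat c k) $$ (p, q) = extm ?n ?KB ?A $$ (p, q)"
    using pq by (simp add: extm_def compound_def)
qed

section \<open>Differences of subset sums\<close>

lemma prod_sign: "(\<And>x. x \<in> A \<Longrightarrow> f x \<in> {1, - 1 :: int}) \<Longrightarrow> prod f A \<in> {1, - 1}"
proof (induction A rule: infinite_finite_induct)
  case (insert x A)
  then have "f x \<in> {1, - 1}" "prod f A \<in> {1, - 1}" by auto
  then show ?case using insert.hyps by auto
qed auto

text \<open>The difference of the sums over two \<open>k\<close>-sets depends only on their disjoint parts, of size \<open>r\<close> each;
  the common part is an arbitrary \<open>(k - r)\<close>-subset of the remaining \<open>n - 2 r\<close> elements.\<close>
lemma subset_sum_differences:
  assumes KB: "kbase n k KB" and k: "0 < k"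
  shows "\<exists>s\<in>{1, - 1 :: int}. \<forall>l. (\<Prod>q<length KB. \<Prod>p<q. (\<Sum>s\<in>set (KB ! q). l s) - (\<Sum>s\<in>set (KB ! p). l s)) =
    of_int s * (\<Prod>r\<in>{1..k}. delta n r l ^ ibinom (int n - 2 * int r) (k - r))"
proof -
  let ?S = "\<lambda>p. set (KB ! p)" and ?N = "length KB"
  define D where "D r = {(S, T). S \<subseteq> {0..<n} \<and> T \<subseteq> {0..<n} \<and> card S = r \<and> card T = r \<and> S \<inter> T = {} \<and> Min S < Min T}" for r
  \<comment> \<open>The orientation by which \<open>delta\<close> selects one of two opposite
    differences; it depends on the disjoint parts only.\<close>
  define ori where "ori S T \<longleftrightarrow> Min (S - T) < Min (T - S)" for S T :: "nat set"
  define B where "B = {S. S \<subseteq> {..<n} \<and> card S = k}"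
  define E where "E = {(S, T). S \<in> B \<and> T \<in> B \<and> S \<noteq> T \<and> ori S T}"
  define Q where "Q = Sigma {..<?N} (\<lambda>q. {..<q})"
  \<comment> \<open>Records where the order of \<open>KB\<close> disagrees with this orientation,
    independently of \<open>l\<close>.\<close>
  define \<epsilon> where "\<epsilon> = (\<Prod>(q, p)\<in>Q. if ori (?S p) (?S q) then 1 else - 1 :: int)"
  have finB: "finite B" unfolding B_def by (rule finite_subset[of _ "Pow {..<n}"]) auto
  have finE: "finite E" by (rule finite_subset[of _ "B \<times> B"]) (use finB in \<open>auto simp: E_def\<close>)
  have finQ: "finite Q" unfolding Q_def by auto
  have finD: "finite (D r)" for r
    unfolding D_def by (rule finite_subset[of _ "Pow {0..<n} \<times> Pow {0..<n}"]) auto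
  have SB: "?S p \<in> B" if "p < ?N" for p using bij_betwE[OF kbase_bij[OF KB]] that by (auto simp: B_def)
  have fB: "finite S" if "S \<in> B" for S using that finite_subset[of S "{..<n}"] by (auto simp: B_def)
  have cards: "card (S - T) = card (T - S)" "S - T \<noteq> {}" "card (S \<inter> T) + card (S - T) = k" if "S \<in> B" "T \<in> B" "S \<noteq> T" for S T
  proof -
    have f: "finite S" "finite T" by (rule fB[OF that(1)], rule fB[OF that(2)])
    have c: "card S = k" "card T = k" using that(1,2) unfolding B_def by blast+
    show 1: "card (S \<inter> T) + card (S - T) = k" using card_Int_Diff[OF f(1), of T] c by simp
    then show "card (S - T) = card (T - S)" using card_Int_Diff[OF f(2), of S] c by (simp add: Int_commute)
    show "S - T \<noteq> {}"
    proof
      assume "S - T = {}"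
      then have "S = T" using card_subset_eq[OF f(2), of S] c by simp
      then show False using that(3) by simp
    qed
  qed
  have tot: "ori T S \<longleftrightarrow> \<not> ori S T" if "S \<in> B" "T \<in> B" "S \<noteq> T" for S T
  proof -
    have f: "finite (S - T)" "finite (T - S)" using fB[OF that(1)] fB[OF that(2)] by auto
    have "Min (S - T) \<in> S - T" "Min (T - S) \<in> T - S" using cards(2)[of S T] cards(2)[of T S] that f by (auto simp del: Diff_iff intro!: Min_in)
    then have "Min (S - T) \<noteq> Min (T - S)" by auto
    then show ?thesis by (auto simp: ori_def)
  qed
  have "\<epsilon> \<in> {1, - 1}"
    unfolding \<epsilon>_def by (rule prod_sign) (simp add: case_prod_unfold split: if_splits)
  moreover have "(\<Prod>q<?N. \<Prod>p<q. (\<Sum>s\<in>?S q. l s) - (\<Sum>s\<in>?S p. l s)) =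
    of_int \<epsilon> * (\<Prod>r\<in>{1..k}. delta n r l ^ ibinom (int n - 2 * int r) (k - r))" for l
  proof -
    let ?x = "\<lambda>S. \<Sum>s\<in>S. l s"
    let ?w = "\<lambda>(q, p). if ori (?S p) (?S q) then (?S p, ?S q) else (?S q, ?S p)"
    let ?F = "\<lambda>(S, T). ?x T - ?x S"
    have "(\<Prod>q<?N. \<Prod>p<q. ?x (?S q) - ?x (?S p)) = (\<Prod>(q, p)\<in>Q. ?x (?S q) - ?x (?S p))"
      unfolding Q_def by (rule prod.Sigma) auto
    also have "\<dots> = (\<Prod>z\<in>Q. of_int (case z of (q, p) \<Rightarrow> if ori (?S p) (?S q) then 1 else - 1) * ?F (?w z))"
      by (intro prod.cong refl) auto
    also have "\<dots> = of_int \<epsilon> * (\<Prod>z\<in>Q. ?F (?w z))"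
      unfolding \<epsilon>_def prod.distrib of_int_prod by (simp add: case_prod_unfold)
    also have "(\<Prod>z\<in>Q. ?F (?w z)) = (\<Prod>z\<in>E. ?F z)"
    proof (rule prod.reindex_bij_betw, rule bij_betw_imageI)
      show "inj_on ?w Q"
      proof (rule inj_onI, clarsimp simp: Q_def)
        fix q p q' p' assume a: "q < ?N" "p < q" "q' < ?N" "p' < q'"
          "(if ori (?S p) (?S q) then (?S p, ?S q) else (?S q, ?S p)) = (if ori (?S p') (?S q') then (?S p', ?S q') else (?S q', ?S p'))"
        have eq: "?S a = ?S b \<longleftrightarrow> a = b" if "a < ?N" "b < ?N" for a b using kbase_set_eq[OF KB that] .
        show "q = q' \<and> p = p'"
          using a eq[of p p'] eq[of q q'] eq[of p q'] eq[of q p'] by (auto split: if_splits)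
      qed
      show "?w ` Q = E"
      proof (intro subset_antisym subsetI)
        fix z assume "z \<in> ?w ` Q"
        then obtain q p where a: "q < ?N" "p < q" "z = ?w (q, p)" by (auto simp: Q_def)
        have "?S p \<noteq> ?S q" using kbase_set_eq[OF KB, of p q] a by auto
        then show "z \<in> E" using a SB[of p] SB[of q] tot[of "?S p" "?S q"] by (auto simp: E_def)
      next
        fix z assume "z \<in> E"
        then obtain S T where z: "z = (S, T)" "S \<in> B" "T \<in> B" "S \<noteq> T" "ori S T" by (auto simp: E_def)
        then obtain p q where pq: "p < ?N" "?S p = S" "q < ?N" "?S q = T"
          using kbase_bij[OF KB] unfolding B_def bij_betw_def by (metis (no_types, lifting) imageE lessThan_iff)
        show "z \<in> ?w ` Q"
        proof (cases "p < q")
          case True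
          then have 1: "(q, p) \<in> Q" and 2: "?w (q, p) = z" using pq z by (auto simp: Q_def)
          show ?thesis using imageI[OF 1, of ?w] unfolding 2 .
        next
          case False
          then have "q < p" using pq z by (cases "p = q") auto
          then have 1: "(p, q) \<in> Q" and 2: "?w (p, q) = z" using pq z tot[of S T] by (auto simp: Q_def)
          show ?thesis using imageI[OF 1, of ?w] unfolding 2 .
        qed
      qed
    qed
    also have "\<dots> = (\<Prod>r\<in>{1..k}. \<Prod>z\<in>{z\<in>E. card (fst z - snd z) = r}. ?F z)"
    proof (rule prod.group[OF finE, symmetric])
      show "(\<lambda>z. card (fst z - snd z)) ` E \<subseteq> {1..k}"
      proof clarsimp
        fix S T assume "(S, T) \<in> E"
        then have ST: "S \<in> B" "T \<in> B" "S \<noteq> T" by (auto simp: E_def)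
        then have "finite (S - T)" using fB by auto
        then have "card (S - T) \<noteq> 0" using cards(2)[OF ST] by (simp only: card_eq_0_iff) blast
        then show "Suc 0 \<le> card (S - T) \<and> card (S - T) \<le> k" using cards(3)[OF ST] by linarith
      qed
    qed auto
    also have "\<dots> = (\<Prod>r\<in>{1..k}. delta n r l ^ ibinom (int n - 2 * int r) (k - r))"
    proof (rule prod.cong[OF refl])
      fix r assume r: "r \<in> {1..k}"
      let ?Er = "{z\<in>E. card (fst z - snd z) = r}" and ?g = "\<lambda>(S, T). (S - T, T - S)"
      have "(\<Prod>z\<in>?Er. ?F z) = (\<Prod>y\<in>D r. \<Prod>z\<in>{z\<in>?Er. ?g z = y}. ?F z)"
      proof (rule prod.group[symmetric])
        show "?g ` ?Er \<subseteq> D r"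
        proof clarsimp
          fix S T assume ST: "(S, T) \<in> E" "r = card (S - T)"
          then have "S \<in> B" "T \<in> B" "S \<noteq> T" "ori S T" by (auto simp: E_def)
          then show "(S - T, T - S) \<in> D (card (S - T))" using cards(1)[of S T] by (auto simp: D_def B_def ori_def)
        qed
      qed (use finE finD in auto)
      also have "\<dots> = (\<Prod>y\<in>D r. ?F y ^ ibinom (int n - 2 * int r) (k - r))"
      proof (rule prod.cong[OF refl])
        fix y assume y: "y \<in> D r"
        then obtain S' T' where y': "y = (S', T')" "S' \<subseteq> {..<n}" "T' \<subseteq> {..<n}" "card S' = r" "card T' = r"
          "S' \<inter> T' = {}" "Min S' < Min T'" by (auto simp: D_def atLeast0LessThan)
        have fS: "finite S'" "finite T'" using y' by (auto intro: finite_subset)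
        let ?W = "{U. U \<subseteq> {..<n} - (S' \<union> T') \<and> card U = k - r}"
        have bij: "bij_betw (\<lambda>U. (S' \<union> U, T' \<union> U)) ?W {z\<in>?Er. ?g z = y}"
        proof (rule bij_betw_byWitness[of _ "\<lambda>(S, T). S \<inter> T"])
          show "\<forall>U\<in>?W. (case (S' \<union> U, T' \<union> U) of (S, T) \<Rightarrow> S \<inter> T) = U" using y' by auto
          show "\<forall>z\<in>{z\<in>?Er. ?g z = y}. (S' \<union> (case z of (S, T) \<Rightarrow> S \<inter> T), T' \<union> (case z of (S, T) \<Rightarrow> S \<inter> T)) = z"
            using y' by auto
          show "(\<lambda>U. (S' \<union> U, T' \<union> U)) ` ?W \<subseteq> {z\<in>?Er. ?g z = y}"
          proof clarsimp
            fix U assume U: "U \<subseteq> {..<n} - (S' \<union> T')" "card U = k - r"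
            have fU: "finite U" using U(1) by (rule finite_subset) auto
            have d: "S' \<union> U - (T' \<union> U) = S'" "T' \<union> U - (S' \<union> U) = T'" using U(1) y' by auto
            have c: "card (S' \<union> U) = k" "card (T' \<union> U) = k"
              using U y' fS fU r by (subst card_Un_disjoint; auto)+
            have "S' \<noteq> {}" using y'(4) r by auto
            then have "S' \<union> U \<noteq> T' \<union> U" using d by blast
            then show "(S' \<union> U, T' \<union> U) \<in> E \<and> card (S' \<union> U - (T' \<union> U)) = r \<and> (S' \<union> U - (T' \<union> U), T' \<union> U - (S' \<union> U)) = y"
              using U y' d c by (auto simp: E_def B_def ori_def)
          qed
          show "(\<lambda>(S, T). S \<inter> T) ` {z\<in>?Er. ?g z = y} \<subseteq> ?W"
          proof
            fix U assume "U \<in> (\<lambda>(S, T). S \<inter> T) ` {z\<in>?Er. ?g z = y}"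
            then obtain S T where ST: "(S, T) \<in> E" "card (S - T) = r" "(S - T, T - S) = y" "U = S \<inter> T" by auto
            then have "S \<in> B" "T \<in> B" "S \<noteq> T" by (auto simp: E_def)
            then show "U \<in> ?W"
              using cards(3)[of S T] ST y' by (auto simp: B_def)
          qed
        qed
        have "(\<Prod>z\<in>{z\<in>?Er. ?g z = y}. ?F z) = (\<Prod>U\<in>?W. ?F (S' \<union> U, T' \<union> U))"
          by (rule prod.reindex_bij_betw[OF bij, symmetric])
        also have "\<dots> = (\<Prod>U\<in>?W. ?F y)"
        proof (rule prod.cong[OF refl])
          fix U assume "U \<in> ?W"
          then have U: "U \<inter> S' = {}" "U \<inter> T' = {}" "finite U" by (auto intro: finite_subset[of U "{..<n}"])
          then show "?F (S' \<union> U, T' \<union> U) = ?F y" using fS y' by (simp add: sum.union_disjoint Int_commute)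
        qed
        also have "\<dots> = ?F y ^ card ?W" by (rule prod_constant)
        also have "card ?W = card ({..<n} - (S' \<union> T')) choose (k - r)" by (rule n_subsets) auto
        also have "card ({..<n} - (S' \<union> T')) = n - 2 * r"
          using y' fS by (subst card_Diff_subset) (auto simp: card_Un_disjoint)
        \<comment> \<open>Two disjoint \<open>r\<close>-sets are present here, so
          \<open>2 * r \<le> n\<close> and the first branch of \<open>ibinom\<close> is not
          taken.\<close>
        also have "(n - 2 * r) choose (k - r) = ibinom (int n - 2 * int r) (k - r)"
        proof -
          have "card (S' \<union> T') \<le> card {..<n}" using y' by (intro card_mono) auto
          then have "2 * r \<le> n" using y' fS by (simp add: card_Un_disjoint)
          then have "nat (int n - 2 * int r) = n - 2 * r" "\<not> int n - 2 * int r < 0" by linarith+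
          then show ?thesis unfolding ibinom_def by (simp only: if_False)
        qed
        finally show "(\<Prod>z\<in>{z\<in>?Er. ?g z = y}. ?F z) = ?F y ^ ibinom (int n - 2 * int r) (k - r)" .
      qed
      also have "\<dots> = delta n r l ^ ibinom (int n - 2 * int r) (k - r)"
        unfolding delta_def D_def prod_power_distrib by (simp add: case_prod_unfold)
      finally show "(\<Prod>z\<in>?Er. ?F z) = delta n r l ^ ibinom (int n - 2 * int r) (k - r)" .
    qed
    finally show ?thesis .
  qed
  ultimately show ?thesis by blast
qed

text \<open>The part \<open>r = 1\<close> is the Vandermonde product, which \<open>Tdet\<close> and
  \<open>fdet\<close> have in common; this matches the start of \<open>Gpoly\<close> at
  \<open>r = 2\<close>.\<close>

lemma delta_1: "delta n 1 l = vd {..<n} l"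
proof -
  have "delta n 1 l = (\<Prod>(b, a)\<in>Sigma {..<n} (\<lambda>b. {a\<in>{..<n}. a < b}). l b - l a)"
    unfolding delta_def
    by (rule prod.reindex_bij_witness[of _ "\<lambda>(b, a). ({a}, {b})" "\<lambda>(S, T). (Min T, Min S)"])
      (auto simp: card_1_singleton_iff)
  also have "\<dots> = vd {..<n} l" unfolding vd_def by (rule prod.Sigma[symmetric]) auto
  finally show ?thesis .
qed

section \<open>Factorization of the block determinant\<close>

text \<open>By \<open>bdet_families\<close> both determinants equal the same quantity times powers
  of their eigenvalue determinants for \<open>A\<close> and for \<open>B\<close>, and up to signs
  these differ exactly by the factors \<open>delta n r\<close> with
  \<open>r \<ge> 2\<close>.\<close>

lemma Tdet_fdet_diagz:
  assumes KB: "kbase n k KB" and KB': "kbase n h KB'" and hk: "h + k = n" "0 < h" "0 < k"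
  shows "\<exists>s\<in>{1, - 1 :: int}. \<forall>A B P Q l m. diagz n A P l \<and> inj_on l {..<n} \<and> diagz n B Q m \<and> inj_on m {..<n} \<longrightarrow>
    Tdet (extm n KB A) (extm n KB B) = of_int s * fdet n KB KB' A (B :: complex mat) *
      (\<Prod>r\<in>{2..k}. delta n r l ^ (length KB * ibinom (int n - 2 * int r) (k - r))) *
      (\<Prod>r\<in>{2..k}. delta n r m ^ (length KB * ibinom (int n - 2 * int r) (k - r)))"
proof -
  let ?N = "length KB" and ?c = "(n - 2) choose (k - 1)"
  obtain s1 where s1: "s1 \<in> {1, - 1 :: int}" "\<And>l. inj_on l {..<n} \<Longrightarrow>
    mdet ?N (\<lambda>j p. zev KB l (KB' ! j) p) = of_int s1 * vd {..<n} (l :: nat \<Rightarrow> complex) ^ ?c"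
    using zev_det[OF KB KB' hk, where 'a = complex] by blast
  obtain s2 where s2: "s2 \<in> {1, - 1 :: int}" "\<And>l. (\<Prod>q<?N. \<Prod>p<q. (\<Sum>s\<in>set (KB ! q). l s) - (\<Sum>s\<in>set (KB ! p). l s)) =
    of_int s2 * (\<Prod>r\<in>{1..k}. delta n r l ^ ibinom (int n - 2 * int r) (k - r))"
    using subset_sum_differences[OF KB hk(3)] by blast
  let ?G = "\<lambda>l. \<Prod>r\<in>{2..k}. delta n r l ^ ibinom (int n - 2 * int r) (k - r)"
  have sq: "s \<in> {1, - 1 :: int} \<Longrightarrow> (of_int s :: complex) * of_int s = 1" for s by auto
  have s2': "(\<Prod>q<?N. \<Prod>p<q. (\<Sum>s\<in>set (KB ! q). l s) - (\<Sum>s\<in>set (KB ! p). l s)) =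
    of_int s2 * vd {..<n} l ^ ?c * ?G l" for l
  proof -
    have "{1..k} = insert 1 {2..k}" using hk(3) by auto
    \<comment> \<open>The exponent of the Vandermonde product agrees with the one in
      \<open>zev_det\<close>.\<close>
    moreover have "ibinom (int n - 2 * int 1) (k - 1) = ?c" using hk by (simp add: ibinom_def nat_diff_distrib)
    ultimately show ?thesis unfolding s2(2) by (simp add: delta_1 delta_1[unfolded One_nat_def] mult.assoc)
  qed
  have "Tdet (extm n KB A) (extm n KB B) = fdet n KB KB' A B * ?G l ^ ?N * ?G m ^ ?N"
    if A: "diagz n A P l" "inj_on l {..<n}" and B: "diagz n B Q m" "inj_on m {..<n}" for A B P Q :: "complex mat" and l m
  proof -
    have A': "A \<in> carrier_mat n n" "P \<in> carrier_mat n n" "det P \<noteq> 0" "A * P = P * dg n l"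
      and B': "B \<in> carrier_mat n n" "Q \<in> carrier_mat n n" "det Q \<noteq> 0" "B * Q = Q * dg n m"
      using A B by (auto simp: diagz_def)
    obtain R where R: "R \<in> carrier_mat n n" "P * R = 1\<^sub>m n" "R * P = 1\<^sub>m n" by (rule mat_inverse_exists[OF A'(2,3)])
    obtain U where U: "U \<in> carrier_mat n n" "Q * U = 1\<^sub>m n" "U * Q = 1\<^sub>m n" by (rule mat_inverse_exists[OF B'(2,3)])
    note inv = compound_inverse[OF KB A'(2) R(1,2)] compound_inverse[OF KB R(1) A'(2) R(3)]
      compound_inverse[OF KB B'(2) U(1,2)] compound_inverse[OF KB U(1) B'(2) U(3)]
    let ?K = "signof (swap_digits ?N) * det (compound KB P) ^ ?N * (\<Prod>S<?N. \<Prod>T<?N. (compound KB R * compound KB Q) $$ (S, T)) * det (compound KB U) ^ ?N"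
    let ?xs = "\<lambda>l p. \<Sum>s\<in>set (KB ! p). l s"
    have "Tdet (extm n KB A) (extm n KB B) = bdet ?N (\<lambda>i p j q. (extm n KB A ^\<^sub>m j * extm n KB B ^\<^sub>m i) $$ (p, q))"
      by (rule Tdet_bdet) (simp add: extm_def)
    also have "\<dots> = signof (swap_digits ?N) * det (compound KB P) ^ ?N * mdet ?N (\<lambda>j p. ?xs l p ^ j) ^ ?N * mdet ?N (\<lambda>j p. ?xs m p ^ j) ^ ?N *
       (\<Prod>S<?N. \<Prod>T<?N. (compound KB R * compound KB Q) $$ (S, T)) * det (compound KB U) ^ ?N"
      by (rule bdet_families[OF compound_carrier compound_carrier inv(1,2) compound_carrier compound_carrier inv(3,4)])
        (auto intro!: diag_pow extm_diag[OF KB] A' B')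
    finally have T: "Tdet (extm n KB A) (extm n KB B) = ?K * (of_int s2 * vd {..<n} l ^ ?c * ?G l) ^ ?N * (of_int s2 * vd {..<n} m ^ ?c * ?G m) ^ ?N"
      unfolding vandermonde s2' by (simp add: mult_ac)
    have "fdet n KB KB' A B = signof (swap_digits ?N) * det (compound KB P) ^ ?N * mdet ?N (\<lambda>j p. zev KB l (KB' ! j) p) ^ ?N *
       mdet ?N (\<lambda>j p. zev KB m (KB' ! j) p) ^ ?N *
       (\<Prod>S<?N. \<Prod>T<?N. (compound KB R * compound KB Q) $$ (S, T)) * det (compound KB U) ^ ?N"
      unfolding fdet_def
      by (rule bdet_families[OF compound_carrier compound_carrier inv(1,2) compound_carrier compound_carrier inv(3,4)])
        (auto intro!: zmat_diag[OF KB] A' B')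
    then have F: "fdet n KB KB' A B = ?K * (of_int s1 * vd {..<n} l ^ ?c) ^ ?N * (of_int s1 * vd {..<n} m ^ ?c) ^ ?N"
      unfolding s1(2)[OF A(2)] s1(2)[OF B(2)] by (simp add: mult_ac)
    have "of_int s ^ ?N * of_int s ^ ?N = (1 :: complex)" if "s \<in> {1, - 1}" for s
      using sq[OF that] by (simp flip: power_mult_distrib)
    from this[OF s1(1)] this[OF s2(1)] show ?thesis
      unfolding T F power_mult_distrib by (simp add: mult_ac)
  qed
  \<comment> \<open>The signs \<open>s1\<close> and \<open>s2\<close> enter equally for
    \<open>A\<close> and for \<open>B\<close>, hence squared, so the total sign is
    \<open>1\<close>.\<close>
  then show ?thesis
    by (intro bexI[of _ 1]) (auto simp: prod_power_distrib power_mult mult.commute[of ?N])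
qed

section \<open>Symmetric polynomials\<close>

inductive_set sring :: "'r::comm_ring_1 set \<Rightarrow> 'r set" for G where
  incl: "x \<in> G \<Longrightarrow> x \<in> sring G"
| one: "1 \<in> sring G"
| add: "x \<in> sring G \<Longrightarrow> y \<in> sring G \<Longrightarrow> x + y \<in> sring G"
| mult: "x \<in> sring G \<Longrightarrow> y \<in> sring G \<Longrightarrow> x * y \<in> sring G"
| uminus: "x \<in> sring G \<Longrightarrow> - x \<in> sring G"

lemma sring_diff: "x \<in> sring G \<Longrightarrow> y \<in> sring G \<Longrightarrow> x - y \<in> sring G"
  using sring.add[OF _ sring.uminus] by fastforce

lemma sring_zero: "0 \<in> sring G"
  using sring_diff[OF sring.one sring.one] by simp

lemma sring_sum: "(\<And>i. i \<in> I \<Longrightarrow> f i \<in> sring G) \<Longrightarrow> sum f I \<in> sring G"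
  by (induction I rule: infinite_finite_induct) (auto intro: sring.intros sring_zero)

definition coeffs_in :: "'r::comm_ring_1 set \<Rightarrow> 'r poly \<Rightarrow> bool" where
  "coeffs_in S p \<longleftrightarrow> (\<forall>i. coeff p i \<in> S)"

lemma coeffs_in_add: "coeffs_in (sring G) p \<Longrightarrow> coeffs_in (sring G) q \<Longrightarrow> coeffs_in (sring G) (p + q)"
  by (auto simp: coeffs_in_def intro: sring.intros)

lemma coeffs_in_diff: "coeffs_in (sring G) p \<Longrightarrow> coeffs_in (sring G) q \<Longrightarrow> coeffs_in (sring G) (p - q)"
  by (auto simp: coeffs_in_def intro: sring_diff)

lemma coeffs_in_uminus: "coeffs_in (sring G) p \<Longrightarrow> coeffs_in (sring G) (- p)"
  by (auto simp: coeffs_in_def intro: sring.intros)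

lemma coeffs_in_mult: "coeffs_in (sring G) p \<Longrightarrow> coeffs_in (sring G) q \<Longrightarrow> coeffs_in (sring G) (p * q)"
  by (auto simp: coeffs_in_def coeff_mult intro!: sring_sum sring.mult)

lemma coeffs_in_const: "a \<in> sring G \<Longrightarrow> coeffs_in (sring G) [:a:]"
  by (auto simp: coeffs_in_def coeff_pCons sring_zero split: nat.split)

lemma coeffs_in_monom: "a \<in> sring G \<Longrightarrow> coeffs_in (sring G) (monom a i)"
  by (auto simp: coeffs_in_def sring_zero)

text \<open>Division by a monic polynomial never divides coefficients, so the remainder stays over
  the subring.\<close>

lemma monic_reduction:
  fixes q :: "'r::idom poly"
  assumes q: "coeffs_in (sring G) q" "lead_coeff q = 1" "degree q = Suc d"
  shows "coeffs_in (sring G) c \<Longrightarrow> \<exists>r. coeffs_in (sring G) r \<and> degree r \<le> d \<and> q dvd c - r"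
proof (induction "degree c" arbitrary: c rule: less_induct)
  case less
  show ?case
  proof (cases "degree c \<le> d")
    case True
    then show ?thesis using less.prems by (intro exI[of _ c]) auto
  next
    case False
    let ?m = "monom (lead_coeff c) (degree c - Suc d)"
    let ?c = "c - ?m * q"
    have lc: "lead_coeff c \<noteq> 0" using False by auto
    have dm: "degree (?m * q) = degree c" using False q lc by (subst degree_mult_eq) (auto simp: degree_monom_eq)
    have "lead_coeff (?m * q) = lead_coeff c" using q(2) by (simp only: lead_coeff_mult lead_coeff_monom mult_1_right)
    then have "coeff ?c (degree c) = 0" using dm by simp
    moreover have "degree ?c \<le> degree c" using dm by (intro degree_diff_le) auto
    ultimately have "degree ?c < degree c" using False
      by (metis coeff_0_degree_minus_1 degree_0 eq_zero_or_degree_less leading_coeff_0_iff nat_less_le le_imp_less_or_eq bot_nat_0.extremum not_le)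
    moreover have "coeffs_in (sring G) ?c"
      using less.prems q(1) by (intro coeffs_in_diff coeffs_in_mult coeffs_in_monom) (auto simp: coeffs_in_def)
    ultimately obtain r where r: "coeffs_in (sring G) r" "degree r \<le> d" "q dvd ?c - r" using less.hyps by blast
    have "c - r = (?c - r) + ?m * q" by simp
    then have "q dvd c - r" using r(3) by (metis dvd_add dvd_triv_right)
    then show ?thesis using r by blast
  qed
qed

type_synonym npoly = "(nat, int) mpoly"

definition rn :: "(nat \<Rightarrow> nat) \<Rightarrow> npoly \<Rightarrow> npoly" where
  "rn \<pi> = mev Cst (\<lambda>v. Var (\<pi> v))"

lemma rn_hom: "comm_ring_hom (rn \<pi>)"
  unfolding rn_def by (rule comm_ring_hom.mev_hom[OF Cst_hom])

lemma rn_Cst [simp]: "rn \<pi> (Cst a) = Cst a"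
  unfolding rn_def by (rule comm_ring_hom.mev_Cst[OF Cst_hom])

lemma rn_Var [simp]: "rn \<pi> (Var v) = Var (\<pi> v)"
  unfolding rn_def by (rule comm_ring_hom.mev_Var[OF Cst_hom])

lemma rn_comp: "rn (\<sigma> \<circ> \<pi>) f = rn \<sigma> (rn \<pi> f)"
  by (rule mpoly_hom_unique[OF rn_hom comm_ring_hom_compose[OF rn_hom rn_hom]]) auto

text \<open>Its coefficients are, up to sign, the elementary symmetric polynomials in the first
  \<open>m\<close> variables.\<close>

definition ep :: "nat \<Rightarrow> npoly poly" where
  "ep m = (\<Prod>i<m. [:- Var i, 1:])"

text \<open>Interpolates between all variables, at \<open>m = 0\<close>, and the elementary
  symmetric polynomials in the first \<open>m\<close>, with the later variables as
  parameters.\<close>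

definition sym_gens :: "nat \<Rightarrow> npoly set" where
  "sym_gens m = range Cst \<union> Var ` {m..} \<union> range (coeff (ep m))"

lemma map_poly_ep:
  assumes "comm_ring_hom h"
  shows "map_poly h (ep m) = (\<Prod>i<m. [:- h (Var i), 1:])"
proof -
  interpret h: comm_ring_hom h by fact
  have 1: "map_poly h [:- Var i, 1:] = [:- h (Var i), 1:]" for i
    by (intro poly_eqI) (simp add: coeff_map_poly coeff_pCons h.hom_uminus split: nat.split)
  interpret mp: comm_ring_hom "map_poly h" by (rule comm_ring_hom_map_poly[OF assms])
  show ?thesis unfolding ep_def mp.hom_prod 1 ..
qed

lemma rn_fixes_sym_gens:
  assumes p: "\<pi> permutes {..<m}" and f: "f \<in> sring (sym_gens m)"
  shows "rn \<pi> f = f"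
proof -
  interpret comm_ring_hom "rn \<pi>" by (rule rn_hom)
  have "map_poly (rn \<pi>) (ep m) = (\<Prod>i<m. [:- Var (\<pi> i), 1:])" by (simp add: map_poly_ep[OF rn_hom])
  also have "\<dots> = ep m" unfolding ep_def
    by (rule prod.reindex_bij_betw[OF permutes_imp_bij[OF p], of "\<lambda>i. [:- Var i, 1:]"])
  finally have e: "rn \<pi> (coeff (ep m) j) = coeff (ep m) j" for j
    by (metis coeff_map_poly hom_zero)
  have "\<pi> v = v" if "v \<ge> m" for v using permutes_not_in[OF p] that by auto
  then have gen: "rn \<pi> x = x" if "x \<in> sym_gens m" for x using that e by (auto simp: sym_gens_def)
  show ?thesis using f by induction (simp_all add: gen hom_add hom_mult hom_uminus)
qed

lemma degree_ep: "degree (ep m) = m" "lead_coeff (ep m) = 1"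
proof -
  show "degree (ep m) = m" unfolding ep_def by (subst degree_prod_eq_sum_degree) auto
  show "lead_coeff (ep m) = 1" unfolding ep_def lead_coeff_prod by simp
qed

text \<open>Since \<open>ep (Suc m)\<close> is \<open>ep m\<close> times a linear factor, synthetic
  division expresses the coefficients of \<open>ep m\<close> through those of
  \<open>ep (Suc m)\<close> and \<open>Var m\<close>, from the top degree downwards.\<close>

lemma sym_gens_step:
  assumes "f \<in> sring (sym_gens m)"
  shows "\<exists>c. coeffs_in (sring (sym_gens (Suc m))) c \<and> poly c (Var m) = f"
proof -
  let ?S = "sring (sym_gens (Suc m))"
  have xm: "coeffs_in ?S [:0, 1:]"
    by (auto simp: coeffs_in_def coeff_pCons intro: sring_zero sring.one split: nat.split)
  have ce: "\<exists>c. coeffs_in ?S c \<and> poly c (Var m) = coeff (ep m) j" for j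
  proof (induction "Suc m - j" arbitrary: j rule: less_induct)
    case less
    show ?case
    proof (cases "j > m")
      case True
      then have "coeff (ep m) j = 0" by (intro coeff_eq_0) (simp add: degree_ep)
      then show ?thesis by (intro exI[of _ 0]) (auto simp: coeffs_in_def sring_zero)
    next
      case False
      then obtain c where c: "coeffs_in ?S c" "poly c (Var m) = coeff (ep m) (Suc j)"
        using less.hyps[of "Suc j"] by (metis Suc_diff_le diff_Suc_Suc lessI not_le_imp_less)
      have "ep (Suc m) = ep m * [:- Var m, 1:]" by (simp add: ep_def)
      then have "coeff (ep m) j = coeff (ep (Suc m)) (Suc j) + Var m * coeff (ep m) (Suc j)"
        by (simp add: coeff_pCons)
      moreover have "coeff (ep (Suc m)) (Suc j) \<in> ?S" by (auto simp: sym_gens_def intro!: sring.incl)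
      ultimately show ?thesis using c xm
        by (intro exI[of _ "[:coeff (ep (Suc m)) (Suc j):] + [:0, 1:] * c"])
          (auto intro!: coeffs_in_add coeffs_in_mult coeffs_in_const simp del: mult_pCons_left)
    qed
  qed
  show ?thesis using assms
  proof induction
    case (incl x)
    consider a where "x = Cst a" | "x = Var m" | v where "x = Var v" "v \<ge> Suc m" | j where "x = coeff (ep m) j"
      using incl by (auto simp: sym_gens_def) (metis Suc_leI le_neq_implies_less)
    then show ?case
    proof cases
      case 1
      then show ?thesis
        by (intro exI[of _ "[:x:]"]) (auto intro!: coeffs_in_const sring.incl simp: sym_gens_def)
    next
      case 2
      then show ?thesis using xm by (intro exI[of _ "[:0, 1:]"]) auto
    next
      case 3
      then show ?thesis
        by (intro exI[of _ "[:x:]"]) (auto intro!: coeffs_in_const sring.incl simp: sym_gens_def)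
    next
      case 4
      then show ?thesis using ce by simp
    qed
  next
    case one
    then show ?case by (intro exI[of _ 1]) (auto simp: one_pCons intro!: coeffs_in_const sring.one)
  next
    case (add x y)
    then show ?case by (metis coeffs_in_add poly_add)
  next
    case (mult x y)
    then show ?case by (metis coeffs_in_mult poly_mult)
  next
    case (uminus x)
    then show ?case by (metis coeffs_in_uminus poly_minus)
  qed
qed

lemma inj_Var: "Var v = (Var w :: ('v, 'a::comm_ring_1) mpoly) \<longleftrightarrow> v = w"
proof
  assume eq: "Var v = (Var w :: ('v, 'a) mpoly)"
  have "ev (\<lambda>u. if u = v then 1 else 0 :: 'a) (Var v) = ev (\<lambda>u. if u = v then 1 else 0) (Var w)" unfolding eq ..
  then show "v = w" by (simp split: if_splits)
qed simp

text \<open>Removing one variable at a time: a symmetric polynomial is \<open>c(x\<^sub>m)\<close> for a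
  polynomial \<open>c\<close> of degree at most \<open>m\<close> over the next ring, and by symmetry \<open>c - f\<close> has the
  \<open>m + 1\<close> roots \<open>x\<^sub>0, \<dots>, x\<^sub>m\<close>.\<close>
theorem symmetric_in_sring:
  "(\<And>\<pi>. \<pi> permutes {..<m} \<Longrightarrow> rn \<pi> f = f) \<Longrightarrow> f \<in> sring (sym_gens m)"
proof (induction m)
  case 0
  show ?case
  proof (induction f rule: mpoly_induct)
    case (Cst a)
    then show ?case by (rule sring.incl) (simp add: sym_gens_def)
  next
    case (Var v)
    then show ?case by (rule sring.incl) (simp add: sym_gens_def)
  qed (rule sring.intros; assumption)+
next
  case (Suc m)
  let ?S = "sring (sym_gens (Suc m))"
  have "f \<in> sring (sym_gens m)"
    by (rule Suc.IH, rule Suc.prems) (auto intro: permutes_subset)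
  then obtain c where c: "coeffs_in ?S c" "poly c (Var m) = f" using sym_gens_step by blast
  have "coeffs_in ?S (ep (Suc m))" by (auto simp: coeffs_in_def sym_gens_def intro!: sring.incl)
  then obtain r where r: "coeffs_in ?S r" "degree r \<le> m" "ep (Suc m) dvd c - r"
    using monic_reduction[OF _ degree_ep(2) degree_ep(1) c(1)] by blast
  have "poly (ep (Suc m)) (Var m) = 0" by (auto simp: ep_def poly_prod)
  moreover obtain q where "c - r = ep (Suc m) * q" using r(3) by (elim dvdE)
  ultimately have "poly (c - r) (Var m) = 0" by (simp only: poly_mult mult_zero_left)
  then have rf: "poly r (Var m) = f" using c(2) by simp
  have "poly r (Var i) = f" if i: "i \<le> m" for i
  proof -
    let ?t = "Transposition.transpose i m"
    have t: "?t permutes {..<Suc m}" using i by (intro permutes_swap_id) auto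
    \<comment> \<open>The transposition fixes \<open>f\<close> and the symmetric coefficients of
      \<open>r\<close>, but moves \<open>Var m\<close> to \<open>Var i\<close>.\<close>
    have "map_poly (rn ?t) r = r"
    proof (rule poly_eqI)
      interpret comm_ring_hom "rn ?t" by (rule rn_hom)
      fix j
      have "coeff r j \<in> ?S" using r(1) by (simp add: coeffs_in_def)
      then show "coeff (map_poly (rn ?t) r) j = coeff r j"
        by (simp add: coeff_map_poly rn_fixes_sym_gens[OF t])
    qed
    then have "poly r (rn ?t (Var m)) = rn ?t f"
      unfolding rf[symmetric] using poly_map_poly_hom[OF rn_hom, of ?t r "Var m"] by simp
    then show ?thesis using Suc.prems[OF t] by simp
  qed
  then have roots: "Var ` {..m} \<subseteq> {x. poly (r - [:f:]) x = 0}" by auto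
  have "r - [:f:] = 0"
  proof (rule ccontr)
    assume nz: "r - [:f:] \<noteq> 0"
    have "card (Var ` {..m} :: npoly set) = Suc m" by (subst card_image) (auto simp: inj_on_def inj_Var)
    then have "Suc m \<le> card {x. poly (r - [:f:]) x = 0}"
      using card_mono[OF poly_roots_finite[OF nz] roots] by simp
    also have "\<dots> \<le> degree (r - [:f:])" by (rule card_poly_roots_bound[OF nz])
    also have "\<dots> \<le> m" using r(2) by (intro degree_diff_le) auto
    finally show False by simp
  qed
  then have "f = coeff r 0" by simp
  then show ?case using r(1) by (auto simp: coeffs_in_def)
qed

section \<open>The polynomials \<open>D\<^sub>r\<close>\<close>

definition dpairs :: "nat \<Rightarrow> nat \<Rightarrow> (nat set \<times> nat set) set" where
  "dpairs n r = {(S, T). S \<subseteq> {0..<n} \<and> T \<subseteq> {0..<n} \<and> card S = r \<and> card T = r \<and> S \<inter> T = {} \<and> Min S < Min T}"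

definition dfac :: "nat set \<Rightarrow> nat set \<Rightarrow> npoly" where
  "dfac S T = (\<Sum>t\<in>T. Var t) - (\<Sum>s\<in>S. Var s)"

definition dpol :: "nat \<Rightarrow> nat \<Rightarrow> npoly" where
  "dpol n r = (\<Prod>(S, T)\<in>dpairs n r. dfac S T)"

lemma finite_dpairs [simp]: "finite (dpairs n r)"
  unfolding dpairs_def by (rule finite_subset[of _ "Pow {0..<n} \<times> Pow {0..<n}"]) auto

lemma dfac_hom:
  assumes "comm_ring_hom h"
  shows "h (dfac S T) = (\<Sum>t\<in>T. h (Var t)) - (\<Sum>s\<in>S. h (Var s))"
proof -
  interpret comm_ring_hom h by fact
  show ?thesis unfolding dfac_def hom_minus hom_sum ..
qed

lemma mev_dpol: "mev of_int l (dpol n r) = delta n r l"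
proof -
  interpret comm_ring_hom "mev of_int l" by (rule comm_ring_hom.mev_hom[OF comm_ring_hom_of_int])
  show ?thesis
    unfolding dpol_def delta_def hom_prod dpairs_def[symmetric]
    by (intro prod.cong refl)
      (auto simp: dfac_hom[OF comm_ring_hom.mev_hom[OF comm_ring_hom_of_int]] comm_ring_hom.mev_Var[OF comm_ring_hom_of_int])
qed

lemma rn_dfac: "inj \<pi> \<Longrightarrow> rn \<pi> (dfac S T) = dfac (\<pi> ` S) (\<pi> ` T)"
  unfolding dfac_hom[OF rn_hom] unfolding dfac_def
  using inj_on_subset[of \<pi> UNIV S] inj_on_subset[of \<pi> UNIV T] by (simp add: sum.reindex)

text \<open>A permutation maps disjoint pairs to disjoint pairs, except that the order by minima may
  be reversed, which negates the factor.\<close>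

lemma rn_dpol_sign:
  assumes p: "\<pi> permutes {..<n}" and r: "r > 0"
  shows "rn \<pi> (dpol n r) = dpol n r \<or> rn \<pi> (dpol n r) = - dpol n r"
proof -
  interpret comm_ring_hom "rn \<pi>" by (rule rn_hom)
  have inj: "inj \<pi>" by (rule permutes_inj[OF p])
  let ?w = "\<lambda>(S, T). if Min (\<pi> ` S) < Min (\<pi> ` T) then (\<pi> ` S, \<pi> ` T) else (\<pi> ` T, \<pi> ` S)"
  let ?\<epsilon> = "\<lambda>(S, T). if Min (\<pi> ` S) < Min (\<pi> ` T) then 1 else - 1 :: int"
  have nonmt: "S \<noteq> {}" "T \<noteq> {}" "finite S" "finite T" if "(S, T) \<in> dpairs n r" for S T
    using that r by (auto simp: dpairs_def intro: finite_subset)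
  have ne: "Min (\<pi> ` S) \<noteq> Min (\<pi> ` T)" if "(S, T) \<in> dpairs n r" for S T
  proof -
    have "Min (\<pi> ` S) \<in> \<pi> ` S" "Min (\<pi> ` T) \<in> \<pi> ` T" using nonmt[OF that] by (auto intro!: Min_in)
    moreover have "\<pi> ` S \<inter> \<pi> ` T = {}" using that inj by (auto simp: dpairs_def inj_eq)
    ultimately show ?thesis by (metis disjoint_iff)
  qed
  have sub: "?w ` dpairs n r \<subseteq> dpairs n r"
  proof
    fix z assume "z \<in> ?w ` dpairs n r"
    then obtain S T where ST: "(S, T) \<in> dpairs n r" and z: "z = ?w (S, T)" by auto
    have c: "card (\<pi> ` A) = card A" for A using inj by (simp add: card_image inj_on_subset)
    have "\<pi> ` A \<subseteq> {0..<n}" if "A \<subseteq> {0..<n}" for A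
      using that permutes_image[OF p] by (auto simp: atLeast0LessThan)
    then show "z \<in> dpairs n r" using ST ne[OF ST] c inj by (auto simp: z dpairs_def inj_eq)
  qed
  have "inj_on ?w (dpairs n r)"
  proof (rule inj_onI)
    fix z z' assume z: "z \<in> dpairs n r" "z' \<in> dpairs n r" "?w z = ?w z'"
    obtain S T S' T' where zz: "z = (S, T)" "z' = (S', T')" by (cases z, cases z')
    have eq: "\<pi> ` A = \<pi> ` B \<longleftrightarrow> A = B" for A B using inj by (simp add: inj_image_eq_iff)
    show "z = z'" using z unfolding zz by (auto simp: eq dpairs_def split: if_splits)
  qed
  then have bij: "bij_betw ?w (dpairs n r) (dpairs n r)"
    unfolding bij_betw_def using endo_inj_surj[OF finite_dpairs sub] by (intro conjI) assumption
  have sw: "dfac S T = - dfac T S" for S T by (simp add: dfac_def)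
  have "rn \<pi> (dpol n r) = (\<Prod>z\<in>dpairs n r. of_int (?\<epsilon> z) * (case ?w z of (S, T) \<Rightarrow> dfac S T))"
    unfolding dpol_def hom_prod by (intro prod.cong refl) (auto simp: rn_dfac[OF inj] intro: sw)
  also have "\<dots> = of_int (\<Prod>z\<in>dpairs n r. ?\<epsilon> z) * (\<Prod>z\<in>dpairs n r. case ?w z of (S, T) \<Rightarrow> dfac S T)"
    by (simp only: prod.distrib of_int_prod)
  also have "(\<Prod>z\<in>dpairs n r. case ?w z of (S, T) \<Rightarrow> dfac S T) = dpol n r"
    unfolding dpol_def by (rule prod.reindex_bij_betw[OF bij])
  finally have *: "rn \<pi> (dpol n r) = of_int (\<Prod>z\<in>dpairs n r. ?\<epsilon> z) * dpol n r" .
  have "(\<Prod>z\<in>dpairs n r. ?\<epsilon> z) \<in> {1, - 1}"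
    by (rule prod_sign) (simp add: case_prod_unfold split: if_splits)
  then show ?thesis
  proof (elim insertE emptyE)
    assume e: "(\<Prod>z\<in>dpairs n r. ?\<epsilon> z) = 1"
    show ?thesis using * unfolding e by simp
  next
    assume e: "(\<Prod>z\<in>dpairs n r. ?\<epsilon> z) = - 1"
    show ?thesis using * unfolding e by simp
  qed
qed

text \<open>A transposition of \<open>a\<close> and \<open>b\<close> cannot change the sign, because \<open>\<delta>\<^sub>r\<close> does not vanish
  identically on the hyperplane \<open>x\<^sub>a = x\<^sub>b\<close> when \<open>r \<ge> 2\<close>.\<close>
lemma rn_dpol:
  assumes p: "\<pi> permutes {..<n}" and r: "r \<ge> 2"
  shows "rn \<pi> (dpol n r) = dpol n r"
proof -
  have tr: "rn (Transposition.transpose a b) (dpol n r) = dpol n r" if ab: "a < n" "b < n" "a \<noteq> b" for a b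
  proof (rule ccontr)
    let ?t = "Transposition.transpose a b"
    have t: "?t permutes {..<n}" using ab by (intro permutes_swap_id) auto
    assume "rn ?t (dpol n r) \<noteq> dpol n r"
    then have neg: "rn ?t (dpol n r) = - dpol n r" using rn_dpol_sign[OF t, of r] r by auto
    \<comment> \<open>Identifying \<open>b\<close> with \<open>a\<close> makes the transposition
      invisible, so the image of \<open>dpol n r\<close> would equal its own negative.\<close>
    let ?h = "rn (\<lambda>v. if v = b then a else v)"
    interpret h: comm_ring_hom ?h by (rule rn_hom)
    have "?h (rn ?t f) = ?h f" for f
      unfolding rn_comp[symmetric] by (rule mpoly_hom_unique[OF rn_hom rn_hom]) (auto simp: transpose_def)
    then have "?h (dpol n r) = - ?h (dpol n r)" using neg by (metis h.hom_uminus)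
    then have "2 * ?h (dpol n r) = 0" by (simp add: mult_2 eq_neg_iff_add_eq_0)
    then have "?h (dpol n r) = 0" by simp
    then obtain S T where ST: "(S, T) \<in> dpairs n r" "?h (dfac S T) = 0"
      unfolding dpol_def h.hom_prod by auto
    have fin: "finite S" "finite T" using ST(1) by (auto simp: dpairs_def intro: finite_subset)
    have "card (S \<union> T) = 2 * r" using ST(1) fin by (auto simp: dpairs_def card_Un_disjoint)
    \<comment> \<open>At least four indices occur, so a variable \<open>c\<close> other than the two
      identified ones keeps its coefficient \<open>1\<close> or \<open>- 1\<close>.\<close>
    then have "\<not> S \<union> T \<subseteq> {a, b}" using r card_mono[of "{a, b}" "S \<union> T"] by (auto simp: card_insert_if split: if_splits)
    then obtain c where c: "c \<in> S \<union> T" "c \<noteq> a" "c \<noteq> b" by blast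
    let ?e = "mev (\<lambda>i::int. i) (\<lambda>v. if v = c then 1 else 0)"
    have e: "comm_ring_hom ?e" by (rule comm_ring_hom.mev_hom[OF comm_ring_hom_id])
    have ev: "?e (?h (Var v)) = (if v = c then 1 else 0)" for v
      using c by (simp add: comm_ring_hom.mev_Var[OF comm_ring_hom_id])
    have "?e (?h (dfac S T)) = (\<Sum>t\<in>T. if t = c then 1 else 0) - (\<Sum>s\<in>S. if s = c then 1 else 0)"
      unfolding dfac_hom[OF comm_ring_hom_compose[OF rn_hom e]] ev ..
    moreover have "?e (?h (dfac S T)) = 0" unfolding ST(2) by (simp add: mev_def)
    moreover have "S \<inter> T = {}" using ST(1) by (auto simp: dpairs_def)
    ultimately show False using fin c(1) by (auto split: if_splits)
  qed
  show ?thesis using p finite_lessThan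
  proof (induction rule: permutes_induct)
    case id
    have "rn id f = f" for f by (rule mpoly_hom_unique[OF rn_hom comm_ring_hom_id]) auto
    then show ?case .
  next
    case (swap a b p)
    then show ?case unfolding rn_comp using tr[of a b] by simp
  qed
qed

lemma dpol_nonzero: "r > 0 \<Longrightarrow> dpol n r \<noteq> 0"
proof
  assume r: "r > 0" and "dpol n r = 0"
  then obtain S T where ST: "(S, T) \<in> dpairs n r" "dfac S T = 0"
    unfolding dpol_def by (auto simp: prod_zero_iff)
  have fin: "finite S" "finite T" using ST(1) by (auto simp: dpairs_def intro: finite_subset)
  have "T \<noteq> {}" "S \<inter> T = {}" using ST(1) r by (auto simp: dpairs_def)
  then obtain c where c: "c \<in> T" "c \<notin> S" by blast
  let ?e = "mev (\<lambda>i::int. i) (\<lambda>v. if v = c then 1 else 0)"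
  have e: "comm_ring_hom ?e" by (rule comm_ring_hom.mev_hom[OF comm_ring_hom_id])
  have "?e (dfac S T) = (\<Sum>t\<in>T. if t = c then 1 else 0) - (\<Sum>s\<in>S. if s = c then 1 else 0)"
    unfolding dfac_hom[OF e] by (simp add: comm_ring_hom.mev_Var[OF comm_ring_hom_id])
  moreover have "?e (dfac S T) = 0" unfolding ST(2) by (simp add: mev_def)
  ultimately show False using fin c by (simp split: if_splits)
qed

section \<open>Symmetric functions of eigenvalues as polynomials in the matrix entries\<close>

definition gmat :: "bool \<Rightarrow> ('n::{finite,linorder} var, 'a::comm_ring_1) mpoly mat" where
  "gmat c = mat (card (UNIV :: 'n set)) (card (UNIV :: 'n set)) (\<lambda>(i, j). Var (c, idx i, idx j))"

definition vmat :: "('n::{finite,linorder} var \<Rightarrow> 'a) \<Rightarrow> bool \<Rightarrow> 'a mat" where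
  "vmat x c = mat (card (UNIV :: 'n set)) (card (UNIV :: 'n set)) (\<lambda>(i, j). x (c, idx i, idx j))"

lemma gmat_carrier [simp]: "(gmat c :: ('n::{finite,linorder} var, 'a::comm_ring_1) mpoly mat) \<in> carrier_mat (card (UNIV :: 'n set)) (card (UNIV :: 'n set))"
  by (simp add: gmat_def)

lemma vmat_carrier [simp]: "(vmat (x :: 'n::{finite,linorder} var \<Rightarrow> 'a) c) \<in> carrier_mat (card (UNIV :: 'n set)) (card (UNIV :: 'n set))"
  by (simp add: vmat_def)

lemma map_gmat: "comm_ring_hom h \<Longrightarrow> map_mat (mev h x) (gmat c) = vmat x c"
  by (intro eq_matI) (auto simp: gmat_def vmat_def comm_ring_hom.mev_Var)

text \<open>Up to sign, the elementary symmetric functions of the eigenvalues are coefficients of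
  the characteristic polynomial, hence integer polynomials in the entries. The generators include
  variables beyond the eigenvalues; those get the value \<open>0\<close>.\<close>

lemma sring_char_poly:
  fixes c :: bool
  assumes "f \<in> sring (sym_gens (card (UNIV :: 'n::{finite,linorder} set)))"
  shows "\<exists>p. \<forall>(x :: 'n var \<Rightarrow> complex) lam. char_poly (vmat x c) = (\<Prod>i<card (UNIV :: 'n set). [:- lam i, 1:]) \<longrightarrow>
    mev of_int x p = mev of_int (\<lambda>i. if i < card (UNIV :: 'n set) then lam i else 0) f"
    (is "\<exists>p. ?P p f")
proof -
  let ?n = "card (UNIV :: 'n set)"
  note hi = comm_ring_hom_of_int
  interpret e: comm_ring_hom "mev of_int (x :: 'v \<Rightarrow> complex)" for x :: "'v \<Rightarrow> complex" by (rule comm_ring_hom.mev_hom[OF hi])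
  show ?thesis using assms
  proof induction
    case (incl f)
    consider a where "f = Cst a" | v where "f = Var v" "v \<ge> ?n" | j where "f = coeff (ep ?n) j"
      using incl by (auto simp: sym_gens_def)
    then show ?case
    proof cases
      case 1
      then show ?thesis by (intro exI[of _ "Cst a"]) (simp add: comm_ring_hom.mev_Cst[OF hi])
    next
      case 2
      then show ?thesis by (intro exI[of _ 0]) (simp add: comm_ring_hom.mev_Var[OF hi])
    next
      case 3
      have "mev of_int x (coeff (char_poly (gmat c)) j) = mev of_int (\<lambda>i. if i < ?n then lam i else 0) f"
        if cp: "char_poly (vmat x c) = (\<Prod>i<?n. [:- lam i, 1:])" for x :: "'n var \<Rightarrow> complex" and lam
      proof -
        have "mev of_int x (coeff (char_poly (gmat c)) j) = coeff (map_poly (mev of_int x) (char_poly (gmat c))) j"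
          by (simp add: coeff_map_poly)
        also have "\<dots> = coeff (char_poly (vmat x c)) j"
          unfolding e.char_poly_hom[OF gmat_carrier, symmetric] map_gmat[OF hi] ..
        also have "\<dots> = coeff (map_poly (mev of_int (\<lambda>i. if i < ?n then lam i else 0)) (ep ?n)) j"
          unfolding cp map_poly_ep[OF comm_ring_hom.mev_hom[OF hi]]
          by (intro arg_cong[of _ _ "\<lambda>p. coeff p j"] prod.cong) (auto simp: comm_ring_hom.mev_Var[OF hi])
        finally show ?thesis by (simp add: coeff_map_poly 3)
      qed
      then show ?thesis by blast
    qed
  next
    case one
    then show ?case by (intro exI[of _ 1]) simp
  next
    case (add f g)
    then obtain p q where "?P p f" "?P q g" by blast
    then show ?case by (intro exI[of _ "p + q"]) (simp add: e.hom_add)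
  next
    case (mult f g)
    then obtain p q where "?P p f" "?P q g" by blast
    then show ?case by (intro exI[of _ "p * q"]) (simp add: e.hom_mult)
  next
    case (uminus f)
    then obtain p where "?P p f" by blast
    then show ?case by (intro exI[of _ "- p"]) (simp add: e.hom_uminus)
  qed
qed

lemma mpoly_int_eqI_complex:
  fixes p q :: "('v, int) mpoly"
  assumes "\<And>x :: 'v \<Rightarrow> complex. mev of_int x p = mev of_int x q"
  shows "p = q"
proof -
  interpret e: comm_ring_hom "mev of_int x" for x :: "'v \<Rightarrow> complex" by (rule comm_ring_hom.mev_hom[OF comm_ring_hom_of_int])
  have "p - q = 0" by (rule mpoly_int_eq_0_complex) (simp add: e.hom_minus assms)
  then show ?thesis by simp
qed

text \<open>Justifies the definite description in \<open>Dpoly\<close>: existence comes from the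
  symmetric polynomial \<open>dpol\<close>, and uniqueness from the fact that every complex matrix
  has a full list of eigenvalues.\<close>

lemma Dpoly_eval:
  fixes x :: "'n::{finite,linorder} var \<Rightarrow> complex"
  assumes r: "r \<ge> 2" and cp: "char_poly (vmat x c) = (\<Prod>i<card (UNIV :: 'n set). [:- lam i, 1:])"
  shows "mev of_int x (Dpoly c r) = delta (card (UNIV :: 'n set)) r lam"
proof -
  let ?n = "card (UNIV :: 'n set)"
  let ?Q = "\<lambda>p. \<forall>(x :: 'n var \<Rightarrow> complex) lam. char_poly (vmat x c) = (\<Prod>i<?n. [:- lam i, 1:]) \<longrightarrow> mpeval p x = delta ?n r lam"
  have "dpol ?n r \<in> sring (sym_gens ?n)" by (rule symmetric_in_sring) (rule rn_dpol[OF _ r])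
  from sring_char_poly[OF this, of c] obtain p where
    p: "\<And>(x :: 'n var \<Rightarrow> complex) lam. char_poly (vmat x c) = (\<Prod>i<?n. [:- lam i, 1:]) \<Longrightarrow>
      mev of_int x p = mev of_int (\<lambda>i. if i < ?n then lam i else 0) (dpol ?n r)" by blast
  have "delta ?n r (\<lambda>i. if i < ?n then lam i else 0) = delta ?n r lam" for lam
    unfolding delta_def
  proof (rule prod.cong[OF refl], clarify)
    fix S T :: "nat set" assume "S \<subseteq> {0..<?n}" "T \<subseteq> {0..<?n}"
    then show "(\<Sum>t\<in>T. if t < ?n then lam t else 0) - (\<Sum>s\<in>S. if s < ?n then lam s else 0) = (\<Sum>t\<in>T. lam t) - (\<Sum>s\<in>S. lam s)"
      by (intro arg_cong2[of _ _ _ _ "(-)"] sum.cong) auto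
  qed
  then have "?Q p" using p by (simp add: mpeval_eq mev_dpol)
  moreover have "q = p" if "?Q q" for q
  proof (rule mpoly_int_eqI_complex)
    fix x :: "'n var \<Rightarrow> complex"
    obtain as where as: "char_poly (vmat x c) = (\<Prod>a\<leftarrow>as. [:- a, 1:])" "length as = ?n"
      using char_poly_factorized[OF vmat_carrier] by blast
    have "char_poly (vmat x c) = (\<Prod>i<?n. [:- (as ! i), 1:])"
      unfolding as(1) by (simp add: prod.list_conv_set_nth as(2) atLeast0LessThan)
    then have "mpeval q x = mpeval p x" using that \<open>?Q p\<close> by simp
    then show "mev of_int x q = mev of_int x p" by (simp add: mpeval_eq)
  qed
  ultimately have "?Q (THE p. ?Q p)" by (rule theI2) auto
  moreover have "Dpoly c r = (THE p. ?Q p)" unfolding Dpoly_def vmat_def ..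
  ultimately show ?thesis using cp by (simp add: mpeval_eq)
qed

lemma char_poly_diagz:
  assumes "diagz n A P (l :: nat \<Rightarrow> 'a::field)"
  shows "char_poly A = (\<Prod>i<n. [:- l i, 1:])"
proof -
  have A: "A \<in> carrier_mat n n" "P \<in> carrier_mat n n" "det P \<noteq> 0" "A * P = P * dg n l"
    using assms by (auto simp: diagz_def)
  obtain R where R: "R \<in> carrier_mat n n" "P * R = 1\<^sub>m n" "R * P = 1\<^sub>m n" by (rule mat_inverse_exists[OF A(2,3)])
  have "A = A * (P * R)" using A R by simp
  also have "\<dots> = A * P * R" by (rule assoc_mult_mat[OF A(1,2) R(1), symmetric])
  finally have "A = P * dg n l * R" unfolding A(4) .
  then have "similar_mat A (dg n l)"
    using A R by (intro similar_matI[of _ _ P R n]) auto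
  then show ?thesis using char_poly_similar char_poly_dg by metis
qed

section \<open>The triangulant is the determinant \<open>fdet\<close>\<close>

lemma Tdet_hom:
  assumes h: "comm_ring_hom h" and A: "A \<in> carrier_mat N N" and B: "B \<in> carrier_mat N N"
  shows "Tdet (map_mat h A) (map_mat h B) = h (Tdet A B)"
proof -
  interpret comm_ring_hom h by fact
  have d: "dim_row A = N" "dim_row (map_mat h A) = N" using A by auto
  show ?thesis
    unfolding Tdet_bdet[OF d(1)] Tdet_bdet[OF d(2)] bdet_def mdet_hom[OF h]
  proof (rule mdet_cong)
    fix r c assume "r < N * N" "c < N * N"
    note d = div_mod_less_square[OF this(1)] div_mod_less_square[OF this(2)]
    have pw: "A ^\<^sub>m i \<in> carrier_mat N N" "B ^\<^sub>m j \<in> carrier_mat N N" for i j using A B by auto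
    have "map_mat h A ^\<^sub>m (c div N) * map_mat h B ^\<^sub>m (r div N) = map_mat h (A ^\<^sub>m (c div N) * B ^\<^sub>m (r div N))"
      unfolding mat_hom_pow[OF A, symmetric] mat_hom_pow[OF B, symmetric] mat_hom_mult[OF pw] ..
    moreover have "A ^\<^sub>m (c div N) * B ^\<^sub>m (r div N) \<in> carrier_mat N N" by (rule mult_carrier_mat[OF pw])
    ultimately show "(map_mat h A ^\<^sub>m (c div N) * map_mat h B ^\<^sub>m (r div N)) $$ (r mod N, c mod N) =
      h ((A ^\<^sub>m (c div N) * B ^\<^sub>m (r div N)) $$ (r mod N, c mod N))"
      using d carrier_matD by (metis index_map_mat(1))
  qed
qed

lemma idx_inj: "i < card (UNIV :: 'n::{finite,linorder} set) \<Longrightarrow> j < card (UNIV :: 'n set) \<Longrightarrow> (idx i :: 'n) = idx j \<longleftrightarrow> i = j"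
  by (metis ix_idx)

lemma mpoly_eqI_vmat:
  fixes p q :: "('n::{finite,linorder} var, 'a::alg_closed_field) mpoly"
  assumes "\<And>x. (\<And>c. \<exists>P l. diagz (card (UNIV :: 'n set)) (vmat x c) P l \<and> inj_on l {..<card (UNIV :: 'n set)}) \<Longrightarrow> ev x p = ev x q"
  shows "p = q"
proof (rule mpoly_eqI_diagz[of "card (UNIV :: 'n set)" "\<lambda>c i j. (c, idx i, idx j)"])
  fix x :: "'n var \<Rightarrow> 'a"
  assume "\<And>c. \<exists>P l. diagz (card (UNIV :: 'n set)) (mat (card (UNIV :: 'n set)) (card (UNIV :: 'n set)) (\<lambda>(i, j). x (c, idx i, idx j))) P l \<and> inj_on l {..<card (UNIV :: 'n set)}"
  then show "ev x p = ev x q" by (intro assms) (simp add: vmat_def)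
qed (auto simp: idx_inj)

definition Fpol :: "nat list list \<Rightarrow> nat list list \<Rightarrow> ('n::{finite,linorder} var, int) mpoly" where
  "Fpol KB KB' = fdet (card (UNIV :: 'n set)) KB KB' (gmat False) (gmat True)"

lemma mev_Fpol:
  fixes x :: "'n::{finite,linorder} var \<Rightarrow> 'a::comm_ring_1"
  assumes "kbase (card (UNIV :: 'n set)) k KB" "comm_ring_hom h"
  shows "mev h x (Fpol KB KB') = fdet (card (UNIV :: 'n set)) KB KB' (vmat x False) (vmat x True)"
  unfolding Fpol_def
  by (subst fdet_hom[OF comm_ring_hom.mev_hom[OF assms(2)] assms(1) gmat_carrier gmat_carrier, symmetric])
    (simp add: map_gmat[OF assms(2)])

lemma Gpoly_eval:
  fixes x :: "'n::{finite,linorder} var \<Rightarrow> complex"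
  assumes "char_poly (vmat x c) = (\<Prod>i<card (UNIV :: 'n set). [:- lam i, 1:])"
  shows "mev of_int x (Gpoly c k) = (\<Prod>r\<in>{2..k}. delta (card (UNIV :: 'n set)) r lam ^ ((card (UNIV :: 'n set) choose k) *
       ibinom (int (card (UNIV :: 'n set)) - 2 * int r) (k - r)))"
proof -
  interpret e: comm_ring_hom "mev of_int x" by (rule comm_ring_hom.mev_hom[OF comm_ring_hom_of_int])
  show ?thesis
    unfolding Gpoly_def e.hom_prod e.hom_power
    by (intro prod.cong refl) (simp add: Dpoly_eval[OF _ assms])
qed

lemma Gpoly_nonzero: "Gpoly c k \<noteq> (0 :: ('n::{finite,linorder} var, int) mpoly)"
proof -
  let ?n = "card (UNIV :: 'n set)"
  have "Dpoly c r \<noteq> (0 :: ('n var, int) mpoly)" if r: "r \<ge> 2" for r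
  proof
    assume 0: "Dpoly c r = (0 :: ('n var, int) mpoly)"
    have "dpol ?n r \<noteq> 0" using r by (intro dpol_nonzero) simp
    then obtain lam :: "nat \<Rightarrow> complex" where lam: "mev of_int lam (dpol ?n r) \<noteq> 0"
      using mpoly_int_eq_0_complex by blast
    define x :: "'n var \<Rightarrow> complex" where "x = (\<lambda>(c, a, b). if a = b then lam (ix a) else 0)"
    have "vmat x c = dg ?n lam" by (intro eq_matI) (auto simp: vmat_def x_def ix_idx idx_inj)
    then have "mev of_int x (Dpoly c r) = delta ?n r lam" by (intro Dpoly_eval[OF r]) (simp add: char_poly_dg)
    moreover have "mev of_int x (Dpoly c r) = 0" unfolding 0 by (simp add: mev_def)
    ultimately show False using lam unfolding mev_dpol by simp
  qed
  then show ?thesis by (auto simp: Gpoly_def)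
qed

text \<open>Both sides of the factorization are compared at complex pairs that are diagonalizable
  with simple spectrum, where \<open>Gpoly\<close> is known through the eigenvalues. As
  \<open>Gpoly\<close> is nonzero, the quotient described by \<open>Tk\<close> is unique.\<close>

theorem Tk_eq_Fpol:
  assumes k: "0 < k" "k < card (UNIV :: 'n::{finite,linorder} set)"
    and KB': "kbase (card (UNIV :: 'n set)) (card (UNIV :: 'n set) - k) KB'"
  shows "(Tk k :: ('n var, int) mpoly) = Fpol (KBn TYPE('n) k) KB' \<or>
    (Tk k :: ('n var, int) mpoly) = - Fpol (KBn TYPE('n) k) KB'"
proof -
  let ?n = "card (UNIV :: 'n set)" and ?KB = "KBn TYPE('n) k"
  let ?F = "Fpol ?KB KB' :: ('n var, int) mpoly"
  have KB: "kbase ?n k ?KB" by (rule kbase_KBn)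
  have len: "length ?KB = ?n choose k" by (rule kbase_length[OF KB])
  obtain s :: int where s: "s \<in> {1, - 1}"
    and T: "\<And>A B P Q l m. diagz ?n A P l \<Longrightarrow> inj_on l {..<?n} \<Longrightarrow> diagz ?n B Q m \<Longrightarrow> inj_on m {..<?n} \<Longrightarrow>
    Tdet (extm ?n ?KB A) (extm ?n ?KB B) = of_int s * fdet ?n ?KB KB' A (B :: complex mat) *
      (\<Prod>r\<in>{2..k}. delta ?n r l ^ ((?n choose k) * ibinom (int ?n - 2 * int r) (k - r))) *
      (\<Prod>r\<in>{2..k}. delta ?n r m ^ ((?n choose k) * ibinom (int ?n - 2 * int r) (k - r)))"
  proof -
    have "card (UNIV :: 'n set) - k + k = ?n" "0 < ?n - k" using k by auto
    from Tdet_fdet_diagz[OF KB KB' this k(1), unfolded len] show thesis by (elim bexE) (rule that, assumption, blast)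
  qed
  note hi = comm_ring_hom_of_int
  have N: "length (kbasis k :: 'n set list) = length ?KB" by (simp add: kbasis_def KBn_def klists_def)
  have car: "(ext_mat c k :: ('n var, int) mpoly mat) \<in> carrier_mat (length ?KB) (length ?KB)" for c
    by (simp add: ext_mat_def Let_def N)
  have fac: "Tdet (ext_mat False k) (ext_mat True k) = (of_int s * ?F) * Gpoly False k * Gpoly True k" (is "?L = ?R")
  proof -
    have "Poly_Mapping.map of_int ?L = (Poly_Mapping.map of_int ?R :: ('n var, complex) mpoly)"
    proof (rule mpoly_eqI_vmat)
      fix x :: "'n var \<Rightarrow> complex"
      assume "\<And>c. \<exists>P l. diagz ?n (vmat x c) P l \<and> inj_on l {..<?n}"
      then obtain P l Q m where d: "diagz ?n (vmat x False) P l" "inj_on l {..<?n}" "diagz ?n (vmat x True) Q m" "inj_on m {..<?n}"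
        by metis
      interpret e: comm_ring_hom "mev of_int x" by (rule comm_ring_hom.mev_hom[OF hi])
      have "mev of_int x ?L = Tdet (extm ?n ?KB (vmat x False)) (extm ?n ?KB (vmat x True))"
        using Tdet_hom[OF e.comm_ring_hom_axioms car car] unfolding ext_mat_eval vmat_def by simp
      also have "\<dots> = mev of_int x ?R"
        unfolding T[OF d] e.hom_mult Gpoly_eval[OF char_poly_diagz[OF d(1)]] Gpoly_eval[OF char_poly_diagz[OF d(3)]]
          mev_Fpol[OF KB hi] by (simp add: e.hom_of_int)
      finally show "ev x (Poly_Mapping.map of_int ?L) = ev x (Poly_Mapping.map of_int ?R)" by (simp add: ev_map[OF hi])
    qed
    then have "ev x (Poly_Mapping.map of_int ?L) = (ev x (Poly_Mapping.map of_int ?R) :: complex)" for x by simp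
    then show ?thesis by (intro mpoly_int_eqI_complex) (simp add: ev_map[OF hi])
  qed
  have "Tk k = of_int s * ?F"
    unfolding Tk_def
  proof (rule the_equality)
    fix q assume "Tdet (ext_mat False k) (ext_mat True k) = q * Gpoly False k * (Gpoly True k :: ('n var, int) mpoly)"
    then show "q = of_int s * ?F" unfolding fac using Gpoly_nonzero[where 'n = 'n] by auto
  qed (rule fac)
  then show ?thesis using s by auto
qed

section \<open>The determinant on diagonalizable pairs\<close>

definition dcols :: "nat \<Rightarrow> (nat \<Rightarrow> nat \<Rightarrow> 'a::comm_ring_1) \<Rightarrow> (nat \<Rightarrow> nat \<Rightarrow> 'a) \<Rightarrow> nat list \<Rightarrow> nat list \<Rightarrow> 'a" where
  "dcols n P Q xs ys = mdet n (\<lambda>i j. if j < length xs then P i (xs ! j) else Q i (ys ! (j - length xs)))"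

lemma dcols_hom: "comm_ring_hom h \<Longrightarrow> h (dcols n P Q xs ys) = dcols n (\<lambda>i j. h (P i j)) (\<lambda>i j. h (Q i j)) xs ys"
  unfolding dcols_def by (subst mdet_hom) (auto intro!: mdet_cong)

lemma mdet_block_upper:
  fixes f :: "nat \<Rightarrow> nat \<Rightarrow> 'a::idom"
  assumes "\<And>i j. h \<le> i \<Longrightarrow> i < h + k \<Longrightarrow> j < h \<Longrightarrow> f i j = 0"
  shows "mdet (h + k) f = mdet h f * mdet k (\<lambda>i j. f (h + i) (h + j))"
proof -
  let ?A = "mat h h (\<lambda>(i, j). f i j)" and ?B = "mat h k (\<lambda>(i, j). f i (h + j))"
    and ?D = "mat k k (\<lambda>(i, j). f (h + i) (h + j))"
  have "mat (h + k) (h + k) (\<lambda>(i, j). f i j) = four_block_mat ?A ?B (0\<^sub>m k h) ?D"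
    by (rule eq_matI) (auto simp: assms)
  then show ?thesis
    unfolding mdet_def by (simp add: det_four_block_mat_lower_left_zero[of _ h _ k])
qed

text \<open>Multiplying the matrix of selected columns by \<open>R\<close>, the inverse of
  \<open>P\<close>, turns its first \<open>h\<close> columns into unit vectors. After
  \<open>\<tau>\<close> reorders the rows, the matrix is block triangular with an identity block and
  the minor of \<open>R * Q\<close> with rows \<open>S\<close>.\<close>

lemma minor_dcols:
  fixes P Q R :: "'a::field mat"
  assumes P: "P \<in> carrier_mat n n" and R: "R \<in> carrier_mat n n" "R * P = 1\<^sub>m n" and Q: "Q \<in> carrier_mat n n"
    and hk: "h + k = n" and xs: "length xs = h" "distinct xs" and S: "length S = k" "distinct S" and ys: "length ys = k" "set ys \<subseteq> {..<n}"
    and cpl: "set xs = {..<n} - set S" "set S \<subseteq> {..<n}"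
    and \<tau>: "\<tau> permutes {0..<n}" "\<And>i. i < n \<Longrightarrow> \<tau> i = (xs @ S) ! i"
  shows "minor (R * Q) S ys * det P = signof \<tau> * dcols n (\<lambda>i j. P $$ (i, j)) (\<lambda>i j. Q $$ (i, j)) xs ys"
proof -
  let ?d = "dcols n (\<lambda>i j. P $$ (i, j)) (\<lambda>i j. Q $$ (i, j)) xs ys"
  have RQ: "R * Q \<in> carrier_mat n n" using R Q by simp
  define Y where "Y i j = (if j < h then (if i = xs ! j then 1 else 0) else (R * Q) $$ (i, ys ! (j - h)))" for i j
  have xsn: "xs ! j < n" if "j < h" for j using that xs cpl(1) by (metis DiffD1 lessThan_iff nth_mem)
  have ysn: "ys ! j < n" if "j < k" for j using that ys by (metis lessThan_iff nth_mem subsetD)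
  have "det R * ?d = mdet n (\<lambda>i j. \<Sum>l<n. R $$ (i, l) * (if j < h then P $$ (l, xs ! j) else Q $$ (l, ys ! (j - h))))"
    unfolding mdet_mult dcols_def xs(1) det_eq_mdet[OF R(1)] ..
  also have "\<dots> = mdet n Y"
  proof (rule mdet_cong)
    fix i j assume ij: "i < n" "j < n"
    show "(\<Sum>l<n. R $$ (i, l) * (if j < h then P $$ (l, xs ! j) else Q $$ (l, ys ! (j - h)))) = Y i j"
    proof (cases "j < h")
      case True
      have "(R * P) $$ (i, xs ! j) = (\<Sum>l<n. R $$ (i, l) * P $$ (l, xs ! j))"
        by (rule index_mult_mat_sum[OF R(1) P ij(1) xsn[OF True]])
      then show ?thesis using True ij xsn[OF True] by (simp add: Y_def R(2))
    next
      case False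
      then have "ys ! (j - h) < n" using ij hk by (intro ysn) auto
      then have "(R * Q) $$ (i, ys ! (j - h)) = (\<Sum>l<n. R $$ (i, l) * Q $$ (l, ys ! (j - h)))"
        by (rule index_mult_mat_sum[OF R(1) Q ij(1)])
      then show ?thesis using False by (simp add: Y_def)
    qed
  qed
  finally have 1: "det R * ?d = mdet n Y" .
  have "signof \<tau> * mdet n Y = mdet n (\<lambda>i j. Y (\<tau> i) j)" by (rule mdet_permute_rows[OF \<tau>(1), symmetric])
  also have "\<dots> = mdet (h + k) (\<lambda>i j. Y ((xs @ S) ! i) j)" unfolding hk by (intro mdet_cong) (simp add: \<tau>(2))
  also have "\<dots> = mdet h (\<lambda>i j. Y ((xs @ S) ! i) j) * mdet k (\<lambda>i j. Y ((xs @ S) ! (h + i)) (h + j))"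
  proof (rule mdet_block_upper)
    fix i j assume "h \<le> i" "i < h + k" "j < h"
    then have "(xs @ S) ! i \<in> set S" "xs ! j \<in> set xs" using xs S by (auto simp: nth_append)
    then have "(xs @ S) ! i \<noteq> xs ! j" unfolding cpl(1) by auto
    then show "Y ((xs @ S) ! i) j = 0" using \<open>j < h\<close> by (simp add: Y_def)
  qed
  also have "mdet h (\<lambda>i j. Y ((xs @ S) ! i) j) = mdet h (\<lambda>i j. if i = j then 1 else 0)"
    using xs by (intro mdet_cong) (auto simp: Y_def nth_append nth_eq_iff_index_eq)
  also have "mdet k (\<lambda>i j. Y ((xs @ S) ! (h + i)) (h + j)) = minor (R * Q) S ys"
    unfolding minor_def S(1) using xs by (intro mdet_cong) (auto simp: Y_def nth_append)
  finally have 2: "signof \<tau> * mdet n Y = minor (R * Q) S ys" by (simp add: mdet_diag)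
  have "det R * det P = 1" using det_mult[OF R(1) P] R(2) by simp
  then have "minor (R * Q) S ys * det P = signof \<tau> * ?d * (det R * det P)" unfolding 2[symmetric] 1[symmetric] by simp
  then show ?thesis using \<open>det R * det P = 1\<close> by simp
qed

text \<open>The statement is cleared of denominators. Each of the
  \<open>length KB * length KB\<close> entries of the compound of \<open>R * Q\<close>, with
  \<open>R\<close> inverse to \<open>P\<close>, costs one \<open>det P\<close>; by Sylvester-Franke
  the compound of the inverse of \<open>Q\<close> costs \<open>(n - 1) choose (k - 1)\<close>
  factors \<open>det Q\<close>, and its determinant is raised to the power
  \<open>length KB\<close>.\<close>

theorem fdet_diagz:
  assumes KB: "kbase n k KB" and KB': "kbase n h KB'" and hk: "h + k = n" "0 < h" "0 < k"
  shows "\<exists>s\<in>{1, - 1 :: int}. \<forall>A B P Q l m. diagz n A P l \<and> inj_on l {..<n} \<and> diagz n B Q m \<and> inj_on m {..<n} \<longrightarrow>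
    fdet n KB KB' A (B :: 'a::alg_closed_field mat) * det P ^ (length KB * length KB) * det Q ^ (((n - 1) choose (k - 1)) * length KB) =
      of_int s * det P ^ (((n - 1) choose (k - 1)) * length KB) *
      (vd {..<n} l * vd {..<n} m) ^ (((n - 2) choose (k - 1)) * length KB) *
      (\<Prod>p<length KB. \<Prod>q<length KB. dcols n (\<lambda>i j. P $$ (i, j)) (\<lambda>i j. Q $$ (i, j)) (KB' ! p) (KB ! q))"
proof -
  let ?N = "length KB" and ?c = "(n - 2) choose (k - 1)" and ?a = "(n - 1) choose (k - 1)"
  have len: "length KB' = ?N"
    unfolding kbase_length[OF KB] kbase_length[OF KB'] using hk(1) binomial_symmetric[of k n] by auto
  obtain \<pi> where \<pi>: "\<pi> permutes {0..<?N}" "\<And>p. p < ?N \<Longrightarrow> set (KB' ! \<pi> p) = {..<n} - set (KB ! p)"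
    "\<And>p. p < ?N \<Longrightarrow> \<pi> p < length KB'" using complement_permutation[OF KB KB' hk(1)] by blast
  obtain s1 where s1: "s1 \<in> {1, - 1 :: int}" "\<And>l. inj_on l {..<n} \<Longrightarrow>
    mdet ?N (\<lambda>j p. zev KB l (KB' ! j) p) = of_int s1 * vd {..<n} (l :: nat \<Rightarrow> 'a) ^ ?c"
    using zev_det[OF KB KB' hk, where 'a = 'a] by blast
  have "\<exists>\<tau>. \<tau> permutes {0..<n} \<and> (\<forall>i<n. \<tau> i = ((KB' ! \<pi> p) @ (KB ! p)) ! i)" if p: "p < ?N" for p
  proof -
    let ?l = "(KB' ! \<pi> p) @ (KB ! p)"
    note K = kbaseD[OF KB p] and K' = kbaseD[OF KB' \<pi>(3)[OF p]]
    have "distinct ?l" using K K' \<pi>(2)[OF p] by auto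
    moreover have "set ?l = set [0..<n]" using K K' \<pi>(2)[OF p] by auto
    moreover have "length ?l = n" using K K' hk by simp
    ultimately obtain \<tau> where "\<tau> permutes {0..<n}" "\<And>i. i < n \<Longrightarrow> ?l ! i = [0..<n] ! \<tau> i"
      using distinct_lists_permutation[of ?l "[0..<n]"] by (metis distinct_upt)
    then show ?thesis by (intro exI[of _ \<tau>]) (auto simp: permutes_lt)
  qed
  then obtain \<tau> where \<tau>: "\<And>p. p < ?N \<Longrightarrow> \<tau> p permutes {0..<n}"
    "\<And>p i. p < ?N \<Longrightarrow> i < n \<Longrightarrow> \<tau> p i = ((KB' ! \<pi> p) @ (KB ! p)) ! i" by metis
  define s where "s = sign (swap_digits ?N) * (\<Prod>p<?N. sign (\<tau> p) ^ ?N)"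
  have pm: "x \<in> {1, - 1 :: int} \<Longrightarrow> x ^ e \<in> {1, - 1}" for x e by (induction e) auto
  have "(\<Prod>p<?N. sign (\<tau> p) ^ ?N) \<in> {1, - 1}" by (intro prod_sign pm) (simp add: sign_def)
  then have "s \<in> {1, - 1}" by (auto simp: s_def sign_def)
  moreover have "fdet n KB KB' A B * det P ^ (?N * ?N) * det Q ^ (?a * ?N) =
      of_int s * det P ^ (?a * ?N) * (vd {..<n} l * vd {..<n} m) ^ (?c * ?N) *
      (\<Prod>p<?N. \<Prod>q<?N. dcols n (\<lambda>i j. P $$ (i, j)) (\<lambda>i j. Q $$ (i, j)) (KB' ! p) (KB ! q))"
    if A: "diagz n A P l" "inj_on l {..<n}" and B: "diagz n B Q m" "inj_on m {..<n}" for A B P Q :: "'a mat" and l m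
  proof -
    let ?d = "dcols n (\<lambda>i j. P $$ (i, j)) (\<lambda>i j. Q $$ (i, j))"
    have A': "A \<in> carrier_mat n n" "P \<in> carrier_mat n n" "det P \<noteq> 0" "A * P = P * dg n l"
      and B': "B \<in> carrier_mat n n" "Q \<in> carrier_mat n n" "det Q \<noteq> 0" "B * Q = Q * dg n m"
      using A B by (auto simp: diagz_def)
    obtain R where R: "R \<in> carrier_mat n n" "P * R = 1\<^sub>m n" "R * P = 1\<^sub>m n" by (rule mat_inverse_exists[OF A'(2,3)])
    obtain U where U: "U \<in> carrier_mat n n" "Q * U = 1\<^sub>m n" "U * Q = 1\<^sub>m n" "det U * det Q = 1" by (rule mat_inverse_exists[OF B'(2,3)])
    note inv = compound_inverse[OF KB A'(2) R(1,2)] compound_inverse[OF KB R(1) A'(2) R(3)]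
      compound_inverse[OF KB B'(2) U(1,2)] compound_inverse[OF KB U(1) B'(2) U(3)]
    let ?W = "\<lambda>S T. (compound KB R * compound KB Q) $$ (S, T)"
    have F: "fdet n KB KB' A B = signof (swap_digits ?N) * det (compound KB P) ^ ?N * mdet ?N (\<lambda>j p. zev KB l (KB' ! j) p) ^ ?N *
       mdet ?N (\<lambda>j p. zev KB m (KB' ! j) p) ^ ?N * (\<Prod>S<?N. \<Prod>T<?N. ?W S T) * det (compound KB U) ^ ?N"
      unfolding fdet_def
      by (rule bdet_families[OF compound_carrier compound_carrier inv(1,2) compound_carrier compound_carrier inv(3,4)])
        (auto intro!: zmat_diag[OF KB] A' B')
    have W: "?W S T * det P = signof (\<tau> S) * ?d (KB' ! \<pi> S) (KB ! T)" if ST: "S < ?N" "T < ?N" for S T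
    proof -
      have "?W S T = minor (R * Q) (KB ! S) (KB ! T)"
        unfolding compound_mult[OF KB R(1) B'(2), symmetric] using ST by (simp add: compound_def)
      moreover have "minor (R * Q) (KB ! S) (KB ! T) * det P = signof (\<tau> S) * ?d (KB' ! \<pi> S) (KB ! T)"
        by (rule minor_dcols[OF A'(2) R(1,3) B'(2) hk(1)])
          (use kbaseD[OF KB ST(1)] kbaseD[OF KB ST(2)] kbaseD[OF KB' \<pi>(3)[OF ST(1)]] \<pi>(2)[OF ST(1)] \<tau>(1)[OF ST(1)] \<tau>(2)[OF ST(1)] in simp_all)
      ultimately show ?thesis by simp
    qed
    have "(\<Prod>S<?N. \<Prod>T<?N. ?W S T) * det P ^ (?N * ?N) = (\<Prod>S<?N. \<Prod>T<?N. ?W S T * det P)"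
      by (simp add: prod.distrib power_mult)
    also have "\<dots> = (\<Prod>S<?N. \<Prod>T<?N. signof (\<tau> S) * ?d (KB' ! \<pi> S) (KB ! T))"
      by (intro prod.cong refl W) auto
    also have "\<dots> = of_int (\<Prod>p<?N. sign (\<tau> p) ^ ?N) * (\<Prod>S<?N. \<Prod>T<?N. ?d (KB' ! \<pi> S) (KB ! T))"
      by (simp add: prod.distrib of_int_prod)
    also have "(\<Prod>S<?N. \<Prod>T<?N. ?d (KB' ! \<pi> S) (KB ! T)) = (\<Prod>S<?N. \<Prod>T<?N. ?d (KB' ! S) (KB ! T))"
      using prod.reindex_bij_betw[OF permutes_imp_bij[OF \<pi>(1)], of "\<lambda>S. \<Prod>T<?N. ?d (KB' ! S) (KB ! T)"]
      by (simp add: atLeast0LessThan)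
    finally have WW: "(\<Prod>S<?N. \<Prod>T<?N. ?W S T) * det P ^ (?N * ?N) =
      of_int (\<Prod>p<?N. sign (\<tau> p) ^ ?N) * (\<Prod>S<?N. \<Prod>T<?N. ?d (KB' ! S) (KB ! T))" .
    have UQ: "det U ^ e * det Q ^ e = 1" for e using U(4) by (simp flip: power_mult_distrib)
    have ss: "of_int s1 ^ ?N * of_int s1 ^ ?N = (1 :: 'a)"
      using s1(1) by (auto simp flip: power_mult_distrib)
    have "fdet n KB KB' A B * det P ^ (?N * ?N) * det Q ^ (?a * ?N) =
      signof (swap_digits ?N) * det P ^ (?a * ?N) * (of_int s1 * vd {..<n} l ^ ?c) ^ ?N * (of_int s1 * vd {..<n} m ^ ?c) ^ ?N *
      ((\<Prod>S<?N. \<Prod>T<?N. ?W S T) * det P ^ (?N * ?N)) * (det U ^ (?a * ?N) * det Q ^ (?a * ?N))"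
      unfolding F s1(2)[OF A(2)] s1(2)[OF B(2)] sylvester_franke[OF KB hk(3) A'(2)] sylvester_franke[OF KB hk(3) U(1)]
      by (simp only: power_mult[symmetric] mult_ac)
    also have "\<dots> = signof (swap_digits ?N) * det P ^ (?a * ?N) * (of_int s1 ^ ?N * of_int s1 ^ ?N) * (vd {..<n} l * vd {..<n} m) ^ (?c * ?N) *
      (of_int (\<Prod>p<?N. sign (\<tau> p) ^ ?N) * (\<Prod>S<?N. \<Prod>T<?N. ?d (KB' ! S) (KB ! T)))"
      unfolding WW UQ by (simp only: power_mult_distrib power_mult[symmetric] mult_ac mult_1_right mult_1_left)
    finally show ?thesis unfolding ss s_def by (simp add: mult_ac)
  qed
  ultimately show ?thesis by blast
qed

section \<open>A nilpotent pair\<close>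

lemma prod_lessThan_add: "(\<Prod>i<h + k. f i) = (\<Prod>i<h. f i) * (\<Prod>i<k. f (h + i :: nat) :: 'a::comm_monoid_mult)"
  by (induction k) (simp_all add: mult.assoc)

lemma prod_pairs_power: "(\<Prod>j<n. \<Prod>i<j. q i * q j) = (\<Prod>j<n. q j ^ (n - 1) :: 'a::comm_ring_1)"
proof (induction n)
  case (Suc n)
  have "(\<Prod>j<Suc n. \<Prod>i<j. q i * q j) = (\<Prod>j<n. q j ^ (n - 1)) * ((\<Prod>i<n. q i) * q n ^ n)"
  proof -
    have "(\<Prod>i<n. q i * q n) = (\<Prod>i<n. q i) * q n ^ n" by (simp add: prod.distrib)
    then show ?thesis unfolding prod.lessThan_Suc Suc by simp
  qed
  also have "\<dots> = (\<Prod>j<n. q j ^ (n - 1) * q j) * q n ^ n" by (simp add: prod.distrib mult_ac)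
  also have "(\<Prod>j<n. q j ^ (n - 1) * q j) = (\<Prod>j<n. q j ^ n)"
    by (intro prod.cong refl) (metis Suc_diff_1 lessThan_iff not_less_zero power_Suc2 gr0I)
  finally show ?case by simp
qed simp

text \<open>The nodes are points \<open>(p : q)\<close> of the projective line; extracting
  \<open>q^(n - 1)\<close> from each column gives the affine case.\<close>

lemma homogeneous_vandermonde:
  fixes p q :: "nat \<Rightarrow> 'a::field"
  assumes "\<And>j. j < n \<Longrightarrow> q j \<noteq> 0"
  shows "mdet n (\<lambda>i j. p j ^ i * q j ^ (n - 1 - i)) = (\<Prod>j<n. \<Prod>i<j. p j * q i - p i * q j)"
proof -
  have "mdet n (\<lambda>i j. p j ^ i * q j ^ (n - 1 - i)) = mdet n (\<lambda>i j. q j ^ (n - 1) * (p j / q j) ^ i)"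
  proof (rule mdet_cong)
    fix i j assume ij: "i < n" "j < n"
    have "q j ^ (n - 1) = q j ^ i * q j ^ (n - 1 - i)" using ij by (simp flip: power_add)
    then show "p j ^ i * q j ^ (n - 1 - i) = q j ^ (n - 1) * (p j / q j) ^ i"
      using assms[OF ij(2)] by (simp add: power_divide)
  qed
  also have "\<dots> = (\<Prod>j<n. q j ^ (n - 1)) * (\<Prod>j<n. \<Prod>i<j. p j / q j - p i / q i)"
    unfolding mdet_scale_cols vandermonde ..
  also have "\<dots> = (\<Prod>j<n. \<Prod>i<j. (q i * q j) * (p j / q j - p i / q i))"
    unfolding prod_pairs_power[symmetric] prod.distrib ..
  also have "\<dots> = (\<Prod>j<n. \<Prod>i<j. p j * q i - p i * q j)"
  proof (intro prod.cong refl)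
    fix j i assume "j \<in> {..<n}" "i \<in> {..<j}"
    then have "q i \<noteq> 0" "q j \<noteq> 0" using assms by auto
    then show "(q i * q j) * (p j / q j - p i / q i) = p j * q i - p i * q j" by (simp add: field_simps)
  qed
  finally show ?thesis .
qed

text \<open>Companion matrix of the polynomial with roots \<open>l s\<close>; with the coefficients
  in the last row, the columns \<open>(1, \<lambda>, \<lambda>^2, \<dots>)\<close> are
  eigenvectors.\<close>

definition cmat :: "nat \<Rightarrow> (nat \<Rightarrow> 'a::comm_ring_1) \<Rightarrow> 'a mat" where
  "cmat n l = mat n n (\<lambda>(i, j). if Suc i = n then - coeff (\<Prod>s<n. [:- l s, 1:]) j else if j = Suc i then 1 else 0)"

text \<open>The same matrix in the reversed basis. Its reversed eigenvectors pair with those of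
  \<open>cmat\<close> to factors \<open>1 - l x * l y\<close>, which do not degenerate as the
  eigenvalues tend to \<open>0\<close>.\<close>

definition cmat' :: "nat \<Rightarrow> (nat \<Rightarrow> 'a::comm_ring_1) \<Rightarrow> 'a mat" where
  "cmat' n l = mat n n (\<lambda>(i, j). cmat n l $$ (n - 1 - i, n - 1 - j))"

lemma cmat_carrier [simp]: "cmat n l \<in> carrier_mat n n" "cmat' n l \<in> carrier_mat n n"
  by (simp_all add: cmat_def cmat'_def)

lemma cmat_dims [simp]: "dim_row (cmat n l) = n" "dim_col (cmat n l) = n" "dim_row (cmat' n l) = n" "dim_col (cmat' n l) = n"
  by (simp_all add: cmat_def cmat'_def)

lemma cmat_row:
  fixes l :: "nat \<Rightarrow> 'a::idom"
  assumes "i < n" "j < n"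
  shows "(\<Sum>m<n. cmat n l $$ (i, m) * l j ^ m) = l j ^ Suc i"
proof (cases "Suc i = n")
  case True
  let ?p = "\<Prod>s<n. [:- l s, 1:]"
  have d: "degree ?p = n" "coeff ?p n = 1" by (simp_all add: newton_poly_degree)
  have "0 = poly ?p (l j)" using assms(2) by (auto simp: poly_prod)
  also have "\<dots> = (\<Sum>m\<le>n. coeff ?p m * l j ^ m)" unfolding poly_altdef d ..
  also have "\<dots> = (\<Sum>m<n. coeff ?p m * l j ^ m) + l j ^ n"
    using d by (simp add: lessThan_Suc_atMost[symmetric])
  finally have "- (\<Sum>m<n. coeff ?p m * l j ^ m) = l j ^ n" by (intro minus_unique) simp
  then show ?thesis using True assms by (simp add: cmat_def sum_negf)
next
  case False
  have "(\<Sum>m<n. cmat n l $$ (i, m) * l j ^ m) = (\<Sum>m<n. if m = Suc i then l j ^ m else 0)"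
    using False assms by (intro sum.cong) (auto simp: cmat_def)
  then show ?thesis using False assms by (simp add: sum.delta)
qed

lemma cmat_diag:
  fixes l :: "nat \<Rightarrow> 'a::idom"
  shows "cmat n l * mat n n (\<lambda>(i, j). l j ^ i) = mat n n (\<lambda>(i, j). l j ^ i) * dg n l" (is "_ * ?P = _")
proof (rule eq_matI)
  have P: "?P \<in> carrier_mat n n" by simp
  fix i j assume "i < dim_row (?P * dg n l)" "j < dim_col (?P * dg n l)"
  then have ij: "i < n" "j < n" by auto
  show "(cmat n l * ?P) $$ (i, j) = (?P * dg n l) $$ (i, j)"
    unfolding index_mult_mat_sum[OF cmat_carrier(1) P ij] index_mult_dg[OF P ij]
    using cmat_row[OF ij, of l] ij by simp
qed (auto simp: cmat_def)

lemma cmat'_diag: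
  fixes l :: "nat \<Rightarrow> 'a::idom"
  shows "cmat' n l * mat n n (\<lambda>(i, j). l j ^ (n - 1 - i)) = mat n n (\<lambda>(i, j). l j ^ (n - 1 - i)) * dg n l" (is "_ * ?P = _")
proof (rule eq_matI)
  have P: "?P \<in> carrier_mat n n" by simp
  fix i j assume "i < dim_row (?P * dg n l)" "j < dim_col (?P * dg n l)"
  then have ij: "i < n" "j < n" by auto
  have "(\<Sum>m<n. cmat n l $$ (n - 1 - i, n - 1 - m) * l j ^ (n - 1 - m)) = (\<Sum>m<n. cmat n l $$ (n - 1 - i, m) * l j ^ m)"
    by (rule sum.reindex_bij_witness[of _ "\<lambda>m. n - 1 - m" "\<lambda>m. n - 1 - m"]) auto
  also have "\<dots> = l j ^ Suc (n - 1 - i)" by (rule cmat_row) (use ij in auto)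
  finally show "(cmat' n l * ?P) $$ (i, j) = (?P * dg n l) $$ (i, j)"
    unfolding index_mult_mat_sum[OF cmat_carrier(2) P ij] index_mult_dg[OF P ij]
    using ij by (simp add: cmat'_def)
qed (auto simp: cmat'_def)

text \<open>The two kinds of columns are the points \<open>(\<lambda> : 1)\<close> and
  \<open>(1 : \<lambda>)\<close>. Two points of the same kind give a difference of eigenvalues up to
  sign, and a mixed pair gives \<open>1 - l x * l y\<close>.\<close>

lemma dcols_vandermonde:
  fixes l :: "nat \<Rightarrow> 'a::field"
  assumes xs: "sorted_wrt (<) xs" "length xs = h" and ys: "sorted_wrt (<) ys" "length ys = k" and hk: "h + k = n"
    and nz: "\<And>y. y \<in> set ys \<Longrightarrow> l y \<noteq> 0"
  shows "dcols n (\<lambda>i j. l j ^ i) (\<lambda>i j. l j ^ (n - 1 - i)) xs ys =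
    of_int (\<Prod>j<k. (- 1) ^ j) * vd (set xs) l * vd (set ys) l * (\<Prod>y\<in>set ys. \<Prod>x\<in>set xs. 1 - l x * l y)"
proof -
  let ?p = "\<lambda>j. if j < h then l (xs ! j) else 1" and ?q = "\<lambda>j. if j < h then 1 else l (ys ! (j - h))"
  let ?w = "\<lambda>j i. ?p j * ?q i - ?p i * ?q j"
  have "dcols n (\<lambda>i j. l j ^ i) (\<lambda>i j. l j ^ (n - 1 - i)) xs ys = mdet n (\<lambda>i j. ?p j ^ i * ?q j ^ (n - 1 - i))"
    unfolding dcols_def xs(2) by (intro mdet_cong) auto
  also have "\<dots> = (\<Prod>j<n. \<Prod>i<j. ?w j i)"
    using hk ys nz by (intro homogeneous_vandermonde) (auto simp: nth_mem)
  also have "\<dots> = (\<Prod>j<h. \<Prod>i<j. ?w j i) * (\<Prod>j<k. \<Prod>i<h + j. ?w (h + j) i)"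
    unfolding hk[symmetric] by (rule prod_lessThan_add)
  also have "(\<Prod>j<h. \<Prod>i<j. ?w j i) = vd (set xs) l"
    unfolding vd_def prod_sorted_nth[OF xs(1), of "\<lambda>a b. l b - l a", symmetric] xs(2) by (intro prod.cong refl) auto
  also have "(\<Prod>j<k. \<Prod>i<h + j. ?w (h + j) i) = (\<Prod>j<k. (\<Prod>i<h. 1 - l (xs ! i) * l (ys ! j)) * ((- 1) ^ j * (\<Prod>i<j. l (ys ! j) - l (ys ! i))))"
  proof (rule prod.cong[OF refl])
    fix j
    have "(\<Prod>i<h + j. ?w (h + j) i) = (\<Prod>i<h. ?w (h + j) i) * (\<Prod>i<j. ?w (h + j) (h + i))" by (rule prod_lessThan_add)
    also have "(\<Prod>i<j. ?w (h + j) (h + i)) = (\<Prod>i<j. (- 1) * (l (ys ! j) - l (ys ! i)))" by (intro prod.cong refl) simp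
    also have "\<dots> = (- 1) ^ j * (\<Prod>i<j. l (ys ! j) - l (ys ! i))" by (simp only: prod.distrib) simp
    also have "(\<Prod>i<h. ?w (h + j) i) = (\<Prod>i<h. 1 - l (xs ! i) * l (ys ! j))" by (intro prod.cong refl) simp
    finally show "(\<Prod>i<h + j. ?w (h + j) i) = (\<Prod>i<h. 1 - l (xs ! i) * l (ys ! j)) * ((- 1) ^ j * (\<Prod>i<j. l (ys ! j) - l (ys ! i)))" .
  qed
  also have "\<dots> = (\<Prod>j<k. \<Prod>i<h. 1 - l (xs ! i) * l (ys ! j)) * (of_int (\<Prod>j<k. (- 1) ^ j) * vd (set ys) l)"
    unfolding prod.distrib vd_def prod_sorted_nth[OF ys(1), of "\<lambda>a b. l b - l a", symmetric] ys(2) by (simp add: of_int_prod)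
  also have "(\<Prod>j<k. \<Prod>i<h. 1 - l (xs ! i) * l (ys ! j)) = (\<Prod>j<k. \<Prod>x\<in>set xs. 1 - l x * l (ys ! j))"
    by (intro prod.cong refl prod.reindex_bij_betw bij_betw_nth) (use xs in \<open>auto simp: strict_sorted_iff\<close>)
  also have "\<dots> = (\<Prod>y\<in>set ys. \<Prod>x\<in>set xs. 1 - l x * l y)"
    by (rule prod.reindex_bij_betw[OF bij_betw_nth]) (use ys in \<open>auto simp: strict_sorted_iff\<close>)
  finally show ?thesis by (simp add: mult_ac)
qed

text \<open>The Vandermonde factors from \<open>fdet_diagz\<close> and from
  \<open>dcols_vandermonde\<close> cancel exactly, and only the mixed factors remain.\<close>

lemma fdet_comp:
  fixes l :: "nat \<Rightarrow> 'a::alg_closed_field"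
  assumes KB: "kbase n k KB" and KB': "kbase n h KB'" and hk: "h + k = n" "0 < h" "0 < k"
  shows "\<exists>s\<in>{1, - 1 :: int}. \<forall>l :: nat \<Rightarrow> 'a. inj_on l {..<n} \<and> (\<forall>i<n. l i \<noteq> 0) \<longrightarrow>
    fdet n KB KB' (cmat n l) (cmat' n l) =
      of_int s * (\<Prod>p<length KB. \<Prod>q<length KB. \<Prod>y\<in>set (KB ! q). \<Prod>x\<in>set (KB' ! p). 1 - l x * l y)"
proof -
  let ?N = "length KB" and ?c = "(n - 2) choose (k - 1)" and ?a = "(n - 1) choose (k - 1)" and ?a' = "(n - 1) choose (h - 1)"
  have len: "length KB' = ?N"
    unfolding kbase_length[OF KB] kbase_length[OF KB'] using hk(1) binomial_symmetric[of k n] by auto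
  have ch: "(n - 2) choose (h - 1) = ?c"
  proof -
    have "n - 2 - (k - 1) = h - 1" "k - 1 \<le> n - 2" using hk by auto
    then show ?thesis using binomial_symmetric[of "k - 1" "n - 2"] by simp
  qed
  \<comment> \<open>Pascal's rule; it balances the exponents of the Vandermonde product.\<close>
  have Na: "?N = ?a + ?a'"
  proof -
    have "n - 1 - k = h - 1" "k \<le> n - 1" "n = Suc (n - 1)" "k = Suc (k - 1)" using hk by auto
    then show ?thesis unfolding kbase_length[OF KB]
      using binomial_symmetric[of k "n - 1"] binomial_Suc_Suc[of "n - 1" "k - 1"] by simp
  qed
  obtain s where s: "s \<in> {1, - 1 :: int}" and
    F: "\<And>A B P Q l m. diagz n A P l \<Longrightarrow> inj_on l {..<n} \<Longrightarrow> diagz n B Q m \<Longrightarrow> inj_on m {..<n} \<Longrightarrow>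
    fdet n KB KB' A (B :: 'a mat) * det P ^ (?N * ?N) * det Q ^ (?a * ?N) =
      of_int s * det P ^ (?a * ?N) * (vd {..<n} l * vd {..<n} m) ^ (?c * ?N) *
      (\<Prod>p<?N. \<Prod>q<?N. dcols n (\<lambda>i j. P $$ (i, j)) (\<lambda>i j. Q $$ (i, j)) (KB' ! p) (KB ! q))"
  proof -
    from fdet_diagz[OF KB KB' hk, where 'a = 'a] show thesis by (elim bexE) (rule that, assumption, blast)
  qed
  define \<rho> where "\<rho> i = (if i < n then n - 1 - i else i)" for i
  have \<rho>: "\<rho> permutes {0..<n}"
    by (rule bij_imp_permutes, rule bij_betw_byWitness[of _ \<rho>]) (auto simp: \<rho>_def)
  define t where "t = s * (\<Prod>j<k. (- 1) ^ j) ^ (?N * ?N) * sign \<rho> ^ (?a * ?N)"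
  have pm: "x \<in> {1, - 1 :: int} \<Longrightarrow> x ^ e \<in> {1, - 1}" for x e by (induction e) auto
  have mm: "x * y \<in> {1, - 1 :: int}" if "x \<in> {1, - 1}" "y \<in> {1, - 1}" for x y using that by auto
  have "t \<in> {1, - 1}"
    unfolding t_def by (intro mm pm s prod_sign) (simp_all add: sign_def)
  moreover have "fdet n KB KB' (cmat n l) (cmat' n l) =
      of_int t * (\<Prod>p<?N. \<Prod>q<?N. \<Prod>y\<in>set (KB ! q). \<Prod>x\<in>set (KB' ! p). 1 - l x * l y)"
    if l: "inj_on l {..<n}" "\<And>i. i < n \<Longrightarrow> l i \<noteq> 0" for l :: "nat \<Rightarrow> 'a"
  proof -
    let ?P = "mat n n (\<lambda>(i, j). l j ^ i)" and ?Q = "mat n n (\<lambda>(i, j). l j ^ (n - 1 - i))"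
    let ?v = "vd {..<n} l"
    let ?\<Theta> = "\<Prod>p<?N. \<Prod>q<?N. \<Prod>y\<in>set (KB ! q). \<Prod>x\<in>set (KB' ! p). 1 - l x * l y"
    have v0: "?v \<noteq> 0" by (rule vd_nonzero[OF l(1)]) simp
    have dP: "det ?P = ?v" using vandermonde[of n l] by (simp add: mdet_def vd_lessThan)
    have dQ: "det ?Q = signof \<rho> * ?v"
    proof -
      have "det ?Q = mdet n (\<lambda>i j. (\<lambda>i j. l j ^ i) (\<rho> i) j)"
        unfolding mdet_def by (intro arg_cong[of _ _ det] eq_matI) (auto simp: \<rho>_def)
      also have "\<dots> = signof \<rho> * mdet n (\<lambda>i j. l j ^ i)" by (rule mdet_permute_rows[OF \<rho>])
      finally show ?thesis by (simp add: vandermonde vd_lessThan)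
    qed
    have sr: "of_int (sign \<rho>) * of_int (sign \<rho>) = (1 :: 'a)" by (simp add: sign_def)
    have "diagz n (cmat n l) ?P l" using cmat_diag[of n l] v0 by (simp add: diagz_def dP)
    moreover have "det ?Q \<noteq> 0" unfolding dQ using v0 by (simp add: sign_def)
    then have "diagz n (cmat' n l) ?Q l"
      unfolding diagz_def using cmat'_diag[of n l] by (intro conjI cmat_carrier mat_carrier)
    ultimately have 1: "fdet n KB KB' (cmat n l) (cmat' n l) * ?v ^ (?N * ?N) * (of_int (sign \<rho>) * ?v) ^ (?a * ?N) =
      of_int s * ?v ^ (?a * ?N) * (?v * ?v) ^ (?c * ?N) *
      (\<Prod>p<?N. \<Prod>q<?N. dcols n (\<lambda>i j. ?P $$ (i, j)) (\<lambda>i j. ?Q $$ (i, j)) (KB' ! p) (KB ! q))"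
      using F[of "cmat n l" ?P l "cmat' n l" ?Q l] l(1) unfolding dP dQ by simp
    let ?e = "of_int (\<Prod>j<k. (- 1) ^ j) :: 'a"
    have "(\<Prod>p<?N. \<Prod>q<?N. dcols n (\<lambda>i j. ?P $$ (i, j)) (\<lambda>i j. ?Q $$ (i, j)) (KB' ! p) (KB ! q)) =
      (\<Prod>p<?N. \<Prod>q<?N. ?e * vd (set (KB' ! p)) l * vd (set (KB ! q)) l * (\<Prod>y\<in>set (KB ! q). \<Prod>x\<in>set (KB' ! p). 1 - l x * l y))"
    proof (intro prod.cong refl)
      fix p q assume "p \<in> {..<?N}" "q \<in> {..<?N}"
      then have pq: "p < length KB'" "q < ?N" using len by auto
      note K' = kbaseD[OF KB' pq(1)] and K = kbaseD[OF KB pq(2)]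
      have "dcols n (\<lambda>i j. ?P $$ (i, j)) (\<lambda>i j. ?Q $$ (i, j)) (KB' ! p) (KB ! q) =
        dcols n (\<lambda>i j. l j ^ i) (\<lambda>i j. l j ^ (n - 1 - i)) (KB' ! p) (KB ! q)"
        unfolding dcols_def using K K' hk(1) by (intro mdet_cong) auto
      also have "\<dots> = ?e * vd (set (KB' ! p)) l * vd (set (KB ! q)) l * (\<Prod>y\<in>set (KB ! q). \<Prod>x\<in>set (KB' ! p). 1 - l x * l y)"
        by (rule dcols_vandermonde[OF K'(1,2) K(1,2) hk(1)]) (use K(3) l(2) in auto)
      finally show "dcols n (\<lambda>i j. ?P $$ (i, j)) (\<lambda>i j. ?Q $$ (i, j)) (KB' ! p) (KB ! q) =
        ?e * vd (set (KB' ! p)) l * vd (set (KB ! q)) l * (\<Prod>y\<in>set (KB ! q). \<Prod>x\<in>set (KB' ! p). 1 - l x * l y)" .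
    qed
    also have "\<dots> = ?e ^ (?N * ?N) * (\<Prod>p<?N. vd (set (KB' ! p)) l) ^ ?N * (\<Prod>q<?N. vd (set (KB ! q)) l) ^ ?N * ?\<Theta>"
      by (simp add: prod.distrib power_mult prod_power_distrib mult_ac)
    finally have 2: "(\<Prod>p<?N. \<Prod>q<?N. dcols n (\<lambda>i j. ?P $$ (i, j)) (\<lambda>i j. ?Q $$ (i, j)) (KB' ! p) (KB ! q)) =
      ?e ^ (?N * ?N) * (\<Prod>p<?N. vd (set (KB' ! p)) l) ^ ?N * (\<Prod>q<?N. vd (set (KB ! q)) l) ^ ?N * ?\<Theta>" .
    have 3: "(\<Prod>q<?N. vd (set (KB ! q)) l) * ?v ^ ?c = ?v ^ ?a" by (rule prod_vd_subsets[OF KB hk(3)])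
    have 4: "(\<Prod>p<?N. vd (set (KB' ! p)) l) * ?v ^ ?c = ?v ^ ?a'"
      using prod_vd_subsets[OF KB' hk(2), of l] unfolding len ch .
    let ?K = "?v ^ (?N * ?N) * ?v ^ (?a * ?N)"
    have "?K * fdet n KB KB' (cmat n l) (cmat' n l) =
      of_int (sign \<rho>) ^ (?a * ?N) * (fdet n KB KB' (cmat n l) (cmat' n l) * ?v ^ (?N * ?N) * (of_int (sign \<rho>) * ?v) ^ (?a * ?N))"
      using sr by (simp add: power_mult_distrib mult_ac) (simp flip: power_mult_distrib)
    also have "\<dots> = of_int (sign \<rho>) ^ (?a * ?N) * (of_int s * ?v ^ (?a * ?N) * (?e ^ (?N * ?N) *
      ((\<Prod>p<?N. vd (set (KB' ! p)) l) * ?v ^ ?c) ^ ?N * ((\<Prod>q<?N. vd (set (KB ! q)) l) * ?v ^ ?c) ^ ?N * ?\<Theta>))"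
      unfolding 1 2 by (simp only: power_mult_distrib power_mult[symmetric] mult_ac)
    also have "\<dots> = (?v ^ (?a' * ?N) * ?v ^ (?a * ?N) * ?v ^ (?a * ?N)) * (of_int t * ?\<Theta>)"
      unfolding 3 4 t_def by (simp only: power_mult[symmetric] mult_ac of_int_power of_int_mult)
    also have "?v ^ (?a' * ?N) * ?v ^ (?a * ?N) * ?v ^ (?a * ?N) = ?K"
      by (subst (4) Na) (simp add: algebra_simps power_add)
    finally show ?thesis using v0 by simp
  qed
  ultimately show ?thesis by blast
qed

section \<open>Degeneration of companion matrices to nilpotent ones\<close>

definition nilp :: "nat \<Rightarrow> 'a::comm_ring_1 mat" where
  "nilp n = mat n n (\<lambda>(i, j). if j = Suc i then 1 else 0)"

definition nilp' :: "nat \<Rightarrow> 'a::comm_ring_1 mat" where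
  "nilp' n = mat n n (\<lambda>(i, j). if i = Suc j then 1 else 0)"

text \<open>The curve of companion matrices with eigenvalues \<open>\<epsilon> f(0), \<epsilon> f(1), \<dots>\<close>.\<close>
abbreviation curve :: "(nat \<Rightarrow> 'a::comm_ring_1) \<Rightarrow> nat \<Rightarrow> 'a poly" where
  "curve f i \<equiv> [:0, f i:]"

lemma cmat_hom:
  assumes "comm_ring_hom h"
  shows "map_mat h (cmat n l) = cmat n (\<lambda>i. h (l i))" "map_mat h (cmat' n l) = cmat' n (\<lambda>i. h (l i))"
proof -
  interpret comm_ring_hom h by fact
  interpret mp: comm_ring_hom "map_poly h" by (rule comm_ring_hom_map_poly[OF assms])
  have 1: "map_poly h [:- l i, 1:] = [:- h (l i), 1:]" for i
    by (intro poly_eqI) (simp add: coeff_map_poly coeff_pCons hom_uminus split: nat.split)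
  have c: "h (coeff (\<Prod>s<n. [:- l s, 1:]) j) = coeff (\<Prod>s<n. [:- h (l s), 1:]) j" for j
    using arg_cong[OF mp.hom_prod[of "\<lambda>s. [:- l s, 1:]" "{..<n}"], of "\<lambda>p. coeff p j"] by (simp add: coeff_map_poly 1)
  show 2: "map_mat h (cmat n l) = cmat n (\<lambda>i. h (l i))"
    by (intro eq_matI) (auto simp: cmat_def c hom_uminus)
  show "map_mat h (cmat' n l) = cmat' n (\<lambda>i. h (l i))"
    unfolding cmat'_def 2[symmetric] by (intro eq_matI) auto
qed

lemma cmat_0:
  assumes "n > 0"
  shows "cmat n (\<lambda>_. 0) = (nilp n :: 'a::comm_ring_1 mat)" "cmat' n (\<lambda>_. 0) = (nilp' n :: 'a mat)"
proof -
  have "(\<Prod>s<n. [:- 0, 1 :: 'a:]) = monom 1 n" by (simp add: monom_altdef)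
  then show 1: "cmat n (\<lambda>_. 0) = (nilp n :: 'a mat)" by (intro eq_matI) (auto simp: cmat_def nilp_def)
  show "cmat' n (\<lambda>_. 0) = (nilp' n :: 'a mat)"
    unfolding cmat'_def 1 by (intro eq_matI) (auto simp: nilp_def nilp'_def)
qed

lemma poly_eval_hom: "comm_ring_hom (\<lambda>p. poly p (x :: 'a::comm_ring_1))"
  by unfold_locales auto

lemma ex_inj_nonzero:
  assumes "infinite (UNIV :: 'a::zero set)"
  shows "\<exists>f :: nat \<Rightarrow> 'a. inj f \<and> (\<forall>i. f i \<noteq> 0)"
proof -
  have "infinite (UNIV - {0 :: 'a})" using assms by simp
  then obtain f :: "nat \<Rightarrow> 'a" where "inj f" "range f \<subseteq> UNIV - {0}" using infinite_countable_subset by blast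
  then show ?thesis by blast
qed

lemma poly_eqI_nonzero:
  fixes p q :: "'a::idom poly"
  assumes "infinite (UNIV :: 'a set)" "\<And>x. x \<noteq> 0 \<Longrightarrow> poly p x = poly q x"
  shows "p = q"
proof (rule ccontr)
  assume "p \<noteq> q"
  then have "finite {x. poly (p - q) x = 0}" by (intro poly_roots_finite) simp
  moreover have "UNIV - {0} \<subseteq> {x. poly (p - q) x = 0}" using assms(2) by auto
  ultimately show False using assms(1) by (meson finite_Diff2 finite.emptyI finite_insert finite_subset)
qed

text \<open>The pair is not diagonalizable, so its value is a limit: along \<open>curve f\<close>
  both sides of \<open>fdet_comp\<close> are polynomials in the parameter that agree away from
  \<open>0\<close>, hence also at \<open>0\<close>, where every factor \<open>1 - l x * l y\<close>
  becomes \<open>1\<close>.\<close>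

lemma fdet_nilp:
  assumes KB: "kbase n k KB" and KB': "kbase n h KB'" and hk: "h + k = n" "0 < h" "0 < k"
  shows "fdet n KB KB' (nilp n) (nilp' n) \<in> {1, - 1 :: 'a::alg_closed_field}"
proof -
  obtain s where s: "s \<in> {1, - 1 :: int}" and C: "\<And>l :: nat \<Rightarrow> 'a. inj_on l {..<n} \<Longrightarrow> (\<And>i. i < n \<Longrightarrow> l i \<noteq> 0) \<Longrightarrow>
    fdet n KB KB' (cmat n l) (cmat' n l) =
      of_int s * (\<Prod>p<length KB. \<Prod>q<length KB. \<Prod>y\<in>set (KB ! q). \<Prod>x\<in>set (KB' ! p). 1 - l x * l y)"
    using fdet_comp[OF KB KB' hk, where 'a = 'a] by blast
  obtain f :: "nat \<Rightarrow> 'a" where f: "inj f" "\<And>i. f i \<noteq> 0" using ex_inj_nonzero[OF infinite_UNIV_alg_closed] by blast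
  let ?F = "fdet n KB KB' (cmat n (curve f)) (cmat' n (curve f))"
  let ?G = "of_int s * (\<Prod>p<length KB. \<Prod>q<length KB. \<Prod>y\<in>set (KB ! q). \<Prod>x\<in>set (KB' ! p). 1 - curve f x * curve f y)"
  have ev: "poly ?F x = fdet n KB KB' (cmat n (\<lambda>i. x * f i)) (cmat' n (\<lambda>i. x * f i))" for x
  proof -
    have "poly ?F x = fdet n KB KB' (map_mat (\<lambda>p. poly p x) (cmat n (curve f))) (map_mat (\<lambda>p. poly p x) (cmat' n (curve f)))"
      by (rule fdet_hom[OF poly_eval_hom KB cmat_carrier(1) cmat_carrier(2), symmetric])
    then show ?thesis unfolding cmat_hom[OF poly_eval_hom] by simp
  qed
  have "?F = ?G"
  proof (rule poly_eqI_nonzero[OF infinite_UNIV_alg_closed])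
    fix x :: 'a assume x: "x \<noteq> 0"
    have "inj_on (\<lambda>i. x * f i) {..<n}" using f(1) x by (auto simp: inj_on_def)
    then show "poly ?F x = poly ?G x" unfolding ev using C[of "\<lambda>i. x * f i"] x f(2) by (simp add: poly_prod mult_ac)
  qed
  then have "poly ?F 0 = of_int s" by (simp add: poly_prod)
  then show ?thesis using s hk unfolding ev by (auto simp: cmat_0)
qed

section \<open>Prime polynomials\<close>

text \<open>Expansion in powers of \<open>v\<close>. The coefficients are kept in the same
  polynomial ring, and the degree of \<open>psi v p\<close> is the degree of \<open>p\<close> in
  \<open>v\<close>.\<close>

definition psi :: "'v \<Rightarrow> ('v, 'a::comm_ring_1) mpoly \<Rightarrow> ('v, 'a) mpoly poly" where
  "psi v = mev (\<lambda>a. [:Cst a:]) (\<lambda>w. if w = v then [:0, 1:] else [:Var w:])"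

lemma psi_coeff_hom: "comm_ring_hom (\<lambda>a::'a::comm_ring_1. [:Cst a :: ('v, 'a) mpoly:])"
  by (rule comm_ring_hom_compose[OF Cst_hom comm_ring_hom_const_poly])

lemma psi_hom: "comm_ring_hom (psi v)"
  unfolding psi_def by (rule comm_ring_hom.mev_hom[OF psi_coeff_hom])

lemma psi_Cst [simp]: "psi v (Cst a) = [:Cst a:]"
  unfolding psi_def by (rule comm_ring_hom.mev_Cst[OF psi_coeff_hom])

lemma psi_Var [simp]: "psi v (Var w) = (if w = v then [:0, 1:] else [:Var w:])"
  unfolding psi_def by (rule comm_ring_hom.mev_Var[OF psi_coeff_hom])

lemma poly_psi: "poly (psi v p) (Var v) = p"
  by (rule mpoly_hom_unique[OF comm_ring_hom_compose[OF psi_hom poly_eval_hom] comm_ring_hom_id]) auto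

lemma psi_polyin:
  assumes "p \<in> polyin (UNIV - {v})"
  shows "psi v p = [:p:]"
proof -
  interpret comm_ring_hom "psi v" by (rule psi_hom)
  show ?thesis using assms by induction (auto simp: hom_add hom_mult)
qed

text \<open>Pseudo-division by \<open>c x + d\<close> leaves a remainder free of \<open>x\<close>, which makes the ideal
  generated by \<open>c x + d\<close> prime as soon as powers of \<open>c\<close> can be cancelled modulo it.\<close>
lemma prime_elem_linear:
  fixes c d :: "('v::linorder, 'a::idom) mpoly"
  assumes c: "c \<in> polyin (UNIV - {v})" and d: "d \<in> polyin (UNIV - {v})"
    and pc: "c = 1 \<or> prime_elem c \<and> \<not> c dvd d"
  shows "prime_elem (c * Var v + d)"
proof -
  let ?p = "c * Var v + d"
  interpret psi: comm_ring_hom "psi v" by (rule psi_hom)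
  have c0: "c \<noteq> 0" using pc by auto
  have psp: "psi v ?p = [:d, c:]"
    by (simp add: psi.hom_add psi.hom_mult psi_polyin[OF c] psi_polyin[OF d])
  have dg: "degree (psi v ?p) = 1" using c0 unfolding psp by simp
  have p0: "?p \<noteq> 0" using dg by (metis degree_0 psi.hom_zero zero_neq_one)
  have psi0: "psi v q \<noteq> 0" if "q \<noteq> 0" for q using that poly_psi[of v q] by auto
  have nounit: "\<not> (?p dvd 1)"
  proof
    assume "?p dvd 1"
    then obtain q where q: "1 = ?p * q" by (elim dvdE)
    then have "psi v ?p * psi v q = 1" by (metis psi.hom_mult psi.hom_one)
    then have "degree (psi v ?p) + degree (psi v q) = 0"
      by (metis degree_1 degree_mult_eq mult_zero_left mult_zero_right zero_neq_one)
    then show False using dg by simp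
  qed
  have division: "\<exists>e q r. r \<in> polyin (UNIV - {v}) \<and> c ^ e * u = ?p * q + r" for u
  proof (induction u rule: mpoly_induct)
    case (Cst a)
    then show ?case by (intro exI[of _ 0] exI[of _ 0] exI[of _ "Cst a"]) (auto intro: polyin.intros)
  next
    case (Var w)
    show ?case
    proof (cases "w = v")
      case True
      then show ?thesis using polyin_uminus[OF d] by (intro exI[of _ 1] exI[of _ 1] exI[of _ "- d"]) auto
    next
      case False
      then show ?thesis by (intro exI[of _ 0] exI[of _ 0] exI[of _ "Var w"]) (auto intro: polyin.intros)
    qed
  next
    case (add u w)
    then obtain e q r e' q' r' where a: "r \<in> polyin (UNIV - {v})" "c ^ e * u = ?p * q + r"
      "r' \<in> polyin (UNIV - {v})" "c ^ e' * w = ?p * q' + r'" by blast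
    have pw: "c ^ i \<in> polyin (UNIV - {v})" for i
      using polyin_prod[of "{..<i}" "\<lambda>_. c"] c by simp
    have "c ^ (e + e') * (u + w) = c ^ e' * (c ^ e * u) + c ^ e * (c ^ e' * w)" by (simp add: power_add algebra_simps)
    also have "\<dots> = ?p * (c ^ e' * q + c ^ e * q') + (c ^ e' * r + c ^ e * r')" unfolding a(2,4) by (simp add: algebra_simps)
    finally show ?case using a pw by (blast intro: polyin.intros)
  next
    case (mult u w)
    then obtain e q r e' q' r' where a: "r \<in> polyin (UNIV - {v})" "c ^ e * u = ?p * q + r"
      "r' \<in> polyin (UNIV - {v})" "c ^ e' * w = ?p * q' + r'" by blast
    have "c ^ (e + e') * (u * w) = (c ^ e * u) * (c ^ e' * w)" by (simp add: power_add algebra_simps)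
    also have "\<dots> = ?p * (q * (?p * q' + r') + r * q') + r * r'" unfolding a(2,4) by (simp add: algebra_simps)
    finally show ?case using a by (blast intro: polyin.intros)
  qed
  \<comment> \<open>A nonzero multiple of \<open>?p\<close> has positive degree in
    \<open>v\<close>.\<close>
  have norem: "r = 0" if rin: "r \<in> polyin (UNIV - {v})" and pr: "?p dvd r" for r
  proof (rule ccontr)
    assume r0: "r \<noteq> 0"
    obtain q where q: "r = ?p * q" using pr by (elim dvdE)
    then have "q \<noteq> 0" using r0 by auto
    have "[:r:] = psi v ?p * psi v q" using psi_polyin[OF rin] q by (metis psi.hom_mult)
    then have "degree (psi v ?p * psi v q) = 0" by (metis degree_pCons_0)
    moreover have "degree (psi v ?p * psi v q) = degree (psi v ?p) + degree (psi v q)"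
      using psi0[OF p0] psi0[OF \<open>q \<noteq> 0\<close>] by (rule degree_mult_eq)
    ultimately show False using dg by simp
  qed
  \<comment> \<open>A prime \<open>c\<close> that does not divide \<open>d\<close> does not divide
    \<open>?p\<close> either, so it must divide the cofactor and can be cancelled.\<close>
  have cancel: "?p dvd c ^ e * u \<Longrightarrow> ?p dvd u" for e u
  proof (induction e)
    case (Suc e)
    show ?case
    proof (cases "c = 1")
      case False
      then have pr: "prime_elem c" "\<not> c dvd d" using pc by auto
      have ncp: "\<not> c dvd ?p" using pr(2) by (simp add: dvd_add_right_iff)
      obtain q where q: "c ^ Suc e * u = ?p * q" using Suc.prems by (elim dvdE)
      then have "c dvd ?p * q" by (metis dvd_triv_left mult.assoc power_Suc)
      then have "c dvd q" using pr(1) ncp by (auto dest: prime_elem_dvd_multD)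
      then obtain q' where "q = c * q'" by (elim dvdE)
      then have "c * (c ^ e * u) = c * (?p * q')" using q by (simp add: mult_ac)
      then have "c ^ e * u = ?p * q'" using c0 by simp
      then show ?thesis using Suc.IH by simp
    qed (use Suc in simp)
  qed simp
  have "?p dvd u \<or> ?p dvd w" if uw: "?p dvd u * w" for u w
  proof -
    obtain e q r where a: "r \<in> polyin (UNIV - {v})" "c ^ e * u = ?p * q + r" using division by blast
    obtain e' q' r' where b: "r' \<in> polyin (UNIV - {v})" "c ^ e' * w = ?p * q' + r'" using division by blast
    have "r * r' = c ^ (e + e') * (u * w) - ?p * (q * (c ^ e' * w) + r * q')"
    proof -
      have "c ^ (e + e') * (u * w) = (c ^ e * u) * (c ^ e' * w)" by (simp add: power_add algebra_simps)
      also have "\<dots> = ?p * (q * (c ^ e' * w)) + r * (?p * q' + r')" unfolding a(2) b(2)[symmetric] by (simp add: algebra_simps)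
      finally show ?thesis by (simp add: algebra_simps)
    qed
    moreover have "?p dvd c ^ (e + e') * (u * w) - ?p * (q * (c ^ e' * w) + r * q')"
      by (rule dvd_diff[OF dvd_mult[OF uw] dvd_triv_left])
    ultimately have "r * r' = 0" using a(1) b(1) by (intro norem polyin.mult) auto
    then have "r = 0 \<or> r' = 0" by simp
    then have "?p dvd c ^ e * u \<or> ?p dvd c ^ e' * w" using a(2) b(2) by auto
    then show ?thesis using cancel by blast
  qed
  then show ?thesis using p0 nounit by (simp add: prime_elem_def)
qed

lemma hom_dvd: "comm_ring_hom h \<Longrightarrow> a dvd b \<Longrightarrow> h a dvd h b"
proof -
  assume "comm_ring_hom h" "a dvd b"
  interpret comm_ring_hom h by fact
  show "h a dvd h b" using \<open>a dvd b\<close> by (auto elim!: dvdE simp: hom_mult)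
qed

lemma hom_0: "comm_ring_hom h \<Longrightarrow> h 0 = 0"
  by (simp add: comm_ring_hom_def ring_hom_def semiring_hom_def comm_monoid_add_hom_def monoid_add_hom_def zero_hom_def)

lemma prime_elem_Var_diff:
  assumes "v \<noteq> w"
  shows "prime_elem (Var v - Var w :: ('v::linorder, 'a::idom) mpoly)"
proof -
  have "1 \<in> polyin (UNIV - {v})" using polyin.Cst[of 1] by simp
  moreover have "- Var w \<in> polyin (UNIV - {v})" using assms by (intro polyin_uminus polyin.Var) auto
  ultimately have "prime_elem (1 * Var v + (- Var w) :: ('v, 'a) mpoly)" by (rule prime_elem_linear) simp
  then show ?thesis by simp
qed

lemma mdet_linear_corner:
  fixes f :: "nat \<Rightarrow> nat \<Rightarrow> 'a::comm_ring_1"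
  shows "mdet (Suc n) f = mdet n (\<lambda>i j. f (Suc i) (Suc j)) * f 0 0 +
    mdet (Suc n) (\<lambda>i j. if i = 0 \<and> j = 0 then 0 else f i j)"
proof -
  let ?g = "\<lambda>i j. if i = 0 \<and> j = 0 then 0 else f i j"
  let ?A = "mat (Suc n) (Suc n) (\<lambda>(i, j). f i j)" and ?B = "mat (Suc n) (Suc n) (\<lambda>(i, j). ?g i j)"
  have cof: "cofactor ?A i 0 = cofactor ?B i 0" if "i < Suc n" for i
    unfolding cofactor_def mat_delete_def
    by (intro arg_cong2[of _ _ _ _ "(*)"] refl arg_cong[of _ _ det] eq_matI) auto
  have c0: "cofactor ?A 0 0 = mdet n (\<lambda>i j. f (Suc i) (Suc j))"
    unfolding cofactor_def mat_delete_def mdet_def by (simp, intro arg_cong[of _ _ det] eq_matI) auto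
  have "mdet (Suc n) f = (\<Sum>i<Suc n. ?A $$ (i, 0) * cofactor ?A i 0)"
    unfolding mdet_def by (rule laplace_expansion_column) auto
  also have "\<dots> = f 0 0 * cofactor ?A 0 0 + (\<Sum>i<n. f (Suc i) 0 * cofactor ?A (Suc i) 0)"
    unfolding sum.lessThan_Suc_shift by simp
  finally have 1: "mdet (Suc n) f = f 0 0 * cofactor ?A 0 0 + (\<Sum>i<n. f (Suc i) 0 * cofactor ?A (Suc i) 0)" .
  have "mdet (Suc n) ?g = (\<Sum>i<Suc n. ?B $$ (i, 0) * cofactor ?B i 0)"
    unfolding mdet_def by (rule laplace_expansion_column) auto
  also have "\<dots> = (\<Sum>i<n. f (Suc i) 0 * cofactor ?B (Suc i) 0)"
    unfolding sum.lessThan_Suc_shift by simp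
  also have "\<dots> = (\<Sum>i<n. f (Suc i) 0 * cofactor ?A (Suc i) 0)" by (intro sum.cong refl) (simp add: cof)
  finally show ?thesis unfolding 1 c0 by (simp add: mult.commute)
qed

lemma signof_nonzero: "signof p \<noteq> (0 :: 'a::idom)"
  by (cases p rule: sign_cases) simp_all

lemma polyin_mdet: "(\<And>i j. i < n \<Longrightarrow> j < n \<Longrightarrow> f i j \<in> polyin V) \<Longrightarrow> mdet n f \<in> polyin V"
  unfolding mdet_sum
proof (intro polyin_sum polyin.mult polyin_prod)
  fix p :: "nat \<Rightarrow> nat"
  show "signof p \<in> polyin V" using polyin.Cst[of 1 V] polyin_uminus[OF polyin.Cst[of 1 V]] by (cases p rule: sign_cases) simp_all
qed (auto simp: permutes_lt)

text \<open>Induction on the size: the determinant is linear in its corner variable, with the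
  smaller generic determinant as leading coefficient, so \<open>prime_elem_linear\<close>
  applies.\<close>

theorem prime_elem_generic_det:
  fixes w :: "nat \<Rightarrow> nat \<Rightarrow> 'v::linorder"
  assumes "n > 0" and "\<And>i j i' j'. i < n \<Longrightarrow> j < n \<Longrightarrow> i' < n \<Longrightarrow> j' < n \<Longrightarrow> w i j = w i' j' \<Longrightarrow> i = i' \<and> j = j'"
  shows "prime_elem (mdet n (\<lambda>i j. Var (w i j)) :: ('v, 'a::idom) mpoly)"
  using assms
proof (induction n arbitrary: w)
  case (Suc n)
  let ?c = "mdet n (\<lambda>i j. Var (w (Suc i) (Suc j))) :: ('v, 'a) mpoly"
  let ?d = "mdet (Suc n) (\<lambda>i j. if i = 0 \<and> j = 0 then 0 else Var (w i j)) :: ('v, 'a) mpoly"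
  let ?V = "UNIV - {w 0 0}"
  have c: "?c \<in> polyin ?V"
  proof (intro polyin_mdet polyin.Var)
    fix i j assume "i < n" "j < n"
    then show "w (Suc i) (Suc j) \<in> ?V" using Suc.prems(2)[of "Suc i" "Suc j" 0 0] by auto
  qed
  have d: "?d \<in> polyin ?V"
  proof (intro polyin_mdet)
    fix i j assume "i < Suc n" "j < Suc n"
    then show "(if i = 0 \<and> j = 0 then 0 else Var (w i j)) \<in> polyin ?V"
      using Suc.prems(2)[of i j 0 0] by (auto intro!: polyin.Var polyin_0)
  qed
  have "?c = 1 \<or> prime_elem ?c \<and> \<not> ?c dvd ?d"
  proof (cases "n = 0")
    case True
    then show ?thesis by (simp add: mdet_sum)
  next
    case False
    have "prime_elem ?c"
    proof (rule Suc.IH)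
      fix i j i' j' assume "i < n" "j < n" "i' < n" "j' < n" "w (Suc i) (Suc j) = w (Suc i') (Suc j')"
      then show "i = i' \<and> j = j'" using Suc.prems(2)[of "Suc i" "Suc j" "Suc i'" "Suc j'"] by auto
    qed (use False in simp)
    moreover have "\<not> ?c dvd ?d"
    proof
      assume "?c dvd ?d"
      \<comment> \<open>At the matrix of this transposition the corner entry is \<open>0\<close> and
        the corner minor has a zero row, while the whole determinant is a sign.\<close>
      let ?t = "Transposition.transpose 0 (1 :: nat)"
      let ?M = "\<lambda>i j. if i = ?t j then 1 else 0 :: 'a"
      define y where "y v = (case SOME (i, j). i < Suc n \<and> j < Suc n \<and> v = w i j of (i, j) \<Rightarrow> ?M i j)" for v
      have y: "y (w i j) = ?M i j" if ij: "i < Suc n" "j < Suc n" for i j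
      proof -
        have "(SOME (i', j'). i' < Suc n \<and> j' < Suc n \<and> w i j = w i' j') = (i, j)"
        proof (rule some_equality)
          fix z :: "nat \<times> nat"
          assume z: "case z of (i', j') \<Rightarrow> i' < Suc n \<and> j' < Suc n \<and> w i j = w i' j'"
          obtain i' j' where "z = (i', j')" by (cases z)
          then show "z = (i, j)" using z Suc.prems(2)[OF ij, of i' j'] by simp
        qed (use ij in simp)
        then show ?thesis by (simp add: y_def)
      qed
      have "ev y ?c = mdet n (\<lambda>i j. ?M (Suc i) (Suc j))"
        unfolding mdet_hom[OF ev_hom] by (intro mdet_cong) (simp add: y)
      also have "\<dots> = 0" by (rule mdet_zero_row[of 0]) (use False in \<open>auto simp: transpose_def\<close>)
      finally have "ev y ?c = 0" .
      moreover have "ev y ?c dvd ev y ?d" using \<open>?c dvd ?d\<close> by (rule hom_dvd[OF ev_hom])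
      ultimately have "ev y ?d = 0" by simp
      moreover have "ev y ?d = mdet (Suc n) ?M"
        unfolding mdet_hom[OF ev_hom]
        by (intro mdet_cong) (auto simp: y transpose_def hom_0[OF ev_hom])
      moreover have "mdet (Suc n) ?M = signof ?t * mdet (Suc n) (\<lambda>i j. if i = j then 1 else 0 :: 'a)"
        using False by (intro mdet_permute_cols permutes_swap_id) auto
      ultimately show False by (simp add: mdet_diag signof_nonzero)
    qed
    ultimately show ?thesis by blast
  qed
  then have "prime_elem (?c * Var (w 0 0) + ?d)" by (rule prime_elem_linear[OF c d])
  then show ?case by (subst mdet_linear_corner)
qed simp

text \<open>Restricted to a line through the origin, a unit becomes a unit of a univariate
  polynomial ring, hence constant; so all its values equal the one at the origin.\<close>

lemma unit_mpoly_const: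
  fixes c :: "('v::linorder, 'a::{field}) mpoly"
  assumes inf: "infinite (UNIV :: 'a set)" and "c dvd 1"
  shows "\<exists>a. a \<noteq> 0 \<and> c = Cst a"
proof -
  obtain c' where c': "1 = c * c'" using assms(2) by (elim dvdE)
  have const: "ev y c = ev (\<lambda>_. 0) c" for y
  proof -
    let ?e = "mev (\<lambda>a. [:a:]) (\<lambda>v. [:0, y v:])"
    have h: "comm_ring_hom ?e" by (rule comm_ring_hom.mev_hom[OF comm_ring_hom_const_poly])
    interpret e: comm_ring_hom ?e by (rule h)
    have p: "poly (?e u) t = ev (\<lambda>v. t * y v) u" for u t
      by (rule mpoly_hom_unique[OF comm_ring_hom_compose[OF h poly_eval_hom] ev_hom])
        (simp_all add: comm_ring_hom.mev_Cst[OF comm_ring_hom_const_poly] comm_ring_hom.mev_Var[OF comm_ring_hom_const_poly])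
    have "?e c * ?e c' = 1" using c' by (metis e.hom_mult e.hom_one)
    then have "degree (?e c) + degree (?e c') = 0"
      by (metis degree_1 degree_mult_eq mult_zero_left mult_zero_right zero_neq_one)
    then obtain b where "?e c = [:b:]" by (metis add_is_0 degree_eq_zeroE)
    then show ?thesis using p[of c 1] p[of c 0] by simp
  qed
  let ?a = "ev (\<lambda>_. 0) c"
  have "c - Cst ?a = 0"
  proof (rule mpoly_eq_0_infinite[OF inf])
    fix x :: "'v \<Rightarrow> 'a"
    interpret comm_ring_hom "ev x" by (rule ev_hom)
    show "ev x (c - Cst ?a) = 0" using const[of x] by (simp add: hom_minus)
  qed
  then have c: "c = Cst ?a" by simp
  moreover have "?a \<noteq> 0" using c c' by (metis Cst_0 mult_zero_left zero_neq_one)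
  ultimately show ?thesis by blast
qed

section \<open>Divisors of products of prime elements\<close>

definition pp :: "'a::comm_semiring_1 set \<Rightarrow> 'a set" where
  "pp S = {x. \<exists>c ps. c dvd 1 \<and> set ps \<subseteq> S \<and> x = c * prod_list ps}"

lemma pp_unit: "c dvd 1 \<Longrightarrow> c \<in> pp S"
  unfolding pp_def by (auto intro!: exI[of _ c] exI[of _ "[]"])

lemma pp_incl: "p \<in> S \<Longrightarrow> p \<in> pp S"
  unfolding pp_def by (auto intro!: exI[of _ 1] exI[of _ "[p]"])

lemma pp_mult: "x \<in> pp S \<Longrightarrow> y \<in> pp S \<Longrightarrow> x * y \<in> pp S"
proof -
  assume "x \<in> pp S" "y \<in> pp S"
  then obtain c ps d qs where a: "c dvd 1" "set ps \<subseteq> S" "x = c * prod_list ps" "d dvd 1" "set qs \<subseteq> S" "y = d * prod_list qs"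
    unfolding pp_def by blast
  then show ?thesis unfolding pp_def
    using mult_dvd_mono[of c 1 d 1] by (auto intro!: exI[of _ "c * d"] exI[of _ "ps @ qs"] simp: mult_ac)
qed

lemma pp_power: "x \<in> pp S \<Longrightarrow> x ^ e \<in> pp S"
  by (induction e) (auto intro: pp_mult pp_unit)

lemma pp_prod: "(\<And>i. i \<in> I \<Longrightarrow> f i \<in> pp S) \<Longrightarrow> prod f I \<in> pp S"
  by (induction I rule: infinite_finite_induct) (auto intro: pp_mult pp_unit)

text \<open>The primes are cancelled one at a time, each from \<open>u\<close> or from its cofactor,
  so only primes dividing \<open>u\<close> need to lie in \<open>T\<close>.\<close>

lemma pp_divisor:
  fixes u :: "'a::idom"
  assumes S: "\<And>p. p \<in> S \<Longrightarrow> prime_elem p" and x: "x \<in> pp S" and u: "u dvd x"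
    and T: "\<And>p. p \<in> S \<Longrightarrow> p dvd u \<Longrightarrow> p \<in> T"
  shows "u \<in> pp T"
proof -
  have main: "u dvd c * prod_list ps \<Longrightarrow> c dvd 1 \<Longrightarrow> set ps \<subseteq> S \<Longrightarrow> (\<And>p. p \<in> S \<Longrightarrow> p dvd u \<Longrightarrow> p \<in> T) \<Longrightarrow> u \<in> pp T"
    for u c ps
  proof (induction ps arbitrary: u)
    case Nil
    then have "u dvd 1" using dvd_trans by auto
    then show ?case by (rule pp_unit)
  next
    case (Cons p ps)
    have p: "prime_elem p" "p \<in> S" using Cons.prems S by auto
    then have p0: "p \<noteq> 0" by auto
    obtain w where w: "c * (p * prod_list ps) = u * w" using Cons.prems(1) by (auto elim!: dvdE)
    then have "p dvd u * w" by (metis dvd_mult dvd_triv_left)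
    then consider "p dvd u" | "p dvd w" using p(1) prime_elem_dvd_multD by blast
    then show ?case
    proof cases
      case 1
      then obtain u' where u': "u = p * u'" by (elim dvdE)
      then have "p * (c * prod_list ps) = p * (u' * w)" using w by (simp add: mult_ac)
      then have "u' dvd c * prod_list ps" using p0 by simp
      moreover have "q \<in> T" if "q \<in> S" "q dvd u'" for q using Cons.prems(4)[OF that(1)] that(2) u' by simp
      ultimately have "u' \<in> pp T" using Cons.IH Cons.prems by auto
      moreover have "p \<in> T" using Cons.prems(4)[OF p(2)] 1 .
      ultimately show ?thesis unfolding u' using pp_mult[OF pp_incl] by blast
    next
      case 2
      then obtain w' where w': "w = p * w'" by (elim dvdE)
      then have "p * (c * prod_list ps) = p * (u * w')" using w by (simp add: mult_ac)
      then have "u dvd c * prod_list ps" using p0 by simp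
      then show ?thesis using Cons.IH Cons.prems by auto
    qed
  qed
  obtain c ps where "c dvd 1" "set ps \<subseteq> S" "x = c * prod_list ps" using x unfolding pp_def by blast
  then show ?thesis using main[of u c ps] u T by simp
qed

section \<open>Parametrization by eigenvectors and eigenvalues\<close>

lemma adj_mat_hom:
  assumes "comm_ring_hom f" "A \<in> carrier_mat n n"
  shows "map_mat f (adj_mat A) = adj_mat (map_mat f A)"
proof -
  interpret comm_ring_hom f by fact
  have "f (cofactor A j i) = cofactor (map_mat f A) j i" if "i < n" "j < n" for i j
  proof -
    have "mat_delete (map_mat f A) j i = map_mat f (mat_delete A j i)"
      using assms(2) that by (intro eq_matI) (auto simp: mat_delete_def)
    then show ?thesis by (simp add: cofactor_def hom_mult hom_power hom_uminus)
  qed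
  then show ?thesis using assms(2) by (intro eq_matI) (auto simp: adj_mat_def)
qed

text \<open>A conjugate of \<open>(det P)\<^sup>2 \<sqdot> dg n l\<close>, free of denominators.\<close>
definition cjm :: "nat \<Rightarrow> 'a::comm_ring_1 mat \<Rightarrow> (nat \<Rightarrow> 'a) \<Rightarrow> 'a mat" where
  "cjm n P l = det P \<cdot>\<^sub>m (P * dg n l * adj_mat P)"

lemma cjm_carrier:
  assumes "P \<in> carrier_mat n n"
  shows "cjm n P l \<in> carrier_mat n n"
  unfolding cjm_def by (intro smult_carrier_mat mult_carrier_mat[where n = n] assms dg_carrier adj_mat(1)[OF assms])

lemma cjm_hom:
  assumes "comm_ring_hom f" "P \<in> carrier_mat n n"
  shows "map_mat f (cjm n P l) = cjm n (map_mat f P) (\<lambda>j. f (l j))"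
proof -
  interpret comm_ring_hom f by fact
  have d: "map_mat f (dg n l) = dg n (\<lambda>j. f (l j))" by (intro eq_matI) auto
  have 1: "P * dg n l \<in> carrier_mat n n" using assms(2) by simp
  have "map_mat f (cjm n P l) = f (det P) \<cdot>\<^sub>m map_mat f (P * dg n l * adj_mat P)"
    unfolding cjm_def by (intro eq_matI) (auto simp: hom_mult)
  then show ?thesis
    unfolding mat_hom_mult[OF 1 adj_mat(1)[OF assms(2)]] mat_hom_mult[OF assms(2) dg_carrier] d
      adj_mat_hom[OF assms] cjm_def hom_det .
qed

lemma cjm_diag:
  assumes P: "P \<in> carrier_mat n n"
  shows "cjm n P l * P = P * dg n (\<lambda>j. det P ^ 2 * l j)"
proof -
  have a: "adj_mat P \<in> carrier_mat n n" "adj_mat P * P = det P \<cdot>\<^sub>m 1\<^sub>m n" using adj_mat[OF P] by auto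
  have 1: "P * dg n l \<in> carrier_mat n n" using P by simp
  have "P * dg n l * adj_mat P \<in> carrier_mat n n" using 1 a by simp
  then have "cjm n P l * P = det P \<cdot>\<^sub>m (P * dg n l * adj_mat P * P)"
    unfolding cjm_def using P by (rule mult_smult_assoc_mat)
  also have "P * dg n l * adj_mat P * P = P * dg n l * (adj_mat P * P)" by (rule assoc_mult_mat[OF 1 a(1) P])
  also have "\<dots> = det P \<cdot>\<^sub>m (P * dg n l)"
    unfolding a(2) using mult_smult_distrib[OF 1 one_carrier_mat] right_mult_one_mat[OF 1] by simp
  finally have eq: "cjm n P l * P = det P \<cdot>\<^sub>m (det P \<cdot>\<^sub>m (P * dg n l))" .
  show ?thesis
  proof (rule eq_matI)
    fix i j assume "i < dim_row (P * dg n (\<lambda>j. det P ^ 2 * l j))" "j < dim_col (P * dg n (\<lambda>j. det P ^ 2 * l j))"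
    then have ij: "i < n" "j < n" using P by auto
    show "(cjm n P l * P) $$ (i, j) = (P * dg n (\<lambda>j. det P ^ 2 * l j)) $$ (i, j)"
      unfolding eq index_mult_dg[OF P ij] using index_mult_dg[OF P ij, of l] ij P 1
      by (simp add: power2_eq_square mult_ac del: index_mult_mat(1))
  qed (use P in \<open>auto simp: eq\<close>)
qed

lemma cjm_diagz:
  assumes "P \<in> carrier_mat n n" "det P \<noteq> 0"
  shows "diagz n (cjm n P l) P (\<lambda>j. det P ^ 2 * l j)"
  using assms cjm_diag[OF assms(1)] cjm_carrier[OF assms(1)] by (simp add: diagz_def)

lemma mat_cancel_right:
  assumes "A \<in> carrier_mat n n" "B \<in> carrier_mat n n" "P \<in> carrier_mat n n" "det P \<noteq> (0 :: 'a::field)" "A * P = B * P"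
  shows "A = B"
proof -
  obtain R where R: "R \<in> carrier_mat n n" "P * R = 1\<^sub>m n" using mat_inverse_exists[OF assms(3,4)] by blast
  have e: "C = C * P * R" if "C \<in> carrier_mat n n" for C
    unfolding assoc_mult_mat[OF that assms(3) R(1)] R(2) right_mult_one_mat[OF that] ..
  show ?thesis by (subst e[OF assms(1)], subst e[OF assms(2)]) (simp only: assms(5))
qed

lemma cjm_det_1:
  assumes "diagz n A P (l :: nat \<Rightarrow> 'a::field)" "det P = 1"
  shows "cjm n P l = A"
proof -
  have A: "A \<in> carrier_mat n n" "P \<in> carrier_mat n n" "A * P = P * dg n l" using assms(1) by (auto simp: diagz_def)
  show ?thesis
    by (rule mat_cancel_right[OF cjm_carrier[OF A(2)] A(1,2)]) (use assms(2) A(3) cjm_diag[OF A(2), of l] in simp_all)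
qed

lemma dg_dg: "dg n f * dg n g = dg n (\<lambda>i. f i * g i :: 'a::comm_ring_1)"
  by (intro eq_matI) (auto simp: index_mult_dg[OF dg_carrier] simp del: index_mult_mat(1))

text \<open>Rescaling one eigenvector suffices. With \<open>cjm_det_1\<close> this puts every
  diagonalizable matrix into the image of the parametrization, at a point where the eigenvector
  matrix has determinant \<open>1\<close>.\<close>

lemma diagz_det_1:
  assumes d: "diagz n A P (l :: nat \<Rightarrow> 'a::field)" and n: "0 < n"
  obtains P' where "diagz n A P' l" "det P' = 1"
proof -
  have A: "A \<in> carrier_mat n n" "P \<in> carrier_mat n n" "det P \<noteq> 0" "A * P = P * dg n l" using d by (auto simp: diagz_def)
  let ?r = "\<lambda>j. if j = 0 then inverse (det P) else 1 :: 'a"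
  let ?P = "P * dg n ?r"
  have "(\<Prod>j<n. ?r j) = inverse (det P)" using n by simp
  then have 1: "det ?P = 1" using det_mult[OF A(2) dg_carrier, of ?r] A(3) by (simp add: det_dg)
  have "A * ?P = A * P * dg n ?r" by (rule assoc_mult_mat[OF A(1,2) dg_carrier, symmetric])
  also have "\<dots> = P * (dg n l * dg n ?r)" unfolding A(4) by (rule assoc_mult_mat[OF A(2) dg_carrier dg_carrier])
  also have "dg n l * dg n ?r = dg n ?r * dg n l" unfolding dg_dg by (simp add: mult.commute)
  also have "P * (dg n ?r * dg n l) = ?P * dg n l" by (rule assoc_mult_mat[OF A(2) dg_carrier dg_carrier, symmetric])
  finally have "diagz n A ?P l" unfolding diagz_def using A 1 by simp
  then show thesis using that 1 by blast
qed

definition mpt :: "(bool \<Rightarrow> 'a mat) \<Rightarrow> 'n::{finite,linorder} var \<Rightarrow> 'a" where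
  "mpt M = (\<lambda>(c, a, b). M c $$ (ix a, ix b))"

lemma vmat_mpt:
  assumes "M c \<in> carrier_mat (card (UNIV :: 'n set)) (card (UNIV :: 'n set))"
  shows "vmat (mpt M :: 'n::{finite,linorder} var \<Rightarrow> 'a) c = M c"
  using assms by (intro eq_matI) (auto simp: vmat_def mpt_def ix_idx)

lemma mpt_vmat: "mpt (vmat x) = x"
  by (auto simp: mpt_def vmat_def ix_lt idx_ix fun_eq_iff)

text \<open>Each list extends by its missing indices to a permutation of \<open>{0..<n}\<close>; one
  of these composed with the inverse of the other does the job.\<close>

lemma exists_permutation_lists:
  assumes "distinct xs" "distinct xs'" "length xs = length xs'" "set xs \<subseteq> {..<n}" "set xs' \<subseteq> {..<n::nat}"
  obtains \<sigma> where "\<sigma> permutes {0..<n}" "map \<sigma> xs = xs'"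
proof -
  have ext: "\<exists>p. p permutes {0..<n} \<and> (\<forall>i<length xs. xs ! i = p i)" if xs: "distinct xs" "set xs \<subseteq> {..<n}" for xs
  proof -
    let ?zs = "xs @ sorted_list_of_set ({..<n} - set xs)"
    have d: "distinct ?zs" "set ?zs = set [0..<n]" using xs by auto
    have len: "length ?zs = n" using distinct_card[OF d(1)] d(2) by simp
    obtain p where p: "p permutes {0..<length ?zs}" "\<And>i. i < length ?zs \<Longrightarrow> ?zs ! i = [0..<n] ! p i"
      using distinct_lists_permutation[OF d(1) distinct_upt d(2)] by blast
    have "xs ! i = p i" if i: "i < length xs" for i
    proof -
      have "i < n" using i len by simp
      then have "p i < n" using p(1) len by (simp add: permutes_lt)
      then show ?thesis using p(2)[of i] i len by (simp add: nth_append)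
    qed
    then show ?thesis using p(1) unfolding len by blast
  qed
  obtain p where p: "p permutes {0..<n}" "\<And>i. i < length xs \<Longrightarrow> xs ! i = p i" using ext[OF assms(1,4)] by blast
  obtain p' where p': "p' permutes {0..<n}" "\<And>i. i < length xs' \<Longrightarrow> xs' ! i = p' i" using ext[OF assms(2,5)] by blast
  have "(p' \<circ> inv_into UNIV p) permutes {0..<n}" by (rule permutes_compose[OF permutes_inv[OF p(1)] p'(1)])
  moreover have "map (p' \<circ> inv_into UNIV p) xs = xs'"
    using p p' assms(3) by (intro nth_equalityI) (auto simp: permutes_inverses(2)[OF p(1)])
  ultimately show thesis using that by blast
qed

type_synonym 'a eigpoly = "(bool \<times> nat \<times> nat, 'a) mpoly"

text \<open>The variable \<open>(c, i, j)\<close> with \<open>i < n\<close> is an entry of the matrix of eigenvectors, and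
  \<open>(c, n, j)\<close> is the \<open>j\<close>-th eigenvalue.\<close>
definition GP :: "nat \<Rightarrow> bool \<Rightarrow> 'a::comm_ring_1 eigpoly mat" where
  "GP n c = mat n n (\<lambda>(i, j). Var (c, i, j))"

definition gdet :: "nat \<Rightarrow> bool \<Rightarrow> 'a::comm_ring_1 eigpoly" where
  "gdet n c = mdet n (\<lambda>i j. Var (c, i, j))"

definition Dpol :: "nat \<Rightarrow> nat list \<Rightarrow> nat list \<Rightarrow> 'a::comm_ring_1 eigpoly" where
  "Dpol n xs ys = dcols n (\<lambda>i j. Var (False, i, j)) (\<lambda>i j. Var (True, i, j)) xs ys"

definition pm :: "nat \<Rightarrow> (bool \<times> nat \<times> nat \<Rightarrow> 'a) \<Rightarrow> bool \<Rightarrow> 'a mat" where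
  "pm n y c = mat n n (\<lambda>(i, j). y (c, i, j))"

lemma pm_carrier [simp]: "pm n y c \<in> carrier_mat n n"
  by (simp add: pm_def)

lemma GP_carrier [simp]: "GP n c \<in> carrier_mat n n"
  by (simp add: GP_def)

lemma map_GP: "map_mat (ev y) (GP n c) = pm n y c"
  by (intro eq_matI) (auto simp: GP_def pm_def)

lemma ev_gdet: "ev y (gdet n c) = det (pm n y c)"
  unfolding gdet_def mdet_hom[OF ev_hom] by (simp add: pm_def mdet_def)

lemma ev_Dpol: "ev y (Dpol n xs ys) = dcols n (\<lambda>i j. y (False, i, j)) (\<lambda>i j. y (True, i, j)) xs ys"
  unfolding Dpol_def dcols_hom[OF ev_hom] by simp

lemma prime_elem_gdet: "0 < n \<Longrightarrow> prime_elem (gdet n c :: 'a::idom eigpoly)"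
  unfolding gdet_def by (rule prime_elem_generic_det) auto

lemma prime_elem_Dpol:
  assumes "0 < n" "length xs + length ys = n" "distinct xs" "distinct ys"
  shows "prime_elem (Dpol n xs ys :: 'a::idom eigpoly)"
proof -
  let ?w = "\<lambda>i j. if j < length xs then (False, i, xs ! j) else (True, i, ys ! (j - length xs))"
  have "Dpol n xs ys = (mdet n (\<lambda>i j. Var (?w i j)) :: 'a eigpoly)"
    unfolding Dpol_def dcols_def by (intro mdet_cong) auto
  also have "prime_elem \<dots>"
  proof (rule prime_elem_generic_det[OF assms(1)])
    fix i j i' j' assume l: "i < n" "j < n" "i' < n" "j' < n" and w: "?w i j = ?w i' j'"
    show "i = i' \<and> j = j'"
    proof (cases "j < length xs"; cases "j' < length xs")
      assume "j < length xs" "j' < length xs"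
      then show ?thesis using w assms(3) by (simp add: nth_eq_iff_index_eq)
    next
      assume a: "\<not> j < length xs" "\<not> j' < length xs"
      then have "j - length xs < length ys" "j' - length xs < length ys" using l assms(2) by auto
      then have "i = i'" "j - length xs = j' - length xs" using w assms(4) a by (simp_all add: nth_eq_iff_index_eq)
      then show ?thesis using a by simp
    qed (use w in auto)
  qed
  finally show ?thesis .
qed

text \<open>A point at which the selected columns form the identity matrix and all other columns vanish.\<close>
definition ypt :: "nat list \<Rightarrow> nat list \<Rightarrow> bool \<times> nat \<times> nat \<Rightarrow> 'a::comm_ring_1" where
  "ypt xs ys = (\<lambda>(c, i, v). if c then (if length xs \<le> i \<and> i < length xs + length ys \<and> ys ! (i - length xs) = v then 1 else 0)
     else (if i < length xs \<and> xs ! i = v then 1 else 0))"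

lemma dcols_ypt:
  assumes "length xs + length ys = n" "distinct xs" "distinct ys"
  shows "ev (ypt xs ys) (Dpol n xs ys) = (1 :: 'a::comm_ring_1)"
proof -
  have "ev (ypt xs ys) (Dpol n xs ys) = mdet n (\<lambda>i j. if i = j then 1 else 0 :: 'a)"
    unfolding ev_Dpol dcols_def
  proof (rule mdet_cong)
    fix i j assume ij: "i < n" "j < n"
    show "(if j < length xs then ypt xs ys (False, i, xs ! j) else ypt xs ys (True, i, ys ! (j - length xs))) = (if i = j then 1 else 0 :: 'a)"
    proof (cases "j < length xs")
      case True
      then show ?thesis using assms(2) by (auto simp: ypt_def nth_eq_iff_index_eq)
    next
      case False
      then have j: "j - length xs < length ys" using ij assms(1) by auto
      show ?thesis
      proof (cases "length xs \<le> i")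
        case True
        then have "i - length xs < length ys" using ij assms(1) by auto
        then have "ys ! (i - length xs) = ys ! (j - length xs) \<longleftrightarrow> i - length xs = j - length xs"
          using j assms(3) by (simp add: nth_eq_iff_index_eq)
        then show ?thesis using True False ij assms(1) by (auto simp: ypt_def)
      qed (use False in \<open>auto simp: ypt_def\<close>)
    qed
  qed
  then show ?thesis by (simp add: mdet_diag)
qed

text \<open>At the point \<open>ypt\<close> belonging to the second pair, the second determinant is
  \<open>1\<close>, while the first has a zero column: of two different sets of equal size, neither
  contains the other.\<close>

lemma Dpol_not_dvd_Dpol:
  assumes l: "length xs + length ys = n" "length xs' = length xs" "length ys' = length ys"
    and d: "distinct xs" "distinct ys" "distinct xs'" "distinct ys'"
    and ne: "set xs \<noteq> set xs' \<or> set ys \<noteq> set ys'"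
  shows "\<not> Dpol n xs ys dvd (Dpol n xs' ys' :: 'a::idom eigpoly)"
proof
  assume "Dpol n xs ys dvd (Dpol n xs' ys' :: 'a eigpoly)"
  then have "ev (ypt xs' ys') (Dpol n xs ys) dvd (ev (ypt xs' ys') (Dpol n xs' ys') :: 'a)" by (rule hom_dvd[OF ev_hom])
  moreover have "ev (ypt xs' ys') (Dpol n xs' ys') = (1 :: 'a)" by (rule dcols_ypt) (use l d in auto)
  ultimately have 1: "ev (ypt xs' ys') (Dpol n xs ys) \<noteq> (0 :: 'a)" by auto
  have sub: "A = B" if "A \<subseteq> B" "card A = card B" "finite B" for A B :: "nat set" using that by (metis card_subset_eq)
  from ne show False
  proof
    assume "set xs \<noteq> set xs'"
    then have "\<not> set xs \<subseteq> set xs'" using sub[of "set xs" "set xs'"] l d by (auto simp: distinct_card)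
    then obtain j where j: "j < length xs" "xs ! j \<notin> set xs'" by (metis in_set_conv_nth subsetI)
    have "ev (ypt xs' ys') (Dpol n xs ys) = (0 :: 'a)" unfolding ev_Dpol dcols_def
      by (rule mdet_zero_col[of j]) (use j l in \<open>auto simp: ypt_def in_set_conv_nth\<close>)
    then show False using 1 by simp
  next
    assume "set ys \<noteq> set ys'"
    then have "\<not> set ys \<subseteq> set ys'" using sub[of "set ys" "set ys'"] l d by (auto simp: distinct_card)
    then obtain j where j: "j < length ys" "ys ! j \<notin> set ys'" by (metis in_set_conv_nth subsetI)
    have "ev (ypt xs' ys') (Dpol n xs ys) = (0 :: 'a)" unfolding ev_Dpol dcols_def
    proof (rule mdet_zero_col[of "length xs + j"])
      fix i assume "i < n"
      have "\<not> (length xs' \<le> i \<and> i < length xs' + length ys' \<and> ys' ! (i - length xs') = ys ! j)"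
        using j(2) l by (auto simp: in_set_conv_nth)
      then show "(if length xs + j < length xs then ypt xs' ys' (False, i, xs ! (length xs + j))
        else ypt xs' ys' (True, i, ys ! (length xs + j - length xs))) = 0" by (simp add: ypt_def)
    qed (use j l in simp)
    then show False using 1 by simp
  qed
qed

text \<open>On side \<open>c\<close> the eigenvector matrix is the identity, on the other side it is
  zero, and \<open>f\<close> gives the eigenvalues. A determinant with columns from both sides
  vanishes here.\<close>

definition ypt' :: "bool \<Rightarrow> (nat \<Rightarrow> 'a::comm_ring_1) \<Rightarrow> nat \<Rightarrow> bool \<times> nat \<times> nat \<Rightarrow> 'a" where
  "ypt' c f n = (\<lambda>(c', i, j). if i = n then f j else if c' = c \<and> i = j then 1 else 0)"

lemma Dpol_ypt':
  assumes "length xs + length ys = n" "0 < length xs" "0 < length ys"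
  shows "ev (ypt' c f n) (Dpol n xs ys) = (0 :: 'a::comm_ring_1)"
  unfolding ev_Dpol dcols_def
proof (cases c)
  case True
  show "mdet n (\<lambda>i j. if j < length xs then ypt' c f n (False, i, xs ! j) else ypt' c f n (True, i, ys ! (j - length xs))) = 0"
    by (rule mdet_zero_col[of 0]) (use True assms in \<open>auto simp: ypt'_def\<close>)
next
  case False
  show "mdet n (\<lambda>i j. if j < length xs then ypt' c f n (False, i, xs ! j) else ypt' c f n (True, i, ys ! (j - length xs))) = 0"
    by (rule mdet_zero_col[of "length xs"]) (use False assms in \<open>auto simp: ypt'_def\<close>)
qed

lemma Dpol_not_dvd_gdet:
  assumes "length xs + length ys = n" "0 < length xs" "0 < length ys"
  shows "\<not> Dpol n xs ys dvd (gdet n c :: 'a::idom eigpoly)"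
proof
  assume "Dpol n xs ys dvd (gdet n c :: 'a eigpoly)"
  then have "ev (ypt' c (\<lambda>_. 0) n) (Dpol n xs ys) dvd (ev (ypt' c (\<lambda>_. 0) n) (gdet n c) :: 'a)" by (rule hom_dvd[OF ev_hom])
  moreover have "pm n (ypt' c (\<lambda>_. 0) n) c = (1\<^sub>m n :: 'a mat)" by (intro eq_matI) (auto simp: pm_def ypt'_def)
  ultimately show False using Dpol_ypt'[OF assms, of c "\<lambda>_. 0 :: 'a"] by (simp add: ev_gdet)
qed

lemma Dpol_not_dvd_diff:
  assumes "length xs + length ys = n" "0 < length xs" "0 < length ys" "a \<noteq> b"
  shows "\<not> Dpol n xs ys dvd (Var (c, n, b) - Var (c, n, a) :: 'a::idom eigpoly)"
proof
  let ?f = "\<lambda>j. if j = b then 1 else 0 :: 'a"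
  interpret e: comm_ring_hom "ev (ypt' c ?f n)" by (rule ev_hom)
  assume "Dpol n xs ys dvd (Var (c, n, b) - Var (c, n, a) :: 'a eigpoly)"
  then have "ev (ypt' c ?f n) (Dpol n xs ys) dvd ev (ypt' c ?f n) (Var (c, n, b) - Var (c, n, a))" by (rule hom_dvd[OF ev_hom])
  then have "ev (ypt' c ?f n) (Var (c, n, b) - Var (c, n, a)) = (0 :: 'a)" unfolding Dpol_ypt'[OF assms(1-3)] by simp
  moreover have "ev (ypt' c ?f n) (Var (c, n, b) - Var (c, n, a)) = (1 :: 'a)"
    unfolding e.hom_minus using assms(4) by (simp add: ypt'_def)
  ultimately show False by simp
qed

section \<open>Irreducibility over algebraically closed fields\<close>

locale triang =
  fixes tn :: "'n::{finite,linorder} itself" and n k h :: nat and KB KB' :: "nat list list"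
  assumes n_def: "n = card (UNIV :: 'n set)"
    and KB: "kbase n k KB" and KB': "kbase n h KB'" and hk: "h + k = n" "0 < h" "0 < k"
begin

lemma n_pos: "0 < n"
  using hk by simp

lemma length_KB'_KB: "length KB' = length KB"
  unfolding kbase_length[OF KB] kbase_length[OF KB'] using hk(1) binomial_symmetric[of k n] by auto

lemma KB_nth:
  assumes "p < length KB" "q < length KB"
  shows "length (KB' ! p) = h" "length (KB ! q) = k" "distinct (KB' ! p)" "distinct (KB ! q)"
    "set (KB' ! p) \<subseteq> {..<n}" "set (KB ! q) \<subseteq> {..<n}"
  using kbaseD[OF KB', of p] kbaseD[OF KB, of q] assms length_KB'_KB by auto

definition Phi :: "('n var, 'a::comm_ring_1) mpoly \<Rightarrow> 'a eigpoly" where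
  "Phi = mev Cst (mpt (\<lambda>c. cjm n (GP n c) (\<lambda>j. Var (c, n, j))))"

lemma Phi_hom: "comm_ring_hom Phi"
  unfolding Phi_def by (rule comm_ring_hom.mev_hom[OF Cst_hom])

lemma ev_Phi: fixes y :: "bool \<times> nat \<times> nat \<Rightarrow> 'b::comm_ring_1" shows "ev y (Phi u) = ev (mpt (\<lambda>c. cjm n (pm n y c) (\<lambda>j. y (c, n, j)))) u"
proof (rule mpoly_hom_unique[OF comm_ring_hom_compose[OF Phi_hom ev_hom] ev_hom])
  fix a show "ev y (Phi (Cst a)) = ev (mpt (\<lambda>c. cjm n (pm n y c) (\<lambda>j. y (c, n, j)))) (Cst a)"
    by (simp add: Phi_def comm_ring_hom.mev_Cst[OF Cst_hom])
next
  fix v :: "'n var"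
  obtain c a b where v: "v = (c, a, b)" by (cases v)
  have "ev y (Phi (Var v)) = ev y (cjm n (GP n c) (\<lambda>j. Var (c, n, j)) $$ (ix a, ix b))"
    by (simp add: Phi_def comm_ring_hom.mev_Var[OF Cst_hom] mpt_def v)
  also have "\<dots> = map_mat (ev y) (cjm n (GP n c) (\<lambda>j. Var (c, n, j))) $$ (ix a, ix b)"
    using carrier_matD[OF cjm_carrier[OF GP_carrier, of n c "\<lambda>j. Var (c, n, j) :: 'b eigpoly"]] ix_lt[of a] ix_lt[of b]
    unfolding n_def[symmetric] by simp
  also have "\<dots> = cjm n (pm n y c) (\<lambda>j. y (c, n, j)) $$ (ix a, ix b)"
    unfolding cjm_hom[OF ev_hom GP_carrier] map_GP by simp
  finally show "ev y (Phi (Var v)) = ev (mpt (\<lambda>c. cjm n (pm n y c) (\<lambda>j. y (c, n, j)))) (Var v)"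
    by (simp add: mpt_def v)
qed

text \<open>Where this is nonzero, the parameters describe two diagonalizable matrices with simple
  spectrum.\<close>

definition gdisc :: "'a::comm_ring_1 eigpoly" where
  "gdisc = gdet n False * gdet n True * (vd {..<n} (\<lambda>j. Var (False, n, j)) * vd {..<n} (\<lambda>j. Var (True, n, j)))"

lemma gdisc_nonzero: "gdisc \<noteq> (0 :: 'a::idom eigpoly)"
proof -
  have "gdet n c \<noteq> (0 :: 'a eigpoly)" for c using prime_elem_gdet[OF n_pos, of c, where 'a = 'a] unfolding prime_elem_def by blast
  moreover have "vd {..<n} (\<lambda>j. Var (c, n, j)) \<noteq> (0 :: 'a eigpoly)" for c
    by (rule vd_nonzero) (auto simp: inj_on_def inj_Var)
  ultimately show ?thesis by (simp add: gdisc_def)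
qed

lemma ev_vd: "ev y (vd R (\<lambda>j. f j)) = vd R (\<lambda>j. ev y (f j))"
proof -
  interpret comm_ring_hom "ev y" by (rule ev_hom)
  show ?thesis unfolding vd_def by (simp add: hom_prod hom_minus)
qed

lemma vd_nonzero_inj:
  assumes "vd {..<n} l \<noteq> (0 :: 'b::idom)"
  shows "inj_on l {..<n}"
proof (rule inj_onI, rule ccontr)
  fix i j assume ij: "i \<in> {..<n}" "j \<in> {..<n}" "l i = l j" "i \<noteq> j"
  have "vd {..<n} l = 0" if "a < b" "b < n" "l a = l b" for a b
  proof -
    have "(\<Prod>a\<in>{a \<in> {..<n}. a < b}. l b - l a) = 0" using that by (intro prod_zero) (auto intro!: exI[of _ a])
    then show ?thesis unfolding vd_def using that by (intro prod_zero) auto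
  qed
  then show False using assms ij by (metis lessThan_iff linorder_neqE_nat)
qed

lemma gdiscD:
  fixes y :: "bool \<times> nat \<times> nat \<Rightarrow> 'a::field"
  assumes "ev y gdisc \<noteq> 0"
  shows "det (pm n y c) \<noteq> 0" "inj_on (\<lambda>j. y (c, n, j)) {..<n}"
proof -
  interpret comm_ring_hom "ev y" by (rule ev_hom)
  have a: "det (pm n y False) \<noteq> 0" "det (pm n y True) \<noteq> 0" "vd {..<n} (\<lambda>j. y (False, n, j)) \<noteq> 0" "vd {..<n} (\<lambda>j. y (True, n, j)) \<noteq> 0"
    using assms by (auto simp: gdisc_def hom_mult ev_gdet ev_vd)
  then show "det (pm n y c) \<noteq> 0" by (cases c) auto
  show "inj_on (\<lambda>j. y (c, n, j)) {..<n}" using a by (cases c) (auto intro: vd_nonzero_inj)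
qed

definition shuf :: "(bool \<Rightarrow> nat \<Rightarrow> nat) \<Rightarrow> 'a::comm_ring_1 eigpoly \<Rightarrow> 'a eigpoly" where
  "shuf \<sigma> = mev Cst (\<lambda>(c, i, j). Var (c, i, \<sigma> c j))"

lemma shuf_hom: "comm_ring_hom (shuf \<sigma>)"
  unfolding shuf_def by (rule comm_ring_hom.mev_hom[OF Cst_hom])

lemma ev_shuf: "ev y (shuf \<sigma> u) = ev (\<lambda>(c, i, j). y (c, i, \<sigma> c j)) u"
  by (rule mpoly_hom_unique[OF comm_ring_hom_compose[OF shuf_hom ev_hom] ev_hom])
    (auto simp: shuf_def comm_ring_hom.mev_Cst[OF Cst_hom] comm_ring_hom.mev_Var[OF Cst_hom])

lemma shuf_Dpol: "h \<le> n \<Longrightarrow> length xs = h \<Longrightarrow> length ys = n - h \<Longrightarrow>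
    shuf \<sigma> (Dpol n xs ys) = Dpol n (map (\<sigma> False) xs) (map (\<sigma> True) ys)"
  unfolding Dpol_def dcols_hom[OF shuf_hom] unfolding dcols_def
  by (intro mdet_cong) (auto simp: shuf_def comm_ring_hom.mev_Var[OF Cst_hom])

text \<open>Reordering the eigenvectors together with the eigenvalues does not change the matrices.\<close>
lemma shuf_Phi:
  fixes u :: "('n var, 'a::alg_closed_field) mpoly"
  assumes \<sigma>: "\<And>c. \<sigma> c permutes {0..<n}"
  shows "shuf \<sigma> (Phi u) = Phi u"
proof (rule mpoly_eqI_generic[OF infinite_UNIV_alg_closed gdisc_nonzero])
  fix y :: "bool \<times> nat \<times> nat \<Rightarrow> 'a" assume "ev y gdisc \<noteq> 0"
  note nz = gdiscD(1)[OF this]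
  let ?y = "\<lambda>(c, i, j). y (c, i, \<sigma> c j)"
  have "cjm n (pm n ?y c) (\<lambda>j. ?y (c, n, j)) = cjm n (pm n y c) (\<lambda>j. y (c, n, j))" for c
  proof -
    let ?P = "pm n y c" and ?P' = "pm n ?y c" and ?l = "\<lambda>j. y (c, n, j)" and ?l' = "\<lambda>j. ?y (c, n, j)"
    let ?M = "cjm n ?P ?l" and ?M' = "cjm n ?P' ?l'"
    have s: "\<sigma> c j < n" if "j < n" for j using \<sigma> that by (simp add: permutes_lt)
    have detP': "det ?P' = signof (\<sigma> c) * det ?P"
      using mdet_permute_cols[OF \<sigma>[of c], of "\<lambda>i j. y (c, i, j)"] by (simp add: pm_def mdet_def)
    \<comment> \<open>The sign of the permutation is squared away; the additional factor
      \<open>det P\<close> in \<open>cjm\<close> serves this purpose.\<close>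
    have sq: "det ?P' ^ 2 = det ?P ^ 2"
    proof -
      have "(signof (\<sigma> c) :: 'a) ^ 2 = 1" by (cases "\<sigma> c" rule: sign_cases) simp_all
      then show ?thesis unfolding detP' by (simp add: power_mult_distrib)
    qed
    have M: "?M \<in> carrier_mat n n" "?M' \<in> carrier_mat n n" by (simp_all add: cjm_carrier)
    \<comment> \<open>Both matrices act on the same eigenvectors with the same eigenvalues, listed
      in a different order.\<close>
    have "?M' * ?P = ?P * dg n (\<lambda>j. det ?P ^ 2 * ?l j)"
    proof (rule eq_matI)
      fix i j assume "i < dim_row (?P * dg n (\<lambda>j. det ?P ^ 2 * ?l j))" "j < dim_col (?P * dg n (\<lambda>j. det ?P ^ 2 * ?l j))"
      then have ij: "i < n" "j < n" by (auto simp: pm_def)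
      let ?j = "inv_into UNIV (\<sigma> c) j"
      have j': "?j < n" using permutes_lt[OF permutes_inv[OF \<sigma>[of c]] ij(2)] .
      have sj: "\<sigma> c ?j = j" by (rule permutes_inverses(1)[OF \<sigma>])
      have "(?M' * ?P) $$ (i, j) = (?M' * ?P') $$ (i, ?j)"
        unfolding index_mult_mat_sum[OF M(2) pm_carrier ij] index_mult_mat_sum[OF M(2) pm_carrier ij(1) j']
        using ij j' sj by (intro sum.cong refl) (simp add: pm_def)
      also have "\<dots> = ?P' $$ (i, ?j) * (det ?P' ^ 2 * ?l' ?j)"
        unfolding cjm_diag[OF pm_carrier] by (rule index_mult_dg[OF pm_carrier ij(1) j'])
      also have "\<dots> = ?P $$ (i, j) * (det ?P ^ 2 * ?l j)" unfolding sq using ij j' sj by (simp add: pm_def)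
      finally show "(?M' * ?P) $$ (i, j) = (?P * dg n (\<lambda>j. det ?P ^ 2 * ?l j)) $$ (i, j)"
        unfolding index_mult_dg[OF pm_carrier ij] .
    qed (use M in \<open>auto simp: pm_def\<close>)
    then have "?M' * ?P = ?M * ?P" unfolding cjm_diag[OF pm_carrier] .
    then show ?thesis by (rule mat_cancel_right[OF M(2,1) pm_carrier nz])
  qed
  then show "ev y (shuf \<sigma> (Phi u)) = ev y (Phi u)" unfolding ev_shuf ev_Phi by simp
qed

text \<open>The columns of the two eigenvector matrices can be permuted independently, which carries
  any selection of columns to any other, and \<open>shuf_Phi\<close> keeps \<open>Phi u\<close>
  fixed.\<close>

lemma Dpol_dvd_symmetric:
  fixes u :: "('n var, 'a::alg_closed_field) mpoly"
  assumes pq: "p < length KB" "q < length KB" "p' < length KB" "q' < length KB"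
    and dvd: "Dpol n (KB' ! p) (KB ! q) dvd Phi u"
  shows "Dpol n (KB' ! p') (KB ! q') dvd Phi u"
proof -
  note a = KB_nth[OF pq(1,2)] and b = KB_nth[OF pq(3,4)]
  obtain \<sigma> where \<sigma>: "\<sigma> permutes {0..<n}" "map \<sigma> (KB' ! p) = KB' ! p'"
    by (rule exists_permutation_lists[of "KB' ! p" "KB' ! p'" n]) (use a b in auto)
  obtain \<tau> where \<tau>: "\<tau> permutes {0..<n}" "map \<tau> (KB ! q) = KB ! q'"
    by (rule exists_permutation_lists[of "KB ! q" "KB ! q'" n]) (use a b in auto)
  let ?s = "\<lambda>c. if c then \<tau> else \<sigma>"
  have "shuf ?s (Dpol n (KB' ! p) (KB ! q)) dvd shuf ?s (Phi u)" by (rule hom_dvd[OF shuf_hom dvd])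
  moreover have "shuf ?s (Dpol n (KB' ! p) (KB ! q)) = (Dpol n (KB' ! p') (KB ! q') :: 'a eigpoly)"
    using shuf_Dpol[of "KB' ! p" "KB ! q" ?s, where 'a = 'a] a hk \<sigma>(2) \<tau>(2) by simp
  moreover have "shuf ?s (Phi u) = Phi u" by (rule shuf_Phi) (use \<sigma> \<tau> in auto)
  ultimately show ?thesis by simp
qed

definition Fm :: "('n var, 'a::comm_ring_1) mpoly" where
  "Fm = Poly_Mapping.map of_int (Fpol KB KB')"

lemma mev_Fm:
  fixes x :: "'n var \<Rightarrow> 'b::comm_ring_1" and f :: "'a::comm_ring_1 \<Rightarrow> 'b"
  assumes "comm_ring_hom f"
  shows "mev f x Fm = fdet n KB KB' (vmat x False) (vmat x True)"
proof -
  have "mev f x Fm = mev (\<lambda>a. f (of_int a)) x (Fpol KB KB')" unfolding Fm_def by (rule mev_map[OF comm_ring_hom_of_int assms])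
  also have "\<dots> = fdet n KB KB' (vmat x False) (vmat x True)"
    unfolding n_def by (rule mev_Fpol[OF KB[unfolded n_def] comm_ring_hom_compose[OF comm_ring_hom_of_int assms]])
  finally show ?thesis .
qed

lemma ev_Fm: "ev x Fm = fdet n KB KB' (vmat x False) (vmat x True)"
  unfolding ev_def by (rule mev_Fm[OF comm_ring_hom_id])

abbreviation "Nn \<equiv> length KB"
abbreviation "cA \<equiv> (n - 1) choose (k - 1)"
abbreviation "cC \<equiv> (n - 2) choose (k - 1)"

text \<open>The eigenvalues of the matrix produced by \<open>cjm\<close> are
  \<open>gdet n c ^ 2 * Var (c, n, j)\<close>, hence the square.\<close>

definition VV :: "bool \<Rightarrow> 'a::comm_ring_1 eigpoly" where
  "VV c = vd {..<n} (\<lambda>j. gdet n c ^ 2 * Var (c, n, j))"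

text \<open>This is \<open>fdet_diagz\<close> for the parametrized pair. It displays every prime
  that can divide \<open>Phi Fm\<close>: determinants, eigenvalue differences, and each
  \<open>Dpol\<close> a single time.\<close>

lemma Phi_Fm:
  "\<exists>s\<in>{1, - 1 :: int}. Phi (Fm :: ('n var, 'a::alg_closed_field) mpoly) * (gdet n False ^ (Nn * Nn) * gdet n True ^ (cA * Nn)) =
    of_int s * (gdet n False ^ (cA * Nn) * (VV False * VV True) ^ (cC * Nn)) * (\<Prod>p<Nn. \<Prod>q<Nn. Dpol n (KB' ! p) (KB ! q))"
proof -
  obtain s where s: "s \<in> {1, - 1 :: int}" and
    F: "\<And>A B P Q l m. diagz n A P l \<Longrightarrow> inj_on l {..<n} \<Longrightarrow> diagz n B Q m \<Longrightarrow> inj_on m {..<n} \<Longrightarrow>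
    fdet n KB KB' A (B :: 'a mat) * det P ^ (Nn * Nn) * det Q ^ (cA * Nn) =
      of_int s * det P ^ (cA * Nn) * (vd {..<n} l * vd {..<n} m) ^ (cC * Nn) *
      (\<Prod>p<Nn. \<Prod>q<Nn. dcols n (\<lambda>i j. P $$ (i, j)) (\<lambda>i j. Q $$ (i, j)) (KB' ! p) (KB ! q))"
  proof -
    from fdet_diagz[OF KB KB' hk, where 'a = 'a] show thesis by (elim bexE) (rule that, assumption, blast)
  qed
  have "Phi (Fm :: ('n var, 'a) mpoly) * (gdet n False ^ (Nn * Nn) * gdet n True ^ (cA * Nn)) =
    of_int s * (gdet n False ^ (cA * Nn) * (VV False * VV True) ^ (cC * Nn)) * (\<Prod>p<Nn. \<Prod>q<Nn. Dpol n (KB' ! p) (KB ! q))"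
  proof (rule mpoly_eqI_generic[OF infinite_UNIV_alg_closed gdisc_nonzero])
    fix y :: "bool \<times> nat \<times> nat \<Rightarrow> 'a" assume "ev y gdisc \<noteq> 0"
    note nz = gdiscD[OF this]
    interpret e: comm_ring_hom "ev y" by (rule ev_hom)
    let ?M = "\<lambda>c. cjm n (pm n y c) (\<lambda>j. y (c, n, j))" and ?l = "\<lambda>c j. det (pm n y c) ^ 2 * y (c, n, j)"
    have d: "diagz n (?M c) (pm n y c) (?l c)" for c by (rule cjm_diagz[OF pm_carrier nz(1)])
    have i: "inj_on (?l c) {..<n}" for c using nz(2)[of c] nz(1)[of c] by (auto simp: inj_on_def)
    have vm: "vmat (mpt ?M :: 'n var \<Rightarrow> 'a) c = ?M c" for c
      by (rule vmat_mpt) (simp add: n_def[symmetric] cjm_carrier)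
    have D: "dcols n (\<lambda>i j. pm n y False $$ (i, j)) (\<lambda>i j. pm n y True $$ (i, j)) (KB' ! p) (KB ! q) =
      ev y (Dpol n (KB' ! p) (KB ! q))" if "p < Nn" "q < Nn" for p q
      unfolding ev_Dpol dcols_def
    proof (rule mdet_cong)
      fix i j assume ij: "i < n" "j < n"
      have "KB' ! p ! j < n" if "j < h" for j using kbaseD(5)[OF KB', of p j] that \<open>p < Nn\<close> length_KB'_KB by simp
      moreover have "KB ! q ! (j - h) < n" if "\<not> j < h" using kbaseD(5)[OF KB \<open>q < Nn\<close>, of "j - h"] that ij hk by simp
      ultimately show "(if j < length (KB' ! p) then pm n y False $$ (i, KB' ! p ! j) else pm n y True $$ (i, KB ! q ! (j - length (KB' ! p)))) =
        (if j < length (KB' ! p) then y (False, i, KB' ! p ! j) else y (True, i, KB ! q ! (j - length (KB' ! p))))"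
        using ij KB_nth(1)[OF that] by (auto simp: pm_def)
    qed
    have v: "ev y (VV c) = vd {..<n} (?l c)" for c
      unfolding VV_def ev_vd by (simp add: e.hom_mult e.hom_power ev_gdet)
    have "(\<Prod>p<Nn. \<Prod>q<Nn. dcols n (\<lambda>i j. pm n y False $$ (i, j)) (\<lambda>i j. pm n y True $$ (i, j)) (KB' ! p) (KB ! q)) =
      (\<Prod>p<Nn. \<Prod>q<Nn. ev y (Dpol n (KB' ! p) (KB ! q)))"
      by (intro prod.cong refl D) auto
    then show "ev y (Phi Fm * (gdet n False ^ (Nn * Nn) * gdet n True ^ (cA * Nn))) =
      ev y (of_int s * (gdet n False ^ (cA * Nn) * (VV False * VV True) ^ (cC * Nn)) * (\<Prod>p<Nn. \<Prod>q<Nn. Dpol n (KB' ! p) (KB ! q)))"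
      using F[OF d[of False] i[of False] d[of True] i[of True]]
      unfolding e.hom_mult e.hom_power e.hom_prod e.hom_of_int ev_Phi ev_Fm vm ev_gdet v by (simp add: mult_ac)
  qed
  then show ?thesis using s by blast
qed

definition diffs :: "'a::comm_ring_1 eigpoly set" where
  "diffs = {Var (c, n, b) - Var (c, n, a) |c a b. a < b \<and> b < n}"

definition Dset :: "'a::comm_ring_1 eigpoly set" where
  "Dset = {Dpol n (KB' ! p) (KB ! q) |p q. p < Nn \<and> q < Nn}"

lemma prime_elem_factors:
  assumes "x \<in> range (gdet n) \<union> diffs \<union> Dset"
  shows "prime_elem (x :: 'a::idom eigpoly)"
proof -
  consider c where "x = gdet n c" | "x \<in> diffs" | "x \<in> Dset" using assms by auto
  then show ?thesis
  proof cases
    case 1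
    then show ?thesis using prime_elem_gdet[OF n_pos] by simp
  next
    case 2
    then show ?thesis by (auto simp: diffs_def intro!: prime_elem_Var_diff)
  next
    case 3
    then obtain p q where "x = Dpol n (KB' ! p) (KB ! q)" "p < Nn" "q < Nn" by (auto simp: Dset_def)
    then show ?thesis using KB_nth[of p q] hk n_pos by (auto intro!: prime_elem_Dpol)
  qed
qed

lemma VV_pp: "VV c \<in> pp (range (gdet n) \<union> diffs \<union> S)"
proof -
  have e: "gdet n c ^ 2 * Var (c, n, b) - gdet n c ^ 2 * Var (c, n, a) = gdet n c ^ 2 * (Var (c, n, b) - Var (c, n, a))" for a b
    by (simp add: right_diff_distrib)
  show ?thesis unfolding VV_def vd_def e
    by (intro pp_prod pp_mult pp_power pp_incl) (auto simp: diffs_def)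
qed

lemma Dpol_prime:
  assumes "p < Nn" "q < Nn"
  shows "prime_elem (Dpol n (KB' ! p) (KB ! q) :: 'a::idom eigpoly)"
  using assms by (intro prime_elem_factors) (auto simp: Dset_def)

lemma Dpol_not_dvd:
  assumes pq: "p < Nn" "q < Nn"
  shows "\<not> Dpol n (KB' ! p) (KB ! q) dvd (gdet n c :: 'a::idom eigpoly)"
    "x \<in> diffs \<Longrightarrow> \<not> Dpol n (KB' ! p) (KB ! q) dvd (x :: 'a::idom eigpoly)"
    "p' < Nn \<Longrightarrow> q' < Nn \<Longrightarrow> (p, q) \<noteq> (p', q') \<Longrightarrow> \<not> Dpol n (KB' ! p) (KB ! q) dvd (Dpol n (KB' ! p') (KB ! q') :: 'a eigpoly)"
proof -
  note a = KB_nth[OF pq]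
  show "\<not> Dpol n (KB' ! p) (KB ! q) dvd (gdet n c :: 'a eigpoly)" using a hk by (intro Dpol_not_dvd_gdet) auto
  show "x \<in> diffs \<Longrightarrow> \<not> Dpol n (KB' ! p) (KB ! q) dvd (x :: 'a eigpoly)"
    using a hk by (auto simp: diffs_def Dpol_not_dvd_diff)
  show "\<not> Dpol n (KB' ! p) (KB ! q) dvd (Dpol n (KB' ! p') (KB ! q') :: 'a eigpoly)"
    if b: "p' < Nn" "q' < Nn" "(p, q) \<noteq> (p', q')"
    using a KB_nth[OF b(1,2)] b(3) hk kbase_set_eq[OF KB pq(2) b(2)] kbase_set_eq[OF KB', of p p'] pq b length_KB'_KB
    by (intro Dpol_not_dvd_Dpol) auto
qed

lemma not_dvd_pp:
  assumes "prime_elem (d :: 'b::idom)" "x \<in> pp S" "\<And>s. s \<in> S \<Longrightarrow> \<not> d dvd s"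
  shows "\<not> d dvd x"
proof
  assume dx: "d dvd x"
  obtain c ps where c: "c dvd 1" "set ps \<subseteq> S" "x = c * prod_list ps" using assms(2) unfolding pp_def by blast
  have nu: "\<not> d dvd 1" using assms(1) by (auto simp: prime_elem_def)
  have "d dvd prod_list ps \<Longrightarrow> set ps \<subseteq> S \<Longrightarrow> False" for ps
    using nu assms(1,3) by (induction ps) (auto dest: prime_elem_dvd_multD)
  moreover have "d dvd c \<or> d dvd prod_list ps" using dx c(3) prime_elem_dvd_multD[OF assms(1)] by auto
  ultimately show False using c nu dvd_trans by blast
qed

text \<open>Each \<open>D\<close> divides \<open>Phi Fm\<close> exactly once, and by symmetry all of them divide the same factor.\<close>
lemma D_free_factor:
  fixes f g :: "('n var, 'a::alg_closed_field) mpoly"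
  assumes fg: "f * g = Fm \<or> f * g = - Fm"
  shows "(\<forall>x\<in>Dset. \<not> x dvd Phi f) \<or> (\<forall>x\<in>Dset. \<not> x dvd Phi g)"
proof (rule ccontr)
  assume "\<not> ?thesis"
  then obtain p q p' q' where a: "p < Nn" "q < Nn" "Dpol n (KB' ! p) (KB ! q) dvd Phi f"
    "p' < Nn" "q' < Nn" "Dpol n (KB' ! p') (KB ! q') dvd Phi g" by (auto simp: Dset_def)
  interpret Phi: comm_ring_hom Phi by (rule Phi_hom)
  let ?D = "Dpol n (KB' ! p) (KB ! q) :: 'a eigpoly"
  have "?D dvd Phi g" by (rule Dpol_dvd_symmetric[OF a(4,5,1,2,6)])
  then have "?D * ?D dvd Phi f * Phi g" using a(3) by (rule mult_dvd_mono[rotated])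
  then have "?D * ?D dvd Phi (f * g)" by (simp add: Phi.hom_mult)
  then have 1: "?D * ?D dvd Phi Fm" using fg by (auto simp: Phi.hom_uminus)
  obtain s where s: "s \<in> {1, - 1 :: int}" and E: "Phi (Fm :: ('n var, 'a) mpoly) * (gdet n False ^ (Nn * Nn) * gdet n True ^ (cA * Nn)) =
    of_int s * (gdet n False ^ (cA * Nn) * (VV False * VV True) ^ (cC * Nn)) * (\<Prod>p<Nn. \<Prod>q<Nn. Dpol n (KB' ! p) (KB ! q))"
    using Phi_Fm by blast
  let ?I = "{..<Nn} \<times> {..<Nn} - {(p, q)}"
  let ?W = "of_int s * (gdet n False ^ (cA * Nn) * (VV False * VV True) ^ (cC * Nn)) * (\<Prod>(p', q')\<in>?I. Dpol n (KB' ! p') (KB ! q')) :: 'a eigpoly"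
  have "(\<Prod>p<Nn. \<Prod>q<Nn. Dpol n (KB' ! p) (KB ! q)) = (\<Prod>(p', q')\<in>{..<Nn} \<times> {..<Nn}. Dpol n (KB' ! p') (KB ! q') :: 'a eigpoly)"
    by (rule prod.cartesian_product)
  also have "\<dots> = ?D * (\<Prod>(p', q')\<in>?I. Dpol n (KB' ! p') (KB ! q'))"
    using prod.remove[of "{..<Nn} \<times> {..<Nn}" "(p, q)" "\<lambda>(p', q'). Dpol n (KB' ! p') (KB ! q') :: 'a eigpoly"] a by simp
  finally have "Phi (Fm :: ('n var, 'a) mpoly) * (gdet n False ^ (Nn * Nn) * gdet n True ^ (cA * Nn)) = ?D * ?W"
    unfolding E by (simp add: mult_ac)
  \<comment> \<open>After cancelling one \<open>?D\<close>, the other would divide a product of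
    primes none of which it divides.\<close>
  then have "?D * ?D dvd ?D * ?W" using 1 by (metis dvd_mult2)
  moreover have D0: "?D \<noteq> 0" using Dpol_prime[OF a(1,2), where 'a = 'a] unfolding prime_elem_def by blast
  ultimately have "?D dvd ?W" by simp
  let ?S = "range (gdet n) \<union> diffs \<union> {Dpol n (KB' ! p') (KB ! q') |p' q'. p' < Nn \<and> q' < Nn \<and> (p, q) \<noteq> (p', q')} :: 'a eigpoly set"
  have "?W \<in> pp ?S"
  proof (intro pp_mult pp_power pp_prod VV_pp)
    show "of_int s \<in> pp ?S" using s by (auto intro: pp_unit)
    show "gdet n False \<in> pp ?S" by (intro pp_incl) auto
  qed (auto intro!: pp_incl)
  then have "\<not> ?D dvd ?W"
    by (rule not_dvd_pp[OF Dpol_prime[OF a(1,2)]]) (use Dpol_not_dvd[OF a(1,2)] in blast)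
  then show False using \<open>?D dvd ?W\<close> by simp
qed

text \<open>With eigenvector matrices of determinant \<open>1\<close> the factors
  \<open>gdet\<close> become invisible, and only differences of eigenvalues are left.\<close>

lemma prod_list_evaluation:
  "set qs \<subseteq> range (gdet n) \<union> diffs \<Longrightarrow> \<exists>ds. (\<forall>(c, a, b)\<in>set ds. a < b \<and> b < n) \<and>
    (\<forall>y :: bool \<times> nat \<times> nat \<Rightarrow> 'a::comm_ring_1. (\<forall>c. ev y (gdet n c) = 1) \<longrightarrow>
      ev y (prod_list qs) = (\<Prod>(c, a, b)\<leftarrow>ds. y (c, n, b) - y (c, n, a)))"
proof (induction qs)
  case Nil
  interpret e: comm_ring_hom "ev y" for y :: "bool \<times> nat \<times> nat \<Rightarrow> 'a" by (rule ev_hom)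
  show ?case by (intro exI[of _ "[]"]) simp
next
  case (Cons q qs)
  interpret e: comm_ring_hom "ev y" for y :: "bool \<times> nat \<times> nat \<Rightarrow> 'a" by (rule ev_hom)
  obtain ds where ds: "\<forall>(c, a, b)\<in>set ds. a < b \<and> b < n"
    "\<And>y :: bool \<times> nat \<times> nat \<Rightarrow> 'a. (\<And>c. ev y (gdet n c) = 1) \<Longrightarrow>
      ev y (prod_list qs) = (\<Prod>(c, a, b)\<leftarrow>ds. y (c, n, b) - y (c, n, a))" using Cons by auto
  consider c where "q = gdet n c" | "q \<in> diffs" using Cons.prems by auto
  then show ?case
  proof cases
    case 1
    then show ?thesis using ds by (intro exI[of _ ds]) (auto simp: e.hom_mult)
  next
    case 2
    then obtain c a b where "q = Var (c, n, b) - Var (c, n, a)" "a < b" "b < n" by (auto simp: diffs_def)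
    then show ?thesis using ds by (intro exI[of _ "(c, a, b) # ds"]) (auto simp: e.hom_mult e.hom_minus)
  qed
qed

text \<open>Such a factor is a constant times a product of eigenvalue differences. On the curve of companion
  matrices it would tend to zero at the nilpotent pair, where \<open>Fm\<close> is a unit.\<close>
lemma D_free_const:
  fixes f g :: "('n var, 'a::alg_closed_field) mpoly"
  assumes fg: "f * g = Fm \<or> f * g = - Fm" and free: "\<forall>x\<in>Dset. \<not> x dvd Phi f"
  shows "\<exists>a. f = Cst a"
proof -
  interpret Phi: comm_ring_hom Phi by (rule Phi_hom)
  obtain s where s: "s \<in> {1, - 1 :: int}" and E: "Phi (Fm :: ('n var, 'a) mpoly) * (gdet n False ^ (Nn * Nn) * gdet n True ^ (cA * Nn)) =
    of_int s * (gdet n False ^ (cA * Nn) * (VV False * VV True) ^ (cC * Nn)) * (\<Prod>p<Nn. \<Prod>q<Nn. Dpol n (KB' ! p) (KB ! q))"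
    (is "_ = ?W") using Phi_Fm by blast
  let ?S = "range (gdet n) \<union> diffs \<union> Dset :: 'a eigpoly set" and ?T = "range (gdet n) \<union> diffs :: 'a eigpoly set"
  have W: "?W \<in> pp ?S"
  proof (intro pp_mult pp_power pp_prod VV_pp)
    show "of_int s \<in> pp ?S" using s by (auto intro: pp_unit)
    show "gdet n False \<in> pp ?S" by (intro pp_incl) auto
    show "Dpol n (KB' ! p) (KB ! q) \<in> pp ?S" if "p \<in> {..<Nn}" "q \<in> {..<Nn}" for p q
      using that by (intro pp_incl) (auto simp: Dset_def)
  qed
  have "Phi f dvd Phi Fm"
    using fg by (metis Phi.hom_mult Phi.hom_uminus dvd_minus_iff dvd_triv_left)
  then have "Phi f dvd ?W" unfolding E[symmetric] by (rule dvd_mult2)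
  then have "Phi f \<in> pp ?T"
  proof (rule pp_divisor[OF _ W, rotated])
    show "p \<in> ?T" if "p \<in> ?S" "p dvd Phi f" for p using that free by blast
    show "prime_elem p" if "p \<in> ?S" for p using that by (rule prime_elem_factors)
  qed
  then obtain c qs where c: "c dvd 1" "set qs \<subseteq> ?T" "Phi f = c * prod_list qs" unfolding pp_def by blast
  obtain a where a: "c = Cst a" using unit_mpoly_const[OF infinite_UNIV_alg_closed c(1)] by blast
  obtain ds where ds: "\<forall>(c, a, b)\<in>set ds. a < b \<and> b < n"
    "\<And>y :: bool \<times> nat \<times> nat \<Rightarrow> 'a. (\<And>c. ev y (gdet n c) = 1) \<Longrightarrow>
      ev y (prod_list qs) = (\<Prod>(c, a, b)\<leftarrow>ds. y (c, n, b) - y (c, n, a))"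
    using prod_list_evaluation[OF c(2)] by blast
  have val: "ev x f = a * (\<Prod>(c, i, j)\<leftarrow>ds. l c j - l c i)"
    if d: "\<And>c. \<exists>P. diagz n (vmat x c) P (l c)" for x :: "'n var \<Rightarrow> 'a" and l
  proof -
    have "\<exists>P. diagz n (vmat x c) P (l c) \<and> det P = 1" for c using d[of c] diagz_det_1[OF _ n_pos] by metis
    then obtain P where P: "\<And>c. diagz n (vmat x c) (P c) (l c)" "\<And>c. det (P c) = 1" by metis
    \<comment> \<open>Normalized eigenvectors in the rows below \<open>n\<close> and the eigenvalues
      in row \<open>n\<close>; at this point \<open>Phi\<close> substitutes exactly
      \<open>x\<close>.\<close>
    define y where "y = (\<lambda>(c, i, j). if i < n then P c $$ (i, j) else l c j)"
    have pm: "pm n y c = P c" for c using P(1)[of c] by (intro eq_matI) (auto simp: pm_def y_def diagz_def)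
    have cj: "cjm n (pm n y c) (\<lambda>j. y (c, n, j)) = vmat x c" for c
      using cjm_det_1[OF P(1)[of c] P(2)[of c]] unfolding pm by (simp add: y_def)
    interpret e: comm_ring_hom "ev y" by (rule ev_hom)
    have "ev x f = ev y (Phi f)" unfolding ev_Phi cj mpt_vmat ..
    also have "\<dots> = a * ev y (prod_list qs)" unfolding c(3) a e.hom_mult by simp
    also have "ev y (prod_list qs) = (\<Prod>(c, i, j)\<leftarrow>ds. y (c, n, j) - y (c, n, i))"
      by (rule ds(2)) (simp add: ev_gdet pm P(2))
    finally show ?thesis by (simp add: y_def)
  qed
  have "ds = []"
  proof (rule ccontr)
    assume "ds \<noteq> []"
    obtain e :: "nat \<Rightarrow> 'a" where e: "inj e" "\<And>i. e i \<noteq> 0" using ex_inj_nonzero[OF infinite_UNIV_alg_closed] by blast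
    let ?C = "\<lambda>l c. if c then cmat' n l else cmat n l"
    let ?x = "\<lambda>t. mpt (?C (\<lambda>i. t * e i)) :: 'n var \<Rightarrow> 'a"
    have cr: "?C l c \<in> carrier_mat (card (UNIV :: 'n set)) (card (UNIV :: 'n set))" for l :: "nat \<Rightarrow> 'a" and c
      by (simp add: n_def[symmetric])
    let ?p = "\<lambda>u. mev (\<lambda>a. [:a:]) (mpt (?C (curve e))) u"
    have hp: "comm_ring_hom ?p" by (rule comm_ring_hom.mev_hom[OF comm_ring_hom_const_poly])
    interpret p: comm_ring_hom ?p by (rule hp)
    have pev: "poly (?p u) t = ev (?x t) u" for u t
    proof (rule mpoly_hom_unique[OF comm_ring_hom_compose[OF hp poly_eval_hom] ev_hom])
      fix v :: "'n var"
      obtain c i j where v: "v = (c, i, j)" by (cases v)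
      have "poly (?C (curve e) c $$ (ix i, ix j)) t = map_mat (\<lambda>q. poly q t) (?C (curve e) c) $$ (ix i, ix j)"
        using ix_lt[of i] ix_lt[of j] by (simp add: n_def[symmetric])
      also have "map_mat (\<lambda>q. poly q t) (?C (curve e) c) = ?C (\<lambda>i. t * e i) c"
        using cmat_hom[OF poly_eval_hom, of t n "curve e"] by simp
      finally show "poly (?p (Var v)) t = ev (?x t) (Var v)"
        by (simp add: comm_ring_hom.mev_Var[OF comm_ring_hom_const_poly] v mpt_def)
    qed (simp add: comm_ring_hom.mev_Cst[OF comm_ring_hom_const_poly])
    let ?\<kappa> = "a * (\<Prod>(c, i, j)\<leftarrow>ds. e j - e i)"
    \<comment> \<open>Each eigenvalue difference is proportional to the parameter
      \<open>t\<close>.\<close>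
    have "?p f = monom ?\<kappa> (length ds)"
    proof (rule poly_eqI_nonzero[OF infinite_UNIV_alg_closed])
      fix t :: 'a assume t: "t \<noteq> 0"
      let ?l = "\<lambda>i. t * e i"
      have "inj_on ?l {..<n}" using t by (intro inj_onI injD[OF e(1)]) simp
      then have v0: "mdet n (\<lambda>i j. ?l j ^ i) \<noteq> 0" by (rule vandermonde_nonzero)
      have "diagz n (cmat n ?l) (mat n n (\<lambda>(i, j). ?l j ^ i)) ?l"
        unfolding diagz_def using cmat_diag[of n ?l] v0 by (simp add: mdet_def)
      moreover have "diagz n (cmat' n ?l) (mat n n (\<lambda>(i, j). ?l j ^ (n - 1 - i))) ?l"
      proof -
        have "det (mat n n (\<lambda>(i, j). ?l j ^ (n - 1 - i))) \<noteq> 0"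
        proof (rule distinct_eigenvectors_det[OF cmat_carrier(2) _ cmat'_diag \<open>inj_on ?l {..<n}\<close>])
          fix j assume "j < n"
          then show "\<exists>p<n. mat n n (\<lambda>(i, j). ?l j ^ (n - 1 - i)) $$ (p, j) \<noteq> 0"
            using t e(2) by (intro exI[of _ 0]) auto
        qed simp
        then show ?thesis unfolding diagz_def using cmat'_diag[of n ?l] by (intro conjI cmat_carrier mat_carrier)
      qed
      ultimately have "\<exists>P. diagz n (vmat (?x t) c) P ?l" for c
        unfolding vmat_mpt[of "?C ?l", OF cr] by (cases c) auto
      then have "ev (?x t) f = a * (\<Prod>(c, i, j)\<leftarrow>ds. ?l j - ?l i)" by (rule val)
      also have "(\<Prod>(c, i, j)\<leftarrow>ds. ?l j - ?l i) = (\<Prod>(c, i, j)\<leftarrow>ds. e j - e i) * t ^ length ds"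
        by (induction ds) (auto simp: right_diff_distrib[symmetric] mult_ac)
      finally show "poly (?p f) t = poly (monom ?\<kappa> (length ds)) t" by (simp add: pev poly_monom mult_ac)
    qed
    \<comment> \<open>A single difference already forces \<open>f\<close>, and with it
      \<open>Fm\<close>, to vanish at the nilpotent pair.\<close>
    then have "poly (?p f) 0 = 0" using \<open>ds \<noteq> []\<close> by (simp add: poly_monom)
    then have "poly (?p (f * g)) 0 = 0" by (simp add: p.hom_mult)
    then have "poly (?p Fm) 0 = 0" using fg by (auto simp: p.hom_uminus)
    then have "ev (?x 0) Fm = 0" by (simp add: pev)
    moreover have "ev (?x 0) Fm = fdet n KB KB' (nilp n) (nilp' n)"
      unfolding ev_Fm vmat_mpt[of "?C (\<lambda>i. 0 * e i)", OF cr] by (simp add: cmat_0[OF n_pos])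
    ultimately show False using fdet_nilp[OF KB KB' hk, where 'a = 'a] by auto
  qed
  have "f = Cst a"
  proof (rule mpoly_eqI_vmat)
    fix x :: "'n var \<Rightarrow> 'a"
    assume "\<And>c. \<exists>P l. diagz (card (UNIV :: 'n set)) (vmat x c) P l \<and> inj_on l {..<card (UNIV :: 'n set)}"
    then obtain l where "\<And>c. \<exists>P. diagz n (vmat x c) P (l c)" unfolding n_def by metis
    then show "ev x f = ev x (Cst a)" using val[of x l] \<open>ds = []\<close> by simp
  qed
  then show ?thesis by blast
qed

section \<open>Special values: units and nonconstancy\<close>

lemma fdet_nilp_of_int:
  "(fdet n KB KB' (nilp n) (nilp' n) :: 'a::comm_ring_1) = of_int (fdet n KB KB' (nilp n) (nilp' n))"
proof -
  have "map_mat of_int (nilp n) = (nilp n :: 'a mat)" "map_mat of_int (nilp' n) = (nilp' n :: 'a mat)"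
    by (intro eq_matI; auto simp: nilp_def nilp'_def)+
  moreover have "(nilp n :: int mat) \<in> carrier_mat n n" "(nilp' n :: int mat) \<in> carrier_mat n n"
    by (simp_all add: nilp_def nilp'_def)
  ultimately show ?thesis using fdet_hom[OF comm_ring_hom_of_int KB, where 'b = 'a] by metis
qed

text \<open>The nilpotent matrices have integer entries, so one integer gives the value over all
  rings, and the complex case shows it to be \<open>1\<close> or \<open>- 1\<close>.\<close>

lemma fdet_nilp_unit: "fdet n KB KB' (nilp n) (nilp' n) \<in> {1, - 1 :: 'a::comm_ring_1}"
proof -
  have "(of_int (fdet n KB KB' (nilp n) (nilp' n)) :: complex) \<in> {1, - 1}"
    using fdet_nilp[OF KB KB' hk, where 'a = complex] unfolding fdet_nilp_of_int[where 'a = complex] .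
  then have "(of_int (fdet n KB KB' (nilp n) (nilp' n)) :: complex) \<in> {of_int 1, of_int (- 1)}" by simp
  then have "fdet n KB KB' (nilp n) (nilp' n) \<in> {1, - 1 :: int}" unfolding insert_iff of_int_eq_iff empty_iff .
  then show ?thesis unfolding fdet_nilp_of_int[where 'a = 'a] by auto
qed

definition npt :: "'n var \<Rightarrow> 'a::comm_ring_1" where
  "npt = mpt (\<lambda>c. if c then nilp' n else nilp n)"

lemma vmat_npt: "vmat npt c = (if c then nilp' n else nilp n)"
  unfolding npt_def by (rule vmat_mpt) (simp add: n_def[symmetric] nilp_def nilp'_def)

lemma ev_Fm_npt: "ev npt Fm \<in> {1, - 1 :: 'a::comm_ring_1}"
  unfolding ev_Fm vmat_npt using fdet_nilp_unit by simp

lemma Fpol_nilp: "ev npt (Fpol KB KB' :: ('n var, int) mpoly) \<in> {1, - 1}"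
proof -
  have "ev npt (Fpol KB KB' :: ('n var, int) mpoly) = fdet n KB KB' (nilp n) (nilp' n)"
    unfolding ev_def mev_Fpol[OF KB[unfolded n_def] comm_ring_hom_id] vmat_npt unfolding n_def[symmetric] by simp
  then show ?thesis using fdet_nilp_unit by simp
qed

lemma Fm_nonzero: "Fm \<noteq> (0 :: ('n var, 'a::comm_ring_1) mpoly)"
proof
  assume "Fm = (0 :: ('n var, 'a) mpoly)"
  then have "0 \<in> {1, - 1 :: 'a}" using ev_Fm_npt[where 'a = 'a] by (simp only: hom_0[OF ev_hom])
  then show False by simp
qed

text \<open>Besides a unit at the nilpotent pair, the value \<open>0\<close> is taken: for two equal
  diagonal matrices the eigenbases coincide, and overlapping index sets select the same column
  twice.\<close>

lemma Fm_not_const: "Fm \<noteq> (Cst a :: ('n var, 'a::alg_closed_field) mpoly)"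
proof -
  show "Fm \<noteq> (Cst a :: ('n var, 'a) mpoly)"
  proof
    assume c: "Fm = (Cst a :: ('n var, 'a) mpoly)"
    have a0: "a \<noteq> 0" using ev_Fm_npt[where 'a = 'a] unfolding c by auto
    obtain e :: "nat \<Rightarrow> 'a" where e: "inj e" "\<And>i. e i \<noteq> 0" using ex_inj_nonzero[OF infinite_UNIV_alg_closed] by blast
    let ?E = "dg n e"
    have ie: "inj_on e {..<n}" using e(1) inj_on_subset by blast
    have d: "diagz n ?E (1\<^sub>m n) e" by (simp add: diagz_def)
    have Nn: "0 < Nn" unfolding kbase_length[OF KB] using hk by simp
    let ?x = "KB' ! 0 ! 0"
    have x: "?x < n" using kbaseD(5)[OF KB', of 0 0] Nn length_KB'_KB hk(2) by simp
    have "card {S. S \<subseteq> {..<n} \<and> card S = k \<and> ?x \<in> S} \<noteq> 0"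
      unfolding card_subsets_containing[OF x hk(3)] using hk by simp
    then have "{S. S \<subseteq> {..<n} \<and> card S = k \<and> ?x \<in> S} \<noteq> {}" by (intro notI) simp
    then obtain S where S: "S \<subseteq> {..<n}" "card S = k" "?x \<in> S" by blast
    have "S \<in> (\<lambda>q. set (KB ! q)) ` {..<Nn}" using S(1,2) bij_betw_imp_surj_on[OF kbase_bij[OF KB]] by auto
    then obtain q where q: "q < Nn" "set (KB ! q) = S" by auto
    obtain j' where j': "j' < k" "KB ! q ! j' = ?x" using S(3) q KB_nth(2)[OF Nn q(1)] by (auto simp: in_set_conv_nth)
    have "dcols n (\<lambda>i j. 1\<^sub>m n $$ (i, j)) (\<lambda>i j. 1\<^sub>m n $$ (i, j)) (KB' ! 0) (KB ! q) = (0 :: 'a)"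
      unfolding dcols_def
      by (rule mdet_identical_cols[of 0 _ "h + j'"]) (use j' hk KB_nth(1)[OF Nn Nn] in auto)
    then have "(\<Prod>p<Nn. \<Prod>q<Nn. dcols n (\<lambda>i j. 1\<^sub>m n $$ (i, j)) (\<lambda>i j. 1\<^sub>m n $$ (i, j)) (KB' ! p) (KB ! q)) = (0 :: 'a)"
      using Nn q by (intro prod_zero[OF _ bexI[of _ 0]] prod_zero[OF _ bexI[of _ q]]) auto
    then have "fdet n KB KB' ?E ?E = 0"
      using fdet_diagz[OF KB KB' hk, where 'a = 'a] d ie by fastforce
    moreover have "vmat (mpt (\<lambda>_. ?E) :: 'n var \<Rightarrow> 'a) c = ?E" for c by (rule vmat_mpt) (simp add: n_def[symmetric])
    ultimately have "ev (mpt (\<lambda>_. ?E)) Fm = (0 :: 'a)" by (simp add: ev_Fm)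
    then show False unfolding c using a0 by simp
  qed
qed

end

section \<open>Descent to arbitrary fields and to the integers\<close>

lemma map_mpoly_const:
  assumes "comm_ring_hom f" "inj f" "Poly_Mapping.map f p = Cst b"
  shows "\<exists>a. p = Cst a"
proof -
  have f0: "f 0 = 0" by (rule hom_0[OF assms(1)])
  have L: "Poly_Mapping.lookup (Poly_Mapping.map f p) m = f (Poly_Mapping.lookup p m)" for m
    by (simp add: Poly_Mapping.map.rep_eq when_def f0)
  have "Poly_Mapping.lookup p m = 0" if "m \<noteq> 0" for m
  proof -
    have "f (Poly_Mapping.lookup p m) = f 0" unfolding L[symmetric] assms(3) f0 using that by (simp add: Cst_def lookup_single)
    then show ?thesis using assms(2) by (simp add: inj_eq)
  qed
  then have "p = Cst (Poly_Mapping.lookup p 0)" by (intro poly_mapping_eqI) (auto simp: Cst_def lookup_single when_def)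
  then show ?thesis by blast
qed

lemma map_mpoly_hom: "comm_ring_hom f \<Longrightarrow> comm_ring_hom (Poly_Mapping.map f :: ('v, 'a::comm_ring_1) mpoly \<Rightarrow> ('v, 'b::comm_ring_1) mpoly)"
proof -
  assume f: "comm_ring_hom f"
  have "(Poly_Mapping.map f :: ('v, 'a) mpoly \<Rightarrow> ('v, 'b) mpoly) = mev (\<lambda>a. Cst (f a)) Var"
    by (rule ext) (rule map_mpoly_eq[OF f])
  then show ?thesis using comm_ring_hom.mev_hom[OF comm_ring_hom_compose[OF f Cst_hom], of Var] by simp
qed

lemma to_ac_hom: "comm_ring_hom (to_ac :: 'a::field \<Rightarrow> 'a alg_closure)"
  by unfold_locales (simp_all add: to_ac_add to_ac_mult)

lemma Cst_unit: "a \<noteq> (0 :: 'a::field) \<Longrightarrow> Cst a dvd (1 :: ('v, 'a) mpoly)"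
  by (rule dvdI[of _ _ "Cst (inverse a)"]) (simp flip: Cst_mult)

text \<open>A factorization persists over the algebraic closure, where one factor is constant, and
  an injective change of coefficients reflects constants.\<close>

lemma irreducible_Tk_field:
  fixes k :: nat
  assumes k: "0 < k" "k < card (UNIV :: ('n::{finite,linorder}) set)"
  shows "irreducible (Poly_Mapping.map (of_int :: int \<Rightarrow> 'a::field) (Tk k :: ('n var, int) mpoly))"
proof -
  let ?n = "card (UNIV :: 'n set)" and ?T = "Tk k :: ('n var, int) mpoly"
  obtain KB' where KB': "kbase ?n (?n - k) KB'" using kbase_exists by blast
  interpret triang "TYPE('n)" ?n k "?n - k" "KBn TYPE('n) k" KB'
    using kbase_KBn KB' k by unfold_locales auto
  have T: "?T = Fpol (KBn TYPE('n) k) KB' \<or> ?T = - Fpol (KBn TYPE('n) k) KB'" by (rule Tk_eq_Fpol[OF k KB'])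
  let ?m = "Poly_Mapping.map of_int :: ('n var, int) mpoly \<Rightarrow> ('n var, 'a) mpoly"
  let ?M = "Poly_Mapping.map to_ac :: ('n var, 'a) mpoly \<Rightarrow> ('n var, 'a alg_closure) mpoly"
  interpret m: comm_ring_hom ?m by (rule map_mpoly_hom[OF comm_ring_hom_of_int])
  interpret M: comm_ring_hom ?M by (rule map_mpoly_hom[OF to_ac_hom])
  \<comment> \<open>The coefficients come from the integers, so extending the field does not affect
    them.\<close>
  have MF: "?M Fm = Fm"
  proof -
    have "?M Fm = mev (\<lambda>a. Cst (to_ac a)) Var Fm" by (rule map_mpoly_eq[OF to_ac_hom])
    also have "\<dots> = mev Cst Var Fm"
      unfolding mev_Fm[OF comm_ring_hom_compose[OF to_ac_hom Cst_hom]] mev_Fm[OF Cst_hom] ..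
    finally show ?thesis by (simp add: mev_Cst_Var)
  qed
  have T': "?m ?T = Fm \<or> ?m ?T = - Fm" using T by (auto simp: Fm_def m.hom_uminus)
  then have MT: "?M (?m ?T) = Fm \<or> ?M (?m ?T) = - Fm" by (auto simp: MF M.hom_uminus)
  have nz: "?m ?T \<noteq> 0" using T' Fm_nonzero[where 'a = 'a] by auto
  show ?thesis
  proof (rule irreducibleI[OF nz])
    show "\<not> ?m ?T dvd 1"
    proof
      assume "?m ?T dvd 1"
      then have "?M (?m ?T) dvd 1" using hom_dvd[OF M.comm_ring_hom_axioms] by (metis M.hom_one)
      then obtain a where "?M (?m ?T) = Cst a" using unit_mpoly_const[OF infinite_UNIV_alg_closed] by blast
      moreover have "- Cst a = Cst (- a)" for a :: "'a alg_closure"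
        by (simp add: Cst_def flip: single_uminus)
      ultimately show False using MT Fm_not_const[where 'a = "'a alg_closure"] by (metis minus_minus)
    qed
    fix f g assume fg: "?m ?T = f * g"
    then have "?M f * ?M g = Fm \<or> ?M f * ?M g = - Fm" using MT by (simp add: M.hom_mult)
    then have "(\<exists>a. ?M f = Cst a) \<or> (\<exists>a. ?M g = Cst a)"
      using D_free_factor[of "?M f" "?M g"] D_free_const[of "?M f" "?M g"] D_free_const[of "?M g" "?M f"]
      by (metis mult.commute)
    then have "(\<exists>a. f = Cst a) \<or> (\<exists>a. g = Cst a)"
      using map_mpoly_const[OF to_ac_hom inj_to_ac] by blast
    then show "f dvd 1 \<or> g dvd 1"
    proof (elim disjE exE)
      fix a assume "f = Cst a"
      then show ?thesis using nz fg Cst_unit[of a] by (cases "a = 0") auto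
    next
      fix a assume "g = Cst a"
      then show ?thesis using nz fg Cst_unit[of a] by (cases "a = 0") auto
    qed
  qed
qed

text \<open>In a factorization one factor becomes constant over the rationals, hence is an integer.
  It divides the value \<open>1\<close> or \<open>- 1\<close> at the nilpotent pair and is therefore
  a unit.\<close>

lemma irreducible_Tk_int:
  fixes k :: nat
  assumes k: "0 < k" "k < card (UNIV :: ('n::{finite,linorder}) set)"
  shows "irreducible (Tk k :: ('n var, int) mpoly)"
proof -
  let ?n = "card (UNIV :: 'n set)" and ?T = "Tk k :: ('n var, int) mpoly"
  obtain KB' where KB': "kbase ?n (?n - k) KB'" using kbase_exists by blast
  interpret triang "TYPE('n)" ?n k "?n - k" "KBn TYPE('n) k" KB'
    using kbase_KBn KB' k by unfold_locales auto
  let ?m = "Poly_Mapping.map of_int :: ('n var, int) mpoly \<Rightarrow> ('n var, rat) mpoly"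
  interpret m: comm_ring_hom ?m by (rule map_mpoly_hom[OF comm_ring_hom_of_int])
  have irr: "irreducible (?m ?T)" by (rule irreducible_Tk_field[OF k])
  let ?np = "npt :: 'n var \<Rightarrow> int"
  interpret e: comm_ring_hom "ev ?np" by (rule ev_hom)
  have val: "ev ?np ?T \<in> {1, - 1}"
    using Tk_eq_Fpol[OF k KB'] Fpol_nilp by (auto simp: e.hom_uminus)
  have unit: "f dvd 1" if f: "?m f dvd 1" and fg: "?T = f * g" for f g
  proof -
    obtain b where "?m f = Cst b" using unit_mpoly_const[OF infinite_UNIV_char_0 f] by blast
    moreover have "inj (of_int :: int \<Rightarrow> rat)" by (simp add: inj_def)
    ultimately obtain a where a: "f = Cst a" using map_mpoly_const[OF comm_ring_hom_of_int] by blast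
    have "a * ev ?np g \<in> {1, - 1}" using val unfolding fg a e.hom_mult by simp
    then have "a dvd 1" by (metis dvd_minus_iff dvd_triv_left insertE singletonD)
    then show ?thesis unfolding a using hom_dvd[OF Cst_hom, of a 1] by simp
  qed
  show ?thesis
  proof (rule irreducibleI)
    show "?T \<noteq> 0" using irr by auto
    show "\<not> ?T dvd 1" using irr hom_dvd[OF m.comm_ring_hom_axioms, of ?T 1] by (auto simp: irreducible_def)
    fix f g assume fg: "?T = f * g"
    then have "?m f dvd 1 \<or> ?m g dvd 1" using irr m.hom_mult[of f g] unfolding irreducible_def by metis
    then show "f dvd 1 \<or> g dvd 1" using unit[of f g] unit[of g f] fg by (auto simp: mult.commute)
  qed
qed

theorem mainTheorem19:
  fixes k :: nat
  assumes "0 < k" and "k < card (UNIV :: ('n::{finite,linorder}) set)"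
  shows "irreducible (Tk k :: ('n var, int) mpoly)
    \<and> irreducible (Poly_Mapping.map (of_int :: int \<Rightarrow> 'a::field) (Tk k :: ('n var, int) mpoly))"
  using irreducible_Tk_int[OF assms] irreducible_Tk_field[OF assms] by blast

end
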